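(* Let $G$ be a second countable locally compact Hausdorff groupoid with Haar system $\lambda$, let $Y$ be a second countable locally compact Hausdorff space, let $\Phi:Y\to G^{(0)}$ be continuous, open and surjective, let $\nu=\{\nu_u\}_{u\in G^{(0)}}$ be a full continuous $\Phi$-system of measures on $Y$, and let $d:Y\to[0,\infty)$ be a continuous function that is not identically zero on any fibre $\Phi^{-1}(u)$. Let $\hat L=(\mu,G^{(0)}*\mathcal H,\hat L)$ be a unitary representation of $G$ with integrated form $\mathfrak L$ on $H_{\mathfrak L}=L^2(G^{(0)}*\mathcal H,\mu)$, and let $\operatorname{Ind}_{\mathrm M}\mathfrak L$ on $H_{\operatorname{Ind}_{\mathrm M}\mathfrak L}$ and $\operatorname{Ind}_{\mathrm J}\mathfrak L$ on $H_{\operatorname{Ind}_{\mathrm J}\mathfrak L}=L^2(Y*\mathcal H,\mu_{\operatorname{Ind}})$ be the two induced representations of $C_c(Y*G*Y,\beta)$ described in the context. With $Z=\{(y,\gamma)\in Y\times G:\Phi(y)=r(\gamma)\}$, define $\mathfrak U:C_c(Z)\odot H_{\mathfrak L}\to H_{\operatorname{Ind}_{\mathrm J}\mathfrak L}$ by $$\mathfrak U(\xi\otimes \mathfrak h)(x)=\int_{G^{\Phi(x)}}\xi(x,\gamma)\,L_\gamma \mathfrak h(s(\gamma))\,\Delta_\mu(\gamma)^{-1/2}\,d\lambda^{\Phi(x)}(\gamma).$$ Then $\mathfrak U$ extends to a Hilbert space isomorphism from $H_{\operatorname{Ind}_{\mathrm M}\mathfrak L}$ onto $H_{\operatorname{Ind}_{\mathrm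 J}\mathfrak L}$ that intertwines $\operatorname{Ind}_{\mathrm M}\mathfrak L$ and $\operatorname{Ind}_{\mathrm J}\mathfrak L$.
   Context: **Systems of measures.** For a continuous map $\pi:Y\to X$ of locally compact spaces, a continuous $\pi$-system is a family $\{\alpha_x\}_{x\in X}$ of positive Radon measures on $Y$ with $\operatorname{supp}\alpha_x\subseteq\pi^{-1}(x)$ and such that $x\mapsto\int f\,d\alpha_x$ lies in $C_c(X)$ for every $f\in C_c(Y)$. It is full if $\operatorname{supp}\alpha_x=\pi^{-1}(x)$ for all $x$. **Groupoids.** $r,s$ are the range and source maps of $G$ (continuous and open); $\lambda=\{\lambda^u\}$ is a (full, left-invariant) Haar system, $G^u=r^{-1}(u)$, and $\lambda_u$ is the image of $\lambda^u$ under inversion. For a positive measure $\mu$ on $G^{(0)}$, $\mu\circ\lambda$ is the measure $\int_{G^{(0)}}\lambda^u\,d\mu(u)$ on $G$; $\mu$ is quasi-invariant if $\mu\circ\lambda$ and its image $(\mu\circ\lambda)^{-1}$ under inversion are mutually absolutely continuous, and $\Delta_\mu=d(\mu\circ\lambda)/d(\mu\circ\lambda)^{-1}$ is the modular function, chosen to be a homomorphism $G\to(0,\infty)$. **Representations.** A unitary representation $\hat L=(\mu,G^{(0)}*\mathcal H,\hat L)$ of $G$ consists of a quasi-invariant measure $\mu$ on $G^{(0)}$, a Borel Hilbert bundle $G^{(0)}*\mathcal H=\{H_u\}_{u\in G^{(0)}}$, and a Borel homomorphism $\gamma\mapsto (r(\gamma),L_\gamma,s(\gamma))$ with $L_\gamma:H_{s(\gamma)}\to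 H_{r(\gamma)}$ unitary. $L^2(G^{(0)}*\mathcal H,\mu)$ is the Hilbert space of square integrable Borel sections. The integrated form is $$\mathfrak L(f)\mathfrak h(u)=\int_G f(\gamma)L_\gamma\mathfrak h(s(\gamma))\Delta_\mu(\gamma)^{-1/2}\,d\lambda^u(\gamma),\qquad f\in C_c(G).$$ **Pullback groupoid.** $Y*G*Y=\{(x,\gamma,y)\in Y\times G\times Y:\Phi(x)=r(\gamma),\ \Phi(y)=s(\gamma)\}$ with $(x,\gamma,y)(y,\delta,z)=(x,\gamma\delta,z)$, $(x,\gamma,y)^{-1}=(y,\gamma^{-1},x)$; its unit space is identified with $Y$. It carries the Haar system $\beta$ given by $\int f\,d\beta^x=\int_G\int_Y f(x,\gamma,y)\,d\nu_{s(\gamma)}(y)\,d\lambda^{\Phi(x)}(\gamma)$. **The representation $\operatorname{Ind}_{\mathrm J}\mathfrak L$.** Let $d\nu_{d,u}=d\cdot d\nu_u$, and let $\mu_{\operatorname{Ind}}$ be the measure on $Y$ with $\int f\,d\mu_{\operatorname{Ind}}=\int_{G^{(0)}}\int_Y f(x)\,d\nu_{d,u}(x)\,d\mu(u)$. Let $Y*\mathcal H$ be the pulled back bundle with fibre $H_{\Phi(x)}$ at $x\in Y$. Then $\operatorname{Ind}_{\mathrm J}\mathfrak L$ acts on $L^2(Y*\mathcal H,\mu_{\operatorname{Ind}})$ by $$\big((\operatorname{Ind}_{\mathrm J}\mathfrak L)(f)\mathfrak h,\mathfrak k\big)=\int_{G^{(0)}}\int_Y\int_G\int_Y f(x,\gamma,y)\big(L_\gamma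 \mathfrak h(y),\mathfrak k(x)\big)\Delta_\mu(\gamma)^{-1/2}d(x)^{1/2}d(y)^{1/2}\,d\nu_{s(\gamma)}(y)\,d\lambda^u(\gamma)\,d\nu_u(x)\,d\mu(u)$$ for $f\in C_c(Y*G*Y)$. **The representation $\operatorname{Ind}_{\mathrm M}\mathfrak L$ (Rieffel induction).** $C_c(Z)$ carries the $C_c(G,\lambda)$-valued inner product $$\langle \xi,\eta\rangle(\gamma)=\int_G\int_Y\overline{\xi(x,\zeta)}\,\eta(x,\zeta\gamma)\,d\nu_{d,r(\zeta)}(x)\,d\lambda_{r(\gamma)}(\zeta),$$ and the left action of $C_c(Y*G*Y,\beta)$ $$(a\cdot\xi)(x,\gamma)=\int_G\int_Y a(x,\zeta,y)\xi(y,\zeta^{-1}\gamma)\frac{d(y)^{1/2}}{d(x)^{1/2}}\,d\nu_{s(\zeta)}(y)\,d\lambda^{r(\gamma)}(\zeta),$$ where the quotient is only considered at points with $d(x)>0$ (the complement is null for the measures defining the inner product). $H_{\operatorname{Ind}_{\mathrm M}\mathfrak L}$ is the Hilbert space completion of the algebraic tensor product $C_c(Z)\odot H_{\mathfrak L}$ in the (semi-)inner product $(\xi\otimes\mathfrak h,\eta\otimes\mathfrak k)=\big(\mathfrak L(\langle\eta,\xi\rangle)\mathfrak h,\mathfrak k\big)$, and $(\operatorname{Ind}_{\mathrm M}\mathfrak L)(f)(\xi\otimes\mathfrak h)=(f\cdot\xi)\otimes\mathfrak h$. *)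

theory Defs
  imports "HOL-Analysis.Analysis"
begin

section \<open>Complex vector spaces and Hilbert spaces with explicit carriers\<close>

record 'a cvs =
  carr :: "'a set"
  vadd :: "'a \<Rightarrow> 'a \<Rightarrow> 'a"
  vscale :: "complex \<Rightarrow> 'a \<Rightarrow> 'a"
  vzero :: 'a

text \<open>Inner products are linear in the first and conjugate linear in the second variable.\<close>

record 'a ips = "'a cvs" +
  ip :: "'a \<Rightarrow> 'a \<Rightarrow> complex"

definition vdiff :: "('a, 'm) cvs_scheme \<Rightarrow> 'a \<Rightarrow> 'a \<Rightarrow> 'a" where
  "vdiff V x y = vadd V x (vscale V (-1) y)"

definition nrm :: "('a, 'm) ips_scheme \<Rightarrow> 'a \<Rightarrow> real" where
  "nrm V x = sqrt (Re (ip V x x))"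

definition cauchy_in :: "('a, 'm) ips_scheme \<Rightarrow> (nat \<Rightarrow> 'a) \<Rightarrow> bool" where
  "cauchy_in V X \<longleftrightarrow> (\<forall>n. X n \<in> carr V) \<and>
     (\<forall>\<epsilon>>0. \<exists>N. \<forall>m\<ge>N. \<forall>n\<ge>N. nrm V (vdiff V (X m) (X n)) < \<epsilon>)"

locale cvector_space =
  fixes V :: "('a, 'm) cvs_scheme"
  assumes zero_in: "vzero V \<in> carr V"
    and add_in: "x \<in> carr V \<Longrightarrow> y \<in> carr V \<Longrightarrow> vadd V x y \<in> carr V"
    and scale_in: "x \<in> carr V \<Longrightarrow> vscale V c x \<in> carr V"
    and add_assoc: "x \<in> carr V \<Longrightarrow> y \<in> carr V \<Longrightarrow> z \<in> carr V \<Longrightarrow>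
      vadd V (vadd V x y) z = vadd V x (vadd V y z)"
    and add_commute: "x \<in> carr V \<Longrightarrow> y \<in> carr V \<Longrightarrow> vadd V x y = vadd V y x"
    and add_zero: "x \<in> carr V \<Longrightarrow> vadd V x (vzero V) = x"
    and add_neg: "x \<in> carr V \<Longrightarrow> vadd V x (vscale V (-1) x) = vzero V"
    and scale_add: "x \<in> carr V \<Longrightarrow> y \<in> carr V \<Longrightarrow>
      vscale V c (vadd V x y) = vadd V (vscale V c x) (vscale V c y)"
    and add_scale: "x \<in> carr V \<Longrightarrow>
      vscale V (b + c) x = vadd V (vscale V b x) (vscale V c x)"
    and scale_scale: "x \<in> carr V \<Longrightarrow> vscale V b (vscale V c x) = vscale V (b * c) x"
    and scale_one: "x \<in> carr V \<Longrightarrow> vscale V 1 x = x"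

locale hilbert_space = cvector_space V for V :: "('a, 'm) ips_scheme" +
  assumes ip_add: "x \<in> carr V \<Longrightarrow> y \<in> carr V \<Longrightarrow> z \<in> carr V \<Longrightarrow>
      ip V (vadd V x y) z = ip V x z + ip V y z"
    and ip_scale: "x \<in> carr V \<Longrightarrow> y \<in> carr V \<Longrightarrow> ip V (vscale V c x) y = c * ip V x y"
    and ip_cnj: "x \<in> carr V \<Longrightarrow> y \<in> carr V \<Longrightarrow> ip V y x = cnj (ip V x y)"
    and ip_nonneg: "x \<in> carr V \<Longrightarrow> 0 \<le> Re (ip V x x)"
    and ip_definite: "x \<in> carr V \<Longrightarrow> ip V x x = 0 \<Longrightarrow> x = vzero V"
    and complete: "cauchy_in V X \<Longrightarrow>
      \<exists>x\<in>carr V. (\<lambda>n. nrm V (vdiff V (X n) x)) \<longlonglongrightarrow> 0"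

definition linear_op :: "('a, 'm) cvs_scheme \<Rightarrow> ('b, 'n) cvs_scheme \<Rightarrow> ('a \<Rightarrow> 'b) \<Rightarrow> bool" where
  "linear_op V W T \<longleftrightarrow> T ` carr V \<subseteq> carr W \<and>
     (\<forall>x\<in>carr V. \<forall>y\<in>carr V. T (vadd V x y) = vadd W (T x) (T y)) \<and>
     (\<forall>c. \<forall>x\<in>carr V. T (vscale V c x) = vscale W c (T x))"

definition bounded_op :: "('a, 'm) ips_scheme \<Rightarrow> ('a \<Rightarrow> 'a) \<Rightarrow> bool" where
  "bounded_op V T \<longleftrightarrow> linear_op V V T \<and> (\<exists>C. \<forall>x\<in>carr V. nrm V (T x) \<le> C * nrm V x)"

definition hilbert_iso :: "('a, 'm) ips_scheme \<Rightarrow> ('b, 'n) ips_scheme \<Rightarrow> ('a \<Rightarrow> 'b) \<Rightarrow> bool" where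
  "hilbert_iso V W T \<longleftrightarrow> linear_op V W T \<and> bij_betw T (carr V) (carr W) \<and>
     (\<forall>x\<in>carr V. \<forall>y\<in>carr V. ip W (T x) (T y) = ip V x y)"

definition rep :: "'a set \<Rightarrow> 'a" where
  "rep A = (SOME x. x \<in> A)"

text \<open>The quotient of a semi-inner product space by its null vectors; for square integrable
  sections this identifies sections that agree almost everywhere.\<close>

definition cls :: "('a, 'm) ips_scheme \<Rightarrow> 'a \<Rightarrow> 'a set" where
  "cls V x = {y \<in> carr V. ip V (vdiff V y x) (vdiff V y x) = 0}"

definition separation :: "('a, 'm) ips_scheme \<Rightarrow> 'a set ips" where
  "separation V = \<lparr>
     carr = cls V ` carr V,
     vadd = (\<lambda>A B. cls V (vadd V (rep A) (rep B))),
     vscale = (\<lambda>c A. cls V (vscale V c (rep A))),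
     vzero = cls V (vzero V),
     ip = (\<lambda>A B. ip V (rep A) (rep B)) \<rparr>"

definition cauchy_space :: "('a, 'm) ips_scheme \<Rightarrow> (nat \<Rightarrow> 'a) ips" where
  "cauchy_space V = \<lparr>
     carr = {X. cauchy_in V X},
     vadd = (\<lambda>X Y n. vadd V (X n) (Y n)),
     vscale = (\<lambda>c X n. vscale V c (X n)),
     vzero = (\<lambda>n. vzero V),
     ip = (\<lambda>X Y. lim (\<lambda>n. ip V (X n) (Y n))) \<rparr>"

definition completion :: "('a, 'm) ips_scheme \<Rightarrow> (nat \<Rightarrow> 'a) set ips" where
  "completion V = separation (cauchy_space V)"

definition embed :: "('a, 'm) ips_scheme \<Rightarrow> 'a \<Rightarrow> (nat \<Rightarrow> 'a) set" where
  "embed V x = cls (cauchy_space V) (\<lambda>n. x)"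


section \<open>Algebraic tensor product\<close>

text \<open>The tensor product is the space of finite formal combinations of pairs modulo the
  span of the bilinearity relations.\<close>

definition single :: "'p \<Rightarrow> 'p \<Rightarrow> complex" where
  "single p q = (if q = p then 1 else 0)"

definition formal_sums ::
  "('v, 'm) cvs_scheme \<Rightarrow> ('w, 'n) cvs_scheme \<Rightarrow> ('v \<times> 'w \<Rightarrow> complex) set" where
  "formal_sums V W = {a. finite {p. a p \<noteq> 0} \<and> {p. a p \<noteq> 0} \<subseteq> carr V \<times> carr W}"

definition bilinear_relations ::
  "('v, 'm) cvs_scheme \<Rightarrow> ('w, 'n) cvs_scheme \<Rightarrow> ('v \<times> 'w \<Rightarrow> complex) set" where
  "bilinear_relations V W =
     {(\<lambda>p. single (vadd V v v', w) p - single (v, w) p - single (v', w) p) | v v' w.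
        v \<in> carr V \<and> v' \<in> carr V \<and> w \<in> carr W}
   \<union> {(\<lambda>p. single (v, vadd W w w') p - single (v, w) p - single (v, w') p) | v w w'.
        v \<in> carr V \<and> w \<in> carr W \<and> w' \<in> carr W}
   \<union> {(\<lambda>p. single (vscale V c v, w) p - c * single (v, w) p) | c v w.
        v \<in> carr V \<and> w \<in> carr W}
   \<union> {(\<lambda>p. single (v, vscale W c w) p - c * single (v, w) p) | c v w.
        v \<in> carr V \<and> w \<in> carr W}"

definition relation_span ::
  "('v, 'm) cvs_scheme \<Rightarrow> ('w, 'n) cvs_scheme \<Rightarrow> ('v \<times> 'w \<Rightarrow> complex) set" where
  "relation_span V W = {(\<lambda>p. \<Sum>b\<in>F. c b * b p) | F c. finite F \<and> F \<subseteq> bilinear_relations V W}"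

definition tensor_class ::
  "('v, 'm) cvs_scheme \<Rightarrow> ('w, 'n) cvs_scheme \<Rightarrow> ('v \<times> 'w \<Rightarrow> complex) \<Rightarrow> ('v \<times> 'w \<Rightarrow> complex) set"
  where
  "tensor_class V W a = {b \<in> formal_sums V W. (\<lambda>p. b p - a p) \<in> relation_span V W}"

definition pure_tensor ::
  "('v, 'm) cvs_scheme \<Rightarrow> ('w, 'n) cvs_scheme \<Rightarrow> 'v \<Rightarrow> 'w \<Rightarrow> ('v \<times> 'w \<Rightarrow> complex) set" where
  "pure_tensor V W v w = tensor_class V W (single (v, w))"

text \<open>The algebraic tensor product with the semi-inner product extending
  \<open>(v \<otimes> w, v' \<otimes> w') = \<phi> v w v' w'\<close> sesquilinearly.\<close>

definition tensor_space ::
  "('v, 'm) cvs_scheme \<Rightarrow> ('w, 'n) cvs_scheme \<Rightarrow> ('v \<Rightarrow> 'w \<Rightarrow> 'v \<Rightarrow> 'w \<Rightarrow> complex)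
    \<Rightarrow> ('v \<times> 'w \<Rightarrow> complex) set ips" where
  "tensor_space V W \<phi> = \<lparr>
     carr = tensor_class V W ` formal_sums V W,
     vadd = (\<lambda>A B. tensor_class V W (\<lambda>p. rep A p + rep B p)),
     vscale = (\<lambda>c A. tensor_class V W (\<lambda>p. c * rep A p)),
     vzero = tensor_class V W (\<lambda>p. 0),
     ip = (\<lambda>A B. \<Sum>p\<in>{p. rep A p \<noteq> 0}. \<Sum>q\<in>{q. rep B q \<noteq> 0}.
             rep A p * cnj (rep B q) * \<phi> (fst p) (snd p) (fst q) (snd q)) \<rparr>"


section \<open>Radon measures and continuous systems of measures\<close>

definition radon_measure :: "'a::topological_space measure \<Rightarrow> bool" where
  "radon_measure M \<longleftrightarrow> sets M = sets borel \<and>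
     (\<forall>K. compact K \<longrightarrow> emeasure M K < \<infinity>) \<and>
     (\<forall>A\<in>sets borel. emeasure M A = (INF U\<in>{U. open U \<and> A \<subseteq> U}. emeasure M U)) \<and>
     (\<forall>U. open U \<longrightarrow> emeasure M U = (SUP K\<in>{K. compact K \<and> K \<subseteq> U}. emeasure M K))"

definition msupport :: "'a::topological_space measure \<Rightarrow> 'a set" where
  "msupport M = {x. \<forall>U. open U \<and> x \<in> U \<longrightarrow> emeasure M U > 0}"

text \<open>Compactly supported continuous functions on a subspace \<open>X\<close>, extended by zero to the
  ambient type.\<close>

definition Cc :: "'a::topological_space set \<Rightarrow> ('a \<Rightarrow> complex) set" where
  "Cc X = {f. continuous_on X f \<and> (\<forall>x. x \<notin> X \<longrightarrow> f x = 0) \<and>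
     (\<exists>K. compact K \<and> K \<subseteq> X \<and> (\<forall>x\<in>X - K. f x = 0))}"

definition Cc_space :: "'a::topological_space set \<Rightarrow> ('a \<Rightarrow> complex) cvs" where
  "Cc_space X = \<lparr> carr = Cc X, vadd = (\<lambda>f g x. f x + g x), vscale = (\<lambda>c f x. c * f x),
     vzero = (\<lambda>x. 0) \<rparr>"

definition continuous_system ::
  "'x::topological_space set \<Rightarrow> ('y::topological_space \<Rightarrow> 'x) \<Rightarrow> ('x \<Rightarrow> 'y measure) \<Rightarrow> bool" where
  "continuous_system X \<pi> \<alpha> \<longleftrightarrow>
     (\<forall>x\<in>X. radon_measure (\<alpha> x) \<and> msupport (\<alpha> x) \<subseteq> \<pi> -` {x}) \<and>
     (\<forall>f\<in>Cc UNIV. (\<lambda>x. if x \<in> X then (LINT y|\<alpha> x. f y) else 0) \<in> Cc X)"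

definition full_system ::
  "'x::topological_space set \<Rightarrow> ('y::topological_space \<Rightarrow> 'x) \<Rightarrow> ('x \<Rightarrow> 'y measure) \<Rightarrow> bool" where
  "full_system X \<pi> \<alpha> \<longleftrightarrow> continuous_system X \<pi> \<alpha> \<and> (\<forall>x\<in>X. msupport (\<alpha> x) = \<pi> -` {x})"

definition integrated_measure ::
  "'x measure \<Rightarrow> ('x \<Rightarrow> 'y::topological_space measure) \<Rightarrow> 'y measure" where
  "integrated_measure \<mu> \<alpha> =
     measure_of UNIV (sets borel) (\<lambda>A. \<integral>\<^sup>+x. emeasure (\<alpha> x) A \<partial>\<mu>)"


section \<open>Topological groupoids\<close>

record 'g groupoid =
  rng :: "'g \<Rightarrow> 'g"
  src :: "'g \<Rightarrow> 'g"
  mul :: "'g \<Rightarrow> 'g \<Rightarrow> 'g"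
  ginv :: "'g \<Rightarrow> 'g"

definition units :: "'g groupoid \<Rightarrow> 'g set" where
  "units G = range (rng G)"

text \<open>The arrows are all elements of the type; the product \<open>mul G \<gamma> \<eta>\<close> is only meaningful
  if \<open>src G \<gamma> = rng G \<eta>\<close>.\<close>

locale topological_groupoid =
  fixes G :: "'g::topological_space groupoid"
  assumes rng_rng: "rng G (rng G \<gamma>) = rng G \<gamma>"
    and src_rng: "src G (rng G \<gamma>) = rng G \<gamma>"
    and rng_src: "rng G (src G \<gamma>) = src G \<gamma>"
    and src_src: "src G (src G \<gamma>) = src G \<gamma>"
    and rng_mul: "src G \<gamma> = rng G \<eta> \<Longrightarrow> rng G (mul G \<gamma> \<eta>) = rng G \<gamma>"
    and src_mul: "src G \<gamma> = rng G \<eta> \<Longrightarrow> src G (mul G \<gamma> \<eta>) = src G \<eta>"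
    and mul_assoc: "src G \<gamma> = rng G \<eta> \<Longrightarrow> src G \<eta> = rng G \<zeta> \<Longrightarrow>
      mul G (mul G \<gamma> \<eta>) \<zeta> = mul G \<gamma> (mul G \<eta> \<zeta>)"
    and mul_src: "mul G \<gamma> (src G \<gamma>) = \<gamma>"
    and rng_mul_self: "mul G (rng G \<gamma>) \<gamma> = \<gamma>"
    and rng_ginv: "rng G (ginv G \<gamma>) = src G \<gamma>"
    and src_ginv: "src G (ginv G \<gamma>) = rng G \<gamma>"
    and mul_ginv: "mul G \<gamma> (ginv G \<gamma>) = rng G \<gamma>"
    and ginv_mul: "mul G (ginv G \<gamma>) \<gamma> = src G \<gamma>"
    and continuous_mul:
      "continuous_on {(\<gamma>, \<eta>). src G \<gamma> = rng G \<eta>} (\<lambda>(\<gamma>, \<eta>). mul G \<gamma> \<eta>)"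
    and continuous_ginv: "continuous_on UNIV (ginv G)"
    and continuous_rng: "continuous_on UNIV (rng G)"
    and continuous_src: "continuous_on UNIV (src G)"
    and open_rng: "open_map euclidean (top_of_set (units G)) (rng G)"
    and open_src: "open_map euclidean (top_of_set (units G)) (src G)"

definition haar_system :: "'g::topological_space groupoid \<Rightarrow> ('g \<Rightarrow> 'g measure) \<Rightarrow> bool" where
  "haar_system G lam \<longleftrightarrow> full_system (units G) (rng G) lam \<and>
     (\<forall>\<gamma>. \<forall>f\<in>Cc UNIV.
        (LINT \<eta>:{\<eta>. rng G \<eta> = src G \<gamma>}|lam (src G \<gamma>). f (mul G \<gamma> \<eta>))
        = (LINT \<eta>|lam (rng G \<gamma>). f \<eta>))"

definition lam_src :: "'g::topological_space groupoid \<Rightarrow> ('g \<Rightarrow> 'g measure) \<Rightarrow> 'g \<Rightarrow> 'g measure" where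
  "lam_src G lam u = distr (lam u) borel (ginv G)"

definition quasi_invariant ::
  "'g::topological_space groupoid \<Rightarrow> ('g \<Rightarrow> 'g measure) \<Rightarrow> 'g measure \<Rightarrow> bool" where
  "quasi_invariant G lam \<mu> \<longleftrightarrow>
     (let m = integrated_measure \<mu> lam; m' = distr m borel (ginv G)
      in absolutely_continuous m m' \<and> absolutely_continuous m' m)"

definition modular_function ::
  "'g::topological_space groupoid \<Rightarrow> ('g \<Rightarrow> 'g measure) \<Rightarrow> 'g measure \<Rightarrow> ('g \<Rightarrow> real) \<Rightarrow> bool" where
  "modular_function G lam \<mu> \<Delta> \<longleftrightarrow>
     \<Delta> \<in> borel_measurable borel \<and> (\<forall>\<gamma>. 0 < \<Delta> \<gamma>) \<and>
     (\<forall>\<gamma> \<eta>. src G \<gamma> = rng G \<eta> \<longrightarrow> \<Delta> (mul G \<gamma> \<eta>) = \<Delta> \<gamma> * \<Delta> \<eta>) \<and>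
     (let m = integrated_measure \<mu> lam
      in m = density (distr m borel (ginv G)) (\<lambda>\<gamma>. ennreal (\<Delta> \<gamma>)))"


section \<open>Borel Hilbert bundles\<close>

text \<open>A Borel structure on the total space of a family of Hilbert spaces over the measurable
  space \<open>M\<close> is given by the measurable sets of \<open>B\<close>. It has to be generated by the projection
  and the functions \<open>(u, v) \<mapsto> (v, e\<^sub>n(u))\<close> for a fundamental sequence of sections.\<close>

definition total_space :: "'x set \<Rightarrow> ('x \<Rightarrow> 'h ips) \<Rightarrow> ('x \<times> 'h) set" where
  "total_space X H = (SIGMA u:X. carr (H u))"

definition fundamental_sequence :: "'x measure \<Rightarrow> ('x \<Rightarrow> 'h ips) \<Rightarrow> (nat \<Rightarrow> 'x \<Rightarrow> 'h) \<Rightarrow> bool" where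
  "fundamental_sequence M H e \<longleftrightarrow>
     (\<forall>n. \<forall>u\<in>space M. e n u \<in> carr (H u)) \<and>
     (\<forall>m n. (\<lambda>u. ip (H u) (e m u) (e n u)) \<in> borel_measurable M) \<and>
     (\<forall>u\<in>space M. \<forall>v\<in>carr (H u). \<forall>w\<in>carr (H u).
        (\<forall>n. ip (H u) v (e n u) = ip (H u) w (e n u)) \<longrightarrow> v = w)"

definition borel_hilbert_bundle ::
  "'x measure \<Rightarrow> ('x \<Rightarrow> 'h ips) \<Rightarrow> ('x \<times> 'h) measure \<Rightarrow> bool" where
  "borel_hilbert_bundle M H B \<longleftrightarrow>
     (\<forall>u\<in>space M. hilbert_space (H u)) \<and>
     space B = total_space (space M) H \<and>
     (\<exists>e. fundamental_sequence M H e \<and>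
        sets B = sigma_sets (total_space (space M) H)
          ({fst -` A \<inter> total_space (space M) H | A. A \<in> sets M}
           \<union> {(\<lambda>(u, v). ip (H u) v (e n u)) -` A \<inter> total_space (space M) H | n A.
                A \<in> sets borel}))"

definition borel_section :: "'x measure \<Rightarrow> ('x \<times> 'h) measure \<Rightarrow> ('x \<Rightarrow> 'h) \<Rightarrow> bool" where
  "borel_section M B h \<longleftrightarrow> (\<lambda>u. (u, h u)) \<in> measurable M B"

text \<open>The Borel structure of the pulled back bundle, as a subspace of \<open>Y \<times> (G\<^sup>0 * H)\<close>.\<close>

definition pullback_structure ::
  "('y::topological_space \<Rightarrow> 'x) \<Rightarrow> ('x \<Rightarrow> 'h ips) \<Rightarrow> ('x \<times> 'h) measure \<Rightarrow> ('y \<times> 'h) measure" where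
  "pullback_structure \<Phi> H B =
     vimage_algebra (total_space UNIV (\<lambda>x. H (\<Phi> x))) (\<lambda>(x, v). (x, (\<Phi> x, v))) (borel \<Otimes>\<^sub>M B)"

definition sq_sections ::
  "'x measure \<Rightarrow> ('x \<Rightarrow> 'h ips) \<Rightarrow> ('x \<times> 'h) measure \<Rightarrow> ('x \<Rightarrow> 'h) ips" where
  "sq_sections M H B = \<lparr>
     carr = {h \<in> extensional (space M).
               borel_section M B h \<and> (\<integral>\<^sup>+u. ennreal ((nrm (H u) (h u))\<^sup>2) \<partial>M) < \<infinity>},
     vadd = (\<lambda>h k. \<lambda>u\<in>space M. vadd (H u) (h u) (k u)),
     vscale = (\<lambda>c h. \<lambda>u\<in>space M. vscale (H u) c (h u)),
     vzero = (\<lambda>u\<in>space M. vzero (H u)),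
     ip = (\<lambda>h k. LINT u|M. ip (H u) (h u) (k u)) \<rparr>"

definition L2 ::
  "'x measure \<Rightarrow> ('x \<Rightarrow> 'h ips) \<Rightarrow> ('x \<times> 'h) measure \<Rightarrow> ('x \<Rightarrow> 'h) set ips" where
  "L2 M H B = separation (sq_sections M H B)"

text \<open>The weak integral of a Hilbert space valued function. As for the scalar integral, its
  value is zero if the function is not absolutely integrable.\<close>

definition hilbert_integral :: "'h ips \<Rightarrow> 'x measure \<Rightarrow> ('x \<Rightarrow> 'h) \<Rightarrow> 'h" where
  "hilbert_integral H M F =
     (if (\<integral>\<^sup>+x. ennreal (nrm H (F x)) \<partial>M) < \<infinity>
      then (THE v. v \<in> carr H \<and> (\<forall>w\<in>carr H. ip H v w = (LINT x|M. ip H (F x) w)))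
      else vzero H)"


section \<open>Unitary representations of groupoids\<close>

record ('g, 'h) groupoid_rep =
  meas :: "'g measure"
  fib :: "'g \<Rightarrow> 'h ips"
  bstr :: "('g \<times> 'h) measure"
  act :: "'g \<Rightarrow> 'h \<Rightarrow> 'h"

text \<open>The measure on the unit space is only assumed \<open>\<sigma>\<close>-finite, which includes all Radon
  measures. The last condition spells out that \<open>\<gamma> \<mapsto> (r \<gamma>, L\<^sub>\<gamma>, s \<gamma>)\<close> is a Borel map into the
  isomorphism groupoid of the bundle, whose Borel structure is the smallest one for which
  \<open>(u, T, v) \<mapsto> (T f(v), g(u))\<close> is Borel for all Borel sections \<open>f\<close>, \<open>g\<close>.\<close>

definition unitary_rep ::
  "'g::topological_space groupoid \<Rightarrow> ('g \<Rightarrow> 'g measure) \<Rightarrow> ('g, 'h) groupoid_rep \<Rightarrow> bool" where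
  "unitary_rep G lam R \<longleftrightarrow>
     sets (meas R) = sets (restrict_space borel (units G)) \<and>
     sigma_finite_measure (meas R) \<and>
     quasi_invariant G lam (meas R) \<and>
     borel_hilbert_bundle (restrict_space borel (units G)) (fib R) (bstr R) \<and>
     (\<forall>\<gamma>. hilbert_iso (fib R (src G \<gamma>)) (fib R (rng G \<gamma>)) (act R \<gamma>)) \<and>
     (\<forall>\<gamma> \<eta>. src G \<gamma> = rng G \<eta> \<longrightarrow>
        (\<forall>v\<in>carr (fib R (src G \<eta>)). act R (mul G \<gamma> \<eta>) v = act R \<gamma> (act R \<eta> v))) \<and>
     (\<forall>f g. borel_section (restrict_space borel (units G)) (bstr R) f \<longrightarrow>
            borel_section (restrict_space borel (units G)) (bstr R) g \<longrightarrow>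
        (\<lambda>\<gamma>. ip (fib R (rng G \<gamma>)) (act R \<gamma> (f (src G \<gamma>))) (g (rng G \<gamma>)))
          \<in> borel_measurable borel)"

abbreviation rep_sections :: "('g, 'h) groupoid_rep \<Rightarrow> ('g \<Rightarrow> 'h) ips" where
  "rep_sections R \<equiv> sq_sections (meas R) (fib R) (bstr R)"

definition rep_space :: "('g, 'h) groupoid_rep \<Rightarrow> ('g \<Rightarrow> 'h) set ips" where
  "rep_space R = L2 (meas R) (fib R) (bstr R)"

text \<open>\<open>\<integral> f(\<gamma>) L\<^sub>\<gamma> h(s \<gamma>) \<Delta>(\<gamma>)\<^sup>-\<^sup>1\<^sup>/\<^sup>2 d\<lambda>\<^sup>u(\<gamma>)\<close>. Off \<open>r\<close>-fibres \<open>L\<^sub>\<gamma> h(s \<gamma>)\<close> does not lie in the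
  fibre over \<open>u\<close>, hence the restriction of \<open>\<lambda>\<^sup>u\<close> to the fibre carrying it.\<close>

definition twisted_integral ::
  "'g::topological_space groupoid \<Rightarrow> ('g \<Rightarrow> 'g measure) \<Rightarrow> ('g, 'h) groupoid_rep \<Rightarrow> ('g \<Rightarrow> real)
    \<Rightarrow> 'g \<Rightarrow> ('g \<Rightarrow> complex) \<Rightarrow> ('g \<Rightarrow> 'h) \<Rightarrow> 'h" where
  "twisted_integral G lam R \<Delta> u f h =
     hilbert_integral (fib R u) (restrict_space (lam u) {\<gamma>. rng G \<gamma> = u})
       (\<lambda>\<gamma>. vscale (fib R u) (f \<gamma> * complex_of_real (\<Delta> \<gamma> powr (-1/2))) (act R \<gamma> (h (src G \<gamma>))))"

definition integrated_form ::
  "'g::topological_space groupoid \<Rightarrow> ('g \<Rightarrow> 'g measure) \<Rightarrow> ('g, 'h) groupoid_rep \<Rightarrow> ('g \<Rightarrow> real)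
    \<Rightarrow> ('g \<Rightarrow> complex) \<Rightarrow> ('g \<Rightarrow> 'h) set \<Rightarrow> ('g \<Rightarrow> 'h) set" where
  "integrated_form G lam R \<Delta> f h =
     cls (rep_sections R) (\<lambda>u\<in>units G. twisted_integral G lam R \<Delta> u f (rep h))"


section \<open>The induced representations\<close>

definition Zsp :: "'g groupoid \<Rightarrow> ('y \<Rightarrow> 'g) \<Rightarrow> ('y \<times> 'g) set" where
  "Zsp G \<Phi> = {(y, \<gamma>). \<Phi> y = rng G \<gamma>}"

definition YGY :: "'g groupoid \<Rightarrow> ('y \<Rightarrow> 'g) \<Rightarrow> ('y \<times> 'g \<times> 'y) set" where
  "YGY G \<Phi> = {(x, \<gamma>, y). \<Phi> x = rng G \<gamma> \<and> \<Phi> y = src G \<gamma>}"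

definition nu_d :: "('g \<Rightarrow> 'y measure) \<Rightarrow> ('y \<Rightarrow> real) \<Rightarrow> 'g \<Rightarrow> 'y measure" where
  "nu_d \<nu> d u = density (\<nu> u) (\<lambda>x. ennreal (d x))"

subsection \<open>The representation on a space of sections over \<open>Y\<close>\<close>

abbreviation IndJ_sections ::
  "('y::topological_space \<Rightarrow> 'g) \<Rightarrow> ('g \<Rightarrow> 'y measure) \<Rightarrow> ('y \<Rightarrow> real) \<Rightarrow> ('g, 'h) groupoid_rep
    \<Rightarrow> ('y \<Rightarrow> 'h) ips" where
  "IndJ_sections \<Phi> \<nu> d R \<equiv>
     sq_sections (integrated_measure (meas R) (nu_d \<nu> d)) (\<lambda>x. fib R (\<Phi> x))
       (pullback_structure \<Phi> (fib R) (bstr R))"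

definition IndJ_space ::
  "('y::topological_space \<Rightarrow> 'g) \<Rightarrow> ('g \<Rightarrow> 'y measure) \<Rightarrow> ('y \<Rightarrow> real) \<Rightarrow> ('g, 'h) groupoid_rep
    \<Rightarrow> ('y \<Rightarrow> 'h) set ips" where
  "IndJ_space \<Phi> \<nu> d R =
     L2 (integrated_measure (meas R) (nu_d \<nu> d)) (\<lambda>x. fib R (\<Phi> x))
       (pullback_structure \<Phi> (fib R) (bstr R))"

definition IndJ_form ::
  "'g groupoid \<Rightarrow> ('g \<Rightarrow> 'g measure) \<Rightarrow> ('y \<Rightarrow> 'g) \<Rightarrow> ('g \<Rightarrow> 'y measure)
    \<Rightarrow> ('y \<Rightarrow> real) \<Rightarrow> ('g, 'h) groupoid_rep \<Rightarrow> ('g \<Rightarrow> real) \<Rightarrow> ('y \<times> 'g \<times> 'y \<Rightarrow> complex)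
    \<Rightarrow> ('y \<Rightarrow> 'h) \<Rightarrow> ('y \<Rightarrow> 'h) \<Rightarrow> complex" where
  "IndJ_form G lam \<Phi> \<nu> d R \<Delta> f h k =
     (LINT u|meas R. LINT x|\<nu> u. LINT \<gamma>|lam u. LINT y|\<nu> (src G \<gamma>).
        f (x, \<gamma>, y) * ip (fib R (\<Phi> x)) (act R \<gamma> (h y)) (k x)
        * complex_of_real (\<Delta> \<gamma> powr (-1/2) * sqrt (d x) * sqrt (d y)))"

definition IndJ ::
  "'g groupoid \<Rightarrow> ('g \<Rightarrow> 'g measure) \<Rightarrow> ('y::topological_space \<Rightarrow> 'g) \<Rightarrow> ('g \<Rightarrow> 'y measure)
    \<Rightarrow> ('y \<Rightarrow> real) \<Rightarrow> ('g, 'h) groupoid_rep \<Rightarrow> ('g \<Rightarrow> real) \<Rightarrow> ('y \<times> 'g \<times> 'y \<Rightarrow> complex)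
    \<Rightarrow> ('y \<Rightarrow> 'h) set \<Rightarrow> ('y \<Rightarrow> 'h) set" where
  "IndJ G lam \<Phi> \<nu> d R \<Delta> f =
     (THE T. T \<in> extensional (carr (IndJ_space \<Phi> \<nu> d R)) \<and>
        bounded_op (IndJ_space \<Phi> \<nu> d R) T \<and>
        (\<forall>h\<in>carr (IndJ_sections \<Phi> \<nu> d R). \<forall>k\<in>carr (IndJ_sections \<Phi> \<nu> d R).
           ip (IndJ_space \<Phi> \<nu> d R) (T (cls (IndJ_sections \<Phi> \<nu> d R) h))
             (cls (IndJ_sections \<Phi> \<nu> d R) k)
           = IndJ_form G lam \<Phi> \<nu> d R \<Delta> f h k))"

subsection \<open>Rieffel induction\<close>

text \<open>The integral over \<open>\<zeta>\<close> is restricted to the fibre carrying \<open>\<lambda>\<^sub>r\<^sub>(\<^sub>\<gamma>\<^sub>)\<close>, where \<open>\<zeta>\<gamma>\<close> is defined.\<close>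

definition Z_inner ::
  "'g::topological_space groupoid \<Rightarrow> ('g \<Rightarrow> 'g measure) \<Rightarrow> ('g \<Rightarrow> 'y measure) \<Rightarrow> ('y \<Rightarrow> real)
    \<Rightarrow> ('y \<times> 'g \<Rightarrow> complex) \<Rightarrow> ('y \<times> 'g \<Rightarrow> complex) \<Rightarrow> 'g \<Rightarrow> complex" where
  "Z_inner G lam \<nu> d \<xi> \<eta> \<gamma> =
     (LINT \<zeta>:{\<zeta>. src G \<zeta> = rng G \<gamma>}|lam_src G lam (rng G \<gamma>). LINT x|nu_d \<nu> d (rng G \<zeta>).
        cnj (\<xi> (x, \<zeta>)) * \<eta> (x, mul G \<zeta> \<gamma>))"

text \<open>At points with \<open>d x = 0\<close> the quotient, and hence the value, is zero by convention.\<close>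

definition left_action ::
  "'g::topological_space groupoid \<Rightarrow> ('g \<Rightarrow> 'g measure) \<Rightarrow> ('y \<Rightarrow> 'g) \<Rightarrow> ('g \<Rightarrow> 'y measure)
    \<Rightarrow> ('y \<Rightarrow> real) \<Rightarrow> ('y \<times> 'g \<times> 'y \<Rightarrow> complex) \<Rightarrow> ('y \<times> 'g \<Rightarrow> complex) \<Rightarrow> 'y \<times> 'g \<Rightarrow> complex" where
  "left_action G lam \<Phi> \<nu> d a \<xi> = (\<lambda>(x, \<gamma>).
     if (x, \<gamma>) \<in> Zsp G \<Phi>
     then LINT \<zeta>:{\<zeta>. rng G \<zeta> = rng G \<gamma>}|lam (rng G \<gamma>). LINT y|\<nu> (src G \<zeta>).
            a (x, \<zeta>, y) * \<xi> (y, mul G (ginv G \<zeta>) \<gamma>) * complex_of_real (sqrt (d y) / sqrt (d x))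
     else 0)"

text \<open>The semi-inner product \<open>(\<xi> \<otimes> h, \<eta> \<otimes> k) = (L(\<langle>\<eta>, \<xi>\<rangle>) h, k)\<close>.\<close>

definition IndM_form ::
  "'g::topological_space groupoid \<Rightarrow> ('g \<Rightarrow> 'g measure) \<Rightarrow> ('g \<Rightarrow> 'y measure) \<Rightarrow> ('y \<Rightarrow> real)
    \<Rightarrow> ('g, 'h) groupoid_rep \<Rightarrow> ('g \<Rightarrow> real) \<Rightarrow> ('y \<times> 'g \<Rightarrow> complex) \<Rightarrow> ('g \<Rightarrow> 'h) set
    \<Rightarrow> ('y \<times> 'g \<Rightarrow> complex) \<Rightarrow> ('g \<Rightarrow> 'h) set \<Rightarrow> complex" where
  "IndM_form G lam \<nu> d R \<Delta> \<xi> h \<eta> k =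
     ip (rep_space R) (integrated_form G lam R \<Delta> (Z_inner G lam \<nu> d \<eta> \<xi>) h) k"

definition IndM_tensor ::
  "'g::topological_space groupoid \<Rightarrow> ('g \<Rightarrow> 'g measure) \<Rightarrow> ('y::topological_space \<Rightarrow> 'g)
    \<Rightarrow> ('g \<Rightarrow> 'y measure) \<Rightarrow> ('y \<Rightarrow> real) \<Rightarrow> ('g, 'h) groupoid_rep \<Rightarrow> ('g \<Rightarrow> real)
    \<Rightarrow> (('y \<times> 'g \<Rightarrow> complex) \<times> ('g \<Rightarrow> 'h) set \<Rightarrow> complex) set ips" where
  "IndM_tensor G lam \<Phi> \<nu> d R \<Delta> =
     tensor_space (Cc_space (Zsp G \<Phi>)) (rep_space R) (IndM_form G lam \<nu> d R \<Delta>)"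

definition IndM_space ::
  "'g::topological_space groupoid \<Rightarrow> ('g \<Rightarrow> 'g measure) \<Rightarrow> ('y::topological_space \<Rightarrow> 'g)
    \<Rightarrow> ('g \<Rightarrow> 'y measure) \<Rightarrow> ('y \<Rightarrow> real) \<Rightarrow> ('g, 'h) groupoid_rep \<Rightarrow> ('g \<Rightarrow> real)
    \<Rightarrow> (nat \<Rightarrow> (('y \<times> 'g \<Rightarrow> complex) \<times> ('g \<Rightarrow> 'h) set \<Rightarrow> complex) set) set ips" where
  "IndM_space G lam \<Phi> \<nu> d R \<Delta> = completion (IndM_tensor G lam \<Phi> \<nu> d R \<Delta>)"

definition elem_vector ::
  "'g::topological_space groupoid \<Rightarrow> ('g \<Rightarrow> 'g measure) \<Rightarrow> ('y::topological_space \<Rightarrow> 'g)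
    \<Rightarrow> ('g \<Rightarrow> 'y measure) \<Rightarrow> ('y \<Rightarrow> real) \<Rightarrow> ('g, 'h) groupoid_rep \<Rightarrow> ('g \<Rightarrow> real)
    \<Rightarrow> ('y \<times> 'g \<Rightarrow> complex) \<Rightarrow> ('g \<Rightarrow> 'h) set
    \<Rightarrow> (nat \<Rightarrow> (('y \<times> 'g \<Rightarrow> complex) \<times> ('g \<Rightarrow> 'h) set \<Rightarrow> complex) set) set" where
  "elem_vector G lam \<Phi> \<nu> d R \<Delta> \<xi> h =
     embed (IndM_tensor G lam \<Phi> \<nu> d R \<Delta>) (pure_tensor (Cc_space (Zsp G \<Phi>)) (rep_space R) \<xi> h)"

text \<open>If \<open>d\<close> has zeros, \<open>f \<cdot> \<xi>\<close> need not be continuous, so that \<open>(f \<cdot> \<xi>) \<otimes> h\<close> need not lie in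
  the algebraic tensor product. It is always a vector in the completion, determined by its
  inner products with the elementary tensors, which are given by the same formula: in
  \<open>\<langle>\<eta>, f \<cdot> \<xi>\<rangle>\<close> the factor \<open>d(x)\<close> of the measure absorbs \<open>d(x)\<^sup>-\<^sup>1\<^sup>/\<^sup>2\<close>.\<close>

definition extended_elem_vector ::
  "'g::topological_space groupoid \<Rightarrow> ('g \<Rightarrow> 'g measure) \<Rightarrow> ('y::topological_space \<Rightarrow> 'g)
    \<Rightarrow> ('g \<Rightarrow> 'y measure) \<Rightarrow> ('y \<Rightarrow> real) \<Rightarrow> ('g, 'h) groupoid_rep \<Rightarrow> ('g \<Rightarrow> real)
    \<Rightarrow> ('y \<times> 'g \<Rightarrow> complex) \<Rightarrow> ('g \<Rightarrow> 'h) set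
    \<Rightarrow> (nat \<Rightarrow> (('y \<times> 'g \<Rightarrow> complex) \<times> ('g \<Rightarrow> 'h) set \<Rightarrow> complex) set) set" where
  "extended_elem_vector G lam \<Phi> \<nu> d R \<Delta> \<zeta> h =
     (if \<zeta> \<in> Cc (Zsp G \<Phi>) then elem_vector G lam \<Phi> \<nu> d R \<Delta> \<zeta> h
      else (THE w. w \<in> carr (IndM_space G lam \<Phi> \<nu> d R \<Delta>) \<and>
        (\<forall>\<eta>\<in>Cc (Zsp G \<Phi>). \<forall>k\<in>carr (rep_space R).
           ip (IndM_space G lam \<Phi> \<nu> d R \<Delta>) w (elem_vector G lam \<Phi> \<nu> d R \<Delta> \<eta> k)
           = IndM_form G lam \<nu> d R \<Delta> \<zeta> h \<eta> k)))"

definition IndM ::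
  "'g::topological_space groupoid \<Rightarrow> ('g \<Rightarrow> 'g measure) \<Rightarrow> ('y::topological_space \<Rightarrow> 'g)
    \<Rightarrow> ('g \<Rightarrow> 'y measure) \<Rightarrow> ('y \<Rightarrow> real) \<Rightarrow> ('g, 'h) groupoid_rep \<Rightarrow> ('g \<Rightarrow> real)
    \<Rightarrow> ('y \<times> 'g \<times> 'y \<Rightarrow> complex)
    \<Rightarrow> (nat \<Rightarrow> (('y \<times> 'g \<Rightarrow> complex) \<times> ('g \<Rightarrow> 'h) set \<Rightarrow> complex) set) set
    \<Rightarrow> (nat \<Rightarrow> (('y \<times> 'g \<Rightarrow> complex) \<times> ('g \<Rightarrow> 'h) set \<Rightarrow> complex) set) set" where
  "IndM G lam \<Phi> \<nu> d R \<Delta> f =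
     (THE T. T \<in> extensional (carr (IndM_space G lam \<Phi> \<nu> d R \<Delta>)) \<and>
        bounded_op (IndM_space G lam \<Phi> \<nu> d R \<Delta>) T \<and>
        (\<forall>\<xi>\<in>Cc (Zsp G \<Phi>). \<forall>h\<in>carr (rep_space R).
           T (elem_vector G lam \<Phi> \<nu> d R \<Delta> \<xi> h)
           = extended_elem_vector G lam \<Phi> \<nu> d R \<Delta> (left_action G lam \<Phi> \<nu> d f \<xi>) h))"

subsection \<open>The intertwiner on elementary tensors\<close>

definition U_section ::
  "'g::topological_space groupoid \<Rightarrow> ('g \<Rightarrow> 'g measure) \<Rightarrow> ('y \<Rightarrow> 'g) \<Rightarrow> ('g, 'h) groupoid_rep
    \<Rightarrow> ('g \<Rightarrow> real) \<Rightarrow> ('y \<times> 'g \<Rightarrow> complex) \<Rightarrow> ('g \<Rightarrow> 'h) \<Rightarrow> 'y \<Rightarrow> 'h" where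
  "U_section G lam \<Phi> R \<Delta> \<xi> h = (\<lambda>x. twisted_integral G lam R \<Delta> (\<Phi> x) (\<lambda>\<gamma>. \<xi> (x, \<gamma>)) h)"

end

theory Submission
 imports Defs
begin

text \<open>\<open>U\<close> is isometric on the algebraic tensor product: expanding \<open>(U(\<xi> \<otimes> h), U(\<eta> \<otimes> k))\<close> gives an integral
 over \<open>Y\<close> and two variables of \<open>G\<close>, which Fubini, left invariance of the Haar system and
 quasi-invariance of \<open>\<mu>\<close> turn into \<open>(L(\<langle>\<eta>, \<xi>\<rangle>) h, k)\<close>. Its range is dense, because a section \<open>k\<close>
 orthogonal to it satisfies \<open>(L\<^sub>\<gamma> h(s(\<gamma>)), k(x)) = 0\<close> for almost all \<open>(x, \<gamma>)\<close> and every section \<open>h\<close>, and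
 the values of countably many sections are dense in every fibre. Finally \<open>(f U(\<xi> \<otimes> h), k) =
 (U((f \<cdot> \<xi>) \<otimes> h), k)\<close> is left invariance and Fubini on a single fibre.

 Since \<open>d\<close> may have zeros, \<open>f \<cdot> \<xi>\<close> is not in \<open>C\<^sub>c(Z)\<close> in general. So \<open>U\<close> is studied on all Borel functions
 \<open>\<xi>\<close> for which \<open>|\<xi>(x, \<gamma>)| d(x)\<^sup>1\<^sup>/\<^sup>2\<close> is bounded with relatively compact support.\<close>

\<comment> \<open>Integrals have default values, and \<open>IndJ\<close>, \<open>IndM\<close> and
  the vectors for discontinuous \<open>f \<cdot> \<xi>\<close> are definite descriptions. So two
  obligations recur: absolute convergence before linearity or Fubini is used, and existence with
  uniqueness before a description is used. Convergence rests on one fact: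
  \<open>W = \<Delta>^{-1/2}\<close> has \<open>W^2 = 1/\<Delta>\<close>, the density produced by
  inversion, so over a compact set of \<open>\<gamma>\<close> the integral of
  \<open>W(\<gamma>)^2 |h(s(\<gamma>))|^2\<close> is at most a constant times the squared norm of
  \<open>h\<close> (\<open>shift_bound\<close>); Cauchy-Schwarz does the rest. Existence comes from
  the Riesz representation theorem, uniqueness of the vectors and of \<open>IndM\<close> from
  density of the range. The isometry and the intertwining relation are two instances of one identity
  on a single fibre (\<open>fibre_identity\<close>), taken with \<open>\<nu>_{d,u}\<close> and with
  \<open>\<nu>_u\<close>. The abstract completion is never studied for itself: it is computed inside
  the space of sections over \<open>Y\<close>, from which the tensor form also inherits its
  positivity.\<close>
syntax "_nni" :: "pttrn \<Rightarrow> ennreal \<Rightarrow> 'a measure \<Rightarrow> ennreal" ("(2NN _./ _ d'/_)" [0, 60, 61] 110)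
translations "NN x. f d/M" == "CONST nn_integral M (\<lambda>x. f)"

abbreviation "cor \<equiv> complex_of_real"
abbreviation "Borel \<equiv> borel_measurable borel"
abbreviation "sqn M H h \<equiv> NN u. ennreal ((nrm (H u) (h u))\<^sup>2) d/M"

section \<open>Semi-inner product spaces with explicit carriers\<close>

text \<open>Sections form only a semi-inner product space before null sections are divided out, so
  everything up to Cauchy-Schwarz is developed without definiteness and completeness; Hilbert spaces
  inherit it through the sublocale.\<close>

locale semi_inner_space = cvector_space V for V :: "('a, 'm) ips_scheme" +
 assumes inner_add: "x \<in> carr V \<Longrightarrow> y \<in> carr V \<Longrightarrow> z \<in> carr V \<Longrightarrow>
   ip V (vadd V x y) z = ip V x z + ip V y z"
  and inner_scale: "x \<in> carr V \<Longrightarrow> y \<in> carr V \<Longrightarrow> ip V (vscale V c x) y = c * ip V x y"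
  and inner_cnj: "x \<in> carr V \<Longrightarrow> y \<in> carr V \<Longrightarrow> ip V y x = cnj (ip V x y)"
  and inner_nonneg: "x \<in> carr V \<Longrightarrow> 0 \<le> Re (ip V x x)"

sublocale hilbert_space \<subseteq> semi_inner_space
 by unfold_locales (rule ip_add ip_scale ip_cnj ip_nonneg; assumption)+

definition tends :: "('a, 'm) ips_scheme \<Rightarrow> (nat \<Rightarrow> 'a) \<Rightarrow> 'a \<Rightarrow> bool" where
 "tends V X x \<longleftrightarrow> (\<lambda>n. nrm V (vdiff V (X n) x)) \<longlonglongrightarrow> 0"

context semi_inner_space
begin

lemma diff_in: "x \<in> carr V \<Longrightarrow> y \<in> carr V \<Longrightarrow> vdiff V x y \<in> carr V"
 by (simp add: vdiff_def add_in scale_in)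

lemmas closed = zero_in add_in scale_in diff_in

lemma inner_add_right:
 "x \<in> carr V \<Longrightarrow> y \<in> carr V \<Longrightarrow> z \<in> carr V \<Longrightarrow> ip V x (vadd V y z) = ip V x y + ip V x z"
 by (metis add_in complex_cnj_add inner_add inner_cnj)

lemma inner_scale_right:
 "x \<in> carr V \<Longrightarrow> y \<in> carr V \<Longrightarrow> ip V x (vscale V c y) = cnj c * ip V x y"
 by (metis complex_cnj_mult inner_cnj inner_scale scale_in)

lemma inner_diff:
 "x \<in> carr V \<Longrightarrow> y \<in> carr V \<Longrightarrow> z \<in> carr V \<Longrightarrow> ip V (vdiff V x y) z = ip V x z - ip V y z"
 by (simp add: vdiff_def inner_add inner_scale scale_in)

lemma inner_diff_right:
 "x \<in> carr V \<Longrightarrow> y \<in> carr V \<Longrightarrow> z \<in> carr V \<Longrightarrow> ip V x (vdiff V y z) = ip V x y - ip V x z"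
 by (simp add: vdiff_def inner_add_right inner_scale_right scale_in)

lemma inner_zero: "x \<in> carr V \<Longrightarrow> ip V (vzero V) x = 0"
 by (metis add_neg diff_self inner_diff vdiff_def zero_in)

lemma inner_zero_right: "x \<in> carr V \<Longrightarrow> ip V x (vzero V) = 0"
 by (metis complex_cnj_zero inner_cnj inner_zero zero_in)

lemmas inner_simps = inner_add inner_add_right inner_scale inner_scale_right
 inner_diff inner_diff_right inner_zero inner_zero_right

lemma inner_self_Im: "x \<in> carr V \<Longrightarrow> Im (ip V x x) = 0"
 using inner_cnj[of x x] by (simp add: complex_eq_iff)

lemma nrm_sq: "x \<in> carr V \<Longrightarrow> (nrm V x)\<^sup>2 = Re (ip V x x)"
 by (simp add: nrm_def inner_nonneg)

lemma inner_self: "x \<in> carr V \<Longrightarrow> ip V x x = cor ((nrm V x)\<^sup>2)"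
 by (simp add: nrm_sq complex_eq_iff inner_self_Im)

lemma nrm_nonneg: "x \<in> carr V \<Longrightarrow> 0 \<le> nrm V x"
 by (simp add: nrm_def inner_nonneg)

lemma inner_self_eq_0: "x \<in> carr V \<Longrightarrow> ip V x x = 0 \<longleftrightarrow> nrm V x = 0"
 by (simp add: inner_self)

text \<open>Vector identities over explicit carriers are laborious; a rearrangement inside a norm is
  instead checked by expanding both inner products with \<open>inner_simps\<close>.\<close>

lemma nrm_cong: "ip V x x = ip V y y \<Longrightarrow> nrm V x = nrm V y"
 by (simp add: nrm_def)

lemma nrm_scale: "x \<in> carr V \<Longrightarrow> nrm V (vscale V c x) = cmod c * nrm V x"
proof -
 assume x: "x \<in> carr V"
 have "ip V (vscale V c x) (vscale V c x) = (c * cnj c) * ip V x x"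
  using x by (simp add: inner_simps closed)
 also have "\<dots> = cor ((cmod c * nrm V x)\<^sup>2)"
  using x by (simp add: inner_self power_mult_distrib flip: complex_norm_square)
 finally show ?thesis
  using x by (simp add: nrm_def[of V "vscale V c x"] nrm_nonneg)
qed

lemma nrm_zero: "nrm V (vzero V) = 0"
 by (simp add: nrm_def inner_zero zero_in)

lemma nrm_diff_self: "x \<in> carr V \<Longrightarrow> nrm V (vdiff V x x) = 0"
 by (simp add: nrm_def inner_simps closed)

lemma nrm_diff_commute: "x \<in> carr V \<Longrightarrow> y \<in> carr V \<Longrightarrow> nrm V (vdiff V x y) = nrm V (vdiff V y x)"
 by (rule nrm_cong) (simp add: inner_simps closed)

lemma nrm_sq_diff:
 assumes "x \<in> carr V" "y \<in> carr V"
 shows "(nrm V (vdiff V x y))\<^sup>2 = (nrm V x)\<^sup>2 - 2 * Re (ip V x y) + (nrm V y)\<^sup>2"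
 using assms inner_cnj[of x y] by (simp add: nrm_sq closed inner_simps)

lemma nrm_sq_add:
 assumes "x \<in> carr V" "y \<in> carr V"
 shows "(nrm V (vadd V x y))\<^sup>2 = (nrm V x)\<^sup>2 + 2 * Re (ip V x y) + (nrm V y)\<^sup>2"
 using assms inner_cnj[of x y] by (simp add: nrm_sq closed inner_simps)

lemma Cauchy_Schwarz:
 assumes x: "x \<in> carr V" and y: "y \<in> carr V"
 shows "cmod (ip V x y) \<le> nrm V x * nrm V y"
proof -
 let ?a = "ip V x y"
 \<comment> \<open>Expand the squared norm of \<open>x - t (x,y) y\<close>; the factor
   \<open>(x,y)\<close> in the coefficient makes the cross term real.\<close>
 have key: "0 \<le> (nrm V x)\<^sup>2 - 2 * t * (cmod ?a)\<^sup>2 + t\<^sup>2 * (cmod ?a)\<^sup>2 * (nrm V y)\<^sup>2" for t :: real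
 proof -
  let ?c = "cor t * ?a"
  have "0 \<le> (nrm V (vdiff V x (vscale V ?c y)))\<^sup>2" by simp
  also have "\<dots> = (nrm V x)\<^sup>2 - 2 * Re (cnj ?c * ?a) + (cmod ?c)\<^sup>2 * (nrm V y)\<^sup>2"
   using x y by (simp add: nrm_sq_diff closed inner_simps nrm_scale power_mult_distrib)
  also have "cnj ?c * ?a = cor (t * (cmod ?a)\<^sup>2)"
   unfolding of_real_mult complex_norm_square by simp
  finally show ?thesis by (simp add: norm_mult power_mult_distrib mult.assoc)
 qed
 have "(cmod ?a)\<^sup>2 \<le> (nrm V x)\<^sup>2 * (nrm V y)\<^sup>2"
 proof (cases "nrm V y = 0")
  case True
  have "(cmod ?a)\<^sup>2 = 0"
  proof (rule ccontr)
   assume "(cmod ?a)\<^sup>2 \<noteq> 0"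
   then have p: "0 < (cmod ?a)\<^sup>2" by simp
   \<comment> \<open>With \<open>|y| = 0\<close> the right hand side of \<open>key\<close> is affine
     in \<open>t\<close>, and this \<open>t\<close> brings it to \<open>-|x|^2 - 2\<close>.\<close>
   from key[of "((nrm V x)\<^sup>2 + 1) / (cmod ?a)\<^sup>2"] True p show False
    by (simp add: add_pos_nonneg)
      (smt (verit) zero_le_power2)
  qed
  then show ?thesis using True by simp
 next
  case False
  let ?t = "1 / (nrm V y)\<^sup>2"
  have "?t\<^sup>2 * (cmod ?a)\<^sup>2 * (nrm V y)\<^sup>2 = ?t * (cmod ?a)\<^sup>2"
   using False by (simp add: power2_eq_square)
  with key[of ?t] have "0 \<le> (nrm V x)\<^sup>2 - (cmod ?a)\<^sup>2 / (nrm V y)\<^sup>2" by simp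
  then show ?thesis using False by (simp add: divide_simps split: if_splits)
 qed
 then show ?thesis
  by (metis nrm_nonneg x y mult_nonneg_nonneg power2_le_imp_le power_mult_distrib)
qed

lemma nrm_triangle:
 assumes "x \<in> carr V" "y \<in> carr V"
 shows "nrm V (vadd V x y) \<le> nrm V x + nrm V y"
proof (rule power2_le_imp_le)
 have "Re (ip V x y) \<le> nrm V x * nrm V y"
  using Cauchy_Schwarz[OF assms] complex_Re_le_cmod[of "ip V x y"] by linarith
 then show "(nrm V (vadd V x y))\<^sup>2 \<le> (nrm V x + nrm V y)\<^sup>2"
  using assms by (simp add: nrm_sq_add power2_sum)
qed (simp add: assms nrm_nonneg)

lemma nrm_diff_triangle:
 assumes "x \<in> carr V" "y \<in> carr V" "z \<in> carr V"
 shows "nrm V (vdiff V x z) \<le> nrm V (vdiff V x y) + nrm V (vdiff V y z)"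
proof -
 have "nrm V (vdiff V x z) = nrm V (vadd V (vdiff V x y) (vdiff V y z))"
  using assms by (intro nrm_cong) (simp add: inner_simps closed)
 then show ?thesis using nrm_triangle[of "vdiff V x y" "vdiff V y z"] assms by (simp add: closed)
qed

lemma nrm_le_diff:
 assumes "x \<in> carr V" "y \<in> carr V"
 shows "nrm V x \<le> nrm V y + nrm V (vdiff V x y)"
proof -
 have "nrm V x = nrm V (vadd V y (vdiff V x y))"
  using assms by (intro nrm_cong) (simp add: inner_simps closed)
 then show ?thesis using nrm_triangle[of y "vdiff V x y"] assms by (simp add: closed)
qed

lemma nrm_diff_le:
 assumes "x \<in> carr V" "y \<in> carr V"
 shows "nrm V (vdiff V x y) \<le> nrm V x + nrm V y"
 using nrm_triangle[of x "vscale V (-1) y"] assms by (simp add: vdiff_def closed nrm_scale)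

text \<open>Cauchy-Schwarz makes null vectors orthogonal to everything, so inner products may be
  computed on arbitrary representatives of classes.\<close>

lemma inner_cong:
 assumes "x \<in> carr V" "x' \<in> carr V" "y \<in> carr V" "y' \<in> carr V"
  and "nrm V (vdiff V x x') = 0" "nrm V (vdiff V y y') = 0"
 shows "ip V x y = ip V x' y'"
proof -
 have "ip V x y - ip V x' y' = ip V (vdiff V x x') y + ip V x' (vdiff V y y')"
  using assms by (simp add: inner_simps closed)
 moreover have "ip V (vdiff V x x') y = 0"
  using Cauchy_Schwarz[of "vdiff V x x'" y] assms by (simp add: closed)
 moreover have "ip V x' (vdiff V y y') = 0"
  using Cauchy_Schwarz[of x' "vdiff V y y'"] assms by (simp add: closed)
 ultimately show ?thesis by simp
qed

lemma inner_tendsto: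
 assumes "\<And>n. X n \<in> carr V" "x \<in> carr V" "\<And>n. Y n \<in> carr V" "y \<in> carr V"
  and X: "tends V X x" and Y: "tends V Y y"
 shows "(\<lambda>n. ip V (X n) (Y n)) \<longlonglongrightarrow> ip V x y"
proof -
 let ?b = "\<lambda>n. nrm V (vdiff V (X n) x) * (nrm V y + nrm V (vdiff V (Y n) y))
  + nrm V x * nrm V (vdiff V (Y n) y)"
 have "?b \<longlonglongrightarrow> 0 * (nrm V y + 0) + nrm V x * 0"
  using X Y unfolding tends_def by (intro tendsto_intros)
 then have b0: "?b \<longlonglongrightarrow> 0" by simp
 have le: "norm (ip V (X n) (Y n) - ip V x y) \<le> ?b n" for n
 proof -
  have "ip V (X n) (Y n) - ip V x y = ip V (vdiff V (X n) x) (Y n) + ip V x (vdiff V (Y n) y)"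
   using assms by (simp add: inner_simps closed)
  also have "norm \<dots> \<le> nrm V (vdiff V (X n) x) * nrm V (Y n) + nrm V x * nrm V (vdiff V (Y n) y)"
   using assms by (intro norm_triangle_mono Cauchy_Schwarz) (auto simp: closed)
  also have "\<dots> \<le> ?b n"
   using assms nrm_le_diff[of "Y n" y] by (intro add_mono mult_left_mono) (auto simp: closed nrm_nonneg)
  finally show ?thesis .
 qed
 have "(\<lambda>n. ip V (X n) (Y n) - ip V x y) \<longlonglongrightarrow> 0"
  by (rule tendsto_rabs_zero_cancel[of "\<lambda>n. norm (ip V (X n) (Y n) - ip V x y)", THEN tendsto_norm_zero_cancel])
    (use tendsto_sandwich[OF _ _ tendsto_const b0] le in auto)
 then show ?thesis by (simp add: LIM_zero_iff)
qed

lemma tends_const: "x \<in> carr V \<Longrightarrow> tends V (\<lambda>n. x) x"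
 by (simp add: tends_def nrm_diff_self)

lemma tends_add:
 assumes "\<And>n. X n \<in> carr V" "x \<in> carr V" "\<And>n. Y n \<in> carr V" "y \<in> carr V"
  and X: "tends V X x" and Y: "tends V Y y"
 shows "tends V (\<lambda>n. vadd V (X n) (Y n)) (vadd V x y)"
 unfolding tends_def
proof (rule tendsto_sandwich[OF _ _ tendsto_const])
 have "nrm V (vdiff V (vadd V (X n) (Y n)) (vadd V x y))
   = nrm V (vadd V (vdiff V (X n) x) (vdiff V (Y n) y))" for n
  using assms(1-4) by (intro nrm_cong) (simp add: inner_simps closed)
 then show "\<forall>\<^sub>F n in sequentially. nrm V (vdiff V (vadd V (X n) (Y n)) (vadd V x y))
   \<le> nrm V (vdiff V (X n) x) + nrm V (vdiff V (Y n) y)"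
  using assms(1-4) by (simp add: nrm_triangle closed)
 show "(\<lambda>n. nrm V (vdiff V (X n) x) + nrm V (vdiff V (Y n) y)) \<longlonglongrightarrow> 0"
  using tendsto_add[OF X[unfolded tends_def] Y[unfolded tends_def]] by simp
qed (use assms in \<open>simp add: nrm_nonneg closed\<close>)

lemma tends_scale:
 assumes "\<And>n. X n \<in> carr V" "x \<in> carr V" and X: "tends V X x"
 shows "tends V (\<lambda>n. vscale V c (X n)) (vscale V c x)"
proof -
 have "nrm V (vdiff V (vscale V c (X n)) (vscale V c x)) = nrm V (vscale V c (vdiff V (X n) x))" for n
  using assms(1-2) by (intro nrm_cong) (simp add: inner_simps closed algebra_simps)
 then show ?thesis
  using tendsto_mult_left[OF X[unfolded tends_def], of "cmod c"] assms(1-2)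
  by (simp add: tends_def nrm_scale closed)
qed

lemma tends_cauchy:
 assumes X: "\<And>n. X n \<in> carr V" and x: "x \<in> carr V" and t: "tends V X x"
 shows "cauchy_in V X"
 unfolding cauchy_in_def
proof (intro conjI allI impI X)
 fix \<epsilon> :: real assume e: "\<epsilon> > 0"
 obtain N where N: "\<And>n. n \<ge> N \<Longrightarrow> nrm V (vdiff V (X n) x) < \<epsilon> / 2"
  using t[unfolded tends_def, THEN LIMSEQ_D, of "\<epsilon> / 2"] e X x by (auto simp: nrm_nonneg closed)
 show "\<exists>N. \<forall>m\<ge>N. \<forall>n\<ge>N. nrm V (vdiff V (X m) (X n)) < \<epsilon>"
 proof (intro exI allI impI)
  fix m n assume "m \<ge> N" "n \<ge> N"
  then show "nrm V (vdiff V (X m) (X n)) < \<epsilon>"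
   using N[of m] N[of n] nrm_diff_triangle[of "X m" x "X n"] X x nrm_diff_commute[of x "X n"] by force
 qed
qed

lemma mem_cls_iff: "x \<in> carr V \<Longrightarrow> y \<in> cls V x \<longleftrightarrow> y \<in> carr V \<and> nrm V (vdiff V y x) = 0"
 by (auto simp: cls_def inner_self_eq_0 closed)

lemma rep_cls: "x \<in> carr V \<Longrightarrow> rep (cls V x) \<in> carr V \<and> nrm V (vdiff V (rep (cls V x)) x) = 0"
 using someI[of "\<lambda>y. y \<in> cls V x" x] mem_cls_iff[of x] nrm_diff_self by (auto simp: rep_def)

lemma cls_eq_iff:
 assumes "x \<in> carr V" "y \<in> carr V"
 shows "cls V x = cls V y \<longleftrightarrow> nrm V (vdiff V x y) = 0"
proof
 assume "cls V x = cls V y"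
 moreover have "x \<in> cls V x" using assms by (simp add: mem_cls_iff nrm_diff_self)
 ultimately show "nrm V (vdiff V x y) = 0" using assms by (simp add: mem_cls_iff)
next
 assume 0: "nrm V (vdiff V x y) = 0"
 then have 1: "nrm V (vdiff V y x) = 0" using assms nrm_diff_commute[of x y] by simp
 have "nrm V (vdiff V z x) = 0 \<longleftrightarrow> nrm V (vdiff V z y) = 0" if "z \<in> carr V" for z
  using that assms 0 1 nrm_diff_triangle[of z x y] nrm_diff_triangle[of z y x]
   nrm_nonneg[of "vdiff V z x"] nrm_nonneg[of "vdiff V z y"] by (auto simp: closed)
 then show "cls V x = cls V y"
  using assms by (auto simp: mem_cls_iff)
qed

lemma rep_in: "x \<in> carr V \<Longrightarrow> rep (cls V x) \<in> carr V"
 using rep_cls by blast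

lemma cls_rep: "A \<in> carr (separation V) \<Longrightarrow> cls V (rep A) = A"
 unfolding separation_def by simp (metis cls_eq_iff imageE rep_cls)

lemma rep_sep_in: "A \<in> carr (separation V) \<Longrightarrow> rep A \<in> carr V"
 by (auto simp: separation_def rep_cls)

lemma carr_separation: "carr (separation V) = cls V ` carr V"
 by (simp add: separation_def)

lemma vadd_separation:
 assumes "x \<in> carr V" "y \<in> carr V"
 shows "vadd (separation V) (cls V x) (cls V y) = cls V (vadd V x y)"
proof -
 let ?x = "rep (cls V x)" and ?y = "rep (cls V y)"
 have "nrm V (vdiff V (vadd V ?x ?y) (vadd V x y)) = nrm V (vadd V (vdiff V ?x x) (vdiff V ?y y))"
  using assms by (intro nrm_cong) (simp add: inner_simps closed rep_in)
 also have "\<dots> \<le> 0"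
  using nrm_triangle[of "vdiff V ?x x" "vdiff V ?y y"] assms by (simp add: rep_cls closed)
 finally have "nrm V (vdiff V (vadd V ?x ?y) (vadd V x y)) = 0"
  using assms by (simp add: antisym nrm_nonneg closed rep_in)
 then show ?thesis
  using assms by (simp add: separation_def cls_eq_iff closed rep_in)
qed

lemma vscale_separation:
 assumes "x \<in> carr V"
 shows "vscale (separation V) c (cls V x) = cls V (vscale V c x)"
proof -
 let ?x = "rep (cls V x)"
 have "nrm V (vdiff V (vscale V c ?x) (vscale V c x)) = nrm V (vscale V c (vdiff V ?x x))"
  using assms by (intro nrm_cong) (simp add: inner_simps closed rep_in algebra_simps)
 also have "\<dots> = 0" using assms by (simp add: nrm_scale closed rep_cls)
 finally show ?thesis
  using assms by (simp add: separation_def cls_eq_iff closed rep_in)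
qed

lemma vzero_separation: "vzero (separation V) = cls V (vzero V)"
 by (simp add: separation_def)

lemma ip_separation:
 assumes "x \<in> carr V" "y \<in> carr V"
 shows "ip (separation V) (cls V x) (cls V y) = ip V x y"
proof -
 have "ip V (rep (cls V x)) (rep (cls V y)) = ip V x y"
  by (rule inner_cong) (auto simp: rep_cls assms)
 then show ?thesis by (simp add: separation_def)
qed

lemma vdiff_separation:
 assumes "x \<in> carr V" "y \<in> carr V"
 shows "vdiff (separation V) (cls V x) (cls V y) = cls V (vdiff V x y)"
 using assms by (simp add: vdiff_def vadd_separation vscale_separation closed)

lemma nrm_separation: "x \<in> carr V \<Longrightarrow> nrm (separation V) (cls V x) = nrm V x"
 by (simp add: nrm_def ip_separation)

text \<open>Choosing representatives preserves distances, so a Cauchy sequence of classes lifts to a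
  Cauchy sequence in \<open>V\<close>, where completeness is assumed.\<close>

lemma hilbert_separation:
 assumes complete: "\<And>X. cauchy_in V X \<Longrightarrow> \<exists>x\<in>carr V. tends V X x"
 shows "hilbert_space (separation V)"
proof -
 note sep = carr_separation vadd_separation vscale_separation ip_separation vzero_separation closed
 show ?thesis
 proof (unfold_locales, goal_cases)
  case 1 show ?case by (simp add: sep)
 next
  case (2 x y) then show ?case by (auto simp: sep)
 next
  case (3 x c) then show ?case by (auto simp: sep)
 next
  case (4 x y z) then show ?case by (auto simp: sep add_assoc)
 next
  case (5 x y) then show ?case by (auto simp: sep add_commute)
 next
  case (6 x) then show ?case by (auto simp: sep add_zero)
 next
  case (7 x) then show ?case by (auto simp: sep add_neg)
 next
  case (8 x y c) then show ?case by (auto simp: sep scale_add)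
 next
  case (9 x b c) then show ?case by (auto simp: sep add_scale)
 next
  case (10 x b c) then show ?case by (auto simp: sep scale_scale)
 next
  case (11 x) then show ?case by (auto simp: sep scale_one)
 next
  case (12 x y z) then show ?case by (auto simp: sep inner_add)
 next
  case (13 x y c) then show ?case by (auto simp: sep inner_scale)
 next
  case (14 x y) then show ?case by (auto simp: sep intro: inner_cnj)
 next
  case (15 x) then show ?case by (auto simp: sep inner_nonneg)
 next
  case (16 x)
  then obtain y where y: "y \<in> carr V" "x = cls V y" by (auto simp: sep)
  with 16 have "nrm V y = 0" by (simp add: sep inner_self_eq_0)
  then have "nrm V (vdiff V y (vzero V)) = 0"
   using y nrm_diff_le[of y "vzero V"] nrm_nonneg[of "vdiff V y (vzero V)"]
   by (simp add: nrm_zero closed)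
  then show ?case using y by (simp add: sep cls_eq_iff)
 next
  case (17 X)
  then have Xn: "X n \<in> carr (separation V)" for n by (simp add: cauchy_in_def)
  then have 1: "rep (X n) \<in> carr V" and 2: "cls V (rep (X n)) = X n" for n
   by (auto simp: rep_sep_in cls_rep)
  have 3: "nrm (separation V) (vdiff (separation V) (X m) (cls V y)) = nrm V (vdiff V (rep (X m)) y)"
   if "y \<in> carr V" for m y
   using that 1[of m] vdiff_separation[of "rep (X m)" y] nrm_separation[of "vdiff V (rep (X m)) y"]
   by (simp add: 2 closed)
  have "cauchy_in V (\<lambda>n. rep (X n))"
   using 17 1 3[OF 1] unfolding cauchy_in_def 2 by simp
  from complete[OF this] obtain x where x: "x \<in> carr V" "tends V (\<lambda>n. rep (X n)) x" by blast
  then have "(\<lambda>n. nrm (separation V) (vdiff (separation V) (X n) (cls V x))) \<longlonglongrightarrow> 0"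
   by (simp add: 3 tends_def)
  then show ?case using x by (auto simp: carr_separation)
 qed
qed

end

context hilbert_space
begin

lemma inner_ext:
 assumes "x \<in> carr V" "y \<in> carr V" "\<And>z. z \<in> carr V \<Longrightarrow> ip V x z = ip V y z"
 shows "x = y"
proof -
 have "ip V (vdiff V x y) (vdiff V x y) = 0"
  using assms by (simp add: inner_diff closed)
 then have z: "vdiff V x y = vzero V" using assms by (simp add: ip_definite closed)
 have "x = vadd V x (vzero V)" using assms by (simp add: add_zero)
 also have "\<dots> = vadd V x (vadd V (vscale V (-1) y) y)"
  using assms add_neg[of y] add_commute[of y "vscale V (-1) y"] by (simp add: closed)
 also have "\<dots> = vadd V (vdiff V x y) y"
  using assms by (simp add: vdiff_def add_assoc closed)
 also have "\<dots> = y" unfolding z using assms add_commute[of "vzero V" y] by (simp add: add_zero closed)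
 finally show ?thesis .
qed

lemma nrm_eq_0: "x \<in> carr V \<Longrightarrow> nrm V x = 0 \<longleftrightarrow> x = vzero V"
 using ip_definite inner_self_eq_0 nrm_zero by blast

lemma eq_if_nrm_diff_0: "x \<in> carr V \<Longrightarrow> y \<in> carr V \<Longrightarrow> nrm V (vdiff V x y) = 0 \<Longrightarrow> x = y"
 by (rule inner_ext) (auto intro: inner_cong simp: nrm_diff_self)

lemma tends_unique:
 assumes "\<And>n. X n \<in> carr V" "x \<in> carr V" "y \<in> carr V" "tends V X x" "tends V X y"
 shows "x = y"
proof (rule inner_ext)
 fix z assume z: "z \<in> carr V"
 show "ip V x z = ip V y z"
  by (rule LIMSEQ_unique[of "\<lambda>n. ip V (X n) z"])
    (use assms z tends_const in \<open>auto intro: inner_tendsto\<close>)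
qed (use assms in auto)

lemma complete_tends: "cauchy_in V X \<Longrightarrow> \<exists>x\<in>carr V. tends V X x"
 using complete by (simp add: tends_def)

end

section \<open>Projections, the Riesz theorem and operators given by bounded forms\<close>

context hilbert_space
begin

lemma closed_subspace_projection:
 assumes D: "D \<subseteq> carr V" "D \<noteq> {}"
  and Da: "\<And>x y. x \<in> D \<Longrightarrow> y \<in> D \<Longrightarrow> vadd V x y \<in> D"
  and Ds: "\<And>c x. x \<in> D \<Longrightarrow> vscale V c x \<in> D"
  and Dc: "\<And>X x. (\<And>n. X n \<in> D) \<Longrightarrow> x \<in> carr V \<Longrightarrow> tends V X x \<Longrightarrow> x \<in> D"
  and x: "x \<in> carr V"
 shows "\<exists>p\<in>D. \<forall>y\<in>D. ip V (vdiff V x p) y = 0"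
proof -
 have Dx: "y \<in> carr V" if "y \<in> D" for y using that D by auto
 let ?S = "(\<lambda>y. (nrm V (vdiff V x y))\<^sup>2) ` D"
 define t where "t = Inf ?S"
 have bdd: "bdd_below ?S" by (rule bdd_belowI[of _ 0]) auto
 have le: "t \<le> (nrm V (vdiff V x y))\<^sup>2" if "y \<in> D" for y
  unfolding t_def using bdd that by (intro cInf_lower) auto
 have "\<exists>y\<in>D. (nrm V (vdiff V x y))\<^sup>2 < t + 1 / Suc n" for n
 proof -
  have "Inf ?S < t + 1 / Suc n" by (simp add: t_def)
  then show ?thesis using cInf_lessD[of ?S "t + 1 / Suc n"] D by auto
 qed
 then obtain Y where Y: "\<And>n. Y n \<in> D" "\<And>n. (nrm V (vdiff V x (Y n)))\<^sup>2 < t + 1 / Suc n" by metis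
 note YV = Dx[OF Y(1)]
 \<comment> \<open>The midpoint \<open>?h\<close> lies in \<open>D\<close>, so its squared distance
   from \<open>x\<close> is at least \<open>t\<close>; the parallelogram law then bounds the
   distance of \<open>Y m\<close> and \<open>Y n\<close> by their excess over the infimum.\<close>
 have par: "(nrm V (vdiff V (Y m) (Y n)))\<^sup>2 < 2 / Suc m + 2 / Suc n" for m n
 proof -
  let ?h = "vscale V (1/2) (vadd V (Y m) (Y n))"
  have "(nrm V (vdiff V (Y m) (Y n)))\<^sup>2
    = 2 * (nrm V (vdiff V x (Y m)))\<^sup>2 + 2 * (nrm V (vdiff V x (Y n)))\<^sup>2 - 4 * (nrm V (vdiff V x ?h))\<^sup>2"
   using YV[of m] YV[of n] x inner_cnj[of x "Y m"] inner_cnj[of x "Y n"] inner_cnj[of "Y m" "Y n"]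
   by (simp add: nrm_sq closed inner_simps algebra_simps)
  moreover have "t \<le> (nrm V (vdiff V x ?h))\<^sup>2" by (intro le Da Ds Y)
  ultimately show ?thesis using Y(2)[of m] Y(2)[of n] by linarith
 qed
 have "cauchy_in V Y"
  unfolding cauchy_in_def
 proof (intro conjI allI impI YV)
  fix \<epsilon> :: real assume e: "\<epsilon> > 0"
  obtain N :: nat where N: "4 / \<epsilon>\<^sup>2 < real N" using reals_Archimedean2 by blast
  have N0: "0 < real N" using N e by (metis divide_pos_pos less_trans zero_less_numeral zero_less_power)
  have N4: "4 / real N < \<epsilon>\<^sup>2" using N e N0 by (simp add: field_simps)
  have "nrm V (vdiff V (Y m) (Y n)) < \<epsilon>" if "m \<ge> N" "n \<ge> N" for m n
  proof (rule power2_less_imp_less)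
   have "2 / real (Suc m) \<le> 2 / real N" "2 / real (Suc n) \<le> 2 / real N"
    using that N0 by (auto intro!: divide_left_mono mult_pos_pos)
   then show "(nrm V (vdiff V (Y m) (Y n)))\<^sup>2 < \<epsilon>\<^sup>2" using par[of m n] N4 by linarith
  qed (use e in simp)
  then show "\<exists>N. \<forall>m\<ge>N. \<forall>n\<ge>N. nrm V (vdiff V (Y m) (Y n)) < \<epsilon>" by blast
 qed
 then obtain p where p: "p \<in> carr V" "tends V Y p" using complete_tends by blast
 have pD: "p \<in> D" by (rule Dc[OF Y(1) p])
 have "(\<lambda>n. ip V (vdiff V x (Y n)) (vdiff V x (Y n))) \<longlonglongrightarrow> ip V (vdiff V x p) (vdiff V x p)"
 proof (rule inner_tendsto)
  have "nrm V (vdiff V (vdiff V x (Y n)) (vdiff V x p)) = nrm V (vdiff V (Y n) p)" for n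
   using x p YV by (intro nrm_cong) (simp add: closed inner_simps)
  then show "tends V (\<lambda>n. vdiff V x (Y n)) (vdiff V x p)"
   "tends V (\<lambda>n. vdiff V x (Y n)) (vdiff V x p)"
   using p(2) by (simp_all add: tends_def)
 qed (use x p YV closed in auto)
 from tendsto_Re[OF this] have lim: "(\<lambda>n. (nrm V (vdiff V x (Y n)))\<^sup>2) \<longlonglongrightarrow> (nrm V (vdiff V x p))\<^sup>2"
  using x p YV by (simp add: nrm_sq closed)
 have lim': "(\<lambda>n. t + 1 / Suc n) \<longlonglongrightarrow> t + 0"
  by (intro tendsto_intros LIMSEQ_Suc lim_1_over_n)
 have "(nrm V (vdiff V x p))\<^sup>2 \<le> t + 0"
  by (rule LIMSEQ_le[OF lim lim']) (use Y(2) less_imp_le in blast)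
 then have pmin: "(nrm V (vdiff V x p))\<^sup>2 \<le> t" by simp
 have "ip V (vdiff V x p) y = 0" if y: "y \<in> D" for y
 proof (cases "nrm V y = 0")
  case True
  then show ?thesis using Cauchy_Schwarz[of "vdiff V x p" y] Dx[OF y] x p by (simp add: closed)
 next
  case False
  let ?z = "vdiff V x p"
  \<comment> \<open>\<open>c\<close> is the coefficient of the projection of \<open>?z\<close> onto
    \<open>y\<close>: moving \<open>p\<close> by \<open>c y\<close> would lower the squared distance
    by \<open>|(z,y)|^2 / |y|^2\<close>.\<close>
  define c where "c = ip V ?z y / cor ((nrm V y)\<^sup>2)"
  have yV: "y \<in> carr V" using y Dx by simp
  have z: "?z \<in> carr V" using x p by (simp add: closed)
  have "t \<le> (nrm V (vdiff V x (vadd V p (vscale V c y))))\<^sup>2" by (intro le Da Ds y pD)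
  also have "nrm V (vdiff V x (vadd V p (vscale V c y))) = nrm V (vdiff V ?z (vscale V c y))"
   using x p yV by (intro nrm_cong) (simp add: closed inner_simps)
  also have "(nrm V (vdiff V ?z (vscale V c y)))\<^sup>2
    = (nrm V ?z)\<^sup>2 - 2 * Re (cnj c * ip V ?z y) + (cmod c * nrm V y)\<^sup>2"
   using z yV by (simp add: nrm_sq_diff closed nrm_scale inner_scale_right)
  also have "cnj c * ip V ?z y = cor ((cmod (ip V ?z y))\<^sup>2 / (nrm V y)\<^sup>2)"
   unfolding c_def of_real_divide complex_norm_square by simp
  also have "(cmod c * nrm V y)\<^sup>2 = (cmod (ip V ?z y))\<^sup>2 / (nrm V y)\<^sup>2"
  proof -
   have "cmod c = cmod (ip V ?z y) / (nrm V y)\<^sup>2" by (simp add: c_def norm_divide norm_power)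
   then show ?thesis using False by (simp add: power2_eq_square)
  qed
  finally have "(cmod (ip V ?z y))\<^sup>2 / (nrm V y)\<^sup>2 \<le> 0" using pmin by simp
  then show ?thesis using False by (simp add: divide_le_0_iff)
 qed
 then show ?thesis using pD by blast
qed

text \<open>Subtracting from \<open>x\<close> its projection to \<open>D\<close> leaves a vector
  orthogonal to \<open>D\<close>. This converts totality into equality of sets, for the closure of
  the rational span of a fundamental sequence and for the limits of Cauchy sequences.\<close>

lemma total_subspace_eq_carr:
 assumes D: "D \<subseteq> carr V" "D \<noteq> {}"
  and Da: "\<And>x y. x \<in> D \<Longrightarrow> y \<in> D \<Longrightarrow> vadd V x y \<in> D"
  and Ds: "\<And>c x. x \<in> D \<Longrightarrow> vscale V c x \<in> D"
  and Dc: "\<And>X x. (\<And>n. X n \<in> D) \<Longrightarrow> x \<in> carr V \<Longrightarrow> tends V X x \<Longrightarrow> x \<in> D"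
  and tot: "\<And>z. z \<in> carr V \<Longrightarrow> (\<And>y. y \<in> D \<Longrightarrow> ip V z y = 0) \<Longrightarrow> z = vzero V"
 shows "D = carr V"
proof
 show "carr V \<subseteq> D"
 proof
  fix x assume x: "x \<in> carr V"
  have "\<exists>p\<in>D. \<forall>y\<in>D. ip V (vdiff V x p) y = 0"
   by (rule closed_subspace_projection[OF D Da Ds Dc x])
  then obtain p where p: "p \<in> D" "\<forall>y\<in>D. ip V (vdiff V x p) y = 0" by blast
  have pV: "p \<in> carr V" using p D by auto
  have "vdiff V x p = vzero V" using tot p x pV by (simp add: closed)
  then have "x = p" using x pV by (intro eq_if_nrm_diff_0) (auto simp: nrm_zero)
  then show "x \<in> D" using p by simp
 qed
qed (use D in simp)

theorem Riesz_representation: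
 assumes add: "\<And>x y. x \<in> carr V \<Longrightarrow> y \<in> carr V \<Longrightarrow> \<phi> (vadd V x y) = \<phi> x + \<phi> y"
  and scale: "\<And>c x. x \<in> carr V \<Longrightarrow> \<phi> (vscale V c x) = c * \<phi> x"
  and bound: "\<And>x. x \<in> carr V \<Longrightarrow> cmod (\<phi> x) \<le> C * nrm V x"
 shows "\<exists>z\<in>carr V. \<forall>x\<in>carr V. \<phi> x = ip V x z"
proof (cases "\<forall>x\<in>carr V. \<phi> x = 0")
 case True
 then show ?thesis using zero_in by (intro bexI[of _ "vzero V"]) (auto simp: inner_zero_right)
next
 case False
 then obtain x where x: "x \<in> carr V" "\<phi> x \<noteq> 0" by blast
 have diff: "\<phi> (vdiff V x y) = \<phi> x - \<phi> y" if "x \<in> carr V" "y \<in> carr V" for x y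
  using that by (simp add: vdiff_def add scale closed)
 let ?D = "{y \<in> carr V. \<phi> y = 0}"
 have "\<exists>p\<in>?D. \<forall>y\<in>?D. ip V (vdiff V x p) y = 0"
 proof (rule closed_subspace_projection[OF _ _ _ _ _ x(1)])
  have "\<phi> (vzero V) = 0" using scale[of x 0] scale[of "vzero V" 0] bound[of "vzero V"] by (simp add: nrm_zero zero_in)
  then show "?D \<noteq> {}" using zero_in by auto
 next
  fix X y assume X: "\<And>n. X n \<in> ?D" and y: "y \<in> carr V" and t: "tends V X y"
  have "norm (\<phi> y) \<le> C * nrm V (vdiff V (X n) y)" for n
   using bound[of "vdiff V (X n) y"] diff[of "X n" y] X[of n] y by (simp add: closed)
  moreover have "(\<lambda>n. C * nrm V (vdiff V (X n) y)) \<longlonglongrightarrow> C * 0"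
   using t by (intro tendsto_intros) (simp add: tends_def)
  ultimately have "norm (\<phi> y) \<le> C * 0" by (meson LIMSEQ_le_const)
  then show "y \<in> ?D" using y by simp
 qed (auto simp: add scale closed)
 then obtain p where p: "p \<in> carr V" "\<phi> p = 0"
  and orth: "\<And>y. y \<in> carr V \<Longrightarrow> \<phi> y = 0 \<Longrightarrow> ip V (vdiff V x p) y = 0" by blast
 define w where "w = vdiff V x p"
 have w: "w \<in> carr V" "\<phi> w \<noteq> 0" using x p by (auto simp: w_def closed diff)
 have w0: "ip V w w \<noteq> 0"
 proof
  assume "ip V w w = 0"
  then have "nrm V w = 0" using w by (simp add: inner_self_eq_0)
  then show False using bound[OF w(1)] w(2) by simp
 qed
 \<comment> \<open>\<open>w\<close> spans the orthogonal complement of the kernel of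
   \<open>\<phi>\<close>; the scalar is forced by \<open>\<phi> w = (w, z)\<close>, conjugated
   because the second variable is conjugate linear.\<close>
 let ?z = "vscale V (cnj (\<phi> w / ip V w w)) w"
 have "\<phi> y = ip V y ?z" if y: "y \<in> carr V" for y
 proof -
  let ?v = "vdiff V y (vscale V (\<phi> y / \<phi> w) w)"
  have "\<phi> ?v = 0" using y w by (simp add: diff scale closed)
  then have "ip V w ?v = 0" using orth[of ?v] y w by (simp add: w_def[symmetric] closed)
  then have "ip V ?v w = 0" using inner_cnj[of w ?v] y w by (simp add: closed)
  then have "ip V y w = \<phi> y / \<phi> w * ip V w w" using y w by (simp add: inner_simps closed)
  then show ?thesis using y w w0 by (simp add: inner_simps closed)
 qed
 then show ?thesis using scale_in[OF w(1)] by blast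
qed

lemma bounded_form_operator:
 assumes addl: "\<And>x y z. x \<in> carr V \<Longrightarrow> y \<in> carr V \<Longrightarrow> z \<in> carr V \<Longrightarrow> b (vadd V x y) z = b x z + b y z"
  and scalel: "\<And>c x y. x \<in> carr V \<Longrightarrow> y \<in> carr V \<Longrightarrow> b (vscale V c x) y = c * b x y"
  and addr: "\<And>x y z. x \<in> carr V \<Longrightarrow> y \<in> carr V \<Longrightarrow> z \<in> carr V \<Longrightarrow> b x (vadd V y z) = b x y + b x z"
  and scaler: "\<And>c x y. x \<in> carr V \<Longrightarrow> y \<in> carr V \<Longrightarrow> b x (vscale V c y) = cnj c * b x y"
  and bound: "\<And>x y. x \<in> carr V \<Longrightarrow> y \<in> carr V \<Longrightarrow> cmod (b x y) \<le> C * nrm V x * nrm V y"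
 shows "\<exists>T. T \<in> extensional (carr V) \<and> bounded_op V T \<and> (\<forall>x\<in>carr V. \<forall>y\<in>carr V. ip V (T x) y = b x y)"
proof -
 have "\<exists>z\<in>carr V. \<forall>y\<in>carr V. cnj (b x y) = ip V y z" if "x \<in> carr V" for x
  using that bound
  by (intro Riesz_representation[of _ "C * nrm V x"]) (auto simp: addr scaler)
 then have "\<exists>z\<in>carr V. \<forall>y\<in>carr V. b x y = ip V z y" if "x \<in> carr V" for x
  using that inner_cnj by (metis complex_cnj_cnj)
 then obtain T where T: "\<And>x. x \<in> carr V \<Longrightarrow> T x \<in> carr V"
  "\<And>x y. x \<in> carr V \<Longrightarrow> y \<in> carr V \<Longrightarrow> b x y = ip V (T x) y" by metis
 have "nrm V (T x) \<le> C * nrm V x" if x: "x \<in> carr V" for x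
 proof (cases "nrm V (T x) = 0")
  case True
  \<comment> \<open>\<open>C\<close> carries no sign condition; testing the bound on
    \<open>b x x\<close> makes \<open>C * nrm V x\<close> nonnegative.\<close>
  have "0 \<le> C * nrm V x"
  proof (cases "nrm V x = 0")
   case False
   have "0 \<le> C * nrm V x * nrm V x" using bound[OF x x] norm_ge_zero order_trans by blast
   then show ?thesis using False nrm_nonneg[OF x] by (simp add: zero_le_mult_iff)
  qed simp
  then show ?thesis using True by simp
 next
  case False
  have "(nrm V (T x))\<^sup>2 = cmod (b x (T x))"
   using x T by (simp add: inner_self norm_power)
  also have "\<dots> \<le> C * nrm V x * nrm V (T x)" using bound x T by blast
  finally show ?thesis using False nrm_nonneg[OF T(1)[OF x]]
   by (simp add: power2_eq_square)
 qed
 moreover have "linear_op V V (restrict T (carr V))"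
  unfolding linear_op_def
 proof (intro conjI allI ballI)
  show "restrict T (carr V) ` carr V \<subseteq> carr V" using T(1) by auto
 next
  fix x y assume xy: "x \<in> carr V" "y \<in> carr V"
  have "T (vadd V x y) = vadd V (T x) (T y)"
   by (rule inner_ext) (use xy in \<open>simp_all add: T(1) closed inner_add T(2)[symmetric] addl\<close>)
  then show "restrict T (carr V) (vadd V x y) = vadd V (restrict T (carr V) x) (restrict T (carr V) y)"
   using xy by (simp add: closed)
 next
  fix c x assume x: "x \<in> carr V"
  have "T (vscale V c x) = vscale V c (T x)"
   by (rule inner_ext) (use x in \<open>simp_all add: T(1) closed inner_scale T(2)[symmetric] scalel\<close>)
  then show "restrict T (carr V) (vscale V c x) = vscale V c (restrict T (carr V) x)"
   using x by (simp add: closed)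
 qed
 ultimately have "bounded_op V (restrict T (carr V))"
  unfolding bounded_op_def by auto
 then show ?thesis using T by (intro exI[of _ "restrict T (carr V)"]) auto
qed

text \<open>For fixed \<open>k\<close> the functional sending \<open>x\<close> to
  \<open>(S x - T x, k)\<close> is represented by some \<open>z\<close>; it vanishes on
  \<open>A\<close>, so totality gives \<open>z = 0\<close>. This avoids approximation by
  combinations of members of \<open>A\<close>, which need not be a subspace.\<close>

lemma bounded_op_eqI:
 assumes S: "bounded_op V S" and T: "bounded_op V T"
  and eq: "\<And>x. x \<in> A \<Longrightarrow> S x = T x" and A: "A \<subseteq> carr V"
  and tot: "\<And>z. z \<in> carr V \<Longrightarrow> (\<And>x. x \<in> A \<Longrightarrow> ip V x z = 0) \<Longrightarrow> z = vzero V"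
  and x: "x \<in> carr V"
 shows "S x = T x"
proof (rule inner_ext)
 have inS: "S x \<in> carr V" and inT: "T x \<in> carr V" if "x \<in> carr V" for x
  using S T that by (auto simp: bounded_op_def linear_op_def)
 show "S x \<in> carr V" "T x \<in> carr V" using x inS inT by auto
 fix k assume k: "k \<in> carr V"
 obtain C1 C2 where C1: "\<And>x. x \<in> carr V \<Longrightarrow> nrm V (S x) \<le> C1 * nrm V x"
  and C2: "\<And>x. x \<in> carr V \<Longrightarrow> nrm V (T x) \<le> C2 * nrm V x"
  using S T by (auto simp: bounded_op_def)
 have "\<exists>z\<in>carr V. \<forall>x\<in>carr V. ip V (S x) k - ip V (T x) k = ip V x z"
 proof (rule Riesz_representation[of _ "(C1 + C2) * nrm V k"])
  fix x assume x: "x \<in> carr V"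
  have "cmod (ip V (S x) k - ip V (T x) k) \<le> nrm V (S x) * nrm V k + nrm V (T x) * nrm V k"
   using x k inS inT Cauchy_Schwarz[of "S x" k] Cauchy_Schwarz[of "T x" k]
   by (intro order_trans[OF norm_triangle_ineq4]) auto
  also have "\<dots> \<le> (C1 * nrm V x) * nrm V k + (C2 * nrm V x) * nrm V k"
   using x k C1 C2 nrm_nonneg by (intro add_mono mult_right_mono) auto
  finally show "cmod (ip V (S x) k - ip V (T x) k) \<le> (C1 + C2) * nrm V k * nrm V x"
   by (simp add: algebra_simps)
 qed (use S T k inS inT in \<open>auto simp: bounded_op_def linear_op_def inner_simps algebra_simps\<close>)
 then obtain z where z: "z \<in> carr V" "\<And>x. x \<in> carr V \<Longrightarrow> ip V (S x) k - ip V (T x) k = ip V x z" by blast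
 have "z = vzero V"
 proof (rule tot[OF z(1)])
  fix x assume "x \<in> A"
  then show "ip V x z = 0" using z(2)[of x] eq[of x] A by auto
 qed
 then show "ip V (S x) k = ip V (T x) k" using z(2)[OF x] x by (simp add: inner_zero_right)
qed

end

section \<open>Separation and completion computed inside a given Hilbert space\<close>

definition closed_ops :: "('a, 'm) cvs_scheme \<Rightarrow> bool" where
 "closed_ops S \<longleftrightarrow> (\<forall>x\<in>carr S. \<forall>y\<in>carr S. vadd S x y \<in> carr S) \<and> (\<forall>c. \<forall>x\<in>carr S. vscale S c x \<in> carr S)"

text \<open>\<open>presents S J l\<close>: the map \<open>l\<close> identifies the semi-inner product space \<open>S\<close>, up to null
 vectors, with a subspace of \<open>J\<close>. Separation, completion and the tensor product only depend on
 their argument up to null vectors, so that they can be computed inside \<open>J\<close>.\<close>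

definition presents :: "('a, 'm) ips_scheme \<Rightarrow> ('b, 'n) ips_scheme \<Rightarrow> ('a \<Rightarrow> 'b) \<Rightarrow> bool" where
 "presents S J l \<longleftrightarrow> carr S \<noteq> {} \<and>
   (\<forall>x\<in>carr S. \<forall>y\<in>carr S. vadd S x y \<in> carr S) \<and>
   (\<forall>c. \<forall>x\<in>carr S. vscale S c x \<in> carr S) \<and>
   linear_op S J l \<and> (\<forall>x\<in>carr S. \<forall>y\<in>carr S. ip S x y = ip J (l x) (l y))"

context
 fixes S :: "('a, 'm) ips_scheme" and J :: "('b, 'n) ips_scheme" and l :: "'a \<Rightarrow> 'b"
 assumes J: "hilbert_space J" and pres: "presents S J l"
begin

interpretation J: hilbert_space J by (rule J)

lemma presents_simps:
 "x \<in> carr S \<Longrightarrow> l x \<in> carr J"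
 "x \<in> carr S \<Longrightarrow> y \<in> carr S \<Longrightarrow> vadd S x y \<in> carr S"
 "x \<in> carr S \<Longrightarrow> vscale S c x \<in> carr S"
 "x \<in> carr S \<Longrightarrow> y \<in> carr S \<Longrightarrow> l (vadd S x y) = vadd J (l x) (l y)"
 "x \<in> carr S \<Longrightarrow> l (vscale S c x) = vscale J c (l x)"
 "x \<in> carr S \<Longrightarrow> y \<in> carr S \<Longrightarrow> ip S x y = ip J (l x) (l y)"
 using pres by (auto simp: presents_def linear_op_def)

lemma presents_diff:
 assumes "x \<in> carr S" "y \<in> carr S"
 shows "vdiff S x y \<in> carr S" "l (vdiff S x y) = vdiff J (l x) (l y)"
  "nrm S (vdiff S x y) = nrm J (vdiff J (l x) (l y))"
 using assms by (simp_all add: vdiff_def presents_simps nrm_def)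

text \<open>Definiteness of \<open>J\<close> turns null differences in \<open>S\<close> into equal
  images, so the classes of \<open>S\<close> are the fibres of \<open>l\<close>.\<close>

lemma presents_cls:
 assumes x: "x \<in> carr S"
 shows "y \<in> cls S x \<longleftrightarrow> y \<in> carr S \<and> l y = l x"
proof -
 have "ip S (vdiff S y x) (vdiff S y x) = 0 \<longleftrightarrow> l y = l x" if y: "y \<in> carr S"
 proof -
  have "ip S (vdiff S y x) (vdiff S y x) = 0 \<longleftrightarrow> nrm J (vdiff J (l y) (l x)) = 0"
   using x y by (simp add: presents_simps presents_diff J.inner_self_eq_0 J.closed)
  also have "\<dots> \<longleftrightarrow> l y = l x"
   using x y J.eq_if_nrm_diff_0 J.nrm_diff_self by (metis presents_simps(1))
  finally show ?thesis .
 qed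
 then show ?thesis by (auto simp: cls_def)
qed

lemma presents_rep:
 assumes "x \<in> carr S"
 shows "rep (cls S x) \<in> carr S" "l (rep (cls S x)) = l x"
 using someI[of "\<lambda>y. y \<in> cls S x" x] presents_cls[OF assms] assms by (auto simp: rep_def)

lemma presents_separation:
 assumes surj: "l ` carr S = carr J"
 shows "hilbert_iso (separation S) J (\<lambda>A. l (rep A))"
proof -
 let ?T = "\<lambda>A. l (rep A)"
 have eq: "cls S x = cls S y" if "x \<in> carr S" "y \<in> carr S" "l x = l y" for x y
  using that presents_cls by auto
 have "linear_op (separation S) J ?T"
  unfolding linear_op_def by (auto simp: separation_def presents_rep presents_simps)
 moreover have "inj_on ?T (carr (separation S))"
 proof (rule inj_onI)
  fix A B assume "A \<in> carr (separation S)" "B \<in> carr (separation S)" and AB: "l (rep A) = l (rep B)"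
  then obtain x y where "x \<in> carr S" "A = cls S x" "y \<in> carr S" "B = cls S y" by (auto simp: separation_def)
  then show "A = B" using AB eq[of x y] by (simp add: presents_rep)
 qed
 moreover have "?T ` carr (separation S) = carr J"
  using surj by (auto simp: separation_def presents_rep presents_simps image_iff) (metis presents_rep(2) imageE)
 moreover have "ip J (?T A) (?T B) = ip (separation S) A B"
  if "A \<in> carr (separation S)" "B \<in> carr (separation S)" for A B
  using that by (auto simp: separation_def presents_rep presents_simps)
 ultimately show ?thesis by (simp add: hilbert_iso_def bij_betw_def)
qed

text \<open>The completion will be compared with \<open>J\<close> without becoming an instance of
  \<open>hilbert_space\<close>; closure under the operations is what the transport of operators asks
  of it.\<close>

lemma presents_separation_closed: "closed_ops (separation S)"
 by (auto simp: closed_ops_def separation_def presents_rep presents_simps)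

definition limJ :: "(nat \<Rightarrow> 'a) \<Rightarrow> 'b" where
 "limJ X = (SOME y. y \<in> carr J \<and> tends J (\<lambda>n. l (X n)) y)"

lemma cauchy_presents: "cauchy_in S X \<longleftrightarrow> (\<forall>n. X n \<in> carr S) \<and> cauchy_in J (\<lambda>n. l (X n))"
 unfolding cauchy_in_def by (auto simp: presents_diff presents_simps)

lemma limJ:
 assumes "cauchy_in S X"
 shows "limJ X \<in> carr J" "tends J (\<lambda>n. l (X n)) (limJ X)"
proof -
 have "\<exists>y. y \<in> carr J \<and> tends J (\<lambda>n. l (X n)) y"
  using assms J.complete_tends by (auto simp: cauchy_presents)
 from someI_ex[OF this] show "limJ X \<in> carr J" "tends J (\<lambda>n. l (X n)) (limJ X)"
  by (auto simp: limJ_def)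
qed

lemma limJ_eqI:
 assumes X: "\<And>n. X n \<in> carr S" and y: "y \<in> carr J" and t: "tends J (\<lambda>n. l (X n)) y"
 shows "cauchy_in S X" "limJ X = y"
proof -
 show c: "cauchy_in S X"
  using J.tends_cauchy[OF _ y t] X by (simp add: cauchy_presents presents_simps)
 show "limJ X = y"
  using J.tends_unique[OF _ limJ(1)[OF c] y limJ(2)[OF c] t] X by (simp add: presents_simps)
qed

text \<open>All operations of \<open>J\<close> are continuous along convergent sequences, so Cauchy
  sequences of \<open>S\<close> are presented by the limits of their images. Completion thereby
  becomes a second use of separation.\<close>

lemma presents_cauchy_space: "presents (cauchy_space S) J limJ"
proof -
 have in_S: "X n \<in> carr S" if "cauchy_in S X" for X n using that by (simp add: cauchy_in_def)
 have add: "cauchy_in S (\<lambda>n. vadd S (X n) (Y n))" "limJ (\<lambda>n. vadd S (X n) (Y n)) = vadd J (limJ X) (limJ Y)"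
  if X: "cauchy_in S X" and Y: "cauchy_in S Y" for X Y
 proof -
  have "tends J (\<lambda>n. l (vadd S (X n) (Y n))) (vadd J (limJ X) (limJ Y))"
   using J.tends_add[OF _ limJ(1)[OF X] _ limJ(1)[OF Y] limJ(2)[OF X] limJ(2)[OF Y]] in_S[OF X] in_S[OF Y]
   by (simp add: presents_simps)
  then show "cauchy_in S (\<lambda>n. vadd S (X n) (Y n))" "limJ (\<lambda>n. vadd S (X n) (Y n)) = vadd J (limJ X) (limJ Y)"
   using limJ_eqI[of "\<lambda>n. vadd S (X n) (Y n)" "vadd J (limJ X) (limJ Y)"]
    presents_simps(2)[OF in_S[OF X] in_S[OF Y]] J.add_in[OF limJ(1)[OF X] limJ(1)[OF Y]] by blast+
 qed
 have scale: "cauchy_in S (\<lambda>n. vscale S c (X n))" "limJ (\<lambda>n. vscale S c (X n)) = vscale J c (limJ X)"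
  if X: "cauchy_in S X" for X c
 proof -
  have "tends J (\<lambda>n. l (vscale S c (X n))) (vscale J c (limJ X))"
   using J.tends_scale[OF _ limJ(1)[OF X] limJ(2)[OF X]] in_S[OF X]
   by (simp add: presents_simps)
  then show "cauchy_in S (\<lambda>n. vscale S c (X n))" "limJ (\<lambda>n. vscale S c (X n)) = vscale J c (limJ X)"
   using limJ_eqI[of "\<lambda>n. vscale S c (X n)" "vscale J c (limJ X)"]
    presents_simps(3)[OF in_S[OF X]] J.scale_in[OF limJ(1)[OF X]] by blast+
 qed
 have ip: "lim (\<lambda>n. ip S (X n) (Y n)) = ip J (limJ X) (limJ Y)"
  if X: "cauchy_in S X" and Y: "cauchy_in S Y" for X Y
  using J.inner_tendsto[OF _ limJ(1)[OF X] _ limJ(1)[OF Y] limJ(2)[OF X] limJ(2)[OF Y]] in_S[OF X] in_S[OF Y]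
  by (simp add: presents_simps limI)
 obtain x where x: "x \<in> carr S" using pres by (auto simp: presents_def)
 then have "cauchy_in S (\<lambda>n. x)"
  using limJ_eqI(1)[of "\<lambda>n. x" "l x"] by (simp add: presents_simps J.tends_const)
 then show ?thesis
  unfolding presents_def linear_op_def cauchy_space_def by (auto simp: add scale ip limJ)
qed

lemma limJ_const: "x \<in> carr S \<Longrightarrow> cauchy_in S (\<lambda>n. x)" "x \<in> carr S \<Longrightarrow> limJ (\<lambda>n. x) = l x"
 using limJ_eqI[of "\<lambda>n. x" "l x"] by (simp_all add: presents_simps J.tends_const)

text \<open>The limits form a subspace containing every \<open>l x\<close>, hence a total one. It is
  closed: replacing the n-th member of a convergent sequence of limits by some \<open>l x\<close>
  within \<open>1 / Suc n\<close> gives a sequence from \<open>S\<close> with the same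
  limit.\<close>

lemma limJ_surj:
 assumes tot: "\<And>z. z \<in> carr J \<Longrightarrow> (\<And>x. x \<in> carr S \<Longrightarrow> ip J z (l x) = 0) \<Longrightarrow> z = vzero J"
 shows "limJ ` carr (cauchy_space S) = carr J"
proof (rule J.total_subspace_eq_carr)
 note P = presents_cauchy_space
 have c: "carr (cauchy_space S) = {X. cauchy_in S X}" by (simp add: cauchy_space_def)
 show "limJ ` carr (cauchy_space S) \<subseteq> carr J" using limJ by (auto simp: c)
 show "limJ ` carr (cauchy_space S) \<noteq> {}" using P by (auto simp: presents_def)
 show "vadd J x y \<in> limJ ` carr (cauchy_space S)"
  if "x \<in> limJ ` carr (cauchy_space S)" "y \<in> limJ ` carr (cauchy_space S)" for x y
  using that P by (auto simp: presents_def linear_op_def) (metis imageI)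
 show "vscale J c x \<in> limJ ` carr (cauchy_space S)"
  if "x \<in> limJ ` carr (cauchy_space S)" for c x
  using that P by (auto simp: presents_def linear_op_def) (metis imageI)
 show "z = vzero J" if "z \<in> carr J" "\<And>y. y \<in> limJ ` carr (cauchy_space S) \<Longrightarrow> ip J z y = 0" for z
 proof (rule tot[OF that(1)])
  fix x assume "x \<in> carr S"
  then have "limJ (\<lambda>n. x) \<in> limJ ` carr (cauchy_space S)" using limJ_const(1)[of x] by (simp add: c)
  then show "ip J z (l x) = 0" using that(2) limJ_const(2)[OF \<open>x \<in> carr S\<close>] by metis
 qed
 fix Y y assume Y: "\<And>n. Y n \<in> limJ ` carr (cauchy_space S)" and y: "y \<in> carr J" and t: "tends J Y y"
 have "\<exists>x\<in>carr S. nrm J (vdiff J (l x) (Y n)) < 1 / Suc n" for n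
 proof -
  obtain X where X: "cauchy_in S X" "Y n = limJ X" using Y[of n] by (auto simp: c)
  have Xn: "X m \<in> carr S" for m using X by (simp add: cauchy_in_def)
  have "(\<lambda>m. nrm J (vdiff J (l (X m)) (limJ X))) \<longlonglongrightarrow> 0" using limJ(2)[OF X(1)] by (simp add: tends_def)
  then have "\<forall>\<^sub>F m in sequentially. nrm J (vdiff J (l (X m)) (limJ X)) < 1 / Suc n"
   by (rule order_tendstoD) simp
  then show ?thesis using Xn X(2) by (auto simp: eventually_sequentially)
 qed
 then obtain x where x: "\<And>n. x n \<in> carr S" "\<And>n. nrm J (vdiff J (l (x n)) (Y n)) < 1 / Suc n" by metis
 have YJ: "Y n \<in> carr J" for n using Y[of n] limJ by (auto simp: c)
 have "tends J (\<lambda>n. l (x n)) y"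
  unfolding tends_def
 proof (rule tendsto_sandwich[OF _ _ tendsto_const])
  show "(\<lambda>n. 1 / Suc n + nrm J (vdiff J (Y n) y)) \<longlonglongrightarrow> 0"
   using tendsto_add[OF LIMSEQ_Suc[OF lim_1_over_n] t[unfolded tends_def]] by simp
  show "\<forall>\<^sub>F n in sequentially. nrm J (vdiff J (l (x n)) y) \<le> 1 / Suc n + nrm J (vdiff J (Y n) y)"
   using J.nrm_diff_triangle[OF _ YJ y] x presents_simps(1)
   by (intro always_eventually allI) (smt (verit, best))
 qed (use x y in \<open>simp add: J.nrm_nonneg J.closed presents_simps\<close>)
 from limJ_eqI[OF x(1) y this] show "y \<in> limJ ` carr (cauchy_space S)" by (auto simp: c)
qed

end

text \<open>Totality makes the limits exhaust \<open>J\<close>, and separation identifies exactly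
  the sequences with equal limit.\<close>

lemma presents_completion:
 assumes J: "hilbert_space J" and P: "presents S J l"
  and tot: "\<And>z. z \<in> carr J \<Longrightarrow> (\<And>x. x \<in> carr S \<Longrightarrow> ip J z (l x) = 0) \<Longrightarrow> z = vzero J"
 shows "\<exists>T. hilbert_iso (completion S) J T \<and> closed_ops (completion S) \<and> (\<forall>x\<in>carr S. embed S x \<in> carr (completion S) \<and> T (embed S x) = l x)"
proof (intro exI conjI ballI)
 note PC = presents_cauchy_space[OF J P]
 show "hilbert_iso (completion S) J (\<lambda>A. limJ J l (rep A))"
  unfolding completion_def by (rule presents_separation[OF J PC limJ_surj[OF J P tot]])
 show "closed_ops (completion S)" unfolding completion_def by (rule presents_separation_closed[OF J PC])
 fix x assume x: "x \<in> carr S"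
 then have c: "(\<lambda>n. x) \<in> carr (cauchy_space S)"
  using limJ_const(1)[OF J P x] by (simp add: cauchy_space_def)
 then show "embed S x \<in> carr (completion S)"
  by (simp add: completion_def embed_def separation_def)
 show "limJ J l (rep (embed S x)) = l x"
  using presents_rep(2)[OF J PC c] limJ_const(2)[OF J P x] by (simp add: embed_def)
qed

subsection \<open>The tensor product\<close>

text \<open>Linear extension of \<open>g\<close> from basis elements to formal combinations; scalar
  valued because the carriers come with a binary addition only.\<close>

definition fsum :: "('p \<Rightarrow> complex) \<Rightarrow> ('p \<Rightarrow> complex) \<Rightarrow> complex" where
 "fsum g a = (\<Sum>p\<in>{p. a p \<noteq> 0}. a p * g p)"

lemma fsum_superset: "finite F \<Longrightarrow> {p. a p \<noteq> 0} \<subseteq> F \<Longrightarrow> fsum g a = (\<Sum>p\<in>F. a p * g p)"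
 unfolding fsum_def by (intro sum.mono_neutral_left) auto

lemma fsum_add:
 assumes "finite {p. a p \<noteq> 0}" "finite {p. b p \<noteq> 0}"
 shows "fsum g (\<lambda>p. a p + b p) = fsum g a + fsum g b"
proof -
 let ?F = "{p. a p \<noteq> 0} \<union> {p. b p \<noteq> 0}"
 have "fsum g (\<lambda>p. a p + b p) = (\<Sum>p\<in>?F. (a p + b p) * g p)"
  by (rule fsum_superset) (use assms in auto)
 moreover have "fsum g a = (\<Sum>p\<in>?F. a p * g p)" by (rule fsum_superset) (use assms in auto)
 moreover have "fsum g b = (\<Sum>p\<in>?F. b p * g p)" by (rule fsum_superset) (use assms in auto)
 ultimately show ?thesis by (simp add: sum.distrib algebra_simps)
qed

lemma fsum_scale: "fsum g (\<lambda>p. c * a p) = c * fsum g a"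
 by (cases "c = 0") (simp_all add: fsum_def sum_distrib_left mult.assoc)

lemma fsum_diff:
 assumes "finite {p. a p \<noteq> 0}" "finite {p. b p \<noteq> 0}"
 shows "fsum g (\<lambda>p. a p - b p) = fsum g a - fsum g b"
 using fsum_add[of a "\<lambda>p. (-1) * b p" g] fsum_scale[of g "-1" b] assms by simp

lemma finite_single: "finite {p. single q p \<noteq> 0}"
 by (rule finite_subset[of _ "{q}"]) (auto simp: single_def)

lemma fsum_single: "fsum g (single q) = g q"
 by (subst fsum_superset[of "{q}"]) (auto simp: single_def)

lemma finite_scale: "finite {p. a p \<noteq> 0} \<Longrightarrow> finite {p. c * a p \<noteq> (0::complex)}"
 by (rule finite_subset) auto

lemma finite_diff: "finite {p. a p \<noteq> 0} \<Longrightarrow> finite {p. b p \<noteq> 0} \<Longrightarrow> finite {p. a p - b p \<noteq> (0::complex)}"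
 by (rule finite_subset[of _ "{p. a p \<noteq> 0} \<union> {p. b p \<noteq> 0}"]) auto

lemma finite_add: "finite {p. a p \<noteq> 0} \<Longrightarrow> finite {p. b p \<noteq> 0} \<Longrightarrow> finite {p. a p + b p \<noteq> (0::complex)}"
 by (rule finite_subset[of _ "{p. a p \<noteq> 0} \<union> {p. b p \<noteq> 0}"]) auto

lemma finite_relation: "b \<in> bilinear_relations V W \<Longrightarrow> finite {p. b p \<noteq> 0}"
 unfolding bilinear_relations_def by (auto intro!: finite_diff finite_scale finite_single)

lemma fsum_relation_span:
 assumes "b \<in> relation_span V W" and "\<And>b. b \<in> bilinear_relations V W \<Longrightarrow> fsum g b = 0"
 shows "finite {p. b p \<noteq> 0}" "fsum g b = 0"
proof -
 obtain F c where F: "finite F" "F \<subseteq> bilinear_relations V W" "b = (\<lambda>p. \<Sum>b\<in>F. c b * b p)"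
  using assms(1) unfolding relation_span_def by blast
 have "finite {p. (\<Sum>b\<in>F. c b * b p) \<noteq> 0} \<and> fsum g (\<lambda>p. \<Sum>b\<in>F. c b * b p) = 0"
  using F(1,2)
 proof (induction F rule: finite_induct)
  case empty show ?case by (simp add: fsum_def)
 next
  case (insert x F)
  have x: "x \<in> bilinear_relations V W" using insert by simp
  have "finite {p. c x * x p \<noteq> 0}" by (rule finite_scale[OF finite_relation[OF x]])
  moreover have "fsum g (\<lambda>p. c x * x p) = 0" using assms(2)[OF x] by (simp add: fsum_scale)
  ultimately show ?case using insert by (simp add: fsum_add finite_add)
 qed
 then show "finite {p. b p \<noteq> 0}" "fsum g b = 0" using F(3) by auto
qed

text \<open>A bilinear map \<open>u\<close> into \<open>J\<close> that reproduces
  \<open>\<phi>\<close> and has total range determines the completion of the tensor product;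
  positivity of \<open>\<phi>\<close> is inherited from \<open>J\<close>.\<close>

locale tensor_presentation = V: cvector_space V + W: cvector_space W + J: hilbert_space J
 for V :: "('v, 'm) cvs_scheme" and W :: "('w, 'n) cvs_scheme" and J :: "('j, 'k) ips_scheme" +
 fixes u :: "'v \<Rightarrow> 'w \<Rightarrow> 'j"
  and \<phi> :: "'v \<Rightarrow> 'w \<Rightarrow> 'v \<Rightarrow> 'w \<Rightarrow> complex"
 assumes u_in: "v \<in> carr V \<Longrightarrow> w \<in> carr W \<Longrightarrow> u v w \<in> carr J"
  and u_addl: "v \<in> carr V \<Longrightarrow> v' \<in> carr V \<Longrightarrow> w \<in> carr W \<Longrightarrow> u (vadd V v v') w = vadd J (u v w) (u v' w)"
  and u_addr: "v \<in> carr V \<Longrightarrow> w \<in> carr W \<Longrightarrow> w' \<in> carr W \<Longrightarrow> u v (vadd W w w') = vadd J (u v w) (u v w')"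
  and u_scalel: "v \<in> carr V \<Longrightarrow> w \<in> carr W \<Longrightarrow> u (vscale V c v) w = vscale J c (u v w)"
  and u_scaler: "v \<in> carr V \<Longrightarrow> w \<in> carr W \<Longrightarrow> u v (vscale W c w) = vscale J c (u v w)"
  and \<phi>: "v \<in> carr V \<Longrightarrow> w \<in> carr W \<Longrightarrow> v' \<in> carr V \<Longrightarrow> w' \<in> carr W \<Longrightarrow> \<phi> v w v' w' = ip J (u v w) (u v' w')"
  and total: "z \<in> carr J \<Longrightarrow> (\<And>v w. v \<in> carr V \<Longrightarrow> w \<in> carr W \<Longrightarrow> ip J z (u v w) = 0) \<Longrightarrow> z = vzero J"
begin

definition ipu :: "'j \<Rightarrow> 'v \<times> 'w \<Rightarrow> complex" where
 "ipu z p = ip J (u (fst p) (snd p)) z"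

text \<open>The vector \<open>\<Sum>\<^sub>p a(p) u(p)\<close>.\<close>

definition tlin :: "('v \<times> 'w \<Rightarrow> complex) \<Rightarrow> 'j" where
 "tlin a = (THE y. y \<in> carr J \<and> (\<forall>z\<in>carr J. ip J y z = fsum (ipu z) a))"

text \<open>A finite combination of vectors is built by induction on its support and afterwards
  recognised by its inner products.\<close>

lemma tlin_exists:
 assumes "finite F" "F \<subseteq> carr V \<times> carr W"
 shows "\<exists>y\<in>carr J. \<forall>z\<in>carr J. ip J y z = (\<Sum>p\<in>F. a p * ipu z p)"
 using assms
proof (induction F rule: finite_induct)
 case empty
 then show ?case using J.zero_in J.inner_zero by (intro bexI[of _ "vzero J"]) auto
next
 case (insert p F)
 then obtain y where y: "y \<in> carr J" "\<And>z. z \<in> carr J \<Longrightarrow> ip J y z = (\<Sum>p\<in>F. a p * ipu z p)" by auto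
 have p: "u (fst p) (snd p) \<in> carr J" using insert by (auto intro: u_in)
 show ?case
  by (rule bexI[of _ "vadd J (vscale J (a p) (u (fst p) (snd p))) y"])
    (use insert y p in \<open>auto simp: J.inner_simps J.closed ipu_def\<close>)
qed

lemma tlin:
 assumes "a \<in> formal_sums V W"
 shows "tlin a \<in> carr J" "z \<in> carr J \<Longrightarrow> ip J (tlin a) z = fsum (ipu z) a"
proof -
 obtain y where y: "y \<in> carr J" "\<And>z. z \<in> carr J \<Longrightarrow> ip J y z = fsum (ipu z) a"
  using tlin_exists[of "{p. a p \<noteq> 0}" a] assms by (auto simp: formal_sums_def fsum_def)
 then have "tlin a = y"
  unfolding tlin_def by (intro the_equality) (auto intro: J.inner_ext)
 then show "tlin a \<in> carr J" "z \<in> carr J \<Longrightarrow> ip J (tlin a) z = fsum (ipu z) a" using y by auto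
qed

lemma formal_sums_closed:
 "a \<in> formal_sums V W \<Longrightarrow> b \<in> formal_sums V W \<Longrightarrow> (\<lambda>p. a p + b p) \<in> formal_sums V W"
 "a \<in> formal_sums V W \<Longrightarrow> (\<lambda>p. c * a p) \<in> formal_sums V W"
 "(\<lambda>p. 0) \<in> formal_sums V W"
 "v \<in> carr V \<Longrightarrow> w \<in> carr W \<Longrightarrow> single (v, w) \<in> formal_sums V W"
proof -
 show "(\<lambda>p. a p + b p) \<in> formal_sums V W" if "a \<in> formal_sums V W" "b \<in> formal_sums V W"
 proof -
  have "{p. a p + b p \<noteq> 0} \<subseteq> {p. a p \<noteq> 0} \<union> {p. b p \<noteq> 0}" by auto
  then show ?thesis using that unfolding formal_sums_def by (blast intro: finite_add)
 qed
 show "(\<lambda>p. c * a p) \<in> formal_sums V W" if "a \<in> formal_sums V W"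
  using that by (auto simp: formal_sums_def finite_scale)
 show "(\<lambda>p. 0) \<in> formal_sums V W" by (simp add: formal_sums_def)
 show "single (v, w) \<in> formal_sums V W" if "v \<in> carr V" "w \<in> carr W"
  using that by (simp add: formal_sums_def finite_single) (auto simp: single_def split: if_splits)
qed

text \<open>Each generator combines at most three basis elements, on which bilinearity of
  \<open>u\<close> produces cancellation. This makes \<open>tlin\<close> constant on tensor
  classes.\<close>

lemma fsum_relation: 
 assumes "b \<in> bilinear_relations V W" and z: "z \<in> carr J"
 shows "fsum (ipu z) b = 0"
proof -
 have 3: "fsum g (\<lambda>p. single x p - single y p - single w p) = g x - g y - g w" for g and x y w :: "'v \<times> 'w"
  by (simp only: fsum_diff[OF finite_diff[OF finite_single finite_single] finite_single]
    fsum_diff[OF finite_single finite_single] fsum_single)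
 have 2: "fsum g (\<lambda>p. single x p - c * single y p) = g x - c * g y" for g c and x y :: "'v \<times> 'w"
  by (simp only: fsum_diff[OF finite_single finite_scale[OF finite_single]] fsum_scale fsum_single)
 show ?thesis
  using assms(1) unfolding bilinear_relations_def
  by (elim UnE CollectE exE conjE)
    (simp_all add: 2 3 ipu_def u_in u_addl u_addr u_scalel u_scaler J.inner_simps z)
qed

lemma tlin_cong:
 assumes a: "a \<in> formal_sums V W" and b: "b \<in> tensor_class V W a"
 shows "b \<in> formal_sums V W" "tlin b = tlin a"
proof -
 show bf: "b \<in> formal_sums V W" using b by (simp add: tensor_class_def)
 show "tlin b = tlin a"
 proof (rule J.inner_ext)
  fix z assume z: "z \<in> carr J"
  have "(\<lambda>p. b p - a p) \<in> relation_span V W" using b by (simp add: tensor_class_def)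
  then have "fsum (ipu z) (\<lambda>p. b p - a p) = 0"
   by (rule fsum_relation_span(2)[OF _ fsum_relation[OF _ z]])
  then have "fsum (ipu z) b = fsum (ipu z) a"
   using a bf by (simp add: fsum_diff formal_sums_def)
  then show "ip J (tlin b) z = ip J (tlin a) z" using a bf z by (simp add: tlin)
 qed (use a bf tlin in auto)
qed

lemma rep_tensor_class:
 assumes a: "a \<in> formal_sums V W"
 shows "rep (tensor_class V W a) \<in> formal_sums V W" "tlin (rep (tensor_class V W a)) = tlin a"
proof -
 have "(\<lambda>p. a p - a p) \<in> relation_span V W"
  unfolding relation_span_def by (intro CollectI exI[of _ "{}"]) auto
 then have "a \<in> tensor_class V W a" using a by (simp add: tensor_class_def)
 then have "rep (tensor_class V W a) \<in> tensor_class V W a"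
  unfolding rep_def by (rule someI[of "\<lambda>x. x \<in> tensor_class V W a"])
 then show "rep (tensor_class V W a) \<in> formal_sums V W" "tlin (rep (tensor_class V W a)) = tlin a"
  using tlin_cong[OF a] by auto
qed

lemma tlin_add:
 assumes "a \<in> formal_sums V W" "b \<in> formal_sums V W"
 shows "tlin (\<lambda>p. a p + b p) = vadd J (tlin a) (tlin b)"
 by (rule J.inner_ext)
   (use assms assms[unfolded formal_sums_def] in
    \<open>auto simp: tlin formal_sums_closed J.closed J.inner_simps fsum_add\<close>)

lemma tlin_scale:
 assumes "a \<in> formal_sums V W"
 shows "tlin (\<lambda>p. c * a p) = vscale J c (tlin a)"
 by (rule J.inner_ext)
   (use assms in \<open>auto simp: tlin formal_sums_closed J.closed J.inner_simps fsum_scale\<close>)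

lemma tlin_single:
 assumes "v \<in> carr V" "w \<in> carr W"
 shows "tlin (single (v, w)) = u v w"
 by (rule J.inner_ext)
   (use assms in \<open>auto simp: tlin formal_sums_closed u_in fsum_single ipu_def\<close>)

lemma ip_tensor:
 assumes a: "a \<in> formal_sums V W" and b: "b \<in> formal_sums V W"
 shows "(\<Sum>p\<in>{p. a p \<noteq> 0}. \<Sum>q\<in>{q. b q \<noteq> 0}. a p * cnj (b q) * \<phi> (fst p) (snd p) (fst q) (snd q))
  = ip J (tlin a) (tlin b)"
proof -
 have "(\<Sum>q\<in>{q. b q \<noteq> 0}. a p * cnj (b q) * \<phi> (fst p) (snd p) (fst q) (snd q)) = a p * ipu (tlin b) p"
  if "a p \<noteq> 0" for p
 proof -
  have p: "fst p \<in> carr V" "snd p \<in> carr W" using a that by (auto simp: formal_sums_def)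
  have q: "fst q \<in> carr V" "snd q \<in> carr W" if "b q \<noteq> 0" for q using b that by (auto simp: formal_sums_def)
  have "ipu (tlin b) p = cnj (ip J (tlin b) (u (fst p) (snd p)))"
   unfolding ipu_def using J.inner_cnj[of "tlin b" "u (fst p) (snd p)"] p b by (simp add: tlin u_in)
  also have "\<dots> = (\<Sum>q\<in>{q. b q \<noteq> 0}. cnj (b q) * \<phi> (fst p) (snd p) (fst q) (snd q))"
  proof -
   have "cnj (ip J (u (fst q) (snd q)) (u (fst p) (snd p))) = \<phi> (fst p) (snd p) (fst q) (snd q)"
    if "b q \<noteq> 0" for q
    using p q[OF that] J.inner_cnj[of "u (fst q) (snd q)" "u (fst p) (snd p)"] by (simp add: \<phi> u_in)
   then show ?thesis using b p by (simp add: tlin u_in fsum_def ipu_def)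
  qed
  finally show ?thesis by (simp add: sum_distrib_left mult.assoc)
 qed
 then have "(\<Sum>p\<in>{p. a p \<noteq> 0}. \<Sum>q\<in>{q. b q \<noteq> 0}. a p * cnj (b q) * \<phi> (fst p) (snd p) (fst q) (snd q))
  = fsum (ipu (tlin b)) a" by (simp add: fsum_def)
 then show ?thesis using a b by (simp add: tlin)
qed

lemma presents_tensor: "presents (tensor_space V W \<phi>) J (\<lambda>A. tlin (rep A))"
proof -
 have "formal_sums V W \<noteq> {}" using formal_sums_closed(3) by blast
 then show ?thesis
 unfolding presents_def linear_op_def tensor_space_def
 by (auto simp: rep_tensor_class formal_sums_closed tlin_add tlin_scale tlin ip_tensor
   intro!: image_eqI[of _ "tensor_class V W"])
qed

theorem completion_tensor:
 "\<exists>T. hilbert_iso (completion (tensor_space V W \<phi>)) J T \<and> closed_ops (completion (tensor_space V W \<phi>)) \<and>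
  (\<forall>v\<in>carr V. \<forall>w\<in>carr W. embed (tensor_space V W \<phi>) (pure_tensor V W v w) \<in> carr (completion (tensor_space V W \<phi>)) \<and>
    T (embed (tensor_space V W \<phi>) (pure_tensor V W v w)) = u v w)"
proof -
 have pt: "pure_tensor V W v w \<in> carr (tensor_space V W \<phi>)" "tlin (rep (pure_tensor V W v w)) = u v w"
  if "v \<in> carr V" "w \<in> carr W" for v w
  using that by (auto simp: tensor_space_def pure_tensor_def rep_tensor_class formal_sums_closed tlin_single)
 have "\<exists>T. hilbert_iso (completion (tensor_space V W \<phi>)) J T \<and> closed_ops (completion (tensor_space V W \<phi>)) \<and>
   (\<forall>x\<in>carr (tensor_space V W \<phi>). embed (tensor_space V W \<phi>) x \<in> carr (completion (tensor_space V W \<phi>)) \<and>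
    T (embed (tensor_space V W \<phi>) x) = tlin (rep x))"
 proof (rule presents_completion[OF J.hilbert_space_axioms presents_tensor])
  fix z assume z: "z \<in> carr J" and 0: "\<And>x. x \<in> carr (tensor_space V W \<phi>) \<Longrightarrow> ip J z (tlin (rep x)) = 0"
  show "z = vzero J"
   by (rule total[OF z]) (metis 0 pt)
 qed
 then show ?thesis using pt by metis
qed

end

subsection \<open>Transport of operators along an isomorphism\<close>

context
 fixes M :: "('a, 'm) ips_scheme" and J :: "('b, 'n) ips_scheme" and V :: "'a \<Rightarrow> 'b"
 assumes J: "hilbert_space J" and iso: "hilbert_iso M J V" and cl: "closed_ops M"
begin

interpretation J: hilbert_space J by (rule J)

lemma iso_simps:
 "x \<in> carr M \<Longrightarrow> V x \<in> carr J"
 "x \<in> carr M \<Longrightarrow> y \<in> carr M \<Longrightarrow> V (vadd M x y) = vadd J (V x) (V y)"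
 "x \<in> carr M \<Longrightarrow> V (vscale M c x) = vscale J c (V x)"
 "x \<in> carr M \<Longrightarrow> y \<in> carr M \<Longrightarrow> ip J (V x) (V y) = ip M x y"
 "x \<in> carr M \<Longrightarrow> y \<in> carr M \<Longrightarrow> vadd M x y \<in> carr M"
 "x \<in> carr M \<Longrightarrow> vscale M c x \<in> carr M"
 "x \<in> carr M \<Longrightarrow> nrm J (V x) = nrm M x"
 using iso cl by (auto simp: hilbert_iso_def linear_op_def closed_ops_def nrm_def)

lemma iso_inj: "x \<in> carr M \<Longrightarrow> y \<in> carr M \<Longrightarrow> V x = V y \<Longrightarrow> x = y"
 using iso by (auto simp: hilbert_iso_def bij_betw_def inj_on_def)

definition Vi :: "'b \<Rightarrow> 'a" where "Vi = inv_into (carr M) V"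

lemma Vi: "z \<in> carr J \<Longrightarrow> Vi z \<in> carr M" "z \<in> carr J \<Longrightarrow> V (Vi z) = z"
proof -
 have "carr J = V ` carr M" using iso by (simp add: hilbert_iso_def bij_betw_def)
 then show "z \<in> carr J \<Longrightarrow> Vi z \<in> carr M" "z \<in> carr J \<Longrightarrow> V (Vi z) = z"
  by (simp_all add: Vi_def inv_into_into f_inv_into_f)
qed

lemma pull_operator:
 assumes T: "bounded_op J T"
 shows "\<exists>S. S \<in> extensional (carr M) \<and> bounded_op M S \<and> (\<forall>x\<in>carr M. V (S x) = T (V x))"
proof -
 have T': "z \<in> carr J \<Longrightarrow> T z \<in> carr J" "z \<in> carr J \<Longrightarrow> z' \<in> carr J \<Longrightarrow> T (vadd J z z') = vadd J (T z) (T z')"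
  "z \<in> carr J \<Longrightarrow> T (vscale J c z) = vscale J c (T z)" for z z' c
  using T by (auto simp: bounded_op_def linear_op_def)
 obtain C where C: "\<And>z. z \<in> carr J \<Longrightarrow> nrm J (T z) \<le> C * nrm J z" using T by (auto simp: bounded_op_def)
 define S where "S = restrict (\<lambda>x. Vi (T (V x))) (carr M)"
 have S: "S x \<in> carr M" "V (S x) = T (V x)" if "x \<in> carr M" for x
  using that by (simp_all add: S_def Vi T' iso_simps)
 have "linear_op M M S"
  unfolding linear_op_def by (auto intro!: iso_inj simp: S T' iso_simps)
 moreover have "nrm M (S x) \<le> C * nrm M x" if "x \<in> carr M" for x
  using C[of "V x"] that by (simp add: S iso_simps flip: iso_simps(7)[OF S(1)[OF that]])
 ultimately have "bounded_op M S" by (auto simp: bounded_op_def)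
 then show ?thesis using S by (intro exI[of _ S]) (auto simp: S_def)
qed

lemma push_operator:
 assumes S: "bounded_op M S"
 shows "bounded_op J (\<lambda>z. V (S (Vi z)))"
proof -
 have S': "x \<in> carr M \<Longrightarrow> S x \<in> carr M" "x \<in> carr M \<Longrightarrow> y \<in> carr M \<Longrightarrow> S (vadd M x y) = vadd M (S x) (S y)"
  "x \<in> carr M \<Longrightarrow> S (vscale M c x) = vscale M c (S x)" for x y c
  using S by (auto simp: bounded_op_def linear_op_def)
 obtain C where C: "\<And>x. x \<in> carr M \<Longrightarrow> nrm M (S x) \<le> C * nrm M x" using S by (auto simp: bounded_op_def)
 have "Vi (vadd J z z') = vadd M (Vi z) (Vi z')" "Vi (vscale J c z) = vscale M c (Vi z)" if "z \<in> carr J" "z' \<in> carr J" for z z' c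
  using that by (auto intro!: iso_inj simp: Vi iso_simps J.closed)
 then have "linear_op J J (\<lambda>z. V (S (Vi z)))"
  unfolding linear_op_def by (auto simp: S' iso_simps Vi)
 moreover have "nrm J (V (S (Vi z))) \<le> C * nrm J z" if "z \<in> carr J" for z
  using C[of "Vi z"] iso_simps(7)[of "Vi z"] that by (simp add: S' iso_simps(7) Vi)
 ultimately show ?thesis by (auto simp: bounded_op_def)
qed

text \<open>Conjugating both operators with the isomorphism brings them to the Hilbert space
  \<open>J\<close>, where \<open>bounded_op_eqI\<close> applies.\<close>

lemma operator_eqI:
 assumes S: "bounded_op M S" "S \<in> extensional (carr M)" and T: "bounded_op M T" "T \<in> extensional (carr M)"
  and eq: "\<And>x. x \<in> A \<Longrightarrow> S x = T x" and A: "A \<subseteq> carr M"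
  and tot: "\<And>z. z \<in> carr J \<Longrightarrow> (\<And>x. x \<in> A \<Longrightarrow> ip J z (V x) = 0) \<Longrightarrow> z = vzero J"
 shows "S = T"
proof (rule extensionalityI[OF S(2) T(2)])
 have in_M: "S x \<in> carr M" "T x \<in> carr M" if "x \<in> carr M" for x
  using that S T by (auto simp: bounded_op_def linear_op_def)
 have ViV: "Vi (V x) = x" if "x \<in> carr M" for x using that by (auto intro!: iso_inj simp: Vi iso_simps)
 fix x assume x: "x \<in> carr M"
 have "V (S (Vi (V x))) = V (T (Vi (V x)))"
 proof (rule J.bounded_op_eqI[OF push_operator[OF S(1)] push_operator[OF T(1)], where A = "V ` A"])
  fix z assume z: "z \<in> carr J" and 0: "\<And>x. x \<in> V ` A \<Longrightarrow> ip J x z = 0"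
  have "ip J z (V y) = 0" if "y \<in> A" for y
   using 0[of "V y"] J.inner_cnj[of "V y" z] that A z by (auto simp: iso_simps)
  then show "z = vzero J" by (rule tot[OF z])
 qed (use A x in \<open>auto simp: ViV eq iso_simps subset_eq\<close>)
 then show "S x = T x" using x by (intro iso_inj in_M) (simp_all add: ViV)
qed

end

section \<open>Borel measures on second countable locally compact Hausdorff spaces\<close>

text \<open>A real valued counterpart of \<open>Cc\<close>: values in \<open>[0,1]\<close> can be
  ordered, so that monotone convergence and nonnegative integrals are available.\<close>

definition test_fun :: "('a::topological_space \<Rightarrow> real) \<Rightarrow> bool" where
 "test_fun f \<longleftrightarrow> continuous_on UNIV f \<and> (\<forall>x. 0 \<le> f x \<and> f x \<le> 1) \<and> (\<exists>K. compact K \<and> (\<forall>x. x \<notin> K \<longrightarrow> f x = 0))"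

lemma test_fun_Cc: "test_fun f \<Longrightarrow> (\<lambda>x. cor (f x)) \<in> Cc UNIV"
 by (auto simp: test_fun_def Cc_def intro!: continuous_intros)

lemma test_fun_measurable: "test_fun f \<Longrightarrow> f \<in> Borel"
 by (auto simp: test_fun_def intro: borel_measurable_continuous_onI)

lemma test_fun_open: "test_fun f \<Longrightarrow> open {x. c < f x}"
 by (rule open_Collect_less) (auto simp: test_fun_def intro: continuous_intros)

text \<open>Locally compact Hausdorff spaces are completely regular. Separating \<open>x\<close>
  from the complement of \<open>U\<close> intersected with a relatively compact neighbourhood forces
  compact support; \<open>1 - g\<close> turns the separating function into a bump.\<close>

lemma locally_compact_test_fun:
 fixes x :: "'a::t2_space"
 assumes lc: "locally_compact_space (euclidean :: 'a topology)" and U: "open U" and x: "x \<in> U"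
 shows "\<exists>f. test_fun f \<and> f x = 1 \<and> (\<forall>y. y \<notin> U \<longrightarrow> f y = 0)"
proof -
 have "completely_regular_space (euclidean :: 'a topology)"
  by (rule locally_compact_regular_imp_completely_regular_space[OF lc])
    (simp add: Hausdorff_space_def, metis hausdorff disjnt_def)
 obtain V K where V: "open V" "compact K" "x \<in> V" "V \<subseteq> K"
  using lc unfolding locally_compact_space_def compactin_euclidean_iff open_openin[symmetric]
  by simp meson
 have "closedin euclidean (- (U \<inter> V))" using open_Int[OF U V(1)] by (simp only: closed_closedin[symmetric] closed_Compl)
 then obtain g :: "'a \<Rightarrow> real" where g: "continuous_map euclidean (top_of_set {0..1}) g" "g x = 0" "g ` (- (U \<inter> V)) \<subseteq> {1}"
  using \<open>completely_regular_space _\<close> x V unfolding completely_regular_space_def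
  by (metis Compl_iff Diff_iff IntI UNIV_I topspace_euclidean)
 have "continuous_on UNIV g" "\<And>y. 0 \<le> g y \<and> g y \<le> 1"
  using g(1) by (auto simp: continuous_map_in_subtopology)
 then have "test_fun (\<lambda>y. 1 - g y)"
  unfolding test_fun_def using g(3) V by (auto intro!: continuous_intros exI[of _ K])
 then show ?thesis using g by (intro exI[of _ "\<lambda>y. 1 - g y"]) auto
qed

lemma test_fun_max: "test_fun f \<Longrightarrow> test_fun g \<Longrightarrow> test_fun (\<lambda>x. max (f x) (g x))"
proof -
 assume f: "test_fun f" and g: "test_fun g"
 obtain K L where "compact K" "\<And>x. x \<notin> K \<Longrightarrow> f x = 0" "compact L" "\<And>x. x \<notin> L \<Longrightarrow> g x = 0"
  using f g by (auto simp: test_fun_def)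
 then have "compact (K \<union> L) \<and> (\<forall>x. x \<notin> K \<union> L \<longrightarrow> max (f x) (g x) = 0)" by (simp add: compact_Un)
 then show ?thesis using f g unfolding test_fun_def by (auto intro!: continuous_intros simp: le_max_iff_disj)
qed

lemma open_exhaustion:
 fixes U :: "'a::{second_countable_topology, t2_space} set"
 assumes lc: "locally_compact_space (euclidean :: 'a topology)" and U: "open U"
 shows "\<exists>f :: nat \<Rightarrow> 'a \<Rightarrow> real. (\<forall>n. test_fun (f n)) \<and> (\<forall>x. incseq (\<lambda>n. f n x)) \<and>
   (\<forall>x. (\<lambda>n. f n x) \<longlonglongrightarrow> indicator U x)"
proof -
 have "\<exists>f. test_fun f \<and> f x = 1 \<and> (\<forall>y. y \<notin> U \<longrightarrow> f y = 0)" if "x \<in> U" for x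
  using locally_compact_test_fun[OF lc U that] .
 then obtain g where g: "\<And>x. x \<in> U \<Longrightarrow> test_fun (g x)" "\<And>x. x \<in> U \<Longrightarrow> g x x = 1"
  "\<And>x y. x \<in> U \<Longrightarrow> y \<notin> U \<Longrightarrow> g x y = (0::real)" by metis
 let ?F = "(\<lambda>x. {y. 1/2 < g x y}) ` U"
 have op: "open S" if "S \<in> ?F" for S
  using that g(1) test_fun_open by blast
 obtain F' where F': "F' \<subseteq> ?F" "countable F'" "\<Union>F' = \<Union>?F" using Lindelof[of ?F] op by blast
 show ?thesis
 proof (cases "U = {}")
  case True
  then show ?thesis
   by (intro exI[of _ "\<lambda>_ _. 0"]) (auto simp: test_fun_def)
 next
  case False
  from F'(1,2) obtain C where C: "countable C" "C \<subseteq> U" "F' = (\<lambda>x. {y. 1/2 < g x y}) ` C"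
   by (meson countable_subset_image)
  have cov: "\<exists>c\<in>C. 1/2 < g c y" if "y \<in> U" for y
  proof -
   have "y \<in> \<Union>?F" using that g(2) by force
   then show ?thesis using F'(3) C(3) by auto
  qed
  have "C \<noteq> {}" using cov False by auto
  define c where "c = from_nat_into C"
  have cC: "c n \<in> C" "c n \<in> U" for n using \<open>C \<noteq> {}\<close> C(2) by (auto simp: c_def from_nat_into subset_iff)
  have csurj: "\<exists>n. c n = x" if "x \<in> C" for x using from_nat_into_surj[OF C(1) that] by (auto simp: c_def)
  \<comment> \<open>Doubling and truncating makes the bump equal to 1 wherever it exceeded 1/2.
    These sets cover \<open>U\<close>, so the running maxima \<open>f n\<close> reach 1 at each
    point of \<open>U\<close> after finitely many steps.\<close>
  define h where "h n y = min 1 (2 * g (c n) y)" for n y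
  have h: "test_fun (h n)" for n
   using g(1)[OF cC(2), of n] unfolding test_fun_def h_def
   by (auto intro!: continuous_intros)
  have h0: "h n y = 0" if "y \<notin> U" for n y using g(3)[OF cC(2) that] by (simp add: h_def)
  define f where "f = rec_nat (h 0) (\<lambda>n p y. max (p y) (h (Suc n) y))"
  have f: "f 0 = h 0" "f (Suc n) = (\<lambda>y. max (f n y) (h (Suc n) y))" for n by (simp_all add: f_def)
  have ft: "test_fun (f n)" for n by (induction n) (auto simp: f h intro: test_fun_max)
  have f0: "f n y = 0" if "y \<notin> U" for n y by (induction n) (auto simp: f h0[OF that])
  have inc: "incseq (\<lambda>n. f n y)" for y by (rule incseq_SucI) (simp add: f)
  have ge: "h n y \<le> f n y" for n y by (cases n) (auto simp: f)
  have "(\<lambda>n. f n y) \<longlonglongrightarrow> indicator U y" for y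
  proof (cases "y \<in> U")
   case True
   then obtain n where n: "1/2 < g (c n) y" using cov csurj by metis
   have "f m y = 1" if "n \<le> m" for m
   proof -
    have "1 \<le> h n y" using n by (simp add: h_def)
    also have "\<dots> \<le> f n y" by (rule ge)
    also have "\<dots> \<le> f m y" using inc[of y] that by (simp add: incseq_def)
    finally show ?thesis using ft[of m] by (auto simp: test_fun_def intro: antisym)
   qed
   then have "\<forall>\<^sub>F m in sequentially. f m y = 1" by (auto simp: eventually_sequentially)
   then show ?thesis using True by (simp add: tendsto_eventually)
  qed (simp add: f0)
  then show ?thesis using ft inc by blast
 qed
qed

lemma compact_test_fun:
 fixes K :: "'a::{second_countable_topology, t2_space} set"
 assumes lc: "locally_compact_space (euclidean :: 'a topology)" and K: "compact K"
 shows "\<exists>f. test_fun f \<and> (\<forall>x\<in>K. 1/2 < f x)"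
proof -
 obtain f :: "nat \<Rightarrow> 'a \<Rightarrow> real" where f: "\<And>n. test_fun (f n)" "\<And>x. incseq (\<lambda>n. f n x)"
  "\<And>x. (\<lambda>n. f n x) \<longlonglongrightarrow> indicator UNIV x" using open_exhaustion[OF lc open_UNIV] by metis
 have op: "open {x. 1/2 < f n x}" for n
  by (rule test_fun_open[OF f(1)])
 have "x \<in> (\<Union>n. {x. 1/2 < f n x})" for x
 proof -
  have "(\<lambda>n. f n x) \<longlonglongrightarrow> 1" using f(3)[of x] by simp
  then have "\<forall>\<^sub>F n in sequentially. 1/2 < f n x" by (rule order_tendstoD) simp
  then show ?thesis by (auto simp: eventually_sequentially)
 qed
 then have cov: "K \<subseteq> (\<Union>n. {x. 1/2 < f n x})" by blast
 obtain C where C: "finite C" "K \<subseteq> (\<Union>n\<in>C. {x. 1/2 < f n x})"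
  by (rule compactE_image[OF K op cov])
 have "1/2 < f (Max C) x" if x: "x \<in> K" for x
 proof -
  obtain n where n: "n \<in> C" "1/2 < f n x" using C(2) x by blast
  have "n \<le> Max C" using C n by simp
  then show ?thesis using n incseqD[OF f(2)[of x], of n "Max C"] by linarith
 qed
 then show ?thesis using f(1) by blast
qed

lemma test_exhaustion:
 assumes lc: "locally_compact_space (euclidean :: 'a::{second_countable_topology, t2_space} topology)"
 shows "\<exists>f :: nat \<Rightarrow> 'a \<Rightarrow> real. (\<forall>n. test_fun (f n)) \<and> incseq (\<lambda>n. {x. 1/2 < f n x}) \<and> (\<Union>n. {x. 1/2 < f n x}) = UNIV"
proof -
 obtain f :: "nat \<Rightarrow> 'a \<Rightarrow> real" where f: "\<And>n. test_fun (f n)" "\<And>x. incseq (\<lambda>n. f n x)"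
  "\<And>x. (\<lambda>n. f n x) \<longlonglongrightarrow> indicator UNIV x" using open_exhaustion[OF lc open_UNIV] by metis
 have "incseq (\<lambda>n. {x. 1/2 < f n x})"
 proof (rule monoI, rule subsetI)
  fix m n x assume "m \<le> (n::nat)" "x \<in> {x. 1/2 < f m x}"
  then show "x \<in> {x. 1/2 < f n x}"
   using incseqD[OF f(2), of m n x] by simp
 qed
 moreover have "x \<in> (\<Union>n. {x. 1/2 < f n x})" for x
 proof -
  have "(\<lambda>n. f n x) \<longlonglongrightarrow> 1" using f(3)[of x] by simp
  then have "\<forall>\<^sub>F n in sequentially. 1/2 < f n x" by (rule order_tendstoD) simp
  then show ?thesis by (auto simp: eventually_sequentially)
 qed
 ultimately show ?thesis using f(1) by blast
qed

lemma emeasure_open_SUP: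
 assumes M: "sets M = sets borel" and f: "\<And>n. test_fun (f n)" "\<And>x. incseq (\<lambda>n. f n x)"
  "\<And>x. (\<lambda>n. f n x) \<longlonglongrightarrow> indicator U x" and U: "U \<in> sets borel"
 shows "emeasure M U = (SUP n. NN x. ennreal (f n x) d/M)"
proof -
 have meas: "(\<lambda>x. ennreal (f n x)) \<in> borel_measurable M" for n
  using measurable_compose[OF test_fun_measurable[OF f(1)] measurable_ennreal]
  by (simp add: measurable_cong_sets[OF M refl])
 have "(SUP n. ennreal (f n x)) = indicator U x" for x
 proof (rule LIMSEQ_unique)
  show "(\<lambda>n. ennreal (f n x)) \<longlonglongrightarrow> (SUP n. ennreal (f n x))"
   using f(2)[of x] by (intro LIMSEQ_SUP) (auto simp: incseq_def intro: ennreal_leI)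
  show "(\<lambda>n. ennreal (f n x)) \<longlonglongrightarrow> indicator U x"
   using tendsto_ennrealI[OF f(3)[of x]] by (simp add: ennreal_indicator)
 qed
 then have "emeasure M U = (NN x. (SUP n. ennreal (f n x)) d/M)" using U M by simp
 also have "\<dots> = (SUP n. NN x. ennreal (f n x) d/M)"
  using f(2) by (intro nn_integral_monotone_convergence_SUP meas)
   (auto simp: incseq_def le_fun_def intro: ennreal_leI)
 finally show ?thesis .
qed

lemma test_fun_integrable:
 fixes M :: "'a::{second_countable_topology, t2_space} measure"
 assumes M: "sets M = sets borel" and fin: "\<And>K. compact K \<Longrightarrow> emeasure M K < \<infinity>" and f: "test_fun f"
 shows "integrable M f"
proof -
 obtain K where K: "compact K" "\<And>x. x \<notin> K \<Longrightarrow> f x = 0" "\<And>x. 0 \<le> f x \<and> f x \<le> 1"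
  using f by (auto simp: test_fun_def)
 have Km: "K \<in> sets M" using K(1) M by (simp add: borel_compact)
 show ?thesis
 proof (rule Bochner_Integration.integrable_bound[where f="indicat_real K"])
  show "integrable M (indicat_real K)" using Km fin[OF K(1)] by (simp add: integrable_indicator_iff)
  show "f \<in> borel_measurable M" using test_fun_measurable[OF f] by (simp add: measurable_cong_sets[OF M refl])
  show "AE x in M. norm (f x) \<le> norm (indicat_real K x)"
   using K by (auto intro!: AE_I2 simp: indicator_def)
 qed
qed

lemma nn_integral_test_fun:
 fixes M :: "'a::{second_countable_topology, t2_space} measure"
 assumes M: "sets M = sets borel" and fin: "\<And>K. compact K \<Longrightarrow> emeasure M K < \<infinity>" and f: "test_fun f"
 shows "(NN x. ennreal (f x) d/M) = ennreal (Re (LINT x|M. cor (f x)))"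
 using nn_integral_eq_integral[OF test_fun_integrable[OF assms]] f
 by (simp add: test_fun_def)

text \<open>Measures of open sets are suprema of integrals of test functions, and open sets are an
  intersection-stable generator; the sets \<open>?E n\<close>, contained in compact sets, supply the
  finiteness that uniqueness of measures requires.\<close>

lemma measure_eqI_test_fun:
 fixes M N :: "'a::{second_countable_topology, t2_space} measure"
 assumes lc: "locally_compact_space (euclidean :: 'a topology)"
  and M: "sets M = sets borel" "\<And>K. compact K \<Longrightarrow> emeasure M K < \<infinity>"
  and N: "sets N = sets borel" "\<And>K. compact K \<Longrightarrow> emeasure N K < \<infinity>"
  and eq: "\<And>f. test_fun f \<Longrightarrow> (LINT x|M. cor (f x)) = (LINT x|N. cor (f x))"
 shows "M = N"
proof -
 obtain g :: "nat \<Rightarrow> 'a \<Rightarrow> real" where g: "\<And>n. test_fun (g n)" "incseq (\<lambda>n. {x. 1/2 < g n x})"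
  "(\<Union>n. {x. 1/2 < g n x}) = UNIV" using test_exhaustion[OF lc] by blast
 let ?E = "\<lambda>n. {x. 1/2 < g n x}"
 have Eo: "open (?E n)" for n
  by (rule test_fun_open[OF g(1)])
 have Efin: "emeasure M (?E n) \<noteq> \<infinity>" for n
 proof -
  obtain K where K: "compact K" "\<And>x. x \<notin> K \<Longrightarrow> g n x = 0" using g(1)[of n] by (auto simp: test_fun_def)
  have "?E n \<subseteq> K" using K(2) by force
  then have "emeasure M (?E n) \<le> emeasure M K" using K M by (intro emeasure_mono) (auto simp: borel_compact)
  then show ?thesis using M(2)[OF K(1)] by (auto simp: top_unique)
 qed
 show ?thesis
 proof (rule measure_eqI_generator_eq[where E="{S. open S}" and \<Omega>=UNIV and A="?E"])
  show "Int_stable {S::'a set. open S}" by (auto simp: Int_stable_def)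
  show "emeasure M X = emeasure N X" if "X \<in> {S. open S}" for X
  proof -
   have op: "open X" using that by simp
   obtain f :: "nat \<Rightarrow> 'a \<Rightarrow> real" where f: "\<And>n. test_fun (f n)" "\<And>x. incseq (\<lambda>n. f n x)"
    "\<And>x. (\<lambda>n. f n x) \<longlonglongrightarrow> indicator X x" using open_exhaustion[OF lc op] by metis
   have X: "X \<in> sets borel" using that by simp
   show ?thesis
    by (simp only: emeasure_open_SUP[OF M(1) f X] emeasure_open_SUP[OF N(1) f X]
      nn_integral_test_fun[OF M f(1)] nn_integral_test_fun[OF N f(1)] eq[OF f(1)])
  qed
  show "sets M = sigma_sets UNIV {S. open S}" "sets N = sigma_sets UNIV {S. open S}"
   using M N by (simp_all add: borel_def)
  show "range ?E \<subseteq> {S. open S}" using Eo by auto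
  show "(\<Union>i. ?E i) = UNIV" by (rule g(3))
  show "emeasure M (?E i) \<noteq> \<infinity>" for i by (rule Efin)
 qed auto
qed

text \<open>The complement of the support is a union of open null sets, which Lindelof's theorem
  reduces to a countable one.\<close>

lemma AE_msupport:
 fixes M :: "'a::second_countable_topology measure"
 assumes M: "sets M = sets borel"
 shows "AE x in M. x \<in> msupport M"
proof -
 let ?F = "{U. open U \<and> emeasure M U = 0}"
 obtain F' where F': "F' \<subseteq> ?F" "countable F'" "\<Union>F' = \<Union>?F" using Lindelof[of ?F] by blast
 have "F' \<subseteq> null_sets M" using F'(1) M by (auto simp: null_sets_def)
 then have "(\<Union>U\<in>F'. U) \<in> null_sets M" using F'(2) by (intro null_sets_UN') auto
 then have n: "\<Union>?F \<in> null_sets M" using F'(3) by simp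
 have "x \<in> msupport M" if "x \<notin> \<Union>?F" for x
  using that by (auto simp: msupport_def zero_less_iff_neq_zero)
 then show ?thesis using AE_not_in[OF n] by (auto elim: eventually_mono)
qed

lemma Cc_measurable:
 fixes f :: "'a::t2_space \<Rightarrow> complex"
 assumes f: "f \<in> Cc X" and X: "closed X"
 shows "f \<in> Borel"
proof -
 have "(\<lambda>x. if x \<in> X then f x else 0) \<in> Borel"
  using f X by (intro borel_measurable_continuous_on_if) (auto simp: Cc_def)
 also have "(\<lambda>x. if x \<in> X then f x else 0) = f" using f by (auto simp: Cc_def)
 finally show ?thesis .
qed

lemma Cc_bound:
 fixes f :: "'a::topological_space \<Rightarrow> complex"
 assumes f: "f \<in> Cc X"
 shows "\<exists>C K. 0 \<le> C \<and> compact K \<and> K \<subseteq> X \<and> (\<forall>x. cmod (f x) \<le> C * indicator K x)"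
proof -
 obtain K where K: "compact K" "K \<subseteq> X" "\<And>x. x \<notin> K \<Longrightarrow> f x = 0"
  using f by (auto simp: Cc_def)
 have "continuous_on K f" using f K(2) continuous_on_subset by (auto simp: Cc_def)
 then have "bounded (f ` K)" using K(1) compact_continuous_image compact_imp_bounded by blast
 then obtain B where B: "\<And>x. x \<in> K \<Longrightarrow> cmod (f x) \<le> B" by (auto simp: bounded_iff)
 have "cmod (f x) \<le> max 0 B * indicator K x" for x
  using B[of x] K(3)[of x] by (cases "x \<in> K") auto
 then show ?thesis using K by (intro exI[of _ "max 0 B"] exI[of _ K]) auto
qed

lemma cvector_space_Cc: "cvector_space (Cc_space X)"
proof
 fix x y :: "'a \<Rightarrow> complex" assume x: "x \<in> carr (Cc_space X)" and y: "y \<in> carr (Cc_space X)"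
 obtain K L where K: "compact K" "K \<subseteq> X" "\<forall>z\<in>X - K. x z = 0" and L: "compact L" "L \<subseteq> X" "\<forall>z\<in>X - L. y z = 0"
  using x y by (auto simp: Cc_space_def Cc_def)
 then have "compact (K \<union> L) \<and> K \<union> L \<subseteq> X \<and> (\<forall>z\<in>X - (K \<union> L). x z + y z = 0)" by (auto intro: compact_Un)
 then show "vadd (Cc_space X) x y \<in> carr (Cc_space X)"
  using x y by (auto simp: Cc_space_def Cc_def intro!: continuous_intros)
next
 fix x :: "'a \<Rightarrow> complex" and c assume "x \<in> carr (Cc_space X)"
 then show "vscale (Cc_space X) c x \<in> carr (Cc_space X)"
  by (auto simp: Cc_space_def Cc_def intro!: continuous_intros)
qed (auto simp: Cc_space_def Cc_def algebra_simps intro: exI[of _ "{}"])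

lemma Cc_restrict:
 fixes f :: "'a::topological_space \<Rightarrow> real"
 assumes f: "test_fun f" and X: "closed X"
 shows "(\<lambda>x. cor (f x * indicator X x)) \<in> Cc X"
proof -
 obtain K where K: "compact K" "\<And>x. x \<notin> K \<Longrightarrow> f x = 0" using f by (auto simp: test_fun_def)
 have "continuous_on X (\<lambda>x. cor (f x))"
  using f by (auto simp: test_fun_def intro!: continuous_intros intro: continuous_on_subset)
 then have "continuous_on X (\<lambda>x. cor (f x * indicator X x))"
  by (rule continuous_on_eq) simp
 moreover have "compact (X \<inter> K)" using K X by (simp add: closed_Int_compact)
 ultimately show ?thesis using K(2) by (auto simp: Cc_def intro!: exI[of _ "X \<inter> K"])
qed

section \<open>Kernels\<close>

text \<open>The bound on the members of the exhaustion is uniform in \<open>x\<close>, so that semidirect products of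
 kernels are kernels again.\<close>

definition kernel :: "'x measure \<Rightarrow> ('x \<Rightarrow> 'y::topological_space measure) \<Rightarrow> bool" where
 "kernel M K \<longleftrightarrow> (\<forall>x\<in>space M. sets (K x) = sets borel) \<and>
   (\<forall>A\<in>sets borel. (\<lambda>x. emeasure (K x) A) \<in> borel_measurable M) \<and>
   (\<exists>E :: nat \<Rightarrow> 'y set. range E \<subseteq> sets borel \<and> incseq E \<and> (\<Union>n. E n) = UNIV \<and>
    (\<forall>n. \<exists>C::real. \<forall>x\<in>space M. emeasure (K x) (E n) \<le> ennreal C))"

lemma kernelD:
 assumes "kernel M K"
 shows "x \<in> space M \<Longrightarrow> sets (K x) = sets borel"
  and "x \<in> space M \<Longrightarrow> space (K x) = UNIV"
  and "A \<in> sets borel \<Longrightarrow> (\<lambda>x. emeasure (K x) A) \<in> borel_measurable M"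
proof -
 show 1: "x \<in> space M \<Longrightarrow> sets (K x) = sets borel" using assms by (simp add: kernel_def)
 show "x \<in> space M \<Longrightarrow> space (K x) = UNIV" using sets_eq_imp_space_eq[OF 1] by simp
 show "A \<in> sets borel \<Longrightarrow> (\<lambda>x. emeasure (K x) A) \<in> borel_measurable M" using assms by (simp add: kernel_def)
qed

lemma kernel_exhaustion:
 assumes "kernel M K"
 obtains E C where "\<And>n::nat. E n \<in> sets borel" "incseq E" "(\<Union>n. E n) = UNIV"
  "\<And>n x. x \<in> space M \<Longrightarrow> emeasure (K x) (E n) \<le> ennreal (C n)"
proof -
 obtain E where E: "range E \<subseteq> sets borel" "incseq E" "(\<Union>n::nat. E n) = UNIV"
  "\<forall>n. \<exists>C::real. \<forall>x\<in>space M. emeasure (K x) (E n) \<le> ennreal C"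
  using assms unfolding kernel_def by blast
 from choice[OF E(4)] obtain C where "\<forall>n. \<forall>x\<in>space M. emeasure (K x) (E n) \<le> ennreal (C n)" ..
 then show ?thesis using E that[of E C] by blast
qed

lemma kernelI:
 assumes "\<And>x. x \<in> space M \<Longrightarrow> sets (K x) = sets borel"
  and "\<And>A. A \<in> sets borel \<Longrightarrow> (\<lambda>x. emeasure (K x) A) \<in> borel_measurable M"
  and "\<And>n::nat. E n \<in> sets borel" "incseq E" "(\<Union>n. E n) = UNIV"
  and "\<And>n x. x \<in> space M \<Longrightarrow> emeasure (K x) (E n) \<le> ennreal (C n)"
 shows "kernel M K"
 unfolding kernel_def using assms by (intro conjI ballI exI[of _ E] allI) blast+

lemma kernel_compose:
 assumes K: "kernel N K" and g: "g \<in> measurable M N"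
 shows "kernel M (\<lambda>x. K (g x))"
proof -
 obtain E C where E: "\<And>n::nat. E n \<in> sets borel" "incseq E" "(\<Union>n. E n) = UNIV"
  "\<And>n x. x \<in> space N \<Longrightarrow> emeasure (K x) (E n) \<le> ennreal (C n)" by (rule kernel_exhaustion[OF K]) blast
 show ?thesis
 proof (rule kernelI[where E=E and C=C])
  show "(\<lambda>x. emeasure (K (g x)) A) \<in> borel_measurable M" if "A \<in> sets borel" for A
   by (rule measurable_compose[OF g kernelD(3)[OF K that]])
 qed (use E kernelD(1)[OF K] measurable_space[OF g] in auto)
qed

lemma kernel_cong_sets:
 assumes "kernel M K" "sets N = sets M"
 shows "kernel N K"
 using kernel_compose[OF assms(1), of "\<lambda>x. x" N] assms(2) by (simp add: measurable_ident_sets)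

lemma measurable_eqI:
 "(\<And>x. x \<in> space M \<Longrightarrow> f x = g x) \<Longrightarrow> g \<in> measurable M N \<Longrightarrow> f \<in> measurable M N"
 by (simp cong: measurable_cong)

text \<open>A Dynkin argument over measurable rectangles. The complement step subtracts measures, so
  it is run inside each \<open>E n\<close>, where they are finite, and the supremum over
  \<open>n\<close> is taken at the end.\<close>

lemma kernel_emeasure_section:
 assumes K: "kernel M K" and Q: "Q \<in> sets (M \<Otimes>\<^sub>M borel)"
 shows "(\<lambda>x. emeasure (K x) (Pair x -` Q)) \<in> borel_measurable M"
proof -
 obtain E C where E: "\<And>n::nat. E n \<in> sets borel" "incseq E" "(\<Union>n. E n) = UNIV"
  "\<And>n x. x \<in> space M \<Longrightarrow> emeasure (K x) (E n) \<le> ennreal (C n)" by (rule kernel_exhaustion[OF K]) blast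
 have sec: "Pair x -` A \<in> sets borel" if "A \<in> sets (M \<Otimes>\<^sub>M borel)" for A x
  using sets_Pair1[OF that, of x] by simp
 have fin: "(\<lambda>x. emeasure (K x) (Pair x -` Q \<inter> E n)) \<in> borel_measurable M" for n
 proof -
  let ?G = "{a \<times> b | a b. a \<in> sets M \<and> b \<in> sets (borel :: 'b measure)}"
  have "Int_stable ?G" using Int_stable_pair_measure_generator[of M borel] .
  moreover have "?G \<subseteq> Pow (space M \<times> UNIV)" using sets.sets_into_space by auto
  moreover have "Q \<in> sigma_sets (space M \<times> UNIV) ?G" using Q by (simp add: sets_pair_measure)
  ultimately show ?thesis
  proof (induction rule: sigma_sets_induct_disjoint)
   case (basic A)
   then obtain a b where ab: "A = a \<times> b" "a \<in> sets M" "b \<in> sets borel" by auto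
   have "emeasure (K x) (Pair x -` A \<inter> E n) = indicator a x * emeasure (K x) (b \<inter> E n)" for x
    using ab by (auto simp: indicator_def vimage_def)
   moreover have "(\<lambda>x. emeasure (K x) (b \<inter> E n)) \<in> borel_measurable M"
    using ab E by (intro kernelD(3)[OF K]) auto
   ultimately show ?case using ab by simp
  next
   case empty show ?case by simp
  next
   case (compl A)
   have A: "A \<in> sets (M \<Otimes>\<^sub>M borel)" using compl(1) by (simp add: sets_pair_measure)
   have "emeasure (K x) (Pair x -` (space M \<times> UNIV - A) \<inter> E n)
     = emeasure (K x) (E n) - emeasure (K x) (Pair x -` A \<inter> E n)" if x: "x \<in> space M" for x
   proof -
    have "Pair x -` (space M \<times> UNIV - A) \<inter> E n = E n - (Pair x -` A \<inter> E n)" using x by auto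
    moreover have "emeasure (K x) (Pair x -` A \<inter> E n) \<noteq> \<infinity>"
    proof -
     have "emeasure (K x) (Pair x -` A \<inter> E n) \<le> emeasure (K x) (E n)"
      using E x sec[OF A] by (intro emeasure_mono) (auto simp: kernelD[OF K])
     also have "\<dots> < \<infinity>" using E(4)[OF x, of n] by (simp add: le_less_trans)
     finally show ?thesis by simp
    qed
    ultimately show ?thesis
     using E x sec[OF A] by (simp add: emeasure_Diff kernelD[OF K])
   qed
   then show ?case
    by (rule measurable_eqI) (use compl(2) kernelD(3)[OF K E(1)] in \<open>auto intro: borel_measurable_minus_ennreal\<close>)
  next
   case (union A)
   have A: "A i \<in> sets (M \<Otimes>\<^sub>M borel)" for i using union(2) by (auto simp: sets_pair_measure)
   have "emeasure (K x) (Pair x -` (\<Union>i. A i) \<inter> E n) = (\<Sum>i. emeasure (K x) (Pair x -` A i \<inter> E n))"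
    if x: "x \<in> space M" for x
   proof -
    have "Pair x -` (\<Union>i. A i) \<inter> E n = (\<Union>i. Pair x -` A i \<inter> E n)" by auto
    moreover have "disjoint_family (\<lambda>i. Pair x -` A i \<inter> E n)"
     using union(1) by (auto simp: disjoint_family_on_def)
    ultimately show ?thesis
     using E x sec[OF A] by (subst suminf_emeasure) (auto simp: kernelD[OF K])
   qed
   then show ?case by (rule measurable_eqI) (use union(3) in auto)
  qed
 qed
 have "emeasure (K x) (Pair x -` Q) = (SUP n. emeasure (K x) (Pair x -` Q \<inter> E n))"
  if x: "x \<in> space M" for x
 proof -
  have "(SUP n. emeasure (K x) (Pair x -` Q \<inter> E n)) = emeasure (K x) (\<Union>n. Pair x -` Q \<inter> E n)"
   using E x sec[OF Q] by (intro SUP_emeasure_incseq) (auto simp: kernelD[OF K] incseq_def)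
  also have "(\<Union>n. Pair x -` Q \<inter> E n) = Pair x -` Q" using E(3) by auto
  finally show ?thesis by simp
 qed
 then show ?thesis by (rule measurable_eqI) (use fin in auto)
qed

lemma measurable_section:
 assumes K: "kernel M K" and f: "f \<in> borel_measurable (M \<Otimes>\<^sub>M borel)" and x: "x \<in> space M"
 shows "(\<lambda>y. f (x, y)) \<in> borel_measurable (K x)"
 using measurable_compose[OF measurable_Pair1'[OF x] f] by (simp add: measurable_cong_sets[OF kernelD(1)[OF K x] refl])

lemma kernel_nn_measurable:
 assumes K: "kernel M K" and f: "f \<in> borel_measurable (M \<Otimes>\<^sub>M borel)"
 shows "(\<lambda>x. NN y. f (x, y) d/K x) \<in> borel_measurable M"
 using f
proof (induction f rule: borel_measurable_induct)
 case (cong f g)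
 have "(NN y. f (x, y) d/K x) = (NN y. g (x, y) d/K x)" if "x \<in> space M" for x
  using cong(3) that by (simp add: space_pair_measure)
 then show ?case using cong(4) by (subst (asm) measurable_cong) auto
next
 case (set A)
 have "(NN y. indicator A (x, y) d/K x) = emeasure (K x) (Pair x -` A)" if x: "x \<in> space M" for x
 proof -
  have "Pair x -` A \<in> sets (K x)" using sets_Pair1[OF set, of x] by (simp add: kernelD(1)[OF K x])
  moreover have "(NN y. indicator A (x, y) d/K x) = (NN y. indicator (Pair x -` A) y d/K x)"
   by (intro nn_integral_cong) (simp add: indicator_def)
  ultimately show ?thesis by (simp only: nn_integral_indicator)
 qed
 then show ?case by (rule measurable_eqI) (use kernel_emeasure_section[OF K set] in auto)
next
 case (mult u c)
 have "(NN y. c * u (x, y) d/K x) = c * (NN y. u (x, y) d/K x)" if x: "x \<in> space M" for x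
  using measurable_section[OF K mult(2) x] by (rule nn_integral_cmult)
 then show ?case by (rule measurable_eqI) (use mult(4) in auto)
next
 case (add u v)
 have "(NN y. v (x, y) + u (x, y) d/K x) = (NN y. v (x, y) d/K x) + (NN y. u (x, y) d/K x)" if x: "x \<in> space M" for x
  using measurable_section[OF K add(1) x] measurable_section[OF K add(3) x] by (intro nn_integral_add)
 then show ?case by (rule measurable_eqI) (use add in auto)
next
 case (seq U)
 have "(NN y. (SUP i. U i) (x, y) d/K x) = (SUP i. NN y. U i (x, y) d/K x)" if x: "x \<in> space M" for x
  unfolding SUP_apply
  by (intro nn_integral_monotone_convergence_SUP measurable_section[OF K seq(1) x])
    (use seq(3) in \<open>auto simp: incseq_def le_fun_def\<close>)
 then show ?case by (rule measurable_eqI) (use seq in auto)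
qed

text \<open>Four nonnegative integrals encode the complex one, so that measurability and Fubini
  statements for kernels reduce to \<open>nn_integral\<close>.\<close>

lemma integral_complex_parts:
 fixes f :: "'a \<Rightarrow> complex"
 assumes f: "integrable M f"
 shows "(LINT x|M. f x) = cor (enn2real (NN x. ennreal (Re (f x)) d/M) - enn2real (NN x. ennreal (- Re (f x)) d/M))
   + \<i> * cor (enn2real (NN x. ennreal (Im (f x)) d/M) - enn2real (NN x. ennreal (- Im (f x)) d/M))"
 using f by (simp add: complex_eq_iff flip: real_lebesgue_integral_def)

lemma kernel_lebesgue_measurable:
 fixes f :: "'x \<times> 'y::topological_space \<Rightarrow> complex"
 assumes K: "kernel M K" and f: "f \<in> borel_measurable (M \<Otimes>\<^sub>M borel)"
 shows "(\<lambda>x. LINT y|K x. f (x, y)) \<in> borel_measurable M"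
proof -
 have m: "(\<lambda>x. NN y. ennreal (l (f (x, y))) d/K x) \<in> borel_measurable M" if "l \<in> Borel" for l :: "complex \<Rightarrow> real"
  using measurable_compose[OF measurable_compose[OF f that] measurable_ennreal] by (rule kernel_nn_measurable[OF K])
 let ?p = "\<lambda>l x. enn2real (NN y. ennreal (l (f (x, y))) d/K x)"
 \<comment> \<open>The case distinction reproduces the default value 0 at parameters where the
   section is not integrable; that set is measurable.\<close>
 have "(\<lambda>x. if (NN y. ennreal (cmod (f (x, y))) d/K x) < \<infinity> then cor (?p Re x - ?p (\<lambda>z. - Re z) x) + \<i> * cor (?p Im x - ?p (\<lambda>z. - Im z) x) else 0) \<in> borel_measurable M"
  using m[of cmod] m[of Re] m[of "\<lambda>z. - Re z"] m[of Im] m[of "\<lambda>z. - Im z"] by measurable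
 then show ?thesis
 proof (rule measurable_eqI[rotated])
  fix x assume "x \<in> space M"
  then have "integrable (K x) (\<lambda>y. f (x, y)) \<longleftrightarrow> (NN y. ennreal (cmod (f (x, y))) d/K x) < \<infinity>"
   using measurable_section[OF K f] by (simp add: integrable_iff_bounded)
  then show "(LINT y|K x. f (x, y)) = (if (NN y. ennreal (cmod (f (x, y))) d/K x) < \<infinity> then cor (?p Re x - ?p (\<lambda>z. - Re z) x) + \<i> * cor (?p Im x - ?p (\<lambda>z. - Im z) x) else 0)"
   by (auto simp: integral_complex_parts not_integrable_integral_eq simp del: of_real_diff)
 qed
qed

lemma kernel_sigma_finite:
 assumes K: "kernel M K" and x: "x \<in> space M"
 shows "sigma_finite_measure (K x)"
proof -
 obtain E C where E: "\<And>n::nat. E n \<in> sets borel" "incseq E" "(\<Union>n. E n) = UNIV"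
  "\<And>n x. x \<in> space M \<Longrightarrow> emeasure (K x) (E n) \<le> ennreal (C n)" by (rule kernel_exhaustion[OF K]) blast
 have "emeasure (K x) (E n) \<noteq> \<infinity>" for n using E(4)[OF x, of n] by (auto simp: top_unique)
 then show ?thesis
  by (intro sigma_finite_measure.intro exI[of _ "range E"]) (use E x in \<open>auto simp: kernelD[OF K]\<close>)
qed

text \<open>A weight may destroy the uniform bounds; cutting \<open>E n\<close> down to the set
  where \<open>w\<close> is at most \<open>n\<close> restores them with constant
  \<open>n * C n\<close>.\<close>

lemma kernel_density:
 fixes w :: "'y::topological_space \<Rightarrow> real"
 assumes K: "kernel M K" and w: "w \<in> Borel"
 shows "kernel M (\<lambda>x. density (K x) (\<lambda>y. ennreal (w y)))"
proof -
 obtain E C where E: "\<And>n::nat. E n \<in> sets borel" "incseq E" "(\<Union>n. E n) = UNIV"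
  "\<And>n x. x \<in> space M \<Longrightarrow> emeasure (K x) (E n) \<le> ennreal (C n)" by (rule kernel_exhaustion[OF K]) blast
 let ?F = "\<lambda>n. E n \<inter> {y. w y \<le> real n}"
 have w': "(\<lambda>y. ennreal (w y)) \<in> borel_measurable (K x)" if "x \<in> space M" for x
  using w by (simp add: measurable_cong_sets[OF kernelD(1)[OF K that] refl])
 have em: "emeasure (density (K x) (\<lambda>y. ennreal (w y))) A = (NN y. ennreal (w y) * indicator A y d/K x)"
  if "x \<in> space M" "A \<in> sets borel" for x A
  using w'[OF that(1)] that by (intro emeasure_density) (auto simp: kernelD[OF K])
 show ?thesis
 proof (rule kernelI[where E="?F" and C="\<lambda>n. real n * C n"])
  fix A :: "'y set" assume A: "A \<in> sets borel"
  have "(\<lambda>x. NN y. ennreal (w y) * indicator A y d/K x) \<in> borel_measurable M"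
   using w A kernel_nn_measurable[OF K, of "\<lambda>p. ennreal (w (snd p)) * indicator A (snd p)"] by simp
  then show "(\<lambda>x. emeasure (density (K x) (\<lambda>y. ennreal (w y))) A) \<in> borel_measurable M"
   using em A by (subst measurable_cong) auto
 next
  show "?F n \<in> sets borel" for n using E w by measurable
  show "incseq ?F" using E(2) unfolding incseq_def by (auto; meson subsetD of_nat_mono order_trans)
  have "y \<in> (\<Union>n. ?F n)" for y
  proof -
   obtain n where n: "y \<in> E n" using E(3) by blast
   obtain m where m: "w y \<le> real m" using real_arch_simple by blast
   have "y \<in> E (max n m)" using n E(2) by (meson incseqD max.cobounded1 subsetD)
   then have "y \<in> ?F (max n m)" using m by (simp add: le_max_iff_disj)
   then show ?thesis by blast
  qed
  then show "(\<Union>n. ?F n) = UNIV" by blast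
  fix n x assume x: "x \<in> space M"
  have Fm: "?F n \<in> sets borel" using E w by measurable
  have "emeasure (density (K x) (\<lambda>y. ennreal (w y))) (?F n) \<le> (NN y. ennreal (real n) * indicator (E n) y d/K x)"
   unfolding em[OF x Fm] by (intro nn_integral_mono) (auto simp: indicator_def intro: ennreal_leI)
  also have "\<dots> = ennreal (real n) * emeasure (K x) (E n)"
   using E x by (intro nn_integral_cmult_indicator) (simp add: kernelD[OF K])
  also have "\<dots> \<le> ennreal (real n) * ennreal (C n)" using E(4)[OF x] by (intro mult_left_mono) auto
  finally show "emeasure (density (K x) (\<lambda>y. ennreal (w y))) (?F n) \<le> ennreal (real n * C n)"
   by (simp add: ennreal_mult')
 qed (use kernelD(1)[OF K] in simp)
qed

subsection \<open>Integrating a kernel\<close>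

context
 fixes M :: "'x measure" and K :: "'x \<Rightarrow> 'y::topological_space measure"
 assumes K: "kernel M K"
begin

lemma sets_integrated[simp]: "sets (integrated_measure M K) = sets borel"
 unfolding integrated_measure_def using sets.sigma_sets_eq[of borel] by (simp add: sets_measure_of sets.space_closed)

lemma space_integrated[simp]: "space (integrated_measure M K) = UNIV"
 using sets_eq_imp_space_eq[OF sets_integrated] by simp

text \<open>\<open>measure_of\<close> takes the intended values only for a countably additive set
  function; additivity is the exchange of a series with the integral over \<open>M\<close>.\<close>

lemma emeasure_integrated:
 assumes A: "A \<in> sets borel"
 shows "emeasure (integrated_measure M K) A = (NN x. emeasure (K x) A d/M)"
proof (rule emeasure_measure_of[OF integrated_measure_def])
 show "countably_additive (sets (integrated_measure M K)) (\<lambda>A. NN x. emeasure (K x) A d/M)"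
 proof (rule countably_additiveI)
  fix B :: "nat \<Rightarrow> 'y set" assume B: "range B \<subseteq> sets (integrated_measure M K)" "disjoint_family B"
  have Bm: "B i \<in> sets borel" for i using B by auto
  have "(\<Sum>i. NN x. emeasure (K x) (B i) d/M) = (NN x. (\<Sum>i. emeasure (K x) (B i)) d/M)"
   using kernelD(3)[OF K Bm] by (intro nn_integral_suminf[symmetric])
  also have "\<dots> = (NN x. emeasure (K x) (\<Union>i. B i) d/M)"
   using B Bm by (intro nn_integral_cong suminf_emeasure) (auto simp: kernelD[OF K])
  finally show "(\<Sum>i. NN x. emeasure (K x) (B i) d/M) = (NN x. emeasure (K x) (\<Union>i. B i) d/M)" .
 qed
qed (use A in \<open>auto simp: positive_def\<close>)

lemma nn_integral_integrated:
 assumes f: "f \<in> Borel"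
 shows "(NN y. f y d/integrated_measure M K) = (NN x. NN y. f y d/K x d/M)"
 using f
proof (induction f rule: borel_measurable_induct)
 case (cong f g)
 then show ?case by (simp cong: nn_integral_cong)
next
 case (set A)
 have "(NN x. NN y. indicator A y d/K x d/M) = (NN x. emeasure (K x) A d/M)"
  using set by (intro nn_integral_cong) (simp add: kernelD[OF K])
 then show ?case using set by (simp add: emeasure_integrated)
next
 case (mult u c)
 have m: "u \<in> borel_measurable (K x)" if "x \<in> space M" for x
  using mult by (simp add: measurable_cong_sets[OF kernelD(1)[OF K that] refl])
 have "(\<lambda>x. NN y. u y d/K x) \<in> borel_measurable M"
  using mult kernel_nn_measurable[OF K, of "\<lambda>p. u (snd p)"] by simp
 then have "(NN x. NN y. c * u y d/K x d/M) = c * (NN x. NN y. u y d/K x d/M)"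
  using m by (simp add: nn_integral_cmult cong: nn_integral_cong)
 then show ?case using mult by (simp add: nn_integral_cmult measurable_cong_sets[OF sets_integrated refl])
next
 case (add u v)
 have m: "u \<in> borel_measurable (K x)" "v \<in> borel_measurable (K x)" if "x \<in> space M" for x
  using add by (simp_all add: measurable_cong_sets[OF kernelD(1)[OF K that] refl])
 have "(\<lambda>x. NN y. u y d/K x) \<in> borel_measurable M" "(\<lambda>x. NN y. v y d/K x) \<in> borel_measurable M"
  using add kernel_nn_measurable[OF K, of "\<lambda>p. u (snd p)"] kernel_nn_measurable[OF K, of "\<lambda>p. v (snd p)"] by simp_all
 then have "(NN x. NN y. v y + u y d/K x d/M) = (NN x. NN y. v y d/K x d/M) + (NN x. NN y. u y d/K x d/M)"
  using m by (simp add: nn_integral_add cong: nn_integral_cong)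
 then show ?case using add by (simp add: nn_integral_add measurable_cong_sets[OF sets_integrated refl])
next
 case (seq U)
 have m: "U i \<in> borel_measurable (K x)" if "x \<in> space M" for x i
  using seq by (simp add: measurable_cong_sets[OF kernelD(1)[OF K that] refl])
 have 1: "(\<lambda>x. NN y. U i y d/K x) \<in> borel_measurable M" for i
  using seq kernel_nn_measurable[OF K, of "\<lambda>p. U i (snd p)"] by simp
 have "(NN x. NN y. (SUP i. U i) y d/K x d/M) = (NN x. (SUP i. NN y. U i y d/K x) d/M)"
  using seq(3) m unfolding SUP_apply by (intro nn_integral_cong nn_integral_monotone_convergence_SUP)
 also have "\<dots> = (SUP i. NN x. NN y. U i y d/K x d/M)"
  using seq(3) 1 by (intro nn_integral_monotone_convergence_SUP)
   (auto simp: incseq_def le_fun_def intro!: nn_integral_mono)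
 also have "\<dots> = (SUP i. NN y. U i y d/integrated_measure M K)" using seq by simp
 also have "\<dots> = (NN y. (SUP i. U i) y d/integrated_measure M K)"
  using seq unfolding SUP_apply by (intro nn_integral_monotone_convergence_SUP[symmetric])
   (simp_all add: measurable_cong_sets[OF sets_integrated refl])
 finally show ?case by simp
qed

lemma AE_integrated:
 assumes P: "{y. \<not> P y} \<in> sets borel" and "AE y in integrated_measure M K. P y"
 shows "AE x in M. AE y in K x. P y"
proof -
 have "emeasure (integrated_measure M K) {y. \<not> P y} = 0"
  using assms by (simp add: AE_iff_measurable[OF _ refl])
 then have "(NN x. emeasure (K x) {y. \<not> P y} d/M) = 0" using P by (simp add: emeasure_integrated)
 then have z: "AE x in M. emeasure (K x) {y. \<not> P y} = 0"
  using kernelD(3)[OF K P] by (simp add: nn_integral_0_iff_AE)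
 show ?thesis
 proof (rule AE_mp[OF z], rule AE_I2, rule impI)
  fix x assume x: "x \<in> space M" "emeasure (K x) {y. \<not> P y} = 0"
  then show "AE y in K x. P y" using P
   by (intro AE_I[of _ _ "{y. \<not> P y}"]) (auto simp: kernelD[OF K])
 qed
qed

lemma integral_integrated:
 fixes f :: "'y \<Rightarrow> complex"
 assumes f: "f \<in> Borel" and fin: "(NN x. NN y. ennreal (norm (f y)) d/K x d/M) < \<infinity>"
 shows "integrable (integrated_measure M K) f"
  and "integrable M (\<lambda>x. LINT y|K x. f y)"
  and "(LINT y|integrated_measure M K. f y) = (LINT x|M. LINT y|K x. f y)"
proof -
 let ?N = "integrated_measure M K"
 have fm: "f \<in> borel_measurable (K x)" if "x \<in> space M" for x
  using f by (simp add: measurable_cong_sets[OF kernelD(1)[OF K that] refl])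
 have m: "(\<lambda>x. NN y. ennreal (l (f y)) d/K x) \<in> borel_measurable M" and lm: "(\<lambda>y. ennreal (l (f y))) \<in> Borel"
  if "l \<in> Borel" for l :: "complex \<Rightarrow> real"
  using measurable_compose[OF measurable_compose[OF f that] measurable_ennreal]
   kernel_nn_measurable[OF K, of "\<lambda>p. ennreal (l (f (snd p)))"] by simp_all
 show iN: "integrable ?N f"
  using f fin nn_integral_integrated[of "\<lambda>y. ennreal (norm (f y))"]
  by (simp add: integrable_iff_bounded measurable_cong_sets[OF sets_integrated refl])
 have ae: "AE x in M. (NN y. ennreal (cmod (f y)) d/K x) \<noteq> \<infinity>"
  using m[of cmod] fin by (intro nn_integral_noteq_infinite) auto
 have part: "integrable M (\<lambda>x. enn2real (NN y. ennreal (l (f y)) d/K x))"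
   "(LINT x|M. enn2real (NN y. ennreal (l (f y)) d/K x)) = enn2real (NN y. ennreal (l (f y)) d/?N)"
  if l: "l \<in> Borel" "\<And>z. l z \<le> cmod z" for l
 proof -
  have le: "(NN y. ennreal (l (f y)) d/K x) \<le> (NN y. ennreal (cmod (f y)) d/K x)" for x
   by (intro nn_integral_mono ennreal_leI l(2))
  \<comment> \<open>\<open>enn2real\<close> sends infinity to 0, so this equality depends on the
    inner integrals being finite almost everywhere.\<close>
  have "(NN x. ennreal (enn2real (NN y. ennreal (l (f y)) d/K x)) d/M) = (NN x. NN y. ennreal (l (f y)) d/K x d/M)"
   by (rule nn_integral_cong_AE, rule eventually_mono[OF ae]) (metis ennreal_enn2real le le_less_trans less_top infinity_ennreal_def)
  moreover have "(NN x. NN y. ennreal (l (f y)) d/K x d/M) < \<infinity>"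
   by (rule le_less_trans[OF nn_integral_mono[OF le]]) (use fin in simp)
  ultimately show "integrable M (\<lambda>x. enn2real (NN y. ennreal (l (f y)) d/K x))"
   "(LINT x|M. enn2real (NN y. ennreal (l (f y)) d/K x)) = enn2real (NN y. ennreal (l (f y)) d/?N)"
   using m[OF l(1)] by (auto simp: integral_eq_nn_integral nn_integral_integrated[OF lm[OF l(1)]] intro!: integrableI_nonneg)
 qed
 note P = part[of Re] part[of "\<lambda>z. - Re z"] part[of Im] part[of "\<lambda>z. - Im z"]
 have b: "Re z \<le> cmod z" "- Re z \<le> cmod z" "Im z \<le> cmod z" "- Im z \<le> cmod z" for z
  using abs_Re_le_cmod[of z] abs_Im_le_cmod[of z] by auto
 let ?p = "\<lambda>l x. enn2real (NN y. ennreal (l (f y)) d/K x)"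
 let ?c = "\<lambda>x. cor (?p Re x - ?p (\<lambda>z. - Re z) x) + \<i> * cor (?p Im x - ?p (\<lambda>z. - Im z) x)"
 have d: "integrable M ?c" and c: "(LINT x|M. ?c x) = (LINT y|?N. f y)"
  using P b unfolding integral_complex_parts[OF iN] by simp_all
 have ae': "AE x in M. (LINT y|K x. f y) = ?c x"
  using ae AE_space
 proof eventually_elim
  case (elim x)
  then have "integrable (K x) f" using fm by (simp add: integrable_iff_bounded less_top)
  then show ?case by (rule integral_complex_parts)
 qed
 have fK: "(\<lambda>x. LINT y|K x. f y) \<in> borel_measurable M"
  using f kernel_lebesgue_measurable[OF K, of "\<lambda>p. f (snd p)"] by simp
 show "integrable M (\<lambda>x. LINT y|K x. f y)"
  using integrable_cong_AE[OF fK borel_measurable_integrable[OF d] ae'] d by (rule iffD2)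
 show "(LINT y|?N. f y) = (LINT x|M. LINT y|K x. f y)"
  using integral_cong_AE[OF fK borel_measurable_integrable[OF d] ae'] unfolding c by (rule sym)
qed

end

subsection \<open>Semidirect products\<close>

text \<open>The product of a measure with a kernel, realised by pushing each \<open>K x\<close> to
  the slice over \<open>x\<close>, so that the results on integrated measures give Fubini
  directly.\<close>

definition semidirect :: "'x::topological_space measure \<Rightarrow> ('x \<Rightarrow> 'y::topological_space measure) \<Rightarrow> ('x \<times> 'y) measure" where
 "semidirect M K = integrated_measure M (\<lambda>x. distr (K x) borel (Pair x))"

lemma measurable_Pair_borel:
 "Pair (x :: 'x::second_countable_topology) \<in> measurable borel (borel :: ('x \<times> 'y::second_countable_topology) measure)"
 by (rule borel_measurable_Pair) auto

context
 fixes M :: "'x::second_countable_topology measure" and K :: "'x \<Rightarrow> 'y::second_countable_topology measure"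
 assumes M: "sets M = sets borel" and K: "kernel M K"
begin

lemma space_M: "space M = UNIV" using sets_eq_imp_space_eq[OF M] by simp

lemma pair_M: "sets (M \<Otimes>\<^sub>M borel) = sets (borel :: ('x \<times> 'y) measure)"
 by (rule trans[OF sets_pair_measure_cong[OF M refl] arg_cong[where f=sets, OF borel_prod]])

lemma Pair_in_K: "Pair x \<in> measurable (K x) borel"
 using measurable_Pair_borel by (simp add: measurable_cong_sets[OF kernelD(1)[OF K] refl] space_M)

lemma nn_distr_Pair:
 assumes "f \<in> Borel"
 shows "(NN p. f p d/distr (K x) borel (Pair x)) = (NN y. f (x, y) d/K x)"
 using assms Pair_in_K by (subst nn_integral_distr) auto

lemma kernel_Pair: "kernel M (\<lambda>x. distr (K x) borel (Pair x))"
proof -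
 obtain E C where E: "\<And>n::nat. E n \<in> sets borel" "incseq E" "(\<Union>n. E n) = UNIV"
  "\<And>n x. x \<in> space M \<Longrightarrow> emeasure (K x) (E n) \<le> ennreal (C n)" by (rule kernel_exhaustion[OF K]) blast
 have em: "emeasure (distr (K x) borel (Pair x)) A = emeasure (K x) (Pair x -` A)" if "A \<in> sets borel" for x A
  using that Pair_in_K[of x] by (subst emeasure_distr) (auto simp: kernelD[OF K] space_M)
 have UE: "UNIV \<times> E n \<in> sets (borel :: ('x \<times> 'y) measure)" for n
  using E(1)[of n] unfolding borel_prod[symmetric] by (intro pair_measureI) auto
 show ?thesis
 proof (rule kernelI[where E="\<lambda>n. UNIV \<times> E n" and C=C])
  show "(\<lambda>x. emeasure (distr (K x) borel (Pair x)) A) \<in> borel_measurable M" if "A \<in> sets borel" for A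
   using kernel_emeasure_section[OF K, of A] that by (simp add: em pair_M)
  show "emeasure (distr (K x) borel (Pair x)) (UNIV \<times> E n) \<le> ennreal (C n)" for n x
   using E(4)[of x n] UE by (simp add: em space_M vimage_def)
  show "(\<Union>n. UNIV \<times> E n) = UNIV" using E(3) by (auto simp: set_eq_iff)
  show "incseq (\<lambda>n. UNIV \<times> E n)" using E(2) unfolding incseq_def by blast
 qed (use UE in auto)
qed

lemma sets_semidirect[simp]: "sets (semidirect M K) = sets borel"
 unfolding semidirect_def by (rule sets_integrated[OF kernel_Pair])

lemma nn_integral_semidirect:
 assumes f: "f \<in> Borel"
 shows "(NN p. f p d/semidirect M K) = (NN x. NN y. f (x, y) d/K x d/M)"
 unfolding semidirect_def nn_integral_integrated[OF kernel_Pair f] using nn_distr_Pair[OF f] by simp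

lemma integral_semidirect:
 fixes f :: "'x \<times> 'y \<Rightarrow> complex"
 assumes f: "f \<in> Borel" and fin: "(NN x. NN y. ennreal (norm (f (x, y))) d/K x d/M) < \<infinity>"
 shows "integrable (semidirect M K) f"
  and "integrable M (\<lambda>x. LINT y|K x. f (x, y))"
  and "(LINT p|semidirect M K. f p) = (LINT x|M. LINT y|K x. f (x, y))"
proof -
 have n: "(NN x. NN p. ennreal (norm (f p)) d/distr (K x) borel (Pair x) d/M) < \<infinity>"
  using fin f by (simp add: nn_distr_Pair)
 have e: "(LINT p|distr (K x) borel (Pair x). f p) = (LINT y|K x. f (x, y))" for x
  using f Pair_in_K by (intro integral_distr) auto
 show "integrable (semidirect M K) f" "integrable M (\<lambda>x. LINT y|K x. f (x, y))"
  "(LINT p|semidirect M K. f p) = (LINT x|M. LINT y|K x. f (x, y))"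
  using integral_integrated[OF kernel_Pair f n] by (simp_all add: e semidirect_def)
qed

lemma AE_semidirect:
 assumes P: "{p. \<not> P p} \<in> sets borel" and ae: "AE p in semidirect M K. P p"
 shows "AE x in M. AE y in K x. P (x, y)"
proof -
 have "AE x in M. AE p in distr (K x) borel (Pair x). P p"
  using ae unfolding semidirect_def by (rule AE_integrated[OF kernel_Pair P])
 moreover have "{p. P p} \<in> sets borel"
  using sets.compl_sets[OF P] by (simp add: Compl_eq_Diff_UNIV[symmetric] Collect_neg_eq)
 ultimately show ?thesis
  using Pair_in_K by (simp add: AE_distr_iff)
qed

end

lemma measure_eqI_nn_integral:
 assumes "sets M = sets borel" "sets N = sets borel"
  and "\<And>f. f \<in> Borel \<Longrightarrow> (NN x. f x d/M) = (NN x. f x d/N)"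
 shows "M = N"
proof (rule measure_eqI)
 fix A assume "A \<in> sets M"
 then have A: "A \<in> sets borel" using assms by simp
 then have "(NN x. indicator A x d/M) = (NN x. indicator A x d/N)" by (intro assms(3)) simp
 then show "emeasure M A = emeasure N A" using A assms by simp
qed (use assms in simp)

lemma nn_integral_swap:
 fixes f :: "'a::second_countable_topology \<times> 'b::second_countable_topology \<Rightarrow> ennreal"
 assumes "sets M = sets borel" "sets N = sets borel" "sigma_finite_measure M" "sigma_finite_measure N"
  and f: "f \<in> Borel"
 shows "(NN x. NN y. f (x, y) d/N d/M) = (NN y. NN x. f (x, y) d/M d/N)"
proof -
 interpret pair_sigma_finite M N using assms by (simp add: pair_sigma_finite_def)
 have eq: "sets (M \<Otimes>\<^sub>M N) = sets (borel :: ('a \<times> 'b) measure)"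
  by (rule trans[OF sets_pair_measure_cong[OF assms(1,2)] arg_cong[where f=sets, OF borel_prod]])
 then have "f \<in> borel_measurable (M \<Otimes>\<^sub>M N)" using f by (simp add: measurable_cong_sets[OF eq refl])
 then show ?thesis using Fubini[of f] by simp
qed

section \<open>Borel Hilbert bundles and their square integrable sections\<close>

text \<open>Finite combinations with coefficients in \<open>Q + iQ\<close>, coded by lists: the
  family is countable, and since indices may repeat, a sum is just a concatenation.\<close>

primrec comb :: "('x \<Rightarrow> 'h ips) \<Rightarrow> (nat \<Rightarrow> 'x \<Rightarrow> 'h) \<Rightarrow> (nat \<times> rat \<times> rat) list \<Rightarrow> 'x \<Rightarrow> 'h" where
 "comb H e [] u = vzero (H u)"
| "comb H e (c # cs) u =
   vadd (H u) (vscale (H u) (Complex (of_rat (fst (snd c))) (of_rat (snd (snd c)))) (e (fst c) u)) (comb H e cs u)"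

locale section_space =
 fixes M :: "'x measure" and H :: "'x \<Rightarrow> 'h ips" and e :: "nat \<Rightarrow> 'x \<Rightarrow> 'h"
 assumes hilbert: "u \<in> space M \<Longrightarrow> hilbert_space (H u)" and fundamental: "fundamental_sequence M H e"
begin

lemma e_in: "u \<in> space M \<Longrightarrow> e n u \<in> carr (H u)"
 using fundamental by (auto simp: fundamental_sequence_def)

lemma e_measurable: "(\<lambda>u. ip (H u) (e m u) (e n u)) \<in> borel_measurable M"
 using fundamental by (auto simp: fundamental_sequence_def)

lemma e_separating:
 "u \<in> space M \<Longrightarrow> v \<in> carr (H u) \<Longrightarrow> w \<in> carr (H u) \<Longrightarrow> (\<And>n. ip (H u) v (e n u) = ip (H u) w (e n u)) \<Longrightarrow> v = w"
 using fundamental by (auto simp: fundamental_sequence_def)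

definition bsec :: "('x \<Rightarrow> 'h) \<Rightarrow> bool" where
 "bsec h \<longleftrightarrow> (\<forall>u\<in>space M. h u \<in> carr (H u)) \<and> (\<forall>n. (\<lambda>u. ip (H u) (h u) (e n u)) \<in> borel_measurable M)"

lemma bsec_in: "bsec h \<Longrightarrow> u \<in> space M \<Longrightarrow> h u \<in> carr (H u)"
 by (simp add: bsec_def)

lemma bsec_cong: "(\<And>u. u \<in> space M \<Longrightarrow> h u = k u) \<Longrightarrow> bsec h \<longleftrightarrow> bsec k"
 unfolding bsec_def by (simp cong: measurable_cong)

definition w :: "nat \<Rightarrow> 'x \<Rightarrow> 'h" where
 "w j = comb H e (from_nat j)"

lemma comb_in: "u \<in> space M \<Longrightarrow> comb H e cs u \<in> carr (H u)"
proof (induction cs)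
 case (Cons c cs)
 interpret hilbert_space "H u" using hilbert Cons.prems .
 show ?case using Cons e_in by (simp add: closed)
qed (simp add: hilbert_space.axioms(1)[OF hilbert] cvector_space.zero_in)

lemma comb_append:
 assumes u: "u \<in> space M"
 shows "comb H e (cs @ ds) u = vadd (H u) (comb H e cs u) (comb H e ds u)"
proof -
 interpret hilbert_space "H u" using hilbert u .
 show ?thesis
 proof (induction cs)
  case Nil
  show ?case using add_commute[OF zero_in comb_in[OF u, of ds]] comb_in[OF u, of ds] by (simp add: add_zero)
 next
  case (Cons c cs)
  then show ?case using comb_in[OF u] e_in[OF u] by (simp add: add_assoc closed)
 qed
qed

lemma comb_scale:
 assumes u: "u \<in> space M"
 shows "\<exists>ds. vscale (H u) (Complex (of_rat a) (of_rat b)) (comb H e cs u) = comb H e ds u"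
proof -
 interpret hilbert_space "H u" using hilbert u .
 show ?thesis
 proof (induction cs)
  case Nil
  have "vscale (H u) (Complex (of_rat a) (of_rat b)) (vzero (H u)) = vzero (H u)"
   by (rule inner_ext) (auto simp: closed inner_simps)
  then show ?case by (intro exI[of _ "[]"]) simp
 next
  case (Cons c cs)
  obtain n a' b' where c: "c = (n, a', b')" by (cases c) auto
  obtain ds where ds: "vscale (H u) (Complex (of_rat a) (of_rat b)) (comb H e cs u) = comb H e ds u" using Cons by blast
  have m: "Complex (of_rat a) (of_rat b) * Complex (of_rat a') (of_rat b')
    = Complex (of_rat (a * a' - b * b')) (of_rat (a * b' + b * a'))"
   by (simp add: complex_eq_iff of_rat_add of_rat_diff of_rat_mult)
  have "vscale (H u) (Complex (of_rat a) (of_rat b)) (comb H e (c # cs) u)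
    = comb H e ((n, a * a' - b * b', a * b' + b * a') # ds) u"
   using comb_in[OF u] e_in[OF u] by (simp add: c scale_add scale_scale closed ds m)
  then show ?case by blast
 qed
qed

lemma rat_complex_dense:
 assumes "0 < t"
 shows "\<exists>a b. cmod (c - Complex (of_rat a) (of_rat b)) < t"
proof -
 obtain a where a: "Re c - t/2 < of_rat a" "of_rat a < Re c + t/2" using of_rat_dense[of "Re c - t/2" "Re c + t/2"] assms by auto
 obtain b where b: "Im c - t/2 < of_rat b" "of_rat b < Im c + t/2" using of_rat_dense[of "Im c - t/2" "Im c + t/2"] assms by auto
 have "cmod (c - Complex (of_rat a) (of_rat b)) \<le> \<bar>Re c - of_rat a\<bar> + \<bar>Im c - of_rat b\<bar>"
  using cmod_le[of "c - Complex (of_rat a) (of_rat b)"] by simp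
 also have "\<dots> < t" using a b by linarith
 finally show ?thesis by blast
qed

text \<open>The closure of the rational combinations is a complex subspace, because complex scalars
  are approximated by rational ones, and it contains the separating vectors \<open>e n u\<close>; so
  its orthogonal complement is zero.\<close>

lemma w_dense:
 assumes u: "u \<in> space M" and v: "v \<in> carr (H u)" and \<epsilon>: "0 < \<epsilon>"
 shows "\<exists>j. nrm (H u) (vdiff (H u) v (w j u)) < \<epsilon>"
proof -
 interpret hilbert_space "H u" using hilbert u .
 note cin = comb_in[OF u]
 let ?D = "{v \<in> carr (H u). \<forall>\<epsilon>>0. \<exists>cs. nrm (H u) (vdiff (H u) v (comb H e cs u)) < \<epsilon>}"
 have "?D = carr (H u)"
 proof (rule total_subspace_eq_carr)
  show "?D \<subseteq> carr (H u)" by auto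
  have "vzero (H u) \<in> ?D" using zero_in
   by (auto intro!: exI[of _ "[]"] simp: nrm_diff_self)
  then show "?D \<noteq> {}" by blast
 next
  fix x y assume x: "x \<in> ?D" and y: "y \<in> ?D"
  show "vadd (H u) x y \<in> ?D"
  proof (intro CollectI conjI allI impI)
   show "vadd (H u) x y \<in> carr (H u)" using x y by (auto simp: closed)
   fix \<epsilon> :: real assume "0 < \<epsilon>"
   then have h: "0 < \<epsilon> / 2" by simp
   obtain cs ds where cd: "nrm (H u) (vdiff (H u) x (comb H e cs u)) < \<epsilon>/2" "nrm (H u) (vdiff (H u) y (comb H e ds u)) < \<epsilon>/2"
    using x y h by blast
   have "nrm (H u) (vdiff (H u) (vadd (H u) x y) (comb H e (cs @ ds) u))
    = nrm (H u) (vadd (H u) (vdiff (H u) x (comb H e cs u)) (vdiff (H u) y (comb H e ds u)))"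
    using x y cin by (intro nrm_cong) (simp add: comb_append[OF u] closed inner_simps)
   also have "\<dots> < \<epsilon>" using cd nrm_triangle[of "vdiff (H u) x (comb H e cs u)" "vdiff (H u) y (comb H e ds u)"] x y cin
    by (simp add: closed)
   finally show "\<exists>cs. nrm (H u) (vdiff (H u) (vadd (H u) x y) (comb H e cs u)) < \<epsilon>" by blast
  qed
 next
  fix c x assume x: "x \<in> ?D"
  then have xin: "x \<in> carr (H u)" by simp
  show "vscale (H u) c x \<in> ?D"
  proof (intro CollectI conjI allI impI)
   show "vscale (H u) c x \<in> carr (H u)" using x by (auto simp: closed)
   fix \<epsilon> :: real assume \<epsilon>: "0 < \<epsilon>"
   \<comment> \<open>Half of the tolerance pays for replacing the scalar, half for replacing the
     vector; the summand 1 keeps the denominators positive.\<close>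
   have "0 < \<epsilon> / (2 * (nrm (H u) x + 1))" using \<epsilon> nrm_nonneg[OF xin] by simp
   then obtain a b where ab: "cmod (c - Complex (of_rat a) (of_rat b)) < \<epsilon> / (2 * (nrm (H u) x + 1))"
    using rat_complex_dense by blast
   let ?q = "Complex (of_rat a) (of_rat b)"
   have "0 < \<epsilon> / (2 * (cmod ?q + 1))" using \<epsilon> by (simp add: add_nonneg_pos)
   then obtain cs where cs: "nrm (H u) (vdiff (H u) x (comb H e cs u)) < \<epsilon> / (2 * (cmod ?q + 1))" using x by blast
   obtain ds where ds: "vscale (H u) ?q (comb H e cs u) = comb H e ds u" using comb_scale[OF u] by blast
   have "nrm (H u) (vdiff (H u) (vscale (H u) c x) (comb H e ds u))
    = nrm (H u) (vadd (H u) (vscale (H u) (c - ?q) x) (vscale (H u) ?q (vdiff (H u) x (comb H e cs u))))"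
    using xin cin by (intro nrm_cong) (simp add: ds[symmetric] closed inner_simps algebra_simps)
   also have "\<dots> \<le> cmod (c - ?q) * nrm (H u) x + cmod ?q * nrm (H u) (vdiff (H u) x (comb H e cs u))"
    using nrm_triangle[of "vscale (H u) (c - ?q) x" "vscale (H u) ?q (vdiff (H u) x (comb H e cs u))"] xin cin
    by (simp add: closed nrm_scale)
   also have "\<dots> < \<epsilon> / 2 + \<epsilon> / 2"
   proof (rule add_less_le_mono)
    have "cmod (c - ?q) * nrm (H u) x \<le> cmod (c - ?q) * (nrm (H u) x + 1)" by (intro mult_left_mono) auto
    also have "\<dots> < \<epsilon> / 2" using ab nrm_nonneg[OF xin] by (simp add: field_simps)
    finally show "cmod (c - ?q) * nrm (H u) x < \<epsilon> / 2" .
    have "cmod ?q * nrm (H u) (vdiff (H u) x (comb H e cs u)) \<le> (cmod ?q + 1) * (\<epsilon> / (2 * (cmod ?q + 1)))"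
     using cs nrm_nonneg[OF diff_in[OF xin cin]] by (intro mult_mono) auto
    also have "\<dots> = \<epsilon> / 2"
    proof -
     have "cmod ?q + 1 \<noteq> 0" using norm_ge_zero[of ?q] by linarith
     then show ?thesis by (simp add: field_simps)
    qed
    finally show "cmod ?q * nrm (H u) (vdiff (H u) x (comb H e cs u)) \<le> \<epsilon> / 2" .
   qed
   finally show "\<exists>cs. nrm (H u) (vdiff (H u) (vscale (H u) c x) (comb H e cs u)) < \<epsilon>" by auto
  qed
 next
  fix X x assume X: "\<And>n. X n \<in> ?D" and x: "x \<in> carr (H u)" and t: "tends (H u) X x"
  have "\<exists>cs. nrm (H u) (vdiff (H u) x (comb H e cs u)) < \<epsilon>" if \<epsilon>: "0 < \<epsilon>" for \<epsilon>
  proof -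
   have "\<forall>\<^sub>F n in sequentially. nrm (H u) (vdiff (H u) (X n) x) < \<epsilon>/2"
    using t \<epsilon> by (intro order_tendstoD(2)[of _ 0]) (auto simp: tends_def)
   then obtain n where n: "nrm (H u) (vdiff (H u) (X n) x) < \<epsilon>/2" by (auto simp: eventually_sequentially)
   have Xn: "X n \<in> carr (H u)" using X[of n] by simp
   obtain cs where cs: "nrm (H u) (vdiff (H u) (X n) (comb H e cs u)) < \<epsilon>/2"
    using X[of n] \<epsilon> by (auto dest!: spec[of _ "\<epsilon>/2"])
   have "nrm (H u) (vdiff (H u) x (comb H e cs u)) < \<epsilon>"
    using nrm_diff_triangle[OF x Xn cin[of cs]] n cs nrm_diff_commute[OF x Xn] by linarith
   then show ?thesis by blast
  qed
  then show "x \<in> ?D" using x by blast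
 next
  fix z assume z: "z \<in> carr (H u)" and 0: "\<And>y. y \<in> ?D \<Longrightarrow> ip (H u) z y = 0"
  have "e n u \<in> ?D" for n
  proof -
   have "comb H e [(n, 1, 0)] u = e n u"
    using e_in[OF u, of n] scale_one[OF e_in[OF u]] by (simp add: add_zero Complex_eq)
   then show ?thesis using e_in[OF u] nrm_diff_self[OF e_in[OF u]] by (auto intro!: exI[of _ "[(n, 1, 0)]"])
  qed
  then show "z = vzero (H u)"
   by (intro e_separating[OF u z zero_in]) (simp add: 0 inner_zero e_in[OF u])
 qed
 then obtain cs where "nrm (H u) (vdiff (H u) v (comb H e cs u)) < \<epsilon>" using v \<epsilon> by blast
 then show ?thesis by (intro exI[of _ "to_nat cs"]) (simp add: w_def)
qed

lemma bsec_zero: "bsec (\<lambda>u. vzero (H u))"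
 unfolding bsec_def
proof (intro conjI ballI allI)
 fix u assume u: "u \<in> space M"
 interpret hilbert_space "H u" using hilbert u .
 show "vzero (H u) \<in> carr (H u)" by (rule zero_in)
next
 fix n
 have "ip (H u) (vzero (H u)) (e n u) = 0" if u: "u \<in> space M" for u
 proof -
  interpret hilbert_space "H u" using hilbert u .
  show ?thesis using inner_zero e_in[OF u] by simp
 qed
 then show "(\<lambda>u. ip (H u) (vzero (H u)) (e n u)) \<in> borel_measurable M" by (simp cong: measurable_cong)
qed

lemma bsec_add:
 assumes h: "bsec h" and k: "bsec k"
 shows "bsec (\<lambda>u. vadd (H u) (h u) (k u))"
 unfolding bsec_def
proof (intro conjI ballI allI)
 fix u assume u: "u \<in> space M"
 interpret hilbert_space "H u" using hilbert u .
 show "vadd (H u) (h u) (k u) \<in> carr (H u)" using bsec_in[OF h u] bsec_in[OF k u] by (rule add_in)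
next
 fix n
 have "ip (H u) (vadd (H u) (h u) (k u)) (e n u) = ip (H u) (h u) (e n u) + ip (H u) (k u) (e n u)"
  if u: "u \<in> space M" for u
 proof -
  interpret hilbert_space "H u" using hilbert u .
  show ?thesis using bsec_in[OF h u] bsec_in[OF k u] e_in[OF u] by (simp add: inner_simps)
 qed
 moreover have "(\<lambda>u. ip (H u) (h u) (e n u) + ip (H u) (k u) (e n u)) \<in> borel_measurable M"
  using h k by (auto simp: bsec_def intro!: borel_measurable_add)
 ultimately show "(\<lambda>u. ip (H u) (vadd (H u) (h u) (k u)) (e n u)) \<in> borel_measurable M"
  by (simp cong: measurable_cong)
qed

lemma bsec_scale:
 assumes h: "bsec h" and c: "c \<in> borel_measurable M"
 shows "bsec (\<lambda>u. vscale (H u) (c u) (h u))"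
 unfolding bsec_def
proof (intro conjI ballI allI)
 fix u assume u: "u \<in> space M"
 interpret hilbert_space "H u" using hilbert u .
 show "vscale (H u) (c u) (h u) \<in> carr (H u)" using bsec_in[OF h u] by (rule scale_in)
next
 fix n
 have "ip (H u) (vscale (H u) (c u) (h u)) (e n u) = c u * ip (H u) (h u) (e n u)"
  if u: "u \<in> space M" for u
 proof -
  interpret hilbert_space "H u" using hilbert u .
  show ?thesis using bsec_in[OF h u] e_in[OF u] by (simp add: inner_simps)
 qed
 moreover have "(\<lambda>u. c u * ip (H u) (h u) (e n u)) \<in> borel_measurable M"
  using h c by (auto simp: bsec_def intro!: borel_measurable_times)
 ultimately show "(\<lambda>u. ip (H u) (vscale (H u) (c u) (h u)) (e n u)) \<in> borel_measurable M"
  by (simp cong: measurable_cong)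
qed

lemma bsec_diff: "bsec h \<Longrightarrow> bsec k \<Longrightarrow> bsec (\<lambda>u. vdiff (H u) (h u) (k u))"
 unfolding vdiff_def by (intro bsec_add bsec_scale) auto

lemma bsec_e: "bsec (e n)"
 using e_in e_measurable by (auto simp: bsec_def)

lemma bsec_comb: "bsec (comb H e cs)"
proof (induction cs)
 case Nil then show ?case using bsec_zero by simp
next
 case (Cons c cs)
 show ?case using bsec_add[OF bsec_scale[OF bsec_e, of "\<lambda>_. Complex (of_rat (fst (snd c))) (of_rat (snd (snd c)))"] Cons]
  by simp
qed

lemma bsec_w: "bsec (w j)"
 unfolding w_def by (rule bsec_comb)

lemma ip_comb_measurable:
 assumes h: "bsec h"
 shows "(\<lambda>u. ip (H u) (h u) (comb H e cs u)) \<in> borel_measurable M"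
proof (induction cs)
 case Nil
 have "ip (H u) (h u) (vzero (H u)) = 0" if u: "u \<in> space M" for u
 proof -
  interpret hilbert_space "H u" using hilbert u .
  show ?thesis using inner_zero_right bsec_in[OF h u] by simp
 qed
 then show ?case by (simp cong: measurable_cong)
next
 case (Cons c cs)
 let ?q = "Complex (of_rat (fst (snd c))) (of_rat (snd (snd c)))"
 have "ip (H u) (h u) (comb H e (c # cs) u) = cnj ?q * ip (H u) (h u) (e (fst c) u) + ip (H u) (h u) (comb H e cs u)"
  if u: "u \<in> space M" for u
 proof -
  interpret hilbert_space "H u" using hilbert u .
  show ?thesis using bsec_in[OF h u] e_in[OF u] comb_in[OF u] by (simp add: inner_simps closed)
 qed
 moreover have "(\<lambda>u. cnj ?q * ip (H u) (h u) (e (fst c) u) + ip (H u) (h u) (comb H e cs u)) \<in> borel_measurable M"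
  using h Cons by (auto simp: bsec_def intro!: borel_measurable_add borel_measurable_times)
 ultimately show ?case by (simp cong: measurable_cong)
qed

lemma nrm_measurable_of_sq:
 assumes h: "bsec h" and "(\<lambda>u. (nrm (H u) (h u))\<^sup>2) \<in> borel_measurable M"
 shows "(\<lambda>u. nrm (H u) (h u)) \<in> borel_measurable M"
proof -
 have "(\<lambda>u. sqrt ((nrm (H u) (h u))\<^sup>2)) \<in> borel_measurable M" using assms(2) by measurable
 moreover have "sqrt ((nrm (H u) (h u))\<^sup>2) = nrm (H u) (h u)" if u: "u \<in> space M" for u
 proof -
  interpret hilbert_space "H u" using hilbert u .
  show ?thesis using nrm_nonneg[OF bsec_in[OF h u]] by simp
 qed
 ultimately show ?thesis by (simp cong: measurable_cong)
qed

lemma nrm_w_measurable: "(\<lambda>u. (nrm (H u) (w j u))\<^sup>2) \<in> borel_measurable M"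
proof -
 have "(\<lambda>u. Re (ip (H u) (w j u) (w j u))) \<in> borel_measurable M"
  using measurable_compose[OF ip_comb_measurable[OF bsec_w[of j], of "from_nat j"] borel_measurable_Re] by (simp add: w_def)
 moreover have "(nrm (H u) (w j u))\<^sup>2 = Re (ip (H u) (w j u) (w j u))" if u: "u \<in> space M" for u
 proof -
  interpret hilbert_space "H u" using hilbert u .
  show ?thesis using nrm_sq bsec_in[OF bsec_w u] by simp
 qed
 ultimately show ?thesis by (simp cong: measurable_cong)
qed

text \<open>Since \<open>2 Re (v, x) - |x|\<^sup>2 = |v|\<^sup>2 - |v - x|\<^sup>2\<close>, the squared norm of \<open>v\<close> is the supremum of the
 left hand side over a dense sequence of vectors \<open>x\<close>.\<close>

lemma nrm_measurable:
 assumes h: "bsec h"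
 shows "(\<lambda>u. nrm (H u) (h u)) \<in> borel_measurable M"
proof (rule nrm_measurable_of_sq[OF h])
 let ?g = "\<lambda>j u. 2 * Re (ip (H u) (h u) (w j u)) - (nrm (H u) (w j u))\<^sup>2"
 have gm: "?g j \<in> borel_measurable M" for j
  using measurable_compose[OF ip_comb_measurable[OF h, of "from_nat j"] borel_measurable_Re] nrm_w_measurable[of j]
  by (auto simp: w_def intro!: borel_measurable_diff borel_measurable_times)
 have eq: "a < (nrm (H u) (h u))\<^sup>2 \<longleftrightarrow> (\<exists>j. a < ?g j u)" if u: "u \<in> space M" for a u
 proof -
  interpret hilbert_space "H u" using hilbert u .
  have hu: "h u \<in> carr (H u)" and wu: "w j u \<in> carr (H u)" for j
   using bsec_in[OF h u] bsec_in[OF bsec_w u] by auto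
  have g: "?g j u = (nrm (H u) (h u))\<^sup>2 - (nrm (H u) (vdiff (H u) (h u) (w j u)))\<^sup>2" for j
   using nrm_sq_diff[OF hu wu, of j] by simp
  show ?thesis
  proof
   assume a: "a < (nrm (H u) (h u))\<^sup>2"
   define \<epsilon> where "\<epsilon> = sqrt ((nrm (H u) (h u))\<^sup>2 - a)"
   have "0 < \<epsilon>" using a by (simp add: \<epsilon>_def)
   then obtain j where j: "nrm (H u) (vdiff (H u) (h u) (w j u)) < \<epsilon>" using w_dense[OF u hu] by blast
   have "(nrm (H u) (vdiff (H u) (h u) (w j u)))\<^sup>2 < \<epsilon>\<^sup>2"
    using j nrm_nonneg[OF diff_in[OF hu wu]] by (intro power_strict_mono) auto
   also have "\<epsilon>\<^sup>2 = (nrm (H u) (h u))\<^sup>2 - a" using a by (simp add: \<epsilon>_def)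
   finally show "\<exists>j. a < ?g j u" unfolding g by (intro exI[of _ j]) linarith
  next
   assume "\<exists>j. a < ?g j u"
   then show "a < (nrm (H u) (h u))\<^sup>2" unfolding g by (auto intro: less_le_trans)
  qed
 qed
 show "(\<lambda>u. (nrm (H u) (h u))\<^sup>2) \<in> borel_measurable M"
  unfolding borel_measurable_iff_greater
 proof
  fix a
  have "{u \<in> space M. a < (nrm (H u) (h u))\<^sup>2} = (\<Union>j. {u \<in> space M. a < ?g j u})" using eq by blast
  also have "\<dots> \<in> sets M" using gm by (intro sets.countable_UN'') (auto simp: borel_measurable_iff_greater)
  finally show "{u \<in> space M. a < (nrm (H u) (h u))\<^sup>2} \<in> sets M" .
 qed
qed

text \<open>Polarization: the four combinations of \<open>h\<close> and \<open>k\<close> are Borel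
  sections, whose norms are measurable.\<close>

lemma ip_measurable:
 assumes h: "bsec h" and k: "bsec k"
 shows "(\<lambda>u. ip (H u) (h u) (k u)) \<in> borel_measurable M"
proof -
 let ?n = "\<lambda>c u. (nrm (H u) (vadd (H u) (h u) (vscale (H u) c (k u))))\<^sup>2"
 have m: "?n c \<in> borel_measurable M" for c
  using nrm_measurable[OF bsec_add[OF h bsec_scale[OF k, of "\<lambda>_. c"]]] by simp
 have "ip (H u) (h u) (k u) = Complex ((?n 1 u - ?n (-1) u) / 4) ((?n \<i> u - ?n (-\<i>) u) / 4)" if u: "u \<in> space M" for u
 proof -
  interpret hilbert_space "H u" using hilbert u .
  have hk: "h u \<in> carr (H u)" "k u \<in> carr (H u)" using bsec_in[OF h u] bsec_in[OF k u] by auto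
  show ?thesis using hk
   by (simp add: complex_eq_iff nrm_sq_add closed nrm_scale inner_simps)
 qed
 moreover have "(\<lambda>u. Complex ((?n 1 u - ?n (-1) u) / 4) ((?n \<i> u - ?n (-\<i>) u) / 4)) \<in> borel_measurable M"
  unfolding Complex_eq using m by measurable
 ultimately show ?thesis by (simp cong: measurable_cong)
qed

text \<open>Taking the least admissible index makes the choice measurable, so the approximant
  \<open>w (idx h n u) u\<close> is some fixed \<open>w j\<close> on each of countably many
  measurable pieces.\<close>

definition idx :: "('x \<Rightarrow> 'h) \<Rightarrow> nat \<Rightarrow> 'x \<Rightarrow> nat" where
 "idx h n u = (LEAST j. nrm (H u) (vdiff (H u) (h u) (w j u)) < 1 / Suc n)"

lemma idx_measurable: "bsec h \<Longrightarrow> idx h n \<in> measurable M (count_space UNIV)"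
 unfolding idx_def
 using nrm_measurable[OF bsec_diff[OF _ bsec_w]] by measurable

lemma idx_tends:
 assumes h: "bsec h" and u: "u \<in> space M"
 shows "tends (H u) (\<lambda>n. w (idx h n u) u) (h u)"
proof -
 interpret hilbert_space "H u" using hilbert u .
 have hw: "h u \<in> carr (H u)" "w j u \<in> carr (H u)" for j using bsec_in[OF h u] bsec_in[OF bsec_w u] by auto
 have "nrm (H u) (vdiff (H u) (h u) (w (idx h n u) u)) < 1 / Suc n" for n
  unfolding idx_def by (rule LeastI_ex[OF w_dense[OF u hw(1)]]) simp
 then have "nrm (H u) (vdiff (H u) (w (idx h n u) u) (h u)) \<le> 1 / Suc n" for n
  using nrm_diff_commute[OF hw] by (simp add: less_imp_le)
 then show ?thesis unfolding tends_def
  by (intro tendsto_sandwich[OF _ _ tendsto_const LIMSEQ_Suc[OF lim_1_over_n]])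
    (auto intro!: always_eventually nrm_nonneg closed hw)
qed

end

section \<open>Square integrable sections and their completeness\<close>

lemma (in semi_inner_space) cauchy_geometric:
 assumes y: "\<And>n. y n \<in> carr V" and le: "\<And>n. nrm V (vdiff V (y (Suc n)) (y n)) \<le> C * (1/2)^n"
 shows "cauchy_in V y"
proof -
 have C: "0 \<le> C" using order_trans[OF nrm_nonneg[OF diff_in[OF y y]] le[of 0]] by simp
 \<comment> \<open>The last factor is the geometric sum \<open>1 + 1/2 + ... + (1/2)^(p-1)\<close>
   in closed form, so the induction loses nothing.\<close>
 have p: "nrm V (vdiff V (y (n + p)) (y n)) \<le> C * (1/2)^n * (2 - 2 * (1/2)^p)" for n p
 proof (induction p)
  case 0 show ?case using y by (simp add: nrm_diff_self)
 next
  case (Suc p)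
  have "nrm V (vdiff V (y (n + Suc p)) (y n)) \<le> nrm V (vdiff V (y (Suc (n + p))) (y (n + p))) + nrm V (vdiff V (y (n + p)) (y n))"
   using nrm_diff_triangle[OF y y y] by simp
  also have "\<dots> \<le> C * (1/2)^(n+p) + C * (1/2)^n * (2 - 2 * (1/2)^p)" by (intro add_mono le Suc)
  also have "\<dots> = C * (1/2)^n * (2 - 2 * (1/2)^(Suc p))" by (simp add: power_add algebra_simps)
  finally show ?case .
 qed
 have p': "nrm V (vdiff V (y m) (y n)) \<le> 2 * C * (1/2)^n" if "n \<le> m" for m n
 proof -
  have "nrm V (vdiff V (y m) (y n)) \<le> C * (1/2)^n * (2 - 2 * (1/2)^(m - n))" using p[of n "m - n"] that by simp
  also have "\<dots> \<le> C * (1/2)^n * 2" using C by (intro mult_left_mono) auto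
  finally show ?thesis by simp
 qed
 show ?thesis
  unfolding cauchy_in_def
 proof (intro conjI allI impI y)
  fix \<epsilon> :: real assume "\<epsilon> > 0"
  have "(\<lambda>n. 2 * C * (1/2)^n) \<longlonglongrightarrow> 2 * C * 0" by (intro tendsto_intros LIMSEQ_power_zero) auto
  then have "\<forall>\<^sub>F n in sequentially. 2 * C * (1/2)^n < \<epsilon>" using \<open>\<epsilon> > 0\<close> by (intro order_tendstoD(2)[of _ 0]) auto
  then obtain N where N: "\<And>n. n \<ge> N \<Longrightarrow> 2 * C * (1/2)^n < \<epsilon>" by (auto simp: eventually_sequentially)
  have "nrm V (vdiff V (y m) (y n)) < \<epsilon>" if "m \<ge> N" "n \<ge> N" for m n
  proof (cases "n \<le> m")
   case True then show ?thesis using p'[of n m] N[of n] that by simp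
  next
   case False
   then show ?thesis using p'[of m n] N[of m] that nrm_diff_commute[OF y y, of m n] by simp
  qed
  then show "\<exists>N. \<forall>m\<ge>N. \<forall>n\<ge>N. nrm V (vdiff V (y m) (y n)) < \<epsilon>" by blast
 qed
qed

context section_space
begin

text \<open>Square integrability without the extensionality that \<open>sq_sections\<close> demands;
  sections given by pointwise formulas can be used directly and restricted when they enter the
  space.\<close>

definition l2 :: "('x \<Rightarrow> 'h) \<Rightarrow> bool" where
 "l2 h \<longleftrightarrow> bsec h \<and> sqn M H h < \<infinity>"

lemma l2_cong: "(\<And>u. u \<in> space M \<Longrightarrow> h u = k u) \<Longrightarrow> l2 h \<longleftrightarrow> l2 k"
 unfolding l2_def using bsec_cong[of h k] by (simp cong: nn_integral_cong)

lemma l2_restrict: "l2 (restrict h (space M)) \<longleftrightarrow> l2 h"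
 by (rule l2_cong) simp

lemma nrm_sq_measurable: "bsec h \<Longrightarrow> (\<lambda>u. ennreal ((nrm (H u) (h u))\<^sup>2)) \<in> borel_measurable M"
 using nrm_measurable by measurable

lemma l2_bound:
 assumes "bsec h" "l2 k" "l2 l"
  and le: "\<And>u. u \<in> space M \<Longrightarrow> (nrm (H u) (h u))\<^sup>2 \<le> A * (nrm (H u) (k u))\<^sup>2 + B * (nrm (H u) (l u))\<^sup>2" and AB: "0 \<le> A" "0 \<le> B"
 shows "l2 h"
proof -
 have "sqn M H h
  \<le> (NN u. ennreal A * ennreal ((nrm (H u) (k u))\<^sup>2) + ennreal B * ennreal ((nrm (H u) (l u))\<^sup>2) d/M)"
  using le AB by (intro nn_integral_mono) (simp flip: ennreal_mult ennreal_plus add: ennreal_leI)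
 also have "\<dots> = ennreal A * sqn M H k + ennreal B * sqn M H l"
  using assms nrm_sq_measurable[of k] nrm_sq_measurable[of l] by (simp add: nn_integral_add nn_integral_cmult l2_def)
 also have "\<dots> < \<infinity>" using assms(2,3) by (simp add: l2_def ennreal_mult_less_top)
 finally show ?thesis using assms(1) by (simp add: l2_def)
qed

lemma l2_zero: "l2 (\<lambda>u. vzero (H u))"
proof -
 have "nrm (H u) (vzero (H u)) = 0" if u: "u \<in> space M" for u
 proof -
  interpret hilbert_space "H u" using hilbert u .
  show ?thesis by (rule nrm_zero)
 qed
 then show ?thesis using bsec_zero by (simp add: l2_def cong: nn_integral_cong)
qed

lemma l2_add:
 assumes h: "l2 h" and k: "l2 k"
 shows "l2 (\<lambda>u. vadd (H u) (h u) (k u))"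
proof (rule l2_bound[OF _ h k])
 show "bsec (\<lambda>u. vadd (H u) (h u) (k u))" using h k by (auto simp: l2_def intro: bsec_add)
 fix u assume u: "u \<in> space M"
 interpret hilbert_space "H u" using hilbert u .
 have hk: "h u \<in> carr (H u)" "k u \<in> carr (H u)" using h k u by (auto simp: l2_def bsec_def)
 have "(nrm (H u) (vadd (H u) (h u) (k u)))\<^sup>2 \<le> (nrm (H u) (h u) + nrm (H u) (k u))\<^sup>2"
  using nrm_triangle[OF hk] nrm_nonneg[OF add_in[OF hk]] by (intro power_mono)
 also have "\<dots> \<le> 2 * (nrm (H u) (h u))\<^sup>2 + 2 * (nrm (H u) (k u))\<^sup>2"
  using sum_squares_bound[of "nrm (H u) (h u)" "nrm (H u) (k u)"] by (simp add: power2_sum)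
 finally show "(nrm (H u) (vadd (H u) (h u) (k u)))\<^sup>2 \<le> 2 * (nrm (H u) (h u))\<^sup>2 + 2 * (nrm (H u) (k u))\<^sup>2" .
qed auto

lemma l2_scale:
 assumes h: "l2 h"
 shows "l2 (\<lambda>u. vscale (H u) c (h u))"
proof (rule l2_bound[OF _ h h])
 show "bsec (\<lambda>u. vscale (H u) c (h u))" using h by (auto simp: l2_def intro: bsec_scale)
 fix u assume u: "u \<in> space M"
 interpret hilbert_space "H u" using hilbert u .
 have h: "h u \<in> carr (H u)" using h u by (auto simp: l2_def bsec_def)
 show "(nrm (H u) (vscale (H u) c (h u)))\<^sup>2 \<le> (cmod c)\<^sup>2 * (nrm (H u) (h u))\<^sup>2 + 0 * (nrm (H u) (h u))\<^sup>2"
  using h by (simp add: nrm_scale power_mult_distrib)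
qed auto

lemma integrable_nrm_sq: "l2 h \<Longrightarrow> integrable M (\<lambda>u. (nrm (H u) (h u))\<^sup>2)"
 using nrm_measurable[of h] by (intro integrableI_nonneg) (auto simp: l2_def)

lemma integrable_ip:
 assumes h: "l2 h" and k: "l2 k"
 shows "integrable M (\<lambda>u. ip (H u) (h u) (k u))"
proof (rule Bochner_Integration.integrable_bound)
 show "integrable M (\<lambda>u. (nrm (H u) (h u))\<^sup>2 + (nrm (H u) (k u))\<^sup>2)"
  using integrable_nrm_sq[OF h] integrable_nrm_sq[OF k] by simp
 show "(\<lambda>u. ip (H u) (h u) (k u)) \<in> borel_measurable M" using h k by (auto simp: l2_def intro: ip_measurable)
 show "AE u in M. norm (ip (H u) (h u) (k u)) \<le> norm ((nrm (H u) (h u))\<^sup>2 + (nrm (H u) (k u))\<^sup>2)"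
 proof (rule AE_I2)
  fix u assume u: "u \<in> space M"
  interpret hilbert_space "H u" using hilbert u .
  have hk: "h u \<in> carr (H u)" "k u \<in> carr (H u)" using h k u by (auto simp: l2_def bsec_def)
  have "norm (ip (H u) (h u) (k u)) \<le> nrm (H u) (h u) * nrm (H u) (k u)" by (rule Cauchy_Schwarz[OF hk])
  also have "\<dots> \<le> 2 * nrm (H u) (h u) * nrm (H u) (k u)"
   using nrm_nonneg[OF hk(1)] nrm_nonneg[OF hk(2)] by simp
  also have "\<dots> \<le> (nrm (H u) (h u))\<^sup>2 + (nrm (H u) (k u))\<^sup>2" by (rule sum_squares_bound)
  finally show "norm (ip (H u) (h u) (k u)) \<le> norm ((nrm (H u) (h u))\<^sup>2 + (nrm (H u) (k u))\<^sup>2)" by simp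
 qed
qed

end

text \<open>The Borel structure \<open>B\<close> enters only through its sections; the base bundle
  and its pullback are then handled by the same results.\<close>

locale section_bundle = section_space M H e for M :: "'x measure" and H :: "'x \<Rightarrow> 'h ips" and e +
 fixes B :: "('x \<times> 'h) measure"
 assumes borel_section: "borel_section M B h \<longleftrightarrow> bsec h"
begin

abbreviation S :: "('x \<Rightarrow> 'h) ips" where "S \<equiv> sq_sections M H B"

lemma carr_S: "h \<in> carr S \<longleftrightarrow> h \<in> extensional (space M) \<and> l2 h"
 by (simp add: sq_sections_def l2_def borel_section)

lemma S_simps:
 "vadd S h k = (\<lambda>u\<in>space M. vadd (H u) (h u) (k u))"
 "vscale S c h = (\<lambda>u\<in>space M. vscale (H u) c (h u))"
 "vzero S = (\<lambda>u\<in>space M. vzero (H u))"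
 "ip S h k = (LINT u|M. ip (H u) (h u) (k u))"
 by (simp_all add: sq_sections_def)

lemma S_in: "h \<in> carr S \<Longrightarrow> u \<in> space M \<Longrightarrow> h u \<in> carr (H u)"
 by (simp add: carr_S l2_def bsec_def)

lemma S_diff: "vdiff S h k = (\<lambda>u\<in>space M. vdiff (H u) (h u) (k u))"
 by (auto simp: vdiff_def S_simps)

lemma S_eqI: "h \<in> extensional (space M) \<Longrightarrow> k \<in> extensional (space M) \<Longrightarrow> (\<And>u. u \<in> space M \<Longrightarrow> h u = k u) \<Longrightarrow> h = k"
 by (rule extensionalityI)

lemma cv: "u \<in> space M \<Longrightarrow> cvector_space (H u)"
 using hilbert by (simp add: hilbert_space.axioms)

lemma semi: "u \<in> space M \<Longrightarrow> semi_inner_space (H u)"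
proof -
 assume u: "u \<in> space M"
 interpret hilbert_space "H u" using hilbert u .
 show ?thesis by (rule semi_inner_space_axioms)
qed

lemma semi_inner_S: "semi_inner_space S"
proof (unfold_locales, goal_cases)
 case 1 show ?case by (simp add: carr_S S_simps l2_restrict l2_zero)
next
 case 2 then show ?case by (simp add: carr_S S_simps l2_restrict l2_add)
next
 case 3 then show ?case by (simp add: carr_S S_simps l2_restrict l2_scale)
next
 case (4 x y z) then show ?case
  by (intro S_eqI) (auto simp: S_simps S_in cvector_space.add_assoc[OF cv])
next
 case (5 x y) then show ?case
  by (intro S_eqI) (auto simp: S_simps S_in intro: cvector_space.add_commute[OF cv])
next
 case (6 x) then show ?case
  by (intro S_eqI) (auto simp: S_simps S_in carr_S cvector_space.add_zero[OF cv])
next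
 case (7 x) then show ?case
  by (intro S_eqI) (auto simp: S_simps S_in cvector_space.add_neg[OF cv])
next
 case (8 x y c) then show ?case
  by (intro S_eqI) (auto simp: S_simps S_in cvector_space.scale_add[OF cv])
next
 case (9 x b c) then show ?case
  by (intro S_eqI) (auto simp: S_simps S_in cvector_space.add_scale[OF cv])
next
 case (10 x b c) then show ?case
  by (intro S_eqI) (auto simp: S_simps S_in cvector_space.scale_scale[OF cv])
next
 case (11 x) then show ?case
  by (intro S_eqI) (auto simp: S_simps S_in carr_S cvector_space.scale_one[OF cv])
next
 case (12 x y z)
 have "(LINT u|M. ip (H u) (vadd (H u) (x u) (y u)) (z u)) = (LINT u|M. ip (H u) (x u) (z u) + ip (H u) (y u) (z u))"
  using 12 by (intro Bochner_Integration.integral_cong refl) (simp add: hilbert_space.ip_add[OF hilbert] S_in)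
 then show ?case using 12 integrable_ip[of x z] integrable_ip[of y z]
  by (simp add: S_simps carr_S cong: Bochner_Integration.integral_cong)
next
 case (13 x y c)
 have "(LINT u|M. ip (H u) (vscale (H u) c (x u)) (y u)) = (LINT u|M. c * ip (H u) (x u) (y u))"
  using 13 by (intro Bochner_Integration.integral_cong refl) (simp add: hilbert_space.ip_scale[OF hilbert] S_in)
 then show ?case
  by (simp add: S_simps cong: Bochner_Integration.integral_cong)
next
 case (14 x y)
 have "(LINT u|M. ip (H u) (y u) (x u)) = (LINT u|M. cnj (ip (H u) (x u) (y u)))"
  using 14 by (intro Bochner_Integration.integral_cong refl) (rule hilbert_space.ip_cnj[OF hilbert]; simp add: S_in)
 then show ?case by (simp add: S_simps)
next
 case (15 x)
 have "0 \<le> (LINT u|M. Re (ip (H u) (x u) (x u)))"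
  using 15 by (intro Bochner_Integration.integral_nonneg_AE AE_I2) (simp add: hilbert_space.ip_nonneg[OF hilbert] S_in)
 then show ?case using 15 integrable_ip[of x x] by (simp add: S_simps carr_S)
qed

sublocale S: semi_inner_space S by (rule semi_inner_S)

lemma nrm_S:
 assumes h: "h \<in> carr S"
 shows "ennreal ((nrm S h)\<^sup>2) = sqn M H h"
proof -
 have l: "l2 h" using h by (simp add: carr_S)
 have "(nrm S h)\<^sup>2 = Re (LINT u|M. ip (H u) (h u) (h u))" using S.nrm_sq[OF h] by (simp add: S_simps)
 also have "\<dots> = (LINT u|M. Re (ip (H u) (h u) (h u)))" using integrable_ip[OF l l] by simp
 also have "\<dots> = (LINT u|M. (nrm (H u) (h u))\<^sup>2)"
  using h by (intro Bochner_Integration.integral_cong refl) (simp add: semi_inner_space.nrm_sq[OF semi] S_in)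
 finally show ?thesis using nn_integral_eq_integral[OF integrable_nrm_sq[OF l]] by simp
qed

lemma nrm_S_eq_0:
 assumes h: "h \<in> carr S"
 shows "nrm S h = 0 \<longleftrightarrow> (AE u in M. nrm (H u) (h u) = 0)"
proof -
 have "nrm S h = 0 \<longleftrightarrow> ennreal ((nrm S h)\<^sup>2) = 0" by simp
 also have "\<dots> \<longleftrightarrow> (AE u in M. ennreal ((nrm (H u) (h u))\<^sup>2) = 0)"
  unfolding nrm_S[OF h] using h by (intro nn_integral_0_iff_AE nrm_sq_measurable) (simp add: carr_S l2_def)
 finally show ?thesis by simp
qed

text \<open>The Riesz-Fischer argument in a bundle: a fast subsequence converges in almost every
  fibre, the limit is Borel because its coefficients are limits of coefficients, and Fatou's lemma
  gives convergence in the seminorm.\<close>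

lemma S_complete:
 assumes X: "cauchy_in S X"
 shows "\<exists>h\<in>carr S. tends S X h"
proof -
 have XS: "X n \<in> carr S" for n using X by (simp add: cauchy_in_def)
 have Xl: "l2 (X n)" for n using XS by (simp add: carr_S)
 have XH: "X n u \<in> carr (H u)" if "u \<in> space M" for n u by (rule S_in[OF XS that])
 have "\<exists>N. \<forall>m\<ge>N. \<forall>n\<ge>N. nrm S (vdiff S (X m) (X n)) < (1/4)^k" for k :: nat
  using X by (simp add: cauchy_in_def)
 then obtain r where r: "\<And>k m n. m \<ge> r k \<Longrightarrow> n \<ge> r k \<Longrightarrow> nrm S (vdiff S (X m) (X n)) < (1/4)^k" by metis
 \<comment> \<open>Summing the thresholds puts \<open>R k\<close> above all of
   \<open>r 0, ..., r k\<close>, without arranging a monotone choice of \<open>r\<close>.\<close>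
 define R where "R k = (\<Sum>i\<le>k. r i)" for k
 have rR: "r i \<le> R k" if "i \<le> k" for i k unfolding R_def using that by (intro member_le_sum) auto
 define f where "f k = X (R k)" for k
 have fS: "f k \<in> carr S" and fl: "l2 (f k)" and fH: "u \<in> space M \<Longrightarrow> f k u \<in> carr (H u)" for k u
  by (auto simp: f_def XS Xl XH)
 define D where "D k u = nrm (H u) (vdiff (H u) (f (Suc k) u) (f k u))" for k u
 have dist: "(NN u. ennreal ((nrm (H u) (vdiff (H u) (X m u) (X n u)))\<^sup>2) d/M) = ennreal ((nrm S (vdiff S (X m) (X n)))\<^sup>2)" for m n
  using nrm_S[OF S.diff_in[OF XS XS]] by (simp add: S_diff cong: nn_integral_cong)
 have dist_le: "(NN u. ennreal ((nrm (H u) (vdiff (H u) (X m u) (X n u)))\<^sup>2) d/M) \<le> ennreal ((1/16)^k)"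
  if "m \<ge> r k" "n \<ge> r k" for m n k
 proof -
  have "(nrm S (vdiff S (X m) (X n)))\<^sup>2 \<le> ((1/4)^k)\<^sup>2"
   using r[OF that] S.nrm_nonneg[OF S.diff_in[OF XS XS]] by (intro power_mono) auto
  also have "\<dots> = (1/16)^k" by (simp add: power2_eq_square flip: power_mult_distrib)
  finally show ?thesis unfolding dist by (rule ennreal_leI)
 qed
 have Dm: "D k \<in> borel_measurable M" for k
  unfolding D_def using fl by (intro nrm_measurable bsec_diff) (auto simp: l2_def)
 have Dint: "(NN u. ennreal ((D k u)\<^sup>2) d/M) \<le> ennreal ((1/16)^k)" for k
  unfolding D_def f_def by (intro dist_le rR) auto
 \<comment> \<open>The weight leaves the summable bound \<open>4^k / 16^k\<close>, while finiteness
   of \<open>G u\<close> forces \<open>D k u\<close> to decay like \<open>2^{-k}\<close>.\<close>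
 define G where "G u = (\<Sum>k. ennreal (4^k * (D k u)\<^sup>2))" for u
 have Gm: "G \<in> borel_measurable M" unfolding G_def using Dm by measurable
 have "(NN u. G u d/M) = (\<Sum>k. NN u. ennreal (4^k * (D k u)\<^sup>2) d/M)"
  unfolding G_def using Dm by (intro nn_integral_suminf) measurable
 also have "\<dots> \<le> (\<Sum>k. ennreal ((1/4)^k))"
 proof (rule suminf_le)
  fix k
  have "(NN u. ennreal (4^k * (D k u)\<^sup>2) d/M) = ennreal (4^k) * (NN u. ennreal ((D k u)\<^sup>2) d/M)"
   using Dm by (simp add: ennreal_mult nn_integral_cmult)
  also have "\<dots> \<le> ennreal (4^k) * ennreal ((1/16)^k)" by (intro mult_left_mono Dint) auto
  also have "\<dots> = ennreal ((1/4)^k)" by (simp flip: ennreal_mult power_mult_distrib)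
  finally show "(NN u. ennreal (4^k * (D k u)\<^sup>2) d/M) \<le> ennreal ((1/4)^k)" .
 qed auto
 also have "\<dots> = ennreal (\<Sum>k. (1/4)^k)" by (intro suminf_ennreal2 summable_geometric) auto
 also have "\<dots> < \<infinity>" by simp
 finally have "AE u in M. G u \<noteq> \<infinity>" by (intro nn_integral_noteq_infinite Gm) auto
 have lim_ex: "\<exists>v\<in>carr (H u). tends (H u) (\<lambda>k. f k u) v" if u: "u \<in> space M" and G: "G u \<noteq> \<infinity>" for u
 proof -
  interpret hilbert_space "H u" using hilbert u .
  obtain C where C: "G u = ennreal C" "0 \<le> C" using G by (cases "G u") auto
  have "D k u \<le> sqrt C * (1/2)^k" for k
  proof -
   have "ennreal (4^k * (D k u)\<^sup>2) \<le> G u"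
   proof -
    have "(\<Sum>j\<in>{k}. ennreal (4^j * (D j u)\<^sup>2)) \<le> G u"
     unfolding G_def by (rule sum_le_suminf) auto
    then show ?thesis by simp
   qed
   then have "4^k * (D k u)\<^sup>2 \<le> C" using C by simp
   moreover have "(2::real)^k * 2^k = 4^k" by (simp flip: power_mult_distrib)
   moreover have "(2^k * D k u)\<^sup>2 = (2^k * 2^k) * (D k u)\<^sup>2" by (simp add: power2_eq_square)
   ultimately have "(2^k * D k u)\<^sup>2 \<le> C" by simp
   then have "2^k * D k u \<le> sqrt C" by (rule real_le_rsqrt)
   then show ?thesis by (simp add: power_one_over field_simps)
  qed
  then have "cauchy_in (H u) (\<lambda>k. f k u)"
   using fH[OF u] by (intro cauchy_geometric[of _ "sqrt C"]) (auto simp: D_def)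
  then show ?thesis by (rule complete_tends)
 qed
 \<comment> \<open>On the null set where \<open>G\<close> is infinite the section is set to zero;
   since \<open>G\<close> is measurable, this keeps it Borel.\<close>
 define h where "h = (\<lambda>u\<in>space M. if G u \<noteq> \<infinity> then (SOME v. v \<in> carr (H u) \<and> tends (H u) (\<lambda>k. f k u) v) else vzero (H u))"
 have hG: "h u \<in> carr (H u) \<and> tends (H u) (\<lambda>k. f k u) (h u)" if u: "u \<in> space M" "G u \<noteq> \<infinity>" for u
  using someI_ex[of "\<lambda>v. v \<in> carr (H u) \<and> tends (H u) (\<lambda>k. f k u) v"] lim_ex[OF u] u by (auto simp: h_def)
 have hH: "h u \<in> carr (H u)" if u: "u \<in> space M" for u
  using hG[OF u] u by (cases "G u = \<infinity>") (auto simp: h_def cvector_space.zero_in[OF cv])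
 have hb: "bsec h"
  unfolding bsec_def
 proof (intro conjI ballI allI)
  fix n
  show "(\<lambda>u. ip (H u) (h u) (e n u)) \<in> borel_measurable M"
  proof (rule borel_measurable_LIMSEQ_metric[where f="\<lambda>k u. if G u \<noteq> \<infinity> then ip (H u) (f k u) (e n u) else 0"])
   show "(\<lambda>u. if G u \<noteq> \<infinity> then ip (H u) (f k u) (e n u) else 0) \<in> borel_measurable M" for k
    using fl[of k] Gm by (intro measurable_If) (auto simp: l2_def bsec_def)
   fix u assume u: "u \<in> space M"
   interpret hilbert_space "H u" using hilbert u .
   show "(\<lambda>k. if G u \<noteq> \<infinity> then ip (H u) (f k u) (e n u) else 0) \<longlonglongrightarrow> ip (H u) (h u) (e n u)"
   proof (cases "G u = \<infinity>")
    case True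
    then show ?thesis using u e_in[OF u] by (simp add: h_def inner_zero)
   next
    case False
    then show ?thesis using hG[OF u False] fH[OF u] e_in[OF u] tends_const[OF e_in[OF u]]
     by (simp add: inner_tendsto)
   qed
  qed
 qed (rule hH)
 have lim_le: "(NN u. ennreal ((nrm (H u) (vdiff (H u) (X n u) (h u)))\<^sup>2) d/M) \<le> ennreal ((1/16)^j)" if n: "n \<ge> r j" for n j
 proof -
  let ?a = "\<lambda>k u. ennreal ((nrm (H u) (vdiff (H u) (X n u) (f k u)))\<^sup>2)"
  have am: "?a k \<in> borel_measurable M" for k
   using Xl fl by (intro nrm_sq_measurable bsec_diff) (auto simp: l2_def)
  have "(NN u. ennreal ((nrm (H u) (vdiff (H u) (X n u) (h u)))\<^sup>2) d/M) = (NN u. liminf (\<lambda>k. ?a k u) d/M)"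
  proof (rule nn_integral_cong_AE, rule AE_mp[OF \<open>AE u in M. G u \<noteq> \<infinity>\<close>], rule AE_I2, rule impI)
   fix u assume u: "u \<in> space M" and G: "G u \<noteq> \<infinity>"
   interpret hilbert_space "H u" using hilbert u .
   have "tends (H u) (\<lambda>k. vdiff (H u) (X n u) (f k u)) (vdiff (H u) (X n u) (h u))"
   proof -
    have "nrm (H u) (vdiff (H u) (vdiff (H u) (X n u) (f k u)) (vdiff (H u) (X n u) (h u))) = nrm (H u) (vdiff (H u) (f k u) (h u))" for k
     using XH[OF u] fH[OF u] hH[OF u] by (intro nrm_cong) (simp add: closed inner_simps)
    then show ?thesis using hG[OF u G] by (simp add: tends_def)
   qed
   then have "(\<lambda>k. ip (H u) (vdiff (H u) (X n u) (f k u)) (vdiff (H u) (X n u) (f k u)))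
    \<longlonglongrightarrow> ip (H u) (vdiff (H u) (X n u) (h u)) (vdiff (H u) (X n u) (h u))"
    using XH[OF u] fH[OF u] hH[OF u] by (intro inner_tendsto) (auto simp: closed)
   then have "(\<lambda>k. (nrm (H u) (vdiff (H u) (X n u) (f k u)))\<^sup>2) \<longlonglongrightarrow> (nrm (H u) (vdiff (H u) (X n u) (h u)))\<^sup>2"
    using XH[OF u] fH[OF u] hH[OF u] tendsto_Re by (simp add: nrm_sq closed) blast
   then have "(\<lambda>k. ?a k u) \<longlonglongrightarrow> ennreal ((nrm (H u) (vdiff (H u) (X n u) (h u)))\<^sup>2)" by (rule tendsto_ennrealI)
   then show "ennreal ((nrm (H u) (vdiff (H u) (X n u) (h u)))\<^sup>2) = liminf (\<lambda>k. ?a k u)"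
    by (rule lim_imp_Liminf[OF trivial_limit_sequentially, symmetric])
  qed
  also have "\<dots> \<le> liminf (\<lambda>k. NN u. ?a k u d/M)" by (rule nn_integral_liminf[OF am])
  also have "\<dots> \<le> ennreal ((1/16)^j)"
  proof (rule Liminf_le)
   show "\<forall>\<^sub>F k in sequentially. (NN u. ?a k u d/M) \<le> ennreal ((1/16)^j)"
    using n rR unfolding f_def by (intro eventually_sequentiallyI[of j] dist_le) auto
  qed simp
  finally show ?thesis .
 qed
 have hl: "l2 h"
 proof (rule l2_bound[OF hb Xl[of "r 0"]])
  show "l2 (\<lambda>u. vdiff (H u) (X (r 0) u) (h u))"
  proof -
   have "bsec (\<lambda>u. vdiff (H u) (X (r 0) u) (h u))" using hb Xl[of "r 0"] by (intro bsec_diff) (simp_all add: l2_def)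
   then show ?thesis unfolding l2_def using le_less_trans[OF lim_le[OF order_refl, of 0]] by simp
  qed
  fix u assume u: "u \<in> space M"
  interpret hilbert_space "H u" using hilbert u .
  have "nrm (H u) (h u) \<le> nrm (H u) (X (r 0) u) + nrm (H u) (vdiff (H u) (X (r 0) u) (h u))"
   using nrm_le_diff[OF hH[OF u] XH[OF u]] nrm_diff_commute[OF hH[OF u] XH[OF u]] by simp
  then have "(nrm (H u) (h u))\<^sup>2 \<le> (nrm (H u) (X (r 0) u) + nrm (H u) (vdiff (H u) (X (r 0) u) (h u)))\<^sup>2"
   using nrm_nonneg[OF hH[OF u]] by (intro power_mono)
  also have "\<dots> \<le> 2 * (nrm (H u) (X (r 0) u))\<^sup>2 + 2 * (nrm (H u) (vdiff (H u) (X (r 0) u) (h u)))\<^sup>2"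
   using sum_squares_bound[of "nrm (H u) (X (r 0) u)" "nrm (H u) (vdiff (H u) (X (r 0) u) (h u))"] by (simp add: power2_sum)
  finally show "(nrm (H u) (h u))\<^sup>2 \<le> 2 * (nrm (H u) (X (r 0) u))\<^sup>2 + 2 * (nrm (H u) (vdiff (H u) (X (r 0) u) (h u)))\<^sup>2" .
 qed auto
 have hS: "h \<in> carr S" using hl by (simp add: carr_S h_def)
 have "nrm S (vdiff S (X n) h) \<le> (1/4)^j" if n: "n \<ge> r j" for n j
 proof -
  have "ennreal ((nrm S (vdiff S (X n) h))\<^sup>2) = (NN u. ennreal ((nrm (H u) (vdiff (H u) (X n u) (h u)))\<^sup>2) d/M)"
   using nrm_S[OF S.diff_in[OF XS hS]] by (simp add: S_diff cong: nn_integral_cong)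
  also have "\<dots> \<le> ennreal ((1/16)^j)" by (rule lim_le[OF n])
  finally have "(nrm S (vdiff S (X n) h))\<^sup>2 \<le> (1/16)^j" by simp
  also have "(1/16::real)^j = ((1/4)^j)\<^sup>2" by (simp add: power2_eq_square flip: power_mult_distrib)
  finally show ?thesis by (rule power2_le_imp_le) simp
 qed
 then have b: "\<exists>N. \<forall>n\<ge>N. nrm S (vdiff S (X n) h) \<le> (1/4)^j" for j by blast
 have "tends S X h"
  unfolding tends_def
 proof (rule LIMSEQ_I)
  fix \<epsilon> :: real assume "0 < \<epsilon>"
  then obtain j where j: "(1/4::real)^j < \<epsilon>" using real_arch_pow_inv[of \<epsilon> "1/4"] by auto
  obtain N where N: "\<forall>n\<ge>N. nrm S (vdiff S (X n) h) \<le> (1/4)^j" using b by blast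
  show "\<exists>N. \<forall>n\<ge>N. norm (nrm S (vdiff S (X n) h) - 0) < \<epsilon>"
   using N j S.nrm_nonneg[OF S.diff_in[OF XS hS]] by (intro exI[of _ N]) (auto intro: le_less_trans)
 qed
 then show ?thesis using hS by blast
qed

lemma hilbert_L2: "hilbert_space (L2 M H B)"
 unfolding L2_def by (rule S.hilbert_separation[OF S_complete])

lemma S_nrm_diff_eq_0:
 assumes h: "h \<in> carr S" and k: "k \<in> carr S"
 shows "nrm S (vdiff S h k) = 0 \<longleftrightarrow> (AE u in M. h u = k u)"
proof -
 have "nrm S (vdiff S h k) = 0 \<longleftrightarrow> (AE u in M. nrm (H u) (vdiff S h k u) = 0)"
  by (rule nrm_S_eq_0[OF S.diff_in[OF h k]])
 also have "\<dots> \<longleftrightarrow> (AE u in M. h u = k u)"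
 proof -
  have "nrm (H u) (vdiff S h k u) = 0 \<longleftrightarrow> h u = k u" if u: "u \<in> space M" for u
  proof -
   interpret hilbert_space "H u" using hilbert u .
   show ?thesis using u eq_if_nrm_diff_0[OF S_in[OF h u] S_in[OF k u]] nrm_diff_self[OF S_in[OF k u]] by (auto simp: S_diff)
  qed
  then show ?thesis by (auto elim!: AE_mp intro!: AE_I2)
 qed
 finally show ?thesis .
qed

lemma S_cls_eq: "h \<in> carr S \<Longrightarrow> k \<in> carr S \<Longrightarrow> cls S h = cls S k \<longleftrightarrow> (AE u in M. h u = k u)"
 by (simp add: S.cls_eq_iff S_nrm_diff_eq_0)

end

subsection \<open>Pullbacks\<close>

lemma section_space_pullback:
 assumes "section_space N H e" and \<Phi>: "\<Phi> \<in> measurable M N"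
 shows "section_space M (\<lambda>x. H (\<Phi> x)) (\<lambda>n x. e n (\<Phi> x))"
proof -
 interpret section_space N H e by fact
 show ?thesis
 proof (rule section_space.intro)
  show "hilbert_space (H (\<Phi> u))" if "u \<in> space M" for u by (rule hilbert[OF measurable_space[OF \<Phi> that]])
  show "fundamental_sequence M (\<lambda>x. H (\<Phi> x)) (\<lambda>n x. e n (\<Phi> x))"
   unfolding fundamental_sequence_def
  proof (intro conjI allI ballI impI)
   fix u v w assume "u \<in> space M" "v \<in> carr (H (\<Phi> u))" "w \<in> carr (H (\<Phi> u))"
    "\<forall>n. ip (H (\<Phi> u)) v (e n (\<Phi> u)) = ip (H (\<Phi> u)) w (e n (\<Phi> u))"
   then show "v = w" using measurable_space[OF \<Phi>] by (intro e_separating[of "\<Phi> u"]) auto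
  qed (use e_in measurable_space[OF \<Phi>] measurable_compose[OF \<Phi> e_measurable] in auto)
 qed
qed

context
 fixes N :: "'u measure" and H :: "'u \<Rightarrow> 'h ips" and B :: "('u \<times> 'h) measure" and e :: "nat \<Rightarrow> 'u \<Rightarrow> 'h"
 assumes spB: "space B = total_space (space N) H" and fund: "fundamental_sequence N H e"
  and setsB: "sets B = sigma_sets (total_space (space N) H)
     ({fst -` A \<inter> total_space (space N) H | A. A \<in> sets N}
      \<union> {(\<lambda>(u, v). ip (H u) v (e n u)) -` A \<inter> total_space (space N) H | n A. A \<in> sets borel})"
begin

text \<open>Since \<open>B\<close> is generated by the projection and the coefficient functions,
  preimages need checking on these generators only; conversely the coefficient functions are
  themselves measurable on \<open>B\<close>.\<close>

lemma bundle_measurable_iff: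
 assumes \<Phi>: "\<Phi> \<in> measurable M N"
 shows "(\<lambda>x. (\<Phi> x, h x)) \<in> measurable M B \<longleftrightarrow>
  (\<forall>x\<in>space M. h x \<in> carr (H (\<Phi> x))) \<and> (\<forall>n. (\<lambda>x. ip (H (\<Phi> x)) (h x) (e n (\<Phi> x))) \<in> borel_measurable M)"
  (is "?L \<longleftrightarrow> ?R")
proof
 assume L: ?L
 have "h x \<in> carr (H (\<Phi> x))" if "x \<in> space M" for x
  using measurable_space[OF L that] by (simp add: spB total_space_def)
 moreover have "(\<lambda>x. ip (H (\<Phi> x)) (h x) (e n (\<Phi> x))) \<in> borel_measurable M" for n
 proof -
  have "(\<lambda>(u, v). ip (H u) v (e n u)) \<in> borel_measurable B"
  proof (rule measurableI)
   fix A :: "complex set" assume "A \<in> sets borel"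
   then show "(\<lambda>(u, v). ip (H u) v (e n u)) -` A \<inter> space B \<in> sets B"
    unfolding setsB spB by (intro sigma_sets.Basic) blast
  qed simp
  from measurable_compose[OF L this] show ?thesis by simp
 qed
 ultimately show ?R by blast
next
 assume R: ?R
 show ?L
 proof (rule measurable_sigma_sets[OF setsB])
  show "(\<lambda>x. (\<Phi> x, h x)) \<in> space M \<rightarrow> total_space (space N) H"
   using R measurable_space[OF \<Phi>] by (auto simp: total_space_def)
  fix Q assume "Q \<in> {fst -` A \<inter> total_space (space N) H | A. A \<in> sets N}
      \<union> {(\<lambda>(u, v). ip (H u) v (e n u)) -` A \<inter> total_space (space N) H | n A. A \<in> sets borel}"
  then show "(\<lambda>x. (\<Phi> x, h x)) -` Q \<inter> space M \<in> sets M"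
  proof (elim UnE CollectE exE conjE)
   fix A assume A: "Q = fst -` A \<inter> total_space (space N) H" "A \<in> sets N"
   have "(\<lambda>x. (\<Phi> x, h x)) -` Q \<inter> space M = \<Phi> -` A \<inter> space M"
    using A R measurable_space[OF \<Phi>] by (auto simp: total_space_def)
   then show ?thesis using measurable_sets[OF \<Phi> A(2)] by simp
  next
   fix n and A :: "complex set"
   assume A: "Q = (\<lambda>(u, v). ip (H u) v (e n u)) -` A \<inter> total_space (space N) H" "A \<in> sets borel"
   have "(\<lambda>x. (\<Phi> x, h x)) -` Q \<inter> space M = (\<lambda>x. ip (H (\<Phi> x)) (h x) (e n (\<Phi> x))) -` A \<inter> space M"
    using A R measurable_space[OF \<Phi>] by (auto simp: total_space_def)
   moreover have "(\<lambda>x. ip (H (\<Phi> x)) (h x) (e n (\<Phi> x))) \<in> borel_measurable M" using R by blast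
   ultimately show ?thesis using measurable_sets[OF _ A(2)] by simp
  qed
 qed auto
qed

lemma section_bundle_base:
 assumes hil: "\<And>u. u \<in> space N \<Longrightarrow> hilbert_space (H u)" and M: "sets M = sets N"
 shows "section_bundle M H e B"
proof -
 have id: "(\<lambda>x. x) \<in> measurable M N" using M by (rule measurable_ident_sets)
 have "section_space N H e" using hil fund by (simp add: section_space_def)
 from section_space_pullback[OF this id] interpret section_space M H e .
 show ?thesis
  by unfold_locales (simp add: borel_section_def bundle_measurable_iff[OF id] bsec_def)
qed

text \<open>Measurability into a subspace of a product is tested componentwise; the first component
  is the identity, and the second falls under \<open>bundle_measurable_iff\<close>.\<close>

lemma section_bundle_pullback:
 fixes \<Phi> :: "'y::topological_space \<Rightarrow> 'u"
 assumes hil: "\<And>u. u \<in> space N \<Longrightarrow> hilbert_space (H u)" and M: "sets M = sets borel" and \<Phi>: "\<Phi> \<in> measurable borel N"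
 shows "section_bundle M (\<lambda>x. H (\<Phi> x)) (\<lambda>n x. e n (\<Phi> x)) (pullback_structure \<Phi> H B)"
proof -
 have \<Phi>': "\<Phi> \<in> measurable M N" using \<Phi> by (simp add: measurable_cong_sets[OF M refl])
 have sp: "space M = UNIV" using sets_eq_imp_space_eq[OF M] by simp
 have \<Phi>N: "\<Phi> x \<in> space N" for x using measurable_space[OF \<Phi>] by simp
 have "section_space N H e" using hil fund by (simp add: section_space_def)
 from section_space_pullback[OF this \<Phi>'] interpret section_space M "\<lambda>x. H (\<Phi> x)" "\<lambda>n x. e n (\<Phi> x)" .
 let ?T = "total_space UNIV (\<lambda>x. H (\<Phi> x))" and ?f = "\<lambda>(x, v). (x, (\<Phi> x, v))"
 have fT: "?f \<in> ?T \<rightarrow> space (borel \<Otimes>\<^sub>M B)"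
  using \<Phi>N by (auto simp: total_space_def space_pair_measure spB)
 have "borel_section M (pullback_structure \<Phi> H B) h \<longleftrightarrow> bsec h" for h
 proof
  assume b: "borel_section M (pullback_structure \<Phi> H B) h"
  have "(\<lambda>x. ?f (x, h x)) \<in> measurable M (borel \<Otimes>\<^sub>M B)"
   using measurable_compose[OF b[unfolded borel_section_def pullback_structure_def] measurable_vimage_algebra1[OF fT]] .
  from measurable_compose[OF this measurable_snd] have "(\<lambda>x. (\<Phi> x, h x)) \<in> measurable M B" by simp
  then show "bsec h" by (simp add: bundle_measurable_iff[OF \<Phi>'] bsec_def)
 next
  assume "bsec h"
  then have m: "(\<lambda>x. (\<Phi> x, h x)) \<in> measurable M B" and hT: "(\<lambda>x. (x, h x)) \<in> space M \<rightarrow> ?T"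
   by (auto simp: bundle_measurable_iff[OF \<Phi>'] bsec_def total_space_def sp)
  have "(\<lambda>x. (x, (\<Phi> x, h x))) \<in> measurable M (borel \<Otimes>\<^sub>M B)"
   using m by (intro measurable_Pair measurable_ident_sets M)
  then show "borel_section M (pullback_structure \<Phi> H B) h"
   unfolding borel_section_def pullback_structure_def
   by (intro measurable_vimage_algebra2 hT) simp
 qed
 then show ?thesis by unfold_locales
qed

end

section \<open>Continuous systems of measures are kernels\<close>

context
 fixes X :: "'x::topological_space set" and \<pi> :: "'y::{second_countable_topology, t2_space} \<Rightarrow> 'x" and \<alpha> :: "'x \<Rightarrow> 'y measure"
 assumes lc: "locally_compact_space (euclidean :: 'y topology)" and sys: "continuous_system X \<pi> \<alpha>"
begin

lemma system_sets: "x \<in> X \<Longrightarrow> sets (\<alpha> x) = sets borel"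
 using sys by (auto simp: continuous_system_def radon_measure_def)

lemma system_finite: "x \<in> X \<Longrightarrow> compact K \<Longrightarrow> emeasure (\<alpha> x) K < \<infinity>"
 using sys by (auto simp: continuous_system_def radon_measure_def)

lemma system_test_fun:
 assumes f: "test_fun f"
 shows "(\<lambda>x. if x \<in> X then (LINT y|\<alpha> x. cor (f y)) else 0) \<in> Cc X"
 using sys test_fun_Cc[OF f] unfolding continuous_system_def by blast

lemma system_nn: "x \<in> X \<Longrightarrow> test_fun f \<Longrightarrow> (NN y. ennreal (f y) d/\<alpha> x) = ennreal (Re (LINT y|\<alpha> x. cor (f y)))"
 by (rule nn_integral_test_fun[OF system_sets system_finite])

text \<open>Twice a test function exceeding 1/2 on \<open>K\<close> dominates the indicator of
  \<open>K\<close>, and its integral is in \<open>Cc X\<close>, hence bounded in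
  \<open>x\<close>.\<close>

lemma system_compact_bound:
 assumes K: "compact K"
 shows "\<exists>C\<ge>0. \<forall>x\<in>X. emeasure (\<alpha> x) K \<le> ennreal C"
proof -
 obtain f where f: "test_fun f" "\<And>x. x \<in> K \<Longrightarrow> 1/2 < f x" using compact_test_fun[OF lc K] by blast
 obtain C L where C: "0 \<le> C" "\<And>x. cmod (if x \<in> X then (LINT y|\<alpha> x. cor (f y)) else 0) \<le> C * indicator L x"
  using Cc_bound[OF system_test_fun[OF f(1)]] by blast
 have "emeasure (\<alpha> x) K \<le> ennreal (2 * C)" if x: "x \<in> X" for x
 proof -
  have Kb: "K \<in> sets (\<alpha> x)" using K by (simp add: system_sets[OF x] borel_compact)
  have "emeasure (\<alpha> x) K = (NN y. indicator K y d/\<alpha> x)" using Kb by simp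
  also have "\<dots> \<le> (NN y. 2 * ennreal (f y) d/\<alpha> x)"
  proof (rule nn_integral_mono)
   fix y
   show "indicator K y \<le> 2 * ennreal (f y)"
   proof (cases "y \<in> K")
    case True
    have "ennreal 1 \<le> ennreal (2 * f y)" using f(2)[OF True] by (intro ennreal_leI) simp
    also have "\<dots> = 2 * ennreal (f y)" using f(2)[OF True] by (simp add: ennreal_mult)
    finally show ?thesis using True by simp
   qed simp
  qed
  also have "\<dots> = 2 * (NN y. ennreal (f y) d/\<alpha> x)"
   using test_fun_measurable[OF f(1)] by (intro nn_integral_cmult) (simp add: measurable_cong_sets[OF system_sets[OF x] refl])
  also have "\<dots> = 2 * ennreal (Re (LINT y|\<alpha> x. cor (f y)))" by (simp only: system_nn[OF x f(1)])
  also have "\<dots> \<le> 2 * ennreal C"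
  proof (intro mult_left_mono ennreal_leI)
   have "cmod (LINT y|\<alpha> x. cor (f y)) \<le> C * indicator L x" using C(2)[of x] x by simp
   also have "\<dots> \<le> C" using C(1) by (simp add: indicator_def)
   finally show "Re (LINT y|\<alpha> x. cor (f y)) \<le> C" using complex_Re_le_cmod order_trans by blast
  qed simp
  also have "\<dots> = ennreal (2 * C)" using C(1) by (simp add: ennreal_mult)
  finally show ?thesis .
 qed
 then show ?thesis using C(1) by (intro exI[of _ "2 * C"]) auto
qed

text \<open>Open sets come first: their measures are suprema of integrals of test functions, which
  depend continuously on \<open>x\<close>. A Dynkin argument inside the sets \<open>E n\<close>
  reaches all Borel sets; each \<open>E n\<close> lies in a compact set, which gives the uniform
  bounds.\<close>

theorem system_kernel: "kernel (restrict_space borel X) \<alpha>"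
proof -
 obtain g :: "nat \<Rightarrow> 'y \<Rightarrow> real" where g: "\<And>n. test_fun (g n)" "incseq (\<lambda>n. {x. 1/2 < g n x})"
  "(\<Union>n. {x. 1/2 < g n x}) = UNIV" using test_exhaustion[OF lc] by blast
 define E where "E n = {x. 1/2 < g n x}" for n
 have Eo: "open (E n)" for n unfolding E_def by (rule test_fun_open[OF g(1)])
 have Eb: "E n \<in> sets borel" for n using Eo by simp
 have "\<exists>C\<ge>0. \<forall>x\<in>X. emeasure (\<alpha> x) (E n) \<le> ennreal C" for n
 proof -
  obtain K where K: "compact K" "\<And>x. x \<notin> K \<Longrightarrow> g n x = 0" using g(1)[of n] by (auto simp: test_fun_def)
  obtain C where C: "0 \<le> C" "\<forall>x\<in>X. emeasure (\<alpha> x) K \<le> ennreal C" using system_compact_bound[OF K(1)] by blast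
  have "emeasure (\<alpha> x) (E n) \<le> emeasure (\<alpha> x) K" if "x \<in> X" for x
  proof (rule emeasure_mono)
   show "E n \<subseteq> K" using K(2) by (force simp: E_def)
   show "K \<in> sets (\<alpha> x)" using K(1) by (simp add: system_sets[OF that] borel_compact)
  qed
  then show ?thesis using C order_trans by blast
 qed
 then obtain C where C: "\<And>n x. x \<in> X \<Longrightarrow> emeasure (\<alpha> x) (E n) \<le> ennreal (C n)" by metis
 have op: "(\<lambda>x. emeasure (\<alpha> x) U) \<in> borel_measurable (restrict_space borel X)" if U: "open U" for U
 proof -
  obtain f :: "nat \<Rightarrow> 'y \<Rightarrow> real" where f: "\<And>n. test_fun (f n)" "\<And>x. incseq (\<lambda>n. f n x)"
    "\<And>x. (\<lambda>n. f n x) \<longlonglongrightarrow> indicator U x" using open_exhaustion[OF lc U] by metis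
  have m: "(\<lambda>x. ennreal (Re (if x \<in> X then (LINT y|\<alpha> x. cor (f n y)) else 0))) \<in> borel_measurable (restrict_space borel X)" for n
  proof -
   have "continuous_on X (\<lambda>x. if x \<in> X then (LINT y|\<alpha> x. cor (f n y)) else 0)"
    using system_test_fun[OF f(1)] by (simp add: Cc_def)
   from measurable_compose[OF borel_measurable_continuous_on_restrict[OF this] borel_measurable_Re]
   show ?thesis by (rule measurable_compose[OF _ measurable_ennreal])
  qed
  have "emeasure (\<alpha> x) U = (SUP n. ennreal (Re (if x \<in> X then (LINT y|\<alpha> x. cor (f n y)) else 0)))"
   if "x \<in> space (restrict_space borel X)" for x
  proof -
   have x: "x \<in> X" using that by (simp add: space_restrict_space)
   show ?thesis using U x by (simp add: emeasure_open_SUP[OF system_sets[OF x] f] system_nn[OF x f(1)] del: integral_complex_of_real)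
  qed
  then show ?thesis by (rule measurable_eqI) (use m in measurable)
 qed
 have fin: "(\<lambda>x. emeasure (\<alpha> x) (A \<inter> E n)) \<in> borel_measurable (restrict_space borel X)" if A: "A \<in> sets borel" for A n
 proof -
  have "Int_stable {S::'y set. open S}" by (auto simp: Int_stable_def)
  moreover have "{S::'y set. open S} \<subseteq> Pow UNIV" by auto
  moreover have "A \<in> sigma_sets UNIV {S. open S}" using A by (simp add: borel_def)
  ultimately show ?thesis
  proof (induction rule: sigma_sets_induct_disjoint)
   case (basic A)
   then show ?case using Eo by (intro op) auto
  next
   case empty show ?case by simp
  next
   case (compl A)
   have A: "A \<in> sets borel" using compl(1) by (simp add: borel_def)
   have "emeasure (\<alpha> x) ((UNIV - A) \<inter> E n) = emeasure (\<alpha> x) (E n) - emeasure (\<alpha> x) (A \<inter> E n)"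
    if "x \<in> space (restrict_space borel X)" for x
   proof -
    have x: "x \<in> X" using that by (simp add: space_restrict_space)
    have "(UNIV - A) \<inter> E n = E n - (A \<inter> E n)" by auto
    moreover have "emeasure (\<alpha> x) (A \<inter> E n) \<noteq> \<infinity>"
    proof -
     have "emeasure (\<alpha> x) (A \<inter> E n) \<le> emeasure (\<alpha> x) (E n)"
      using Eb by (intro emeasure_mono) (auto simp: system_sets[OF x])
     also have "\<dots> < \<infinity>" using C[OF x, of n] by (simp add: le_less_trans)
     finally show ?thesis by simp
    qed
    ultimately show ?thesis using Eb A by (simp add: emeasure_Diff system_sets[OF x])
   qed
   then show ?case
    by (rule measurable_eqI) (use compl(2) op[OF Eo] in \<open>auto intro: borel_measurable_minus_ennreal\<close>)
  next
   case (union A)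
   have A: "A i \<in> sets borel" for i using union(2) by (auto simp: borel_def)
   have "emeasure (\<alpha> x) ((\<Union>i. A i) \<inter> E n) = (\<Sum>i. emeasure (\<alpha> x) (A i \<inter> E n))"
    if "x \<in> space (restrict_space borel X)" for x
   proof -
    have x: "x \<in> X" using that by (simp add: space_restrict_space)
    have "(\<Union>i. A i) \<inter> E n = (\<Union>i. A i \<inter> E n)" by auto
    moreover have "disjoint_family (\<lambda>i. A i \<inter> E n)" using union(1) by (auto simp: disjoint_family_on_def)
    ultimately show ?thesis using Eb A by (subst suminf_emeasure) (auto simp: system_sets[OF x])
   qed
   then show ?case by (rule measurable_eqI) (use union(3) in auto)
  qed
 qed
 show ?thesis
 proof (rule kernelI[where E=E and C=C])
  show "sets (\<alpha> x) = sets borel" if "x \<in> space (restrict_space borel X)" for x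
   using that by (simp add: space_restrict_space system_sets)
  show "E n \<in> sets borel" for n by (rule Eb)
  show "incseq E" "(\<Union>n. E n) = UNIV" using g by (auto simp: E_def[abs_def])
  show "emeasure (\<alpha> x) (E n) \<le> ennreal (C n)" if "x \<in> space (restrict_space borel X)" for n x
   using that C by (simp add: space_restrict_space)
  fix A :: "'y set" assume A: "A \<in> sets borel"
  have "emeasure (\<alpha> x) A = (SUP n. emeasure (\<alpha> x) (A \<inter> E n))" if "x \<in> space (restrict_space borel X)" for x
  proof -
   have x: "x \<in> X" using that by (simp add: space_restrict_space)
   have "(SUP n. emeasure (\<alpha> x) (A \<inter> E n)) = emeasure (\<alpha> x) (\<Union>n. A \<inter> E n)"
    using A Eb g(2) by (intro SUP_emeasure_incseq) (auto simp: system_sets[OF x] incseq_def E_def[abs_def])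
   also have "(\<Union>n. A \<inter> E n) = A" using g(3) by (auto simp: E_def)
   finally show ?thesis by simp
  qed
  then show "(\<lambda>x. emeasure (\<alpha> x) A) \<in> borel_measurable (restrict_space borel X)"
   by (rule measurable_eqI) (use fin[OF A] in auto)
 qed
qed

lemma system_AE:
 assumes x: "x \<in> X"
 shows "AE y in \<alpha> x. \<pi> y = x"
proof -
 have "msupport (\<alpha> x) \<subseteq> \<pi> -` {x}" using sys x by (simp add: continuous_system_def)
 then show ?thesis using AE_msupport[OF system_sets[OF x]] by (auto elim: eventually_mono)
qed

end

section \<open>The groupoid and its measures\<close>

locale induction_data = topological_groupoid G
 for G :: "'g::{second_countable_topology, t2_space} groupoid" +
 fixes lam :: "'g \<Rightarrow> 'g measure"
  and \<Phi> :: "'y::{second_countable_topology, t2_space} \<Rightarrow> 'g"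
  and \<nu> :: "'g \<Rightarrow> 'y measure"
  and d :: "'y \<Rightarrow> real"
  and R :: "('g, 'h) groupoid_rep"
  and \<Delta> :: "'g \<Rightarrow> real"
 assumes lcG: "locally_compact_space (euclidean :: 'g topology)"
  and haar: "haar_system G lam"
  and lcY: "locally_compact_space (euclidean :: 'y topology)"
  and contPhi: "continuous_on UNIV \<Phi>"
  and range_Phi: "range \<Phi> = units G"
  and fullnu: "full_system (units G) \<Phi> \<nu>"
  and contd: "continuous_on UNIV d"
  and d_nonneg: "\<And>y. 0 \<le> d y"
  and rep: "unitary_rep G lam R"
  and modular: "modular_function G lam (meas R) \<Delta>"
begin

abbreviation r :: "'g \<Rightarrow> 'g" where "r \<equiv> rng G"
abbreviation s :: "'g \<Rightarrow> 'g" where "s \<equiv> src G"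
abbreviation inv :: "'g \<Rightarrow> 'g" where "inv \<equiv> ginv G"
abbreviation X0 :: "'g set" where "X0 \<equiv> units G"
abbreviation N0 :: "'g measure" where "N0 \<equiv> restrict_space borel (units G)"
abbreviation \<mu> :: "'g measure" where "\<mu> \<equiv> meas R"
abbreviation H :: "'g \<Rightarrow> 'h ips" where "H \<equiv> fib R"
abbreviation L :: "'g \<Rightarrow> 'h \<Rightarrow> 'h" where "L \<equiv> act R"

lemma units_iff: "u \<in> X0 \<longleftrightarrow> r u = u"
 unfolding units_def image_iff by (auto simp: rng_rng intro: exI[of _ u])

lemma units_s: "u \<in> X0 \<Longrightarrow> s u = u"
 by (metis src_rng units_iff)

lemma r_unit[simp]: "r g \<in> X0" and s_unit[simp]: "s g \<in> X0" and Phi_unit[simp]: "\<Phi> y \<in> X0"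
 using rng_rng rng_src range_Phi by (auto simp: units_iff)

text \<open>Names for Borel measures on iterated products; they fix the bracketing in which the
  variables of the iterated integrals are nested.\<close>

abbreviation "bGGY \<equiv> borel :: (('g \<times> 'g) \<times> 'y) measure"
abbreviation "bGG \<equiv> borel :: ('g \<times> 'g) measure"
abbreviation "bYG \<equiv> borel :: ('y \<times> 'g) measure"
abbreviation "bYGY \<equiv> borel :: (('y \<times> 'g) \<times> 'y) measure"
abbreviation "bYGGY \<equiv> borel :: ((('y \<times> 'g) \<times> 'g) \<times> 'y) measure"
abbreviation "bYGG \<equiv> borel :: (('y \<times> 'g) \<times> 'g) measure"
abbreviation "bGYG \<equiv> borel :: (('g \<times> 'y) \<times> 'g) measure"
abbreviation "bGY \<equiv> borel :: ('g \<times> 'y) measure"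

lemma inv_inv[simp]: "inv (inv g) = g"
proof -
 have "inv (inv g) = mul G (inv (inv g)) (s (inv (inv g)))" by (simp add: mul_src)
 also have "\<dots> = mul G (inv (inv g)) (mul G (inv g) g)" by (simp add: ginv_mul rng_ginv src_ginv)
 also have "\<dots> = mul G (mul G (inv (inv g)) (inv g)) g" by (simp add: mul_assoc rng_ginv src_ginv)
 also have "\<dots> = mul G (r g) g" by (simp add: ginv_mul src_ginv)
 finally show ?thesis by (simp add: rng_mul_self)
qed

lemma r_measurable: "r \<in> Borel" and s_measurable: "s \<in> Borel"
 and inv_measurable: "inv \<in> Borel" and Phi_measurable: "\<Phi> \<in> Borel"
 and d_measurable: "d \<in> Borel"
 using continuous_rng continuous_src continuous_ginv contPhi contd
 by (auto intro: borel_measurable_continuous_onI)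

declare r_measurable[measurable] s_measurable[measurable] inv_measurable[measurable]
 Phi_measurable[measurable] d_measurable[measurable]

lemma space_N0[simp]: "space N0 = X0" by (simp add: space_restrict_space)

lemma r_N0: "r \<in> measurable borel N0" and s_N0: "s \<in> measurable borel N0" and Phi_N0: "\<Phi> \<in> measurable borel N0"
 by (auto intro!: measurable_restrict_space2)

lemma sets_mu: "sets \<mu> = sets N0" and space_mu[simp]: "space \<mu> = X0"
proof -
 show 1: "sets \<mu> = sets N0" using rep by (simp add: unitary_rep_def)
 show "space \<mu> = X0" using sets_eq_imp_space_eq[OF 1] by simp
qed

lemma meas_mu: "measurable \<mu> M = measurable N0 M"
 by (rule measurable_cong_sets[OF sets_mu refl])

lemma mu_sigma_finite: "sigma_finite_measure \<mu>"
 using rep by (simp add: unitary_rep_def)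

lemma lam_system: "continuous_system X0 r lam"
 using haar by (simp add: haar_system_def full_system_def)

lemma nu_system: "continuous_system X0 \<Phi> \<nu>"
 using fullnu by (simp add: full_system_def)

lemma kernel_lam: "kernel N0 lam" by (rule system_kernel[OF lcG lam_system])
lemma kernel_nu: "kernel N0 \<nu>" by (rule system_kernel[OF lcY nu_system])

abbreviation \<nu>d :: "'g \<Rightarrow> 'y measure" where "\<nu>d \<equiv> nu_d \<nu> d"

lemma kernel_nud: "kernel N0 \<nu>d"
 using kernel_density[OF kernel_nu d_measurable] by (simp add: nu_d_def[abs_def])

lemma lam_AE: "u \<in> X0 \<Longrightarrow> AE g in lam u. r g = u" by (rule system_AE[OF lcG lam_system])
lemma nu_AE: "u \<in> X0 \<Longrightarrow> AE y in \<nu> u. \<Phi> y = u" by (rule system_AE[OF lcY nu_system])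

lemma sets_lam: "u \<in> X0 \<Longrightarrow> sets (lam u) = sets borel" and sets_nu: "u \<in> X0 \<Longrightarrow> sets (\<nu> u) = sets borel"
 and sets_nud: "u \<in> X0 \<Longrightarrow> sets (\<nu>d u) = sets borel"
 using kernelD(1)[OF kernel_lam] kernelD(1)[OF kernel_nu] kernelD(1)[OF kernel_nud] by auto

lemma space_lam: "u \<in> X0 \<Longrightarrow> space (lam u) = UNIV" and space_nu: "u \<in> X0 \<Longrightarrow> space (\<nu> u) = UNIV"
 using kernelD(2)[OF kernel_lam] kernelD(2)[OF kernel_nu] by auto

lemma meas_lam: "u \<in> X0 \<Longrightarrow> measurable (lam u) M = measurable borel M"
 and meas_nu: "u \<in> X0 \<Longrightarrow> measurable (\<nu> u) M = measurable borel M"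
 and meas_nud: "u \<in> X0 \<Longrightarrow> measurable (\<nu>d u) M = measurable borel M"
 by (simp_all add: measurable_cong_sets[OF sets_lam refl] measurable_cong_sets[OF sets_nu refl]
   measurable_cong_sets[OF sets_nud refl])

lemma nn_nud: "u \<in> X0 \<Longrightarrow> f \<in> Borel \<Longrightarrow> (NN x. f x d/\<nu>d u) = (NN x. ennreal (d x) * f x d/\<nu> u)"
 unfolding nu_d_def by (subst nn_integral_density) (auto simp: meas_nu)

lemma nud_AE: "u \<in> X0 \<Longrightarrow> AE y in \<nu>d u. \<Phi> y = u"
 unfolding nu_d_def using nu_AE[of u] by (subst AE_density) (auto simp: meas_nu elim: eventually_mono)

lemma lam_bound: "compact K \<Longrightarrow> \<exists>C\<ge>0. \<forall>u\<in>X0. emeasure (lam u) K \<le> ennreal C"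
 by (rule system_compact_bound[OF lcG lam_system])

lemma nu_bound: "compact K \<Longrightarrow> \<exists>C\<ge>0. \<forall>u\<in>X0. emeasure (\<nu> u) K \<le> ennreal C"
 by (rule system_compact_bound[OF lcY nu_system])

lemma lam_finite: "u \<in> X0 \<Longrightarrow> compact K \<Longrightarrow> emeasure (lam u) K < \<infinity>"
 by (rule system_finite[OF lcG lam_system])

text \<open>Fullness puts the unit \<open>u\<close> itself into the support. Needed later to extract
  a point of a fibre from a statement that holds almost everywhere.\<close>

lemma lam_nonzero: "u \<in> X0 \<Longrightarrow> emeasure (lam u) UNIV \<noteq> 0"
proof -
 assume u: "u \<in> X0"
 have "msupport (lam u) = r -` {u}" using haar u by (simp add: haar_system_def full_system_def)
 moreover have "u \<in> r -` {u}" using u by (simp add: units_iff)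
 ultimately have "u \<in> msupport (lam u)" by simp
 then show ?thesis unfolding msupport_def by (auto dest!: spec[of _ UNIV])
qed

lemma lam_sf: "u \<in> X0 \<Longrightarrow> sigma_finite_measure (lam u)" and nu_sf: "u \<in> X0 \<Longrightarrow> sigma_finite_measure (\<nu> u)"
 and nud_sf: "u \<in> X0 \<Longrightarrow> sigma_finite_measure (\<nu>d u)"
 using kernel_sigma_finite[OF kernel_lam] kernel_sigma_finite[OF kernel_nu] kernel_sigma_finite[OF kernel_nud] by auto

lemma kernel_mu_lam: "kernel \<mu> lam" and kernel_mu_nu: "kernel \<mu> \<nu>" and kernel_mu_nud: "kernel \<mu> \<nu>d"
 using kernel_cong_sets[OF _ sets_mu] kernel_lam kernel_nu kernel_nud by auto

lemma kernel_lam_r: "kernel borel (\<lambda>g. lam (r g))" and kernel_lam_s: "kernel borel (\<lambda>g. lam (s g))"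
 and kernel_lam_Phi: "kernel borel (\<lambda>y. lam (\<Phi> y))"
 and kernel_nu_s: "kernel borel (\<lambda>g. \<nu> (s g))" and kernel_nud_s: "kernel borel (\<lambda>g. \<nu>d (s g))"
 and kernel_nud_r: "kernel borel (\<lambda>g. \<nu>d (r g))"
 using kernel_compose[OF kernel_lam r_N0] kernel_compose[OF kernel_lam s_N0] kernel_compose[OF kernel_lam Phi_N0]
  kernel_compose[OF kernel_nu s_N0] kernel_compose[OF kernel_nud s_N0] kernel_compose[OF kernel_nud r_N0] by auto

subsection \<open>Quasi-invariance\<close>

definition mG :: "'g measure" where "mG = integrated_measure \<mu> lam"

lemma sets_mG[simp]: "sets mG = sets borel" and space_mG[simp]: "space mG = UNIV"
 unfolding mG_def using sets_integrated[OF kernel_mu_lam] space_integrated[OF kernel_mu_lam] by auto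

lemma meas_mG: "measurable mG M = measurable borel M"
 by (rule measurable_cong_sets[OF sets_mG refl])

lemma nn_mG: "f \<in> Borel \<Longrightarrow> (NN g. f g d/mG) = (NN u. NN g. f g d/lam u d/\<mu>)"
 unfolding mG_def by (rule nn_integral_integrated[OF kernel_mu_lam])

lemma Delta_measurable[measurable]: "\<Delta> \<in> Borel"
 using modular by (simp add: modular_function_def)

lemma Delta_pos[simp]: "0 < \<Delta> g"
 using modular by (simp add: modular_function_def)

lemma Delta_simps[simp]: "\<Delta> g \<noteq> 0" "0 \<le> \<Delta> g" "\<bar>\<Delta> g\<bar> = \<Delta> g"
 by (metis Delta_pos less_irrefl, rule less_imp_le[OF Delta_pos], rule abs_of_pos[OF Delta_pos])

lemma Delta_mul: "s g = r \<eta> \<Longrightarrow> \<Delta> (mul G g \<eta>) = \<Delta> g * \<Delta> \<eta>"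
 using modular by (simp add: modular_function_def)

lemma Delta_r: "\<Delta> (r g) = 1"
proof -
 have "\<Delta> g = \<Delta> (r g) * \<Delta> g" using Delta_mul[of "r g" g] by (simp add: src_rng rng_mul_self)
 then show ?thesis using Delta_pos[of g] by simp
qed

lemma Delta_inv: "\<Delta> (inv g) = 1 / \<Delta> g"
proof -
 have "\<Delta> g * \<Delta> (inv g) = 1" using Delta_mul[of g "inv g"] by (simp add: rng_ginv mul_ginv Delta_r)
 then show ?thesis by (simp add: divide_simps mult.commute)
qed

text \<open>The substitution rule for inversion: \<open>\<Delta>\<close> is the density of
  \<open>mG\<close> relative to its image, and inverting the argument inverts
  \<open>\<Delta>\<close>.\<close>

lemma nn_mG_inv:
 assumes f: "f \<in> Borel"
 shows "(NN g. f g d/mG) = (NN g. ennreal (1 / \<Delta> g) * f (inv g) d/mG)"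
proof -
 have "mG = density (distr mG borel inv) (\<lambda>g. ennreal (\<Delta> g))"
  using modular by (simp add: modular_function_def mG_def Let_def)
 then have "(NN g. f g d/mG) = (NN g. f g d/density (distr mG borel inv) (\<lambda>g. ennreal (\<Delta> g)))" by simp
 also have "\<dots> = (NN g. ennreal (\<Delta> g) * f g d/distr mG borel inv)"
  using f by (intro nn_integral_density) auto
 also have "\<dots> = (NN g. ennreal (\<Delta> (inv g)) * f (inv g) d/mG)"
  using f by (intro nn_integral_distr) (auto simp: meas_mG)
 finally show ?thesis by (simp add: Delta_inv)
qed

text \<open>The weight of the integrated form. Its square is the density in
  \<open>nn_mG_inv\<close>, and it is multiplicative like \<open>\<Delta>\<close>; every later
  cancellation uses one of these two facts.\<close>

definition W :: "'g \<Rightarrow> real" where "W g = \<Delta> g powr (-1/2)"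

lemma W_measurable[measurable]: "W \<in> Borel" unfolding W_def by measurable
lemma W_pos[simp]: "0 < W g" by (simp add: W_def)
lemma W_nonneg[simp]: "0 \<le> W g" using W_pos[of g] by linarith
lemma W_sq: "(W g)\<^sup>2 = 1 / \<Delta> g"
 by (simp add: W_def power2_eq_square powr_minus divide_simps flip: powr_add)
lemma W_mul: "s g = r \<eta> \<Longrightarrow> W (mul G g \<eta>) = W g * W \<eta>"
 by (simp add: W_def Delta_mul powr_mult less_imp_le)
lemma W_inv: "W (inv g) = 1 / W g"
 by (simp add: W_def Delta_inv powr_divide less_imp_le)

subsection \<open>Left invariance\<close>

text \<open>A total Borel extension of the product. The value \<open>\<eta>\<close> off the closed
  set of composable pairs keeps \<open>s (tmul g \<eta>) = s \<eta>\<close> true without a side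
  condition.\<close>

definition tmul :: "'g \<Rightarrow> 'g \<Rightarrow> 'g" where "tmul g \<eta> = (if s g = r \<eta> then mul G g \<eta> else \<eta>)"

lemma tmul_measurable: "(\<lambda>(g, \<eta>). tmul g \<eta>) \<in> Borel"
proof -
 have c: "closed {p. s (fst p) = r (snd p)}"
  using continuous_src continuous_rng by (intro closed_Collect_eq)
   (auto intro!: continuous_on_compose2[OF continuous_src] continuous_on_compose2[OF continuous_rng] continuous_intros)
 have "(\<lambda>p. if p \<in> {p. s (fst p) = r (snd p)} then mul G (fst p) (snd p) else snd p) \<in> Borel"
  using continuous_mul c by (intro borel_measurable_continuous_on_if)
   (auto simp: case_prod_beta' intro!: continuous_intros)
 also have "(\<lambda>p. if p \<in> {p. s (fst p) = r (snd p)} then mul G (fst p) (snd p) else snd p) = (\<lambda>(g, \<eta>). tmul g \<eta>)"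
  by (auto simp: tmul_def)
 finally show ?thesis .
qed

lemma tmul_measurable'[measurable (raw)]:
 assumes "f \<in> borel_measurable M" "g \<in> borel_measurable M"
 shows "(\<lambda>x. tmul (f x) (g x)) \<in> borel_measurable M"
 using measurable_compose[OF borel_measurable_Pair[OF assms] tmul_measurable] by simp

lemma r_tmul: "r \<eta> = s g \<Longrightarrow> r (tmul g \<eta>) = r g" and s_tmul: "s (tmul g \<eta>) = s \<eta>"
 by (auto simp: tmul_def rng_mul src_mul)

lemma tmul_inv: "r \<eta> = s g \<Longrightarrow> tmul (inv g) (tmul g \<eta>) = \<eta>"
 and tmul_inv': "r \<eta> = r g \<Longrightarrow> tmul g (tmul (inv g) \<eta>) = \<eta>"
proof -
 have 1: "mul G (inv g) (mul G g \<eta>) = \<eta>" if "r \<eta> = s g" for g \<eta>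
 proof -
  have "mul G (inv g) (mul G g \<eta>) = mul G (mul G (inv g) g) \<eta>" using that by (simp add: mul_assoc src_ginv)
  also have "\<dots> = \<eta>" using that by (simp add: ginv_mul rng_mul_self flip: that)
  finally show ?thesis .
 qed
 show "r \<eta> = s g \<Longrightarrow> tmul (inv g) (tmul g \<eta>) = \<eta>" using 1 by (simp add: tmul_def rng_mul src_ginv)
 show "r \<eta> = r g \<Longrightarrow> tmul g (tmul (inv g) \<eta>) = \<eta>" using 1[of \<eta> "inv g"] by (simp add: tmul_def rng_mul src_ginv rng_ginv)
qed

text \<open>Left invariance is given on \<open>Cc\<close> functions and upgraded to an equality of
  measures. The translated measure is finite on a compact \<open>K\<close> because the preimage of
  \<open>K\<close> lies, up to a null set, in the compact set of products of \<open>g^{-1}\<close>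
  with elements of \<open>K\<close>.\<close>

lemma lam_translate: "distr (lam (s g)) borel (tmul g) = lam (r g)"
proof (rule measure_eqI_test_fun[OF lcG])
 have tm: "tmul g \<in> Borel" by measurable
 then have tm': "tmul g \<in> measurable (lam (s g)) borel" by (simp add: meas_lam)
 show "sets (lam (r g)) = sets borel" by (simp add: sets_lam)
 show "emeasure (lam (r g)) K < \<infinity>" if "compact K" for K by (rule lam_finite[OF r_unit that])
 show "emeasure (distr (lam (s g)) borel (tmul g)) K < \<infinity>" if K: "compact K" for K
 proof -
  have cl: "closed {\<eta>. r \<eta> = r g}" by (intro closed_Collect_eq continuous_rng continuous_on_const)
  let ?K = "K \<inter> {\<eta>. r \<eta> = r g}"
  have cK: "compact ?K" using K cl by (simp add: compact_Int_closed)
  have "continuous_on ?K (\<lambda>\<eta>. (\<lambda>(g, \<eta>). mul G g \<eta>) (inv g, \<eta>))"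
   by (rule continuous_on_compose2[OF continuous_mul]) (auto intro!: continuous_intros simp: src_ginv)
  then have cimg: "compact ((\<lambda>\<eta>. mul G (inv g) \<eta>) ` ?K)" using compact_continuous_image[OF _ cK] by simp
  have "emeasure (distr (lam (s g)) borel (tmul g)) K = emeasure (lam (s g)) (tmul g -` K)"
   using K tm' by (subst emeasure_distr) (auto simp: borel_compact space_lam)
  also have "\<dots> \<le> emeasure (lam (s g)) ((\<lambda>\<eta>. mul G (inv g) \<eta>) ` ?K)"
  proof (rule emeasure_mono_AE)
   show "AE \<eta> in lam (s g). \<eta> \<in> tmul g -` K \<longrightarrow> \<eta> \<in> (\<lambda>\<eta>. mul G (inv g) \<eta>) ` ?K"
   proof (rule AE_mp[OF lam_AE[OF s_unit[of g]]], rule AE_I2, intro impI)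
    fix \<eta> assume \<eta>: "r \<eta> = s g" "\<eta> \<in> tmul g -` K"
    have "\<eta> = mul G (inv g) (tmul g \<eta>)"
     using tmul_inv[OF \<eta>(1)] \<eta>(1) by (simp add: tmul_def[of "inv g"] src_ginv r_tmul)
    then show "\<eta> \<in> (\<lambda>\<eta>. mul G (inv g) \<eta>) ` ?K" using \<eta> by (auto simp: r_tmul)
   qed
   show "(\<lambda>\<eta>. mul G (inv g) \<eta>) ` ?K \<in> sets (lam (s g))" using cimg by (simp add: sets_lam borel_compact)
  qed
  also have "\<dots> < \<infinity>" using cimg by (intro lam_finite) auto
  finally show ?thesis .
 qed
 fix f :: "'g \<Rightarrow> real" assume f: "test_fun f"
 have fm: "(\<lambda>x. cor (f x)) \<in> Borel" using test_fun_measurable[OF f] by measurable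
 have "(LINT x|distr (lam (s g)) borel (tmul g). cor (f x)) = (LINT \<eta>|lam (s g). cor (f (tmul g \<eta>)))"
  using fm tm' by (intro integral_distr) auto
 also have "\<dots> = (LINT \<eta>:{\<eta>. r \<eta> = s g}|lam (s g). cor (f (mul G g \<eta>)))"
  unfolding set_lebesgue_integral_def
 proof (rule integral_cong_AE)
  have fm': "(\<lambda>\<eta>. cor (f (tmul g \<eta>))) \<in> Borel" using measurable_compose[OF tm fm] .
  then show "(\<lambda>\<eta>. cor (f (tmul g \<eta>))) \<in> borel_measurable (lam (s g))" by (simp add: meas_lam)
  have "{\<eta>. r \<eta> = s g} \<in> sets borel" by measurable
  then have "(\<lambda>\<eta>. indicat_real {\<eta>. r \<eta> = s g} \<eta> *\<^sub>R cor (f (tmul g \<eta>))) \<in> Borel"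
   using fm' by (intro borel_measurable_scaleR borel_measurable_indicator)
  also have "(\<lambda>\<eta>. indicat_real {\<eta>. r \<eta> = s g} \<eta> *\<^sub>R cor (f (tmul g \<eta>)))
   = (\<lambda>\<eta>. indicat_real {\<eta>. r \<eta> = s g} \<eta> *\<^sub>R cor (f (mul G g \<eta>)))"
   by (auto simp: indicator_def tmul_def)
  finally show "(\<lambda>\<eta>. indicat_real {\<eta>. r \<eta> = s g} \<eta> *\<^sub>R cor (f (mul G g \<eta>))) \<in> borel_measurable (lam (s g))"
   by (simp add: meas_lam)
  show "AE \<eta> in lam (s g). cor (f (tmul g \<eta>)) = indicat_real {\<eta>. r \<eta> = s g} \<eta> *\<^sub>R cor (f (mul G g \<eta>))"
   using lam_AE[OF s_unit[of g]] by (auto simp: tmul_def elim: eventually_mono)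
 qed
 also have "\<dots> = (LINT \<eta>|lam (r g). cor (f \<eta>))"
  by (rule haar[unfolded haar_system_def, THEN conjunct2, THEN spec, THEN bspec, OF test_fun_Cc[OF f]])
 finally show "(LINT x|distr (lam (s g)) borel (tmul g). cor (f x)) = (LINT \<eta>|lam (r g). cor (f \<eta>))" .
qed simp

lemma nn_translate:
 assumes f: "f \<in> Borel"
 shows "(NN \<eta>. f (tmul g \<eta>) d/lam (s g)) = (NN \<eta>. f \<eta> d/lam (r g))"
proof -
 have tm: "tmul g \<in> Borel" by measurable
 show ?thesis
  unfolding lam_translate[symmetric, of g] using f tm by (subst nn_integral_distr) (auto simp: meas_lam)
qed

lemma nn_translate_inv:
 assumes f: "f \<in> Borel"
 shows "(NN \<eta>. f (tmul (inv g) \<eta>) d/lam (r g)) = (NN \<eta>. f \<eta> d/lam (s g))"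
 using nn_translate[OF f, of "inv g"] by (simp add: rng_ginv src_ginv)

subsection \<open>The representation\<close>

text \<open>One fundamental sequence is fixed so that the bundles \<open>N\<close>,
  \<open>base\<close> and \<open>ind\<close> speak about the same coefficients.\<close>

definition e0 :: "nat \<Rightarrow> 'g \<Rightarrow> 'h" where
 "e0 = (SOME e. fundamental_sequence N0 H e \<and>
    sets (bstr R) = sigma_sets (total_space (space N0) H)
     ({fst -` A \<inter> total_space (space N0) H | A. A \<in> sets N0}
      \<union> {(\<lambda>(u, v). ip (H u) v (e n u)) -` A \<inter> total_space (space N0) H | n A. A \<in> sets borel}))"

lemma hbundle: "borel_hilbert_bundle N0 H (bstr R)" using rep by (simp add: unitary_rep_def)

lemma e0: "fundamental_sequence N0 H e0"
 "sets (bstr R) = sigma_sets (total_space (space N0) H)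
     ({fst -` A \<inter> total_space (space N0) H | A. A \<in> sets N0}
      \<union> {(\<lambda>(u, v). ip (H u) v (e0 n u)) -` A \<inter> total_space (space N0) H | n A. A \<in> sets borel})"
proof -
 have "\<exists>e. fundamental_sequence N0 H e \<and>
    sets (bstr R) = sigma_sets (total_space (space N0) H)
     ({fst -` A \<inter> total_space (space N0) H | A. A \<in> sets N0}
      \<union> {(\<lambda>(u, v). ip (H u) v (e n u)) -` A \<inter> total_space (space N0) H | n A. A \<in> sets borel})"
  using hbundle unfolding borel_hilbert_bundle_def by blast
 from someI_ex[OF this] show "fundamental_sequence N0 H e0" "sets (bstr R) = sigma_sets (total_space (space N0) H)
     ({fst -` A \<inter> total_space (space N0) H | A. A \<in> sets N0}
      \<union> {(\<lambda>(u, v). ip (H u) v (e0 n u)) -` A \<inter> total_space (space N0) H | n A. A \<in> sets borel})"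
  unfolding e0_def[symmetric] by blast+
qed

lemma space_bstr: "space (bstr R) = total_space (space N0) H"
 using hbundle by (simp add: borel_hilbert_bundle_def)

lemma hilH: "u \<in> X0 \<Longrightarrow> hilbert_space (H u)"
 using hbundle by (simp add: borel_hilbert_bundle_def)

lemma hilH': "u \<in> space N0 \<Longrightarrow> hilbert_space (H u)" by (simp add: hilH)

text \<open>\<open>N\<close> serves Borel measurability over the unit space, \<open>base\<close>
  adds the measure \<open>\<mu>\<close>, and \<open>ind\<close> is the pulled back bundle over
  \<open>Y\<close>.\<close>

sublocale N: section_bundle N0 H e0 "bstr R"
 by (rule section_bundle_base[OF space_bstr e0 hilH' refl])

sublocale base: section_bundle \<mu> H e0 "bstr R"
 by (rule section_bundle_base[OF space_bstr e0 hilH' sets_mu])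

lemma base_bsec: "base.bsec h \<longleftrightarrow> N.bsec h"
 unfolding base.bsec_def N.bsec_def by (simp add: meas_mu)

definition muInd :: "'y measure" where "muInd = integrated_measure \<mu> \<nu>d"

lemma sets_muInd[simp]: "sets muInd = sets borel" and space_muInd[simp]: "space muInd = UNIV"
 unfolding muInd_def using sets_integrated[OF kernel_mu_nud] space_integrated[OF kernel_mu_nud] by auto

lemma meas_muInd: "measurable muInd M = measurable borel M"
 by (rule measurable_cong_sets[OF sets_muInd refl])

sublocale ind: section_bundle muInd "\<lambda>x. H (\<Phi> x)" "\<lambda>n x. e0 n (\<Phi> x)" "pullback_structure \<Phi> H (bstr R)"
 by (rule section_bundle_pullback[OF space_bstr e0 hilH' sets_muInd Phi_N0])

lemma act_iso: "hilbert_iso (H (s g)) (H (r g)) (L g)"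
 using rep by (simp add: unitary_rep_def)

lemma act_in: "v \<in> carr (H (s g)) \<Longrightarrow> L g v \<in> carr (H (r g))"
 using act_iso[of g] by (auto simp: hilbert_iso_def linear_op_def)

lemma act_ip: "v \<in> carr (H (s g)) \<Longrightarrow> w \<in> carr (H (s g)) \<Longrightarrow> ip (H (r g)) (L g v) (L g w) = ip (H (s g)) v w"
 using act_iso[of g] by (auto simp: hilbert_iso_def)

lemma act_nrm: "v \<in> carr (H (s g)) \<Longrightarrow> nrm (H (r g)) (L g v) = nrm (H (s g)) v"
 by (simp add: nrm_def act_ip)

lemma act_add: "v \<in> carr (H (s g)) \<Longrightarrow> w \<in> carr (H (s g)) \<Longrightarrow> L g (vadd (H (s g)) v w) = vadd (H (r g)) (L g v) (L g w)"
 and act_scale: "v \<in> carr (H (s g)) \<Longrightarrow> L g (vscale (H (s g)) c v) = vscale (H (r g)) c (L g v)"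
 using act_iso[of g] by (auto simp: hilbert_iso_def linear_op_def)

lemma act_mul: "s g = r \<eta> \<Longrightarrow> v \<in> carr (H (s \<eta>)) \<Longrightarrow> L (mul G g \<eta>) v = L g (L \<eta> v)"
 using rep by (simp add: unitary_rep_def)

text \<open>The homomorphism property makes \<open>L u\<close> idempotent, and an injective
  idempotent map is the identity.\<close>

lemma act_unit: "u \<in> X0 \<Longrightarrow> v \<in> carr (H u) \<Longrightarrow> L u v = v"
proof -
 assume u: "u \<in> X0" and v: "v \<in> carr (H u)"
 have su: "s u = u" "r u = u" using u units_s units_iff by auto
 have uv: "L u v \<in> carr (H u)" using act_in[of v u] v su by simp
 have "mul G u u = u" using rng_mul_self[of u] su by simp
 then have "L u (L u v) = L u v" using act_mul[of u u v] v su by simp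
 moreover have "inj_on (L u) (carr (H u))" using act_iso[of u] su by (simp add: hilbert_iso_def bij_betw_def)
 ultimately show ?thesis using uv v by (simp add: inj_on_def)
qed

lemma act_inv: "v \<in> carr (H (r g)) \<Longrightarrow> L g (L (inv g) v) = v"
 using act_mul[of g "inv g" v] act_unit[of "r g" v] by (simp add: rng_ginv src_ginv mul_ginv)

lemma act_adjoint:
 assumes v: "v \<in> carr (H (s g))" and w: "w \<in> carr (H (r g))"
 shows "ip (H (r g)) (L g v) w = ip (H (s g)) v (L (inv g) w)"
proof -
 have "L (inv g) w \<in> carr (H (s g))" using act_in[of w "inv g"] w by (simp add: rng_ginv src_ginv)
 then show ?thesis using act_ip[OF v, of "L (inv g) w"] act_inv[OF w] by simp
qed

definition \<Theta> :: "('g \<Rightarrow> 'h) \<Rightarrow> ('g \<Rightarrow> 'h) \<Rightarrow> 'g \<Rightarrow> complex" where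
 "\<Theta> h g a = ip (H (r a)) (L a (h (s a))) (g (r a))"

lemma Theta_measurable: "N.bsec h \<Longrightarrow> N.bsec g \<Longrightarrow> \<Theta> h g \<in> Borel"
 using rep unfolding \<Theta>_def unitary_rep_def N.borel_section by blast

lemma section_space_src: "p \<in> borel_measurable M \<Longrightarrow> section_space M (\<lambda>x. H (s (p x))) (\<lambda>n x. e0 n (s (p x)))"
 and section_space_rng: "p \<in> borel_measurable M \<Longrightarrow> section_space M (\<lambda>x. H (r (p x))) (\<lambda>n x. e0 n (r (p x)))"
 by (rule section_space_pullback[OF N.section_space_axioms]; rule measurable_compose[OF _ s_N0] measurable_compose[OF _ r_N0]; assumption)+

lemma comb_pullback: "comb (\<lambda>x. H (q x)) (\<lambda>n x. e0 n (q x)) cs x = comb H e0 cs (q x)"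
 by (induction cs) auto

text \<open>A sequence of sections that is pointwise dense lets us approximate sections along arbitrary
 measurable maps by sections of the form \<open>w\<^sub>j\<close>, where the matrix coefficients of \<open>L\<close> are Borel by assumption.\<close>

lemma act_ip_measurable:
 assumes p: "p \<in> borel_measurable M"
  and a: "section_space.bsec M (\<lambda>x. H (s (p x))) (\<lambda>n x. e0 n (s (p x))) a"
  and b: "section_space.bsec M (\<lambda>x. H (r (p x))) (\<lambda>n x. e0 n (r (p x))) b"
 shows "(\<lambda>x. ip (H (r (p x))) (L (p x) (a x)) (b x)) \<in> borel_measurable M"
proof -
 interpret A: section_space M "\<lambda>x. H (s (p x))" "\<lambda>n x. e0 n (s (p x))" by (rule section_space_src[OF p])
 interpret B: section_space M "\<lambda>x. H (r (p x))" "\<lambda>n x. e0 n (r (p x))" by (rule section_space_rng[OF p])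
 have wA: "A.w j x = N.w j (s (p x))" and wB: "B.w j x = N.w j (r (p x))" for j x
  by (simp_all add: A.w_def B.w_def N.w_def comb_pullback[of "\<lambda>x. s (p x)"] comb_pullback[of "\<lambda>x. r (p x)"])
 show ?thesis
 proof (rule borel_measurable_LIMSEQ_metric[where
   f="\<lambda>n x. \<Theta> (N.w (A.idx a n x)) (N.w (B.idx b n x)) (p x)"])
  fix n
  have 1: "(\<lambda>x. \<Theta> (N.w i) (N.w j) (p x)) \<in> borel_measurable M" for i j
   by (rule measurable_compose[OF p Theta_measurable[OF N.bsec_w N.bsec_w]])
  have 2: "(\<lambda>x. \<Theta> (N.w i) (N.w (B.idx b n x)) (p x)) \<in> borel_measurable M" for i
   by (rule measurable_compose_countable[where f="\<lambda>j x. \<Theta> (N.w i) (N.w j) (p x)", OF 1 B.idx_measurable[OF b]])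
  show "(\<lambda>x. \<Theta> (N.w (A.idx a n x)) (N.w (B.idx b n x)) (p x)) \<in> borel_measurable M"
   by (rule measurable_compose_countable[where f="\<lambda>i x. \<Theta> (N.w i) (N.w (B.idx b n x)) (p x)", OF 2 A.idx_measurable[OF a]])
 next
  fix x assume x: "x \<in> space M"
  interpret Hr: hilbert_space "H (r (p x))" by (rule hilH) simp
  interpret Hs: hilbert_space "H (s (p x))" by (rule hilH) simp
  have ax: "a x \<in> carr (H (s (p x)))" and bx: "b x \<in> carr (H (r (p x)))" using A.bsec_in[OF a x] B.bsec_in[OF b x] by auto
  have wx: "N.w i (s (p x)) \<in> carr (H (s (p x)))" "N.w i (r (p x)) \<in> carr (H (r (p x)))" for i
   using A.bsec_in[OF A.bsec_w x] B.bsec_in[OF B.bsec_w x] by (auto simp: wA wB)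
  have "nrm (H (r (p x))) (vdiff (H (r (p x))) (L (p x) v) (L (p x) w)) = nrm (H (s (p x))) (vdiff (H (s (p x))) v w)"
   if "v \<in> carr (H (s (p x)))" "w \<in> carr (H (s (p x)))" for v w
   using that act_nrm[OF Hs.diff_in[OF that]] by (simp add: vdiff_def act_add act_scale Hs.closed)
  then have "tends (H (r (p x))) (\<lambda>n. L (p x) (N.w (A.idx a n x) (s (p x)))) (L (p x) (a x))"
   using A.idx_tends[OF a x] wx ax by (simp add: tends_def wA)
  moreover have "tends (H (r (p x))) (\<lambda>n. N.w (B.idx b n x) (r (p x))) (b x)"
   using B.idx_tends[OF b x] by (simp add: wB)
  ultimately show "(\<lambda>n. \<Theta> (N.w (A.idx a n x)) (N.w (B.idx b n x)) (p x)) \<longlonglongrightarrow> ip (H (r (p x))) (L (p x) (a x)) (b x)"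
   unfolding \<Theta>_def using ax bx wx by (intro Hr.inner_tendsto act_in) auto
 qed
qed

end

section \<open>Weak integrals\<close>

lemma ennreal_sq_finite: "(x::ennreal)\<^sup>2 < \<infinity> \<Longrightarrow> x < \<infinity>"
 by (cases x) (auto simp: power2_eq_square ennreal_top_mult)

context induction_data
begin

abbreviation TI :: "'g \<Rightarrow> ('g \<Rightarrow> complex) \<Rightarrow> ('g \<Rightarrow> 'h) \<Rightarrow> 'h" where
 "TI \<equiv> twisted_integral G lam R \<Delta>"

text \<open>As \<open>L g\<close> is unitary this is also the norm of \<open>L g (h (s g))\<close>,
  in a form that no longer mentions the fibre over \<open>r g\<close>.\<close>

definition hn :: "('g \<Rightarrow> 'h) \<Rightarrow> 'g \<Rightarrow> real" where
 "hn h g = nrm (H (s g)) (h (s g))"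

definition NI :: "'g \<Rightarrow> ('g \<Rightarrow> complex) \<Rightarrow> ('g \<Rightarrow> 'h) \<Rightarrow> ennreal" where
 "NI u f h = (NN g. ennreal (cmod (f g) * W g * hn h g) d/lam u)"

text \<open>The matrix coefficient against \<open>v\<close>, set to zero off the
  \<open>r\<close>-fibre of \<open>u\<close>, where the moved vector lies in a different Hilbert
  space; for \<open>lam u\<close> this is a null set.\<close>

definition pr :: "('g \<Rightarrow> 'h) \<Rightarrow> 'g \<Rightarrow> 'h \<Rightarrow> 'g \<Rightarrow> complex" where
 "pr h u v g = (if r g = u then ip (H u) (L g (h (s g))) v else 0)"

lemma bsec_s: "N.bsec h \<Longrightarrow> h (s g) \<in> carr (H (s g))" and bsec_r: "N.bsec h \<Longrightarrow> h (r g) \<in> carr (H (r g))"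
 by (auto intro: N.bsec_in)

lemma hn_measurable: "N.bsec h \<Longrightarrow> hn h \<in> Borel"
 using measurable_compose[OF s_N0 N.nrm_measurable] by (simp add: hn_def[abs_def])

lemma hn_nonneg: "N.bsec h \<Longrightarrow> 0 \<le> hn h g"
 unfolding hn_def by (rule semi_inner_space.nrm_nonneg[OF base.semi bsec_s]) auto

abbreviation psec :: "'x measure \<Rightarrow> ('x \<Rightarrow> 'g) \<Rightarrow> ('x \<Rightarrow> 'h) \<Rightarrow> bool" where
 "psec M q \<equiv> section_space.bsec M (\<lambda>x. H (q x)) (\<lambda>n x. e0 n (q x))"

lemma psec_iff: "q \<in> measurable M N0 \<Longrightarrow> psec M q k \<longleftrightarrow>
  (\<forall>x\<in>space M. k x \<in> carr (H (q x))) \<and> (\<forall>n. (\<lambda>x. ip (H (q x)) (k x) (e0 n (q x))) \<in> borel_measurable M)"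
 by (rule section_space.bsec_def[OF section_space_pullback[OF N.section_space_axioms]])

lemma psec_compose:
 assumes q: "q \<in> measurable X N0" and k: "psec X q k" and g: "g \<in> measurable M X"
 shows "psec M (\<lambda>x. q (g x)) (\<lambda>x. k (g x))"
 using k measurable_space[OF g] unfolding psec_iff[OF q] psec_iff[OF measurable_compose[OF g q]]
 by (auto intro: measurable_compose[OF g, where g = "\<lambda>x. ip (H (q x)) (k x) (e0 _ (q x))"])

lemma ind_bsec: "ind.bsec k \<longleftrightarrow> psec borel \<Phi> k"
 unfolding ind.bsec_def psec_iff[OF Phi_N0] by (simp add: meas_muInd)

text \<open>On the measurable set \<open>P\<close> the base points match and
  \<open>act_ip_measurable\<close> applies; the extension by zero is measurable again.\<close>

lemma act_pair_measurable:
 assumes p: "p \<in> borel_measurable M" and P: "{x \<in> space M. P x} \<in> sets M"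
  and v: "v \<in> measurable M N0" and u: "u \<in> measurable M N0" and e: "\<And>x. P x \<Longrightarrow> u x = r (p x) \<and> v x = s (p x)"
  and a: "psec M v a" and b: "psec M u b"
 shows "(\<lambda>x. if P x then ip (H (u x)) (L (p x) (a x)) (b x) else 0) \<in> borel_measurable M"
proof -
 let ?M = "restrict_space M {x. P x}"
 have p': "p \<in> borel_measurable ?M" by (rule measurable_restrict_space1[OF p])
 have i: "(\<lambda>x. x) \<in> measurable ?M M" by (rule measurable_restrict_space1) simp
 have sp: "x \<in> space ?M \<Longrightarrow> u x = r (p x) \<and> v x = s (p x)" for x using e by (simp add: space_restrict_space)
 have ps: "psec ?M q' c" if "psec M q c" "q \<in> measurable M N0" "\<And>x. x \<in> space ?M \<Longrightarrow> q x = q' x" "q' \<in> measurable ?M N0" for q q' c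
  using psec_compose[OF that(2,1) i] that(3) unfolding psec_iff[OF that(4)] psec_iff[OF measurable_compose[OF i that(2)]]
  by (simp cong: measurable_cong)
 have "psec ?M (\<lambda>x. s (p x)) a" "psec ?M (\<lambda>x. r (p x)) b"
  using sp by (auto intro!: ps[OF a v] ps[OF b u] measurable_compose[OF p' s_N0] measurable_compose[OF p' r_N0])
 from act_ip_measurable[OF p' this] have "(\<lambda>x. ip (H (u x)) (L (p x) (a x)) (b x)) \<in> borel_measurable ?M"
  by (rule measurable_eqI[rotated]) (simp only: sp)
 then show ?thesis by (subst measurable_If_restrict_space_iff[OF P]) simp
qed

lemma pairing_measurable:
 assumes q: "q \<in> measurable X N0" and k: "psec X q k" and h: "N.bsec h"
 shows "(\<lambda>p. pr h (q (fst p)) (k (fst p)) (snd p)) \<in> borel_measurable (X \<Otimes>\<^sub>M borel)"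
proof -
 have "q \<in> borel_measurable X" using q by (simp add: measurable_restrict_space2_iff)
 from measurable_compose[OF measurable_fst this] measurable_compose[OF measurable_snd r_measurable]
 have S: "{p \<in> space (X \<Otimes>\<^sub>M borel). r (snd p) = q (fst p)} \<in> sets (X \<Otimes>\<^sub>M borel)" by measurable
 have b: "psec (X \<Otimes>\<^sub>M borel) (\<lambda>p. q (fst p)) (\<lambda>p. k (fst p))" by (rule psec_compose[OF q k measurable_fst])
 have a: "psec (X \<Otimes>\<^sub>M borel) (\<lambda>p. s (snd p)) (\<lambda>p. h (s (snd p)))"
  by (rule psec_compose[OF _ _ measurable_compose[OF measurable_snd s_N0], where q = "\<lambda>u. u"]) (simp_all add: h measurable_ident_sets)
 show ?thesis
  unfolding pr_def
  by (rule act_pair_measurable[OF measurable_snd S measurable_compose[OF measurable_snd s_N0] measurable_compose[OF measurable_fst q] _ a b]) simp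
qed

lemma pr_measurable:
 assumes u: "u \<in> X0" and h: "N.bsec h" and v: "v \<in> carr (H u)"
 shows "pr h u v \<in> Borel"
proof -
 \<comment> \<open>A single vector is a section over a one-point space, so the statement with
   parameters applies.\<close>
 let ?X = "count_space (UNIV :: unit set)"
 have q: "(\<lambda>_. u) \<in> measurable ?X N0" using u by simp
 interpret Q: section_space ?X "\<lambda>x. H u" "\<lambda>n x. e0 n u" by (rule section_space_pullback[OF N.section_space_axioms q])
 have "Q.bsec (\<lambda>_. v)" using v by (simp add: Q.bsec_def)
 from pairing_measurable[OF q this h] have "(\<lambda>p. pr h u v (snd p)) \<in> borel_measurable (?X \<Otimes>\<^sub>M borel)" .
 from measurable_compose[OF measurable_Pair1'[of "()" ?X borel] this] show ?thesis by simp
qed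

lemma pr_bound:
 assumes u: "u \<in> X0" and h: "N.bsec h" and v: "v \<in> carr (H u)"
 shows "cmod (pr h u v g) \<le> hn h g * nrm (H u) v"
proof (cases "r g = u")
 case True
 interpret hilbert_space "H (r g)" by (rule hilH) simp
 have "cmod (pr h u v g) \<le> nrm (H (r g)) (L g (h (s g))) * nrm (H (r g)) v"
  using Cauchy_Schwarz[OF act_in[OF bsec_s[OF h]], of v] v True by (simp add: pr_def)
 then show ?thesis unfolding hn_def act_nrm[OF bsec_s[OF h], of g, symmetric] using True by simp
next
 case False
 have "0 \<le> nrm (H u) v" by (rule semi_inner_space.nrm_nonneg[OF base.semi v]) (simp add: u)
 then show ?thesis using False hn_nonneg[OF h] by (simp add: pr_def)
qed

lemma NI_measurable_fun:
 assumes f: "f \<in> Borel" and h: "N.bsec h"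
 shows "(\<lambda>g. cmod (f g) * W g * hn h g) \<in> Borel"
 using f hn_measurable[OF h] by measurable

text \<open>\<open>lam u\<close> is carried by the \<open>r\<close>-fibre, so integrals over the
  restricted measure become integrals over \<open>lam u\<close> of functions defined
  everywhere.\<close>

lemma twisted_cases:
 assumes u: "u \<in> X0" and h: "N.bsec h"
 shows "(NN a. ennreal (nrm (H u) (vscale (H u) (f a * cor (\<Delta> a powr (-1/2))) (L a (h (s a)))))
    d/restrict_space (lam u) {a. r a = u}) = NI u f h"
  and "v \<in> carr (H u) \<Longrightarrow> (LINT a|restrict_space (lam u) {a. r a = u}. ip (H u) (vscale (H u) (f a * cor (\<Delta> a powr (-1/2))) (L a (h (s a)))) v)
    = (LINT a|lam u. f a * cor (W a) * pr h u v a)"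
proof -
 interpret hilbert_space "H u" by (rule hilH[OF u])
 let ?S = "{a. r a = u}"
 have S: "?S \<inter> space (lam u) \<in> sets (lam u)"
  using u by (simp add: sets_lam space_lam)
 have Lin: "L a (h (s a)) \<in> carr (H u)" and Lnrm: "nrm (H u) (L a (h (s a))) = hn h a" if "r a = u" for a
  using act_in[OF bsec_s[OF h], of a] act_nrm[OF bsec_s[OF h], of a] that by (auto simp: hn_def)
 have "(NN a. ennreal (nrm (H u) (vscale (H u) (f a * cor (\<Delta> a powr (-1/2))) (L a (h (s a)))))
    d/restrict_space (lam u) ?S) = (NN a. ennreal (nrm (H u) (vscale (H u) (f a * cor (W a)) (L a (h (s a))))) * indicator ?S a d/lam u)"
  by (subst nn_integral_restrict_space[OF S]) (simp add: W_def)
 also have "\<dots> = NI u f h"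
  unfolding NI_def
 proof (rule nn_integral_cong_AE, rule AE_mp[OF lam_AE[OF u]], rule AE_I2, rule impI)
  fix a assume g: "r a = u"
  show "ennreal (nrm (H u) (vscale (H u) (f a * cor (W a)) (L a (h (s a))))) * indicator ?S a
   = ennreal (cmod (f a) * W a * hn h a)"
   using g by (simp add: nrm_scale Lin Lnrm norm_mult)
 qed
 finally show "(NN a. ennreal (nrm (H u) (vscale (H u) (f a * cor (\<Delta> a powr (-1/2))) (L a (h (s a)))))
    d/restrict_space (lam u) ?S) = NI u f h" .
 show "(LINT a|restrict_space (lam u) ?S. ip (H u) (vscale (H u) (f a * cor (\<Delta> a powr (-1/2))) (L a (h (s a)))) v)
    = (LINT a|lam u. f a * cor (W a) * pr h u v a)" if v: "v \<in> carr (H u)"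
  by (subst integral_restrict_space[OF S], rule Bochner_Integration.integral_cong[OF refl])
    (use v in \<open>auto simp: indicator_def pr_def W_def inner_simps Lin\<close>)
qed

lemma pr_add:
 assumes "N.bsec h" "v \<in> carr (H u)" "w \<in> carr (H u)" "u \<in> X0"
 shows "pr h u (vadd (H u) v w) g = pr h u v g + pr h u w g"
proof -
 interpret hilbert_space "H u" by (rule hilH) fact
 have "L g (h (s g)) \<in> carr (H u)" if "r g = u" using act_in[OF bsec_s[OF assms(1)], of g] that by simp
 then show ?thesis using assms by (simp add: pr_def inner_simps)
qed

lemma pr_scale:
 assumes "N.bsec h" "v \<in> carr (H u)" "u \<in> X0"
 shows "pr h u (vscale (H u) c v) g = cnj c * pr h u v g"
proof -
 interpret hilbert_space "H u" by (rule hilH) fact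
 have "L g (h (s g)) \<in> carr (H u)" if "r g = u" using act_in[OF bsec_s[OF assms(1)], of g] that by simp
 then show ?thesis using assms by (simp add: pr_def inner_simps)
qed

lemma pr_integrable:
 assumes u: "u \<in> X0" and f: "f \<in> Borel" and h: "N.bsec h" and fin: "NI u f h < \<infinity>" and v: "v \<in> carr (H u)"
 shows "integrable (lam u) (\<lambda>a. f a * cor (W a) * pr h u v a)"
  and "cmod (LINT a|lam u. f a * cor (W a) * pr h u v a) \<le> enn2real (NI u f h) * nrm (H u) v"
proof -
 interpret hilbert_space "H u" by (rule hilH[OF u])
 let ?g = "\<lambda>a. f a * cor (W a) * pr h u v a"
 have gm: "?g \<in> borel_measurable (lam u)" using f pr_measurable[OF u h v] by (simp add: meas_lam[OF u])
 have "(NN a. ennreal (norm (?g a)) d/lam u) \<le> (NN a. ennreal (cmod (f a) * W a * hn h a) * ennreal (nrm (H u) v) d/lam u)"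
 proof (rule nn_integral_mono)
  fix a
  have "norm (?g a) \<le> cmod (f a) * W a * (hn h a * nrm (H u) v)"
   using pr_bound[OF u h v, of a] by (simp add: norm_mult mult_left_mono)
  then show "ennreal (norm (?g a)) \<le> ennreal (cmod (f a) * W a * hn h a) * ennreal (nrm (H u) v)"
   using nrm_nonneg[OF v] hn_nonneg[OF h] by (simp flip: ennreal_mult add: ennreal_leI mult.assoc)
 qed
 also have "\<dots> = NI u f h * ennreal (nrm (H u) v)"
  unfolding NI_def using NI_measurable_fun[OF f h] by (intro nn_integral_multc) (simp add: meas_lam[OF u])
 finally have le: "(NN a. ennreal (norm (?g a)) d/lam u) \<le> NI u f h * ennreal (nrm (H u) v)" .
 have "NI u f h * ennreal (nrm (H u) v) < \<infinity>" using fin by (simp add: ennreal_mult_less_top)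
 then show int: "integrable (lam u) ?g" using gm le by (simp add: integrable_iff_bounded le_less_trans)
 have "ennreal (cmod (LINT a|lam u. ?g a)) \<le> NI u f h * ennreal (nrm (H u) v)"
  using integral_norm_bound_ennreal[OF int] le by (rule order_trans)
 also have "\<dots> = ennreal (enn2real (NI u f h) * nrm (H u) v)"
  using fin by (simp add: ennreal_mult' less_top)
 finally show "cmod (LINT a|lam u. ?g a) \<le> enn2real (NI u f h) * nrm (H u) v"
  using nrm_nonneg[OF v] by (simp add: ennreal_le_iff)
qed

lemma TI_infinite: "u \<in> X0 \<Longrightarrow> N.bsec h \<Longrightarrow> \<not> NI u f h < \<infinity> \<Longrightarrow> TI u f h = vzero (H u)"
 unfolding twisted_integral_def hilbert_integral_def using twisted_cases(1)[of u h f] by simp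

text \<open>The conjugate of the weak integral is linear in \<open>v\<close>, because inner products
  are conjugate linear there, and is bounded by \<open>NI\<close>; the Riesz vector is the value
  required by the definite description.\<close>

lemma TI:
 assumes u: "u \<in> X0" and f: "f \<in> Borel" and h: "N.bsec h" and fin: "NI u f h < \<infinity>"
 shows "TI u f h \<in> carr (H u)"
  and "v \<in> carr (H u) \<Longrightarrow> ip (H u) (TI u f h) v = (LINT g|lam u. f g * cor (W g) * pr h u v g)"
proof -
 interpret hilbert_space "H u" by (rule hilH[OF u])
 let ?I = "\<lambda>v. LINT g|lam u. f g * cor (W g) * pr h u v g"
 have "\<exists>z\<in>carr (H u). \<forall>v\<in>carr (H u). cnj (?I v) = ip (H u) v z"
 proof (rule Riesz_representation[of _ "enn2real (NI u f h)"])
  fix v w assume vw: "v \<in> carr (H u)" "w \<in> carr (H u)"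
  show "cnj (?I (vadd (H u) v w)) = cnj (?I v) + cnj (?I w)"
   using pr_integrable(1)[OF u f h fin vw(1)] pr_integrable(1)[OF u f h fin vw(2)]
   by (simp add: pr_add[OF h vw u] distrib_left)
 next
  fix c v assume v: "v \<in> carr (H u)"
  have "?I (vscale (H u) c v) = (LINT g|lam u. cnj c * (f g * cor (W g) * pr h u v g))"
   by (simp add: pr_scale[OF h v u] mult_ac)
  then show "cnj (?I (vscale (H u) c v)) = c * cnj (?I v)" by simp
 next
  fix v assume v: "v \<in> carr (H u)"
  show "cmod (cnj (?I v)) \<le> enn2real (NI u f h) * nrm (H u) v"
   using pr_integrable(2)[OF u f h fin v] by simp
 qed
 then obtain z where z: "z \<in> carr (H u)" "\<And>v. v \<in> carr (H u) \<Longrightarrow> cnj (?I v) = ip (H u) v z" by blast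
 have zv: "ip (H u) z v = ?I v" if "v \<in> carr (H u)" for v
  using z(2)[OF that] inner_cnj[OF that z(1)] by (metis complex_cnj_cnj)
 have "TI u f h = (THE z. z \<in> carr (H u) \<and> (\<forall>v\<in>carr (H u). ip (H u) z v =
   (LINT g|restrict_space (lam u) {g. r g = u}. ip (H u) (vscale (H u) (f g * cor (\<Delta> g powr (-1/2))) (L g (h (s g)))) v)))"
  unfolding twisted_integral_def hilbert_integral_def using twisted_cases(1)[OF u h, of f] fin by simp
 also have "\<dots> = z"
 proof (rule the_equality)
  show "z \<in> carr (H u) \<and> (\<forall>v\<in>carr (H u). ip (H u) z v =
   (LINT g|restrict_space (lam u) {g. r g = u}. ip (H u) (vscale (H u) (f g * cor (\<Delta> g powr (-1/2))) (L g (h (s g)))) v))"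
   using z(1) zv twisted_cases(2)[OF u h, of _ f] by simp
  fix y assume y: "y \<in> carr (H u) \<and> (\<forall>v\<in>carr (H u). ip (H u) y v =
   (LINT g|restrict_space (lam u) {g. r g = u}. ip (H u) (vscale (H u) (f g * cor (\<Delta> g powr (-1/2))) (L g (h (s g)))) v))"
  show "y = z" by (rule inner_ext) (use y z zv twisted_cases(2)[OF u h, of _ f] in auto)
 qed
 finally have "TI u f h = z" .
 then show "TI u f h \<in> carr (H u)" "v \<in> carr (H u) \<Longrightarrow> ip (H u) (TI u f h) v = ?I v"
  using z(1) zv by auto
qed

lemma TI_in: "u \<in> X0 \<Longrightarrow> f \<in> Borel \<Longrightarrow> N.bsec h \<Longrightarrow> TI u f h \<in> carr (H u)"
 using TI(1)[of u f h] TI_infinite[of u h f] cvector_space.zero_in[OF base.cv[of u]] by (cases "NI u f h < \<infinity>") auto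

lemma TI_ip:
 assumes u: "u \<in> X0" and f: "f \<in> Borel" and h: "N.bsec h" and v: "v \<in> carr (H u)"
 shows "ip (H u) (TI u f h) v = (if NI u f h < \<infinity> then (LINT g|lam u. f g * cor (W g) * pr h u v g) else 0)"
proof -
 interpret hilbert_space "H u" by (rule hilH[OF u])
 show ?thesis using TI(2)[OF u f h _ v] TI_infinite[OF u h, of f] inner_zero[OF v] by auto
qed

lemma TI_nrm:
 assumes u: "u \<in> X0" and f: "f \<in> Borel" and h: "N.bsec h"
 shows "ennreal (nrm (H u) (TI u f h)) \<le> NI u f h"
proof (cases "NI u f h < \<infinity>")
 case True
 interpret hilbert_space "H u" by (rule hilH[OF u])
 let ?n = "nrm (H u) (TI u f h)"
 have t: "TI u f h \<in> carr (H u)" by (rule TI_in[OF u f h])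
 have "?n * ?n = cmod (ip (H u) (TI u f h) (TI u f h))"
  using inner_self[OF t] by (simp add: norm_power power2_eq_square norm_mult nrm_nonneg[OF t])
 also have "\<dots> \<le> enn2real (NI u f h) * ?n"
  using pr_integrable(2)[OF u f h True t] TI(2)[OF u f h True t] by simp
 finally have "?n \<le> enn2real (NI u f h)"
  using nrm_nonneg[OF t] by (cases "?n = 0") auto
 then have "ennreal ?n \<le> ennreal (enn2real (NI u f h))" by (rule ennreal_leI)
 also have "\<dots> = NI u f h" using True by (intro ennreal_enn2real) simp
 finally show ?thesis .
qed (simp add: not_less top_unique)

text \<open>The coefficients are integrals of kernels; the case distinction on finiteness of
  \<open>NI\<close> mirrors the default value of the weak integral and is itself measurable.\<close>

lemma TI_bsec:
 assumes q: "q \<in> measurable X N0" and F: "F \<in> borel_measurable (X \<Otimes>\<^sub>M borel)" and h: "N.bsec h"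
 shows "section_space.bsec X (\<lambda>x. H (q x)) (\<lambda>n x. e0 n (q x)) (\<lambda>x. TI (q x) (\<lambda>g. F (x, g)) h)"
proof -
 interpret Q: section_space X "\<lambda>x. H (q x)" "\<lambda>n x. e0 n (q x)" by (rule section_space_pullback[OF N.section_space_axioms q])
 have Fx: "(\<lambda>g. F (x, g)) \<in> Borel" if "x \<in> space X" for x
  using measurable_compose[OF measurable_Pair1'[OF that] F] .
 have qx: "q x \<in> X0" if "x \<in> space X" for x using measurable_space[OF q that] by simp
 have K: "kernel X (\<lambda>x. lam (q x))" by (rule kernel_compose[OF kernel_lam q])
 have NIm: "(\<lambda>x. NI (q x) (\<lambda>g. F (x, g)) h) \<in> borel_measurable X"
 proof -
  have "(\<lambda>p. ennreal (cmod (F p) * W (snd p) * hn h (snd p))) \<in> borel_measurable (X \<Otimes>\<^sub>M borel)"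
   using F measurable_compose[OF measurable_snd hn_measurable[OF h]] by measurable
  from kernel_nn_measurable[OF K this] show ?thesis by (simp add: NI_def)
 qed
 show ?thesis
  unfolding Q.bsec_def
 proof (intro conjI ballI allI)
  show "TI (q x) (\<lambda>g. F (x, g)) h \<in> carr (H (q x))" if "x \<in> space X" for x
   by (rule TI_in[OF qx[OF that] Fx[OF that] h])
  fix n
  have "(\<lambda>p. F p * cor (W (snd p)) * pr h (q (fst p)) (e0 n (q (fst p))) (snd p)) \<in> borel_measurable (X \<Otimes>\<^sub>M borel)"
   using F pairing_measurable[OF q Q.bsec_e h] by measurable
  from kernel_lebesgue_measurable[OF K this]
  have "(\<lambda>x. LINT g|lam (q x). F (x, g) * cor (W g) * pr h (q x) (e0 n (q x)) g) \<in> borel_measurable X" by simp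
  then have "(\<lambda>x. if NI (q x) (\<lambda>g. F (x, g)) h < \<infinity> then LINT g|lam (q x). F (x, g) * cor (W g) * pr h (q x) (e0 n (q x)) g else 0) \<in> borel_measurable X"
   using NIm by (intro measurable_If) (auto simp: pred_def)
  then show "(\<lambda>x. ip (H (q x)) (TI (q x) (\<lambda>g. F (x, g)) h) (e0 n (q x))) \<in> borel_measurable X"
   by (rule measurable_eqI[rotated]) (simp add: TI_ip[OF qx Fx h Q.e_in])
 qed
qed

subsection \<open>Square integrability\<close>

text \<open>The second factor left by Cauchy-Schwarz in \<open>NI_sq\<close>; for compact
  \<open>K\<close> and square integrable \<open>h\<close> it is integrable over
  \<open>\<mu>\<close>.\<close>

definition PI :: "'g set \<Rightarrow> ('g \<Rightarrow> 'h) \<Rightarrow> 'g \<Rightarrow> ennreal" where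
 "PI K h u = (NN g. indicator K g * ennreal ((W g * hn h g)\<^sup>2) d/lam u)"

lemma PI_measurable_fun:
 assumes h: "N.bsec h" and K: "K \<in> sets borel"
 shows "(\<lambda>g. indicator K g * ennreal ((W g * hn h g)\<^sup>2)) \<in> Borel"
 using hn_measurable[OF h] K by measurable

text \<open>Cauchy-Schwarz with the bound on \<open>f\<close> in one factor and the weighted norm in
  the other. Keeping squares avoids roots of possibly infinite values.\<close>

lemma NI_sq:
 assumes u: "u \<in> X0" and h: "N.bsec h" and K: "K \<in> sets borel" and C: "0 \<le> C"
  and f: "\<And>g. cmod (f g) \<le> C * indicator K g"
 shows "(NI u f h)\<^sup>2 \<le> ennreal (C\<^sup>2) * emeasure (lam u) K * PI K h u"
proof -
 let ?a = "\<lambda>g. ennreal C * indicator K g" and ?b = "\<lambda>g. indicator K g * ennreal (W g * hn h g)"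
 have "NI u f h \<le> (NN g. ?a g * ?b g d/lam u)"
  unfolding NI_def
 proof (rule nn_integral_mono)
  fix g
  show "ennreal (cmod (f g) * W g * hn h g) \<le> ?a g * ?b g"
  proof (cases "g \<in> K")
   case True
   then have "cmod (f g) * W g * hn h g \<le> C * (W g * hn h g)"
    using f[of g] hn_nonneg[OF h, of g] by (simp add: mult.assoc mult_right_mono)
   then show ?thesis using True C hn_nonneg[OF h, of g] by (simp flip: ennreal_mult add: ennreal_leI)
  next
   case False
   then show ?thesis using f[of g] by simp
  qed
 qed
 then have "(NI u f h)\<^sup>2 \<le> (NN g. ?a g * ?b g d/lam u)\<^sup>2" by (rule power_mono) simp
 also have "\<dots> \<le> (NN g. (?a g)\<^sup>2 d/lam u) * (NN g. (?b g)\<^sup>2 d/lam u)"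
  using K hn_measurable[OF h] by (intro Cauchy_Schwarz_nn_integral) (auto simp: meas_lam[OF u])
 also have "(NN g. (?a g)\<^sup>2 d/lam u) = (NN g. ennreal (C\<^sup>2) * indicator K g d/lam u)"
  using C by (intro nn_integral_cong) (auto simp: indicator_def ennreal_power)
 also have "\<dots> = ennreal (C\<^sup>2) * emeasure (lam u) K" using K by (intro nn_integral_cmult_indicator) (simp add: sets_lam[OF u])
 also have "(NN g. (?b g)\<^sup>2 d/lam u) = PI K h u"
  unfolding PI_def using hn_nonneg[OF h] by (intro nn_integral_cong) (auto simp: indicator_def ennreal_power)
 finally show ?thesis .
qed

lemma PI_measurable: "N.bsec h \<Longrightarrow> K \<in> sets borel \<Longrightarrow> PI K h \<in> borel_measurable \<mu>"
 using kernel_nn_measurable[OF kernel_mu_lam measurable_compose[OF measurable_snd PI_measurable_fun[of h K]]]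
 by (simp add: PI_def[abs_def])

lemma compact_inv: "compact K \<Longrightarrow> compact (inv ` K)"
 using continuous_ginv by (intro compact_continuous_image) (auto intro: continuous_on_subset)

lemma inv_mem: "inv g \<in> K \<longleftrightarrow> g \<in> inv ` K"
 by (auto simp: image_iff) (metis inv_inv)

text \<open>Inversion cancels \<open>W^2 = 1/\<Delta>\<close> and replaces \<open>g(s(a))\<close> by
  \<open>g(r(a))\<close>, which is constant on the fibre; what remains is the mass of the compact
  set of inverses, bounded uniformly in \<open>u\<close>.\<close>

lemma shift_bound:
 assumes K: "compact K"
 shows "\<exists>B\<ge>0. \<forall>g\<in>borel_measurable N0. (NN u. NN a. indicator K a * ennreal ((W a)\<^sup>2) * g (s a) d/lam u d/\<mu>) \<le> ennreal B * (NN u. g u d/\<mu>)"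
proof -
 have Kb: "K \<in> sets borel" using K by (rule borel_compact)
 have cK: "compact (inv ` K)" by (rule compact_inv[OF K])
 obtain B where B: "0 \<le> B" "\<And>u. u \<in> X0 \<Longrightarrow> emeasure (lam u) (inv ` K) \<le> ennreal B" using lam_bound[OF cK] by blast
 have "(NN u. NN a. indicator K a * ennreal ((W a)\<^sup>2) * g (s a) d/lam u d/\<mu>) \<le> ennreal B * (NN u. g u d/\<mu>)"
  if g: "g \<in> borel_measurable N0" for g
 proof -
  let ?F = "\<lambda>a. indicator (inv ` K) a * g (r a)"
  have gr: "(\<lambda>a. g (r a)) \<in> Borel" and gs: "(\<lambda>a. g (s a)) \<in> Borel"
   by (rule measurable_compose[OF r_N0 g] measurable_compose[OF s_N0 g])+
  have Fm: "?F \<in> Borel" using borel_compact[OF cK] gr by measurable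
  have Fm': "(\<lambda>a. indicator K a * ennreal ((W a)\<^sup>2) * g (s a)) \<in> Borel" using Kb gs by measurable
  have "(NN u. NN a. indicator K a * ennreal ((W a)\<^sup>2) * g (s a) d/lam u d/\<mu>) = (NN a. indicator K a * ennreal ((W a)\<^sup>2) * g (s a) d/mG)"
   by (rule nn_mG[OF Fm', symmetric])
  also have "\<dots> = (NN a. ennreal (1 / \<Delta> a) * ?F (inv a) d/mG)"
   by (rule nn_integral_cong) (simp add: W_sq rng_ginv indicator_def mult.commute flip: inv_mem)
  also have "\<dots> = (NN a. ?F a d/mG)" by (rule nn_mG_inv[symmetric, OF Fm])
  also have "\<dots> = (NN u. NN a. ?F a d/lam u d/\<mu>)" by (rule nn_mG[OF Fm])
  also have "\<dots> \<le> (NN u. ennreal B * g u d/\<mu>)"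
  proof (rule nn_integral_mono)
   fix u assume "u \<in> space \<mu>"
   then have u: "u \<in> X0" by simp
   have "(NN a. ?F a d/lam u) = (NN a. g u * indicator (inv ` K) a d/lam u)"
    using lam_AE[OF u] by (intro nn_integral_cong_AE) (auto elim!: eventually_mono simp: mult.commute)
   also have "\<dots> = g u * emeasure (lam u) (inv ` K)"
    using cK by (intro nn_integral_cmult_indicator) (simp add: sets_lam[OF u] borel_compact)
   also have "\<dots> \<le> g u * ennreal B" using B(2)[OF u] by (intro mult_left_mono) auto
   finally show "(NN a. ?F a d/lam u) \<le> ennreal B * g u" by (simp add: mult.commute)
  qed
  also have "\<dots> = ennreal B * (NN u. g u d/\<mu>)" by (intro nn_integral_cmult) (simp add: meas_mu g)
  finally show ?thesis .
 qed
 then show ?thesis using B(1) by blast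
qed

lemma PI_int:
 assumes K: "compact K"
 shows "\<exists>B\<ge>0. \<forall>h. N.bsec h \<longrightarrow> (NN u. PI K h u d/\<mu>) \<le> ennreal B * sqn \<mu> H h"
proof -
 obtain B where B: "0 \<le> B" "\<And>g. g \<in> borel_measurable N0 \<Longrightarrow>
   (NN u. NN a. indicator K a * ennreal ((W a)\<^sup>2) * g (s a) d/lam u d/\<mu>) \<le> ennreal B * (NN u. g u d/\<mu>)"
  using shift_bound[OF K] by blast
 have "PI K h u = (NN a. indicator K a * ennreal ((W a)\<^sup>2) * ennreal ((nrm (H (s a)) (h (s a)))\<^sup>2) d/lam u)" for h u
  unfolding PI_def hn_def by (simp add: power_mult_distrib ennreal_mult mult.assoc)
 then show ?thesis using B(1) B(2)[OF N.nrm_sq_measurable] by auto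
qed

lemma TI_l2:
 assumes f: "f \<in> Borel" and K: "compact K" and C: "0 \<le> C" and le: "\<And>g. cmod (f g) \<le> C * indicator K g"
  and h: "base.l2 h"
 shows "base.l2 (\<lambda>u. TI u f h)" "AE u in \<mu>. NI u f h < \<infinity>"
proof -
 have hb: "N.bsec h" using h by (simp add: base.l2_def base_bsec)
 have Kb: "K \<in> sets borel" using K by (rule borel_compact)
 obtain B where B: "0 \<le> B" "\<And>u. u \<in> X0 \<Longrightarrow> emeasure (lam u) K \<le> ennreal B" using lam_bound[OF K] by blast
 obtain D where D: "0 \<le> D" "(NN u. PI K h u d/\<mu>) \<le> ennreal D * sqn \<mu> H h"
  using PI_int[OF K] hb by blast
 have PIfin: "(NN u. PI K h u d/\<mu>) < \<infinity>"
  using D(2) h by (auto simp: base.l2_def ennreal_mult_less_top intro: le_less_trans)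
 have NI: "(NI u f h)\<^sup>2 \<le> ennreal (C\<^sup>2 * B) * PI K h u" if u: "u \<in> X0" for u
 proof -
  have "(NI u f h)\<^sup>2 \<le> ennreal (C\<^sup>2) * emeasure (lam u) K * PI K h u" by (rule NI_sq[OF u hb Kb C le])
  also have "\<dots> \<le> ennreal (C\<^sup>2) * ennreal B * PI K h u" using B(2)[OF u] by (intro mult_mono) auto
  finally show ?thesis using B(1) by (simp add: ennreal_mult)
 qed
 have "AE u in \<mu>. PI K h u \<noteq> \<infinity>"
  using PI_measurable[OF hb Kb] PIfin by (intro nn_integral_noteq_infinite) auto
 then show "AE u in \<mu>. NI u f h < \<infinity>"
 proof (rule AE_mp, intro AE_I2 impI)
  fix u assume "u \<in> space \<mu>" and P: "PI K h u \<noteq> \<infinity>"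
  then have u: "u \<in> X0" by simp
  have "(NI u f h)\<^sup>2 < \<infinity>" using P by (intro le_less_trans[OF NI[OF u]]) (simp add: ennreal_mult_less_top less_top)
  then show "NI u f h < \<infinity>" by (rule ennreal_sq_finite)
 qed
 have "N.bsec (\<lambda>u. TI u f h)"
  using TI_bsec[of "\<lambda>u. u" N0 "\<lambda>p. f (snd p)", OF _ _ hb] f by (simp add: measurable_ident_sets)
 moreover have "(NN u. ennreal ((nrm (H u) (TI u f h))\<^sup>2) d/\<mu>) < \<infinity>"
 proof -
  have "(NN u. ennreal ((nrm (H u) (TI u f h))\<^sup>2) d/\<mu>) \<le> (NN u. ennreal (C\<^sup>2 * B) * PI K h u d/\<mu>)"
  proof (rule nn_integral_mono)
   fix u assume "u \<in> space \<mu>"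
   then have u: "u \<in> X0" by simp
   have "ennreal ((nrm (H u) (TI u f h))\<^sup>2) = (ennreal (nrm (H u) (TI u f h)))\<^sup>2"
    using semi_inner_space.nrm_nonneg[OF base.semi TI_in[OF u f hb]] u by (simp add: ennreal_power)
   also have "\<dots> \<le> (NI u f h)\<^sup>2" by (intro power_mono TI_nrm[OF u f hb]) simp
   finally show "ennreal ((nrm (H u) (TI u f h))\<^sup>2) \<le> ennreal (C\<^sup>2 * B) * PI K h u" using NI[OF u] by (rule order_trans)
  qed
  also have "\<dots> = ennreal (C\<^sup>2 * B) * (NN u. PI K h u d/\<mu>)" by (rule nn_integral_cmult[OF PI_measurable[OF hb Kb]])
  also have "\<dots> < \<infinity>" using PIfin by (simp add: ennreal_mult_less_top)
  finally show ?thesis .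
 qed
 ultimately show "base.l2 (\<lambda>u. TI u f h)" by (simp add: base.l2_def base_bsec)
qed

text \<open>Functions on \<open>Y \<times> G\<close> for which \<open>U\<close> is defined; the class contains \<open>C\<^sub>c(Z)\<close> and is preserved by the
 left action, whose results may blow up near the zeros of \<open>d\<close> like \<open>d\<^sup>-\<^sup>1\<^sup>/\<^sup>2\<close>.\<close>

definition BB :: "('y \<times> 'g \<Rightarrow> complex) \<Rightarrow> bool" where
 "BB \<xi> \<longleftrightarrow> \<xi> \<in> Borel \<and> (\<exists>C K1 K2. 0 \<le> C \<and> compact K1 \<and> compact K2 \<and>
   (\<forall>x g. cmod (\<xi> (x, g)) * sqrt (d x) \<le> C * indicator K1 x * indicator K2 g))"

abbreviation U :: "('y \<times> 'g \<Rightarrow> complex) \<Rightarrow> ('g \<Rightarrow> 'h) \<Rightarrow> 'y \<Rightarrow> 'h" where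
 "U \<equiv> U_section G lam \<Phi> R \<Delta>"

lemma U_def: "U \<xi> h x = TI (\<Phi> x) (\<lambda>g. \<xi> (x, g)) h"
 by (simp add: U_section_def)

text \<open>The integral of the norms of the integrand of \<open>U\<close>. It dominates the norm of
  \<open>U \<xi> h x\<close> and is square integrable over \<open>muInd\<close>, which makes it the
  majorant in the later convergence checks.\<close>

definition A :: "('y \<times> 'g \<Rightarrow> complex) \<Rightarrow> ('g \<Rightarrow> 'h) \<Rightarrow> 'y \<Rightarrow> ennreal" where
 "A \<xi> h x = NI (\<Phi> x) (\<lambda>g. \<xi> (x, g)) h"

lemma borel_pair: "f \<in> borel_measurable (borel :: ('a::second_countable_topology \<times> 'b::second_countable_topology) measure) \<longleftrightarrow> f \<in> borel_measurable (borel \<Otimes>\<^sub>M borel)"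
 by (simp add: borel_prod)

lemma BB_measurable: "BB \<xi> \<Longrightarrow> \<xi> \<in> Borel" by (simp add: BB_def)

lemma BB_section: "BB \<xi> \<Longrightarrow> (\<lambda>g. \<xi> (x, g)) \<in> Borel"
 using measurable_compose[OF measurable_Pair_borel BB_measurable] .

lemma A_measurable:
 assumes \<xi>: "\<xi> \<in> Borel" and h: "N.bsec h"
 shows "A \<xi> h \<in> Borel"
proof -
 have "(\<lambda>p. ennreal (cmod (\<xi> p) * W (snd p) * hn h (snd p))) \<in> borel_measurable (borel \<Otimes>\<^sub>M borel)"
  using \<xi>[unfolded borel_pair] measurable_compose[OF measurable_snd hn_measurable[OF h]] by measurable
 from kernel_nn_measurable[OF kernel_lam_Phi this] show ?thesis by (simp add: A_def[abs_def] NI_def)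
qed

text \<open>The density \<open>d(x)\<close> of \<open>muInd\<close> is split as a square, and
  \<open>d(x)^{1/2}\<close> is absorbed into \<open>\<xi>\<close>, which is then bounded with
  compact cut-offs; \<open>NI_sq\<close> and \<open>PI_int\<close> finish.\<close>

lemma A_bound:
 assumes \<xi>: "BB \<xi>"
 shows "\<exists>B\<ge>0. \<forall>h. N.bsec h \<longrightarrow> (NN x. (A \<xi> h x)\<^sup>2 d/muInd) \<le> ennreal B * sqn \<mu> H h"
proof -
 obtain C K1 K2 where C: "0 \<le> C" and K1: "compact K1" and K2: "compact K2"
  and le: "\<And>x g. cmod (\<xi> (x, g)) * sqrt (d x) \<le> C * indicator K1 x * indicator K2 g"
  using \<xi> unfolding BB_def by blast
 have K1b: "K1 \<in> sets borel" and K2b: "K2 \<in> sets borel" using K1 K2 by (auto intro: borel_compact)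
 obtain B1 where B1: "0 \<le> B1" "\<And>u. u \<in> X0 \<Longrightarrow> emeasure (\<nu> u) K1 \<le> ennreal B1" using nu_bound[OF K1] by blast
 obtain B2 where B2: "0 \<le> B2" "\<And>u. u \<in> X0 \<Longrightarrow> emeasure (lam u) K2 \<le> ennreal B2" using lam_bound[OF K2] by blast
 obtain D where D: "0 \<le> D" "\<And>h. N.bsec h \<Longrightarrow> (NN u. PI K2 h u d/\<mu>) \<le> ennreal D * sqn \<mu> H h"
  using PI_int[OF K2] by blast
 have "(NN x. (A \<xi> h x)\<^sup>2 d/muInd) \<le> ennreal (C\<^sup>2 * B2 * B1 * D) * sqn \<mu> H h" if h: "N.bsec h" for h
 proof -
  have Am: "(\<lambda>x. (A \<xi> h x)\<^sup>2) \<in> Borel" using A_measurable[OF BB_measurable[OF \<xi>] h] by measurable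
  have "(NN x. (A \<xi> h x)\<^sup>2 d/muInd) = (NN u. NN x. (A \<xi> h x)\<^sup>2 d/\<nu>d u d/\<mu>)"
   unfolding muInd_def by (rule nn_integral_integrated[OF kernel_mu_nud Am])
  also have "\<dots> = (NN u. NN x. ennreal (d x) * (A \<xi> h x)\<^sup>2 d/\<nu> u d/\<mu>)"
   using Am by (intro nn_integral_cong nn_nud) auto
  also have "\<dots> \<le> (NN u. ennreal (C\<^sup>2 * B2 * B1) * PI K2 h u d/\<mu>)"
  proof (rule nn_integral_mono)
   fix u assume "u \<in> space \<mu>"
   then have u: "u \<in> X0" by simp
   have "(NN x. ennreal (d x) * (A \<xi> h x)\<^sup>2 d/\<nu> u) \<le> (NN x. (ennreal (C\<^sup>2) * ennreal B2 * PI K2 h u) * indicator K1 x d/\<nu> u)"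
   proof (rule nn_integral_mono_AE, rule AE_mp[OF nu_AE[OF u]], rule AE_I2, rule impI)
    fix x assume x: "\<Phi> x = u"
    let ?f = "\<lambda>g. cor (sqrt (d x)) * \<xi> (x, g)"
    have "(\<lambda>g. cmod (\<xi> (x, g)) * W g * hn h g) \<in> Borel"
     by (rule NI_measurable_fun[OF BB_section[OF \<xi>] h])
    then have "ennreal (sqrt (d x)) * NI u (\<lambda>g. \<xi> (x, g)) h = (NN g. ennreal (sqrt (d x)) * ennreal (cmod (\<xi> (x, g)) * W g * hn h g) d/lam u)"
     unfolding NI_def by (intro nn_integral_cmult[symmetric]) (simp add: meas_lam[OF u])
    also have "\<dots> = NI u ?f h"
     unfolding NI_def using d_nonneg[of x] hn_nonneg[OF h]
     by (intro nn_integral_cong) (simp flip: ennreal_mult add: norm_mult mult_ac)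
    finally have "(ennreal (sqrt (d x)) * NI u (\<lambda>g. \<xi> (x, g)) h)\<^sup>2 = (NI u ?f h)\<^sup>2" by simp
    then have "ennreal (d x) * (A \<xi> h x)\<^sup>2 = (NI u ?f h)\<^sup>2"
     using d_nonneg[of x] x by (simp add: A_def power_mult_distrib ennreal_power)
    also have "\<dots> \<le> ennreal ((C * indicator K1 x)\<^sup>2) * emeasure (lam u) K2 * PI K2 h u"
     using le[of x] C d_nonneg[of x] by (intro NI_sq[OF u h K2b]) (auto simp: norm_mult mult.commute)
    also have "\<dots> \<le> ennreal ((C * indicator K1 x)\<^sup>2) * ennreal B2 * PI K2 h u"
     using B2(2)[OF u] by (intro mult_mono) auto
    also have "\<dots> = (ennreal (C\<^sup>2) * ennreal B2 * PI K2 h u) * indicator K1 x"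
     by (cases "x \<in> K1") auto
    finally show "ennreal (d x) * (A \<xi> h x)\<^sup>2 \<le> (ennreal (C\<^sup>2) * ennreal B2 * PI K2 h u) * indicator K1 x" .
   qed
   also have "\<dots> = (ennreal (C\<^sup>2) * ennreal B2 * PI K2 h u) * emeasure (\<nu> u) K1"
    using K1b by (intro nn_integral_cmult_indicator) (simp add: sets_nu[OF u])
   also have "\<dots> \<le> (ennreal (C\<^sup>2) * ennreal B2 * PI K2 h u) * ennreal B1" using B1(2)[OF u] by (intro mult_left_mono) auto
   also have "\<dots> = ennreal (C\<^sup>2 * B2 * B1) * PI K2 h u" using B1(1) B2(1) by (simp add: ennreal_mult mult_ac)
   finally show "(NN x. ennreal (d x) * (A \<xi> h x)\<^sup>2 d/\<nu> u) \<le> ennreal (C\<^sup>2 * B2 * B1) * PI K2 h u" .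
  qed
  also have "\<dots> = ennreal (C\<^sup>2 * B2 * B1) * (NN u. PI K2 h u d/\<mu>)" by (rule nn_integral_cmult[OF PI_measurable[OF h K2b]])
  also have "\<dots> \<le> ennreal (C\<^sup>2 * B2 * B1) * (ennreal D * sqn \<mu> H h)"
   by (intro mult_left_mono D(2)[OF h]) auto
  finally show ?thesis using D(1) B1(1) B2(1) by (simp add: ennreal_mult mult_ac)
 qed
 then show ?thesis using C B1(1) B2(1) D(1) by (intro exI[of _ "C\<^sup>2 * B2 * B1 * D"]) auto
qed

lemma U_bsec: "\<xi> \<in> Borel \<Longrightarrow> N.bsec h \<Longrightarrow> ind.bsec (U \<xi> h)"
 using TI_bsec[of \<Phi> borel \<xi> h, OF Phi_N0] unfolding U_def[abs_def] ind.bsec_def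
 by (simp add: section_space.bsec_def[OF section_space_pullback[OF N.section_space_axioms Phi_N0]] meas_muInd borel_pair)

lemma U_nrm: "BB \<xi> \<Longrightarrow> N.bsec h \<Longrightarrow> ennreal (nrm (H (\<Phi> x)) (U \<xi> h x)) \<le> A \<xi> h x"
 unfolding U_def A_def by (intro TI_nrm BB_section) auto

lemma U_nrm_sq:
 assumes "BB \<xi>" "N.bsec h"
 shows "ennreal ((nrm (H (\<Phi> x)) (U \<xi> h x))\<^sup>2) \<le> (A \<xi> h x)\<^sup>2"
proof -
 have "0 \<le> nrm (H (\<Phi> x)) (U \<xi> h x)"
  using semi_inner_space.nrm_nonneg[OF ind.semi ind.bsec_in[OF U_bsec[OF BB_measurable]]] assms by simp
 then have "ennreal ((nrm (H (\<Phi> x)) (U \<xi> h x))\<^sup>2) = (ennreal (nrm (H (\<Phi> x)) (U \<xi> h x)))\<^sup>2" by (simp add: ennreal_power)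
 also have "\<dots> \<le> (A \<xi> h x)\<^sup>2" by (intro power_mono U_nrm assms) simp
 finally show ?thesis .
qed

lemma A_finite:
 assumes \<xi>: "BB \<xi>" and h: "base.l2 h"
 shows "(NN x. (A \<xi> h x)\<^sup>2 d/muInd) < \<infinity>" "AE x in muInd. A \<xi> h x < \<infinity>"
proof -
 have hb: "N.bsec h" using h by (simp add: base.l2_def base_bsec)
 show 1: "(NN x. (A \<xi> h x)\<^sup>2 d/muInd) < \<infinity>"
  using A_bound[OF \<xi>] h hb by (auto simp: base.l2_def ennreal_mult_less_top intro: le_less_trans)
 have "AE x in muInd. (A \<xi> h x)\<^sup>2 \<noteq> \<infinity>"
  using A_measurable[OF BB_measurable[OF \<xi>] hb] 1 by (intro nn_integral_noteq_infinite) (auto simp: meas_muInd)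
 then show "AE x in muInd. A \<xi> h x < \<infinity>" by (rule eventually_mono) (rule ennreal_sq_finite, simp add: less_top)
qed

lemma U_l2:
 assumes \<xi>: "BB \<xi>" and h: "base.l2 h"
 shows "ind.l2 (U \<xi> h)"
proof -
 have hb: "N.bsec h" using h by (simp add: base.l2_def base_bsec)
 have "(NN x. ennreal ((nrm (H (\<Phi> x)) (U \<xi> h x))\<^sup>2) d/muInd) \<le> (NN x. (A \<xi> h x)\<^sup>2 d/muInd)"
  by (intro nn_integral_mono U_nrm_sq \<xi> hb)
 also have "\<dots> < \<infinity>" by (rule A_finite(1)[OF \<xi> h])
 finally show ?thesis using U_bsec[OF BB_measurable[OF \<xi>] hb] by (simp add: ind.l2_def)
qed

end

section \<open>Iterated integrals\<close>

lemma borel_fst[measurable]: "fst \<in> borel_measurable (borel :: ('a::second_countable_topology \<times> 'b::second_countable_topology) measure)"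
 and borel_snd[measurable]: "snd \<in> borel_measurable (borel :: ('a::second_countable_topology \<times> 'b::second_countable_topology) measure)"
 by (intro borel_measurable_continuous_onI continuous_intros)+

lemma borel_measurable_cnj[measurable (raw)]: "f \<in> borel_measurable M \<Longrightarrow> (\<lambda>x. cnj (f x)) \<in> borel_measurable M"
 by (rule measurable_compose[OF _ borel_measurable_continuous_onI]) (auto intro: continuous_intros)

text \<open>True without integrability, since a nonintegrable function has integral 0.\<close>

lemma norm_integral_le: "ennreal (norm (LINT x|M. f x)) \<le> (NN x. ennreal (norm (f x)) d/M)"
 for f :: "'a \<Rightarrow> complex"
 by (cases "integrable M f") (simp_all add: integral_norm_bound_ennreal not_integrable_integral_eq)

lemma nn_kernel_borel:
 fixes F :: "'a::second_countable_topology \<times> 'b::second_countable_topology \<Rightarrow> ennreal"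
 assumes K: "kernel borel K" and F: "F \<in> Borel"
 shows "(\<lambda>x. NN y. F (x, y) d/K x) \<in> Borel"
 using kernel_nn_measurable[OF K] F by (simp add: borel_prod)

lemma integral_kernel_borel:
 fixes F :: "'a::second_countable_topology \<times> 'b::second_countable_topology \<Rightarrow> complex"
 assumes K: "kernel borel K" and F: "F \<in> Borel"
 shows "(\<lambda>x. LINT y|K x. F (x, y)) \<in> Borel"
 using kernel_lebesgue_measurable[OF K] F by (simp add: borel_prod)

lemma kernel_borel_compose:
 "kernel borel K \<Longrightarrow> g \<in> Borel \<Longrightarrow> kernel borel (\<lambda>x. K (g x))"
 by (rule kernel_compose)

lemma kernel_borel_cong: "kernel borel K \<Longrightarrow> sets M = sets borel \<Longrightarrow> kernel M K"
 by (rule kernel_cong_sets)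

lemma integral_semidirect_iterated:
 fixes f :: "('a::second_countable_topology \<times> 'b::second_countable_topology) \<times> 'c::second_countable_topology \<Rightarrow> complex"
 assumes M: "sets M = sets borel" and K: "kernel borel K" and K': "kernel borel K'" and f: "f \<in> Borel"
  and fin: "(NN x. NN y. NN z. ennreal (norm (f ((x, y), z))) d/K' (x, y) d/K x d/M) < \<infinity>"
 shows "integrable (semidirect (semidirect M K) K') f"
  and "(LINT p|semidirect (semidirect M K) K'. f p) = (LINT x|M. LINT y|K x. LINT z|K' (x, y). f ((x, y), z))"
proof -
 have KM: "kernel M K" by (rule kernel_borel_cong[OF K M])
 have S: "sets (semidirect M K) = sets borel" by (rule sets_semidirect[OF M KM])
 have KS: "kernel (semidirect M K) K'" by (rule kernel_borel_cong[OF K' S])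
 have nf: "(\<lambda>p. ennreal (norm (f p))) \<in> Borel" using f by measurable
 have in1: "(\<lambda>p. NN z. ennreal (norm (f (p, z))) d/K' p) \<in> Borel"
  by (rule nn_kernel_borel[OF K' nf])
 have fin': "(NN p. NN z. ennreal (norm (f (p, z))) d/K' p d/semidirect M K) < \<infinity>"
  using fin by (simp add: nn_integral_semidirect[OF M KM in1])
 show "integrable (semidirect (semidirect M K) K') f" by (rule integral_semidirect(1)[OF S KS f fin'])
 have Im: "(\<lambda>p. LINT z|K' p. f (p, z)) \<in> Borel" by (rule integral_kernel_borel[OF K' f])
 have "(LINT p|semidirect (semidirect M K) K'. f p) = (LINT p|semidirect M K. LINT z|K' p. f (p, z))"
  by (rule integral_semidirect(3)[OF S KS f fin'])
 also have "\<dots> = (LINT x|M. LINT y|K x. LINT z|K' (x, y). f ((x, y), z))"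
 proof (rule integral_semidirect(3)[OF M KM Im])
  have "(NN x. NN y. ennreal (norm (LINT z|K' (x, y). f ((x, y), z))) d/K x d/M)
   \<le> (NN x. NN y. NN z. ennreal (norm (f ((x, y), z))) d/K' (x, y) d/K x d/M)"
   by (intro nn_integral_mono norm_integral_le)
  then show "(NN x. NN y. ennreal (norm (LINT z|K' (x, y). f ((x, y), z))) d/K x d/M) < \<infinity>"
   using fin by (rule le_less_trans)
 qed
 finally show "(LINT p|semidirect (semidirect M K) K'. f p) = (LINT x|M. LINT y|K x. LINT z|K' (x, y). f ((x, y), z))" .
qed

lemma nn_semidirect_iterated:
 fixes f :: "('a::second_countable_topology \<times> 'b::second_countable_topology) \<times> 'c::second_countable_topology \<Rightarrow> ennreal"
 assumes M: "sets M = sets borel" and K: "kernel borel K" and K': "kernel borel K'" and f: "f \<in> Borel"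
 shows "(NN p. f p d/semidirect (semidirect M K) K') = (NN x. NN y. NN z. f ((x, y), z) d/K' (x, y) d/K x d/M)"
proof -
 have KM: "kernel M K" by (rule kernel_borel_cong[OF K M])
 have S: "sets (semidirect M K) = sets borel" by (rule sets_semidirect[OF M KM])
 have KS: "kernel (semidirect M K) K'" by (rule kernel_borel_cong[OF K' S])
 show ?thesis
  by (simp only: nn_integral_semidirect[OF S KS f] nn_integral_semidirect[OF M KM nn_kernel_borel[OF K' f]])
qed

lemma sets_semidirect_iterated:
 fixes K :: "'a::second_countable_topology \<Rightarrow> 'b::second_countable_topology measure"
  and K' :: "'a \<times> 'b \<Rightarrow> 'c::second_countable_topology measure"
 assumes M: "sets M = sets borel" and K: "kernel borel K" and K': "kernel borel K'"
 shows "sets (semidirect M K) = sets borel" "sets (semidirect (semidirect M K) K') = sets borel"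
proof -
 show S: "sets (semidirect M K) = sets borel" by (rule sets_semidirect[OF M kernel_borel_cong[OF K M]])
 show "sets (semidirect (semidirect M K) K') = sets borel" by (rule sets_semidirect[OF S kernel_borel_cong[OF K' S]])
qed

text \<open>The identity for nonnegative functions identifies \<open>M\<close> with the image under
  \<open>\<tau>\<close> of a weighted \<open>N\<close>, so the substitution carries over to complex
  integrals.\<close>

lemma integral_transfer:
 fixes f :: "'a::topological_space \<Rightarrow> complex" and w :: "'b::topological_space \<Rightarrow> real"
 assumes M: "sets M = sets borel" and N: "sets N = sets borel" and \<tau>: "\<tau> \<in> Borel"
  and w: "w \<in> Borel" "\<And>y. 0 \<le> w y" and f: "f \<in> Borel"
  and eq: "\<And>g. g \<in> Borel \<Longrightarrow> (NN x. g x d/M) = (NN y. ennreal (w y) * g (\<tau> y) d/N)"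
 shows "(LINT x|M. f x) = (LINT y|N. w y *\<^sub>R f (\<tau> y))"
proof -
 have mN: "measurable N L = measurable borel L" for L :: "'d measure" by (rule measurable_cong_sets[OF N refl])
 have mN': "measurable N L = measurable borel L" for L :: "real measure" by (rule measurable_cong_sets[OF N refl])
 have mN'': "measurable N L = measurable borel L" for L :: "ennreal measure" by (rule measurable_cong_sets[OF N refl])
 have mN3: "measurable N L = measurable borel L" for L :: "complex measure" by (rule measurable_cong_sets[OF N refl])
 have mN4: "measurable N L = measurable borel L" for L :: "'a measure" by (rule measurable_cong_sets[OF N refl])
 have "M = distr (density N (\<lambda>y. ennreal (w y))) borel \<tau>"
 proof (rule measure_eqI_nn_integral[OF M])
  fix g :: "'a \<Rightarrow> ennreal" assume g: "g \<in> Borel"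
  have "(NN x. g x d/distr (density N (\<lambda>y. ennreal (w y))) borel \<tau>) = (NN y. ennreal (w y) * g (\<tau> y) d/N)"
   using g \<tau> w by (subst nn_integral_distr, simp add: mN4, simp, subst nn_integral_density)
    (auto simp: mN'' intro: measurable_compose)
  then show "(NN x. g x d/M) = (NN x. g x d/distr (density N (\<lambda>y. ennreal (w y))) borel \<tau>)" using eq[OF g] by simp
 qed simp
 then have "(LINT x|M. f x) = (LINT x|distr (density N (\<lambda>y. ennreal (w y))) borel \<tau>. f x)" by simp
 also have "\<dots> = (LINT y|density N (\<lambda>y. ennreal (w y)). f (\<tau> y))"
  using f \<tau> by (intro integral_distr) (simp_all add: mN4)
 also have "\<dots> = (LINT y|N. w y *\<^sub>R f (\<tau> y))"
  using f \<tau> w by (intro integral_density) (auto simp: mN3 mN' intro: measurable_compose)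
 finally show ?thesis .
qed

lemma kernel_const: "kernel M K \<Longrightarrow> x \<in> space M \<Longrightarrow> kernel N (\<lambda>_. K x)"
 by (rule kernel_compose[where N=M]) auto

context induction_data
begin

lemma kernel_const_lam: "u \<in> X0 \<Longrightarrow> kernel N (\<lambda>_. lam u)"
 using kernel_const[OF kernel_lam] by auto

end

section \<open>Products of compact sets and the inner product on functions over
  \<open>Z\<close>\<close>

context induction_data
begin

definition conv :: "'g set \<Rightarrow> 'g set \<Rightarrow> 'g set" where
 "conv K K' = (\<lambda>(a, b). mul G a b) ` {(a, b). a \<in> K \<and> b \<in> K' \<and> s a = r b}"

lemma compact_conv:
 assumes "compact K" "compact K'"
 shows "compact (conv K K')"
proof -
 have c: "closed {p. s (fst p) = r (snd p)}"
  by (intro closed_Collect_eq)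
   (auto intro!: continuous_on_compose2[OF continuous_src] continuous_on_compose2[OF continuous_rng] continuous_intros)
 have e: "{(a, b). a \<in> K \<and> b \<in> K' \<and> s a = r b} = (K \<times> K') \<inter> {p. s (fst p) = r (snd p)}" by auto
 have "compact {(a, b). a \<in> K \<and> b \<in> K' \<and> s a = r b}"
  unfolding e using assms c by (intro compact_Int_closed compact_Times)
 moreover have "continuous_on {(a, b). a \<in> K \<and> b \<in> K' \<and> s a = r b} (\<lambda>(a, b). mul G a b)"
  by (rule continuous_on_subset[OF continuous_mul]) auto
 ultimately show ?thesis unfolding conv_def by (rule compact_continuous_image[rotated])
qed

lemma conv_mem:
 assumes e: "r z = r g" and "z \<in> K" "tmul (inv z) g \<in> K'"
 shows "g \<in> conv K K'"
proof -
 have r: "r (tmul (inv z) g) = s z" using r_tmul[of g "inv z"] e by (simp add: src_ginv rng_ginv)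
 have "g = mul G z (tmul (inv z) g)" using tmul_inv'[of g z] e r by (simp add: tmul_def[of z])
 then show ?thesis unfolding conv_def using assms r by (intro image_eqI[of _ _ "(z, tmul (inv z) g)"]) auto
qed

lemma Z_inner_integrand:
 assumes "BB \<xi>" "BB \<eta>"
 shows "(\<lambda>q. cnj (\<eta> (snd q, fst (fst q))) * \<xi> (snd q, tmul (fst (fst q)) (snd (fst q)))) \<in> borel_measurable bGGY"
proof -
 have 1: "(\<lambda>q. (snd q, fst (fst q))) \<in> borel_measurable bGGY"
  by (intro borel_measurable_Pair measurable_compose[OF borel_fst borel_fst] borel_snd)
 have 2: "(\<lambda>q. (snd q, tmul (fst (fst q)) (snd (fst q)))) \<in> borel_measurable bGGY"
  by (intro borel_measurable_Pair tmul_measurable' measurable_compose[OF borel_fst borel_fst] measurable_compose[OF borel_fst borel_snd] borel_snd)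
 show ?thesis
  by (intro borel_measurable_times borel_measurable_cnj measurable_compose[OF 1 BB_measurable[OF assms(2)]]
    measurable_compose[OF 2 BB_measurable[OF assms(1)]])
qed

lemma Z_inner_measurable_aux:
 assumes "BB \<xi>" "BB \<eta>"
 shows "(\<lambda>p. LINT x|\<nu>d (r (fst p)). cnj (\<eta> (x, fst p)) * \<xi> (x, tmul (fst p) (snd p))) \<in> borel_measurable bGG"
 using integral_kernel_borel[OF kernel_borel_compose[OF kernel_nud_r borel_fst] Z_inner_integrand[OF assms]] by simp

lemma Z_inner_eq:
 assumes \<xi>: "BB \<xi>" and \<eta>: "BB \<eta>"
 shows "Z_inner G lam \<nu> d \<eta> \<xi> a = (LINT z|lam (r a). LINT x|\<nu>d (s z). cnj (\<eta> (x, inv z)) * \<xi> (x, tmul (inv z) a))"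
proof -
 define g where "g z = (LINT x|\<nu>d (r z). cnj (\<eta> (x, z)) * \<xi> (x, tmul z a))" for z
 have gm: "g \<in> Borel"
  using measurable_compose[OF _ Z_inner_measurable_aux[OF \<xi> \<eta>], of "\<lambda>z. (z, a)" borel] unfolding g_def[abs_def]
  by (simp add: borel_measurable_Pair)
 have S: "{z. s z = r a} \<in> sets borel" by measurable
 have g': "(\<lambda>z. indicat_real {z. s z = r a} z *\<^sub>R g z) \<in> Borel"
  using S gm by (intro borel_measurable_scaleR borel_measurable_indicator)
 have "Z_inner G lam \<nu> d \<eta> \<xi> a = (LINT z|distr (lam (r a)) borel inv. indicat_real {z. s z = r a} z *\<^sub>R g z)"
  unfolding Z_inner_def set_lebesgue_integral_def lam_src_def
  by (rule Bochner_Integration.integral_cong[OF refl]) (auto simp: indicator_def tmul_def g_def)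
 also have "\<dots> = (LINT z|lam (r a). indicat_real {z. s z = r a} (inv z) *\<^sub>R g (inv z))"
  using g' by (intro integral_distr) (simp_all add: meas_lam)
 also have "\<dots> = (LINT z|lam (r a). g (inv z))"
 proof (rule integral_cong_AE)
  show "(\<lambda>z. indicat_real {z. s z = r a} (inv z) *\<^sub>R g (inv z)) \<in> borel_measurable (lam (r a))"
   using measurable_compose[OF inv_measurable g'] by (simp add: meas_lam)
  show "(\<lambda>z. g (inv z)) \<in> borel_measurable (lam (r a))"
   using measurable_compose[OF inv_measurable gm] by (simp add: meas_lam)
  show "AE z in lam (r a). indicat_real {z. s z = r a} (inv z) *\<^sub>R g (inv z) = g (inv z)"
   by (rule eventually_mono[OF lam_AE[OF r_unit]]) (simp add: src_ginv)
 qed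
 finally show ?thesis by (simp add: g_def rng_ginv)
qed

lemma Z_inner_measurable:
 assumes \<xi>: "BB \<xi>" and \<eta>: "BB \<eta>"
 shows "Z_inner G lam \<nu> d \<eta> \<xi> \<in> Borel"
proof -
 have 1: "(\<lambda>p. (inv (snd p), fst p)) \<in> borel_measurable bGG"
  by (intro borel_measurable_Pair measurable_compose[OF borel_snd inv_measurable] borel_fst)
 have "(\<lambda>p. LINT x|\<nu>d (s (snd p)). cnj (\<eta> (x, inv (snd p))) * \<xi> (x, tmul (inv (snd p)) (fst p))) \<in> borel_measurable bGG"
  using measurable_compose[OF 1 Z_inner_measurable_aux[OF \<xi> \<eta>]] by (simp add: rng_ginv)
 from integral_kernel_borel[OF kernel_lam_r this] show ?thesis
  by (rule measurable_eqI[rotated]) (simp add: Z_inner_eq[OF \<xi> \<eta>])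
qed

text \<open>The estimate shared by \<open>Z_inner_bound\<close> and \<open>LA_BB\<close>;
  \<open>B\<close> does not depend on \<open>c\<close>, so \<open>c\<close> may contain the cut-offs
  in the remaining variables.\<close>

lemma double_integral_bound:
 assumes K2: "compact K2" and K3: "compact K3"
 shows "\<exists>B\<ge>0. \<forall>u\<in>X0. \<forall>c G. (\<forall>z y. r z = u \<longrightarrow> G z y \<le> ennreal c * indicator K2 z * indicator K3 y) \<longrightarrow>
  (NN z. NN y. G z y d/\<nu> (s z) d/lam u) \<le> ennreal (c * B)"
proof -
 obtain B2 where B2: "0 \<le> B2" "\<And>u. u \<in> X0 \<Longrightarrow> emeasure (lam u) K2 \<le> ennreal B2" using lam_bound[OF K2] by blast
 obtain B3 where B3: "0 \<le> B3" "\<And>u. u \<in> X0 \<Longrightarrow> emeasure (\<nu> u) K3 \<le> ennreal B3" using nu_bound[OF K3] by blast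
 have "(NN z. NN y. G z y d/\<nu> (s z) d/lam u) \<le> ennreal (c * (B3 * B2))"
  if u: "u \<in> X0" and G: "\<And>z y. r z = u \<Longrightarrow> G z y \<le> ennreal c * indicator K2 z * indicator K3 y" for u c G
 proof -
  have "(NN z. NN y. G z y d/\<nu> (s z) d/lam u) \<le> (NN z. (ennreal c * ennreal B3) * indicator K2 z d/lam u)"
  proof (rule nn_integral_mono_AE, rule eventually_mono[OF lam_AE[OF u]])
   fix z assume z: "r z = u"
   have "(NN y. G z y d/\<nu> (s z)) \<le> (NN y. (ennreal c * indicator K2 z) * indicator K3 y d/\<nu> (s z))"
    by (intro nn_integral_mono G z)
   also have "\<dots> = (ennreal c * indicator K2 z) * emeasure (\<nu> (s z)) K3"
    using K3 by (intro nn_integral_cmult_indicator) (simp add: sets_nu borel_compact)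
   also have "\<dots> \<le> (ennreal c * indicator K2 z) * ennreal B3" by (intro mult_left_mono B3) auto
   finally show "(NN y. G z y d/\<nu> (s z)) \<le> (ennreal c * ennreal B3) * indicator K2 z" by (simp only: mult_ac)
  qed
  also have "\<dots> = (ennreal c * ennreal B3) * emeasure (lam u) K2"
   using K2 by (intro nn_integral_cmult_indicator) (simp add: sets_lam[OF u] borel_compact)
  also have "\<dots> \<le> (ennreal c * ennreal B3) * ennreal B2" by (intro mult_left_mono B2 u) auto
  also have "\<dots> = ennreal (c * (B3 * B2))" using B2(1) B3(1) by (simp add: ennreal_mult'' mult.assoc)
  finally show ?thesis .
 qed
 then show ?thesis using B2(1) B3(1) by (intro exI[of _ "B3 * B2"]) simp
qed

text \<open>The density \<open>d(x)\<close> splits into one root for \<open>\<xi>\<close> and one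
  for \<open>\<eta>\<close>, exactly what \<open>BB\<close> controls. The support lies in the
  products of inverses from the second cut-off of \<open>\<eta>\<close> with elements of that of
  \<open>\<xi>\<close>.\<close>

lemma Z_inner_bound:
 assumes \<xi>: "BB \<xi>" and \<eta>: "BB \<eta>"
 shows "\<exists>C K. 0 \<le> C \<and> compact K \<and> (\<forall>g. cmod (Z_inner G lam \<nu> d \<eta> \<xi> g) \<le> C * indicator K g)"
proof -
 obtain C K1 K2 where C: "0 \<le> C" and K1: "compact K1" and K2: "compact K2"
  and le: "\<And>x g. cmod (\<xi> (x, g)) * sqrt (d x) \<le> C * indicator K1 x * indicator K2 g"
  using \<xi> unfolding BB_def by blast
 obtain D L1 L2 where D: "0 \<le> D" and L1: "compact L1" and L2: "compact L2"
  and le': "\<And>x g. cmod (\<eta> (x, g)) * sqrt (d x) \<le> D * indicator L1 x * indicator L2 g"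
  using \<eta> unfolding BB_def by blast
 define K where "K = conv (inv ` L2) K2"
 have K: "compact K" unfolding K_def by (intro compact_conv compact_inv L2 K2)
 obtain B where B: "0 \<le> B" "\<And>u c G. u \<in> X0 \<Longrightarrow> (\<And>z y. r z = u \<Longrightarrow> G z y \<le> ennreal c * indicator (inv ` L2) z * indicator K1 y) \<Longrightarrow>
  (NN z. NN y. G z y d/\<nu> (s z) d/lam u) \<le> ennreal (c * B)"
  using double_integral_bound[OF compact_inv[OF L2] K1] by blast
 have "cmod (Z_inner G lam \<nu> d \<eta> \<xi> g) \<le> (D * C * B) * indicator K g" for g
 proof -
  let ?F = "\<lambda>z x. cnj (\<eta> (x, inv z)) * \<xi> (x, tmul (inv z) g)"
  have m: "(\<lambda>x. ennreal (cmod (?F z x))) \<in> Borel" for z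
   using measurable_compose[OF measurable_Pair_borel Z_inner_integrand[OF \<xi> \<eta>], of "(inv z, g)"] by (simp del: complex_mod_cnj)
  have "ennreal (cmod (Z_inner G lam \<nu> d \<eta> \<xi> g)) \<le> (NN z. NN x. ennreal (cmod (?F z x)) d/\<nu>d (s z) d/lam (r g))"
   unfolding Z_inner_eq[OF \<xi> \<eta>] by (rule order_trans[OF norm_integral_le], rule nn_integral_mono, rule norm_integral_le)
  also have "\<dots> = (NN z. NN x. ennreal (d x) * ennreal (cmod (?F z x)) d/\<nu> (s z) d/lam (r g))"
   by (intro nn_integral_cong nn_nud[OF s_unit m])
  also have "\<dots> \<le> ennreal (D * C * indicator K g * B)"
  proof (rule B(2)[OF r_unit])
   fix z x assume z: "r z = r g"
   have "d x * cmod (?F z x) = (cmod (\<eta> (x, inv z)) * sqrt (d x)) * (cmod (\<xi> (x, tmul (inv z) g)) * sqrt (d x))"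
    using d_nonneg[of x] by (simp add: norm_mult mult_ac flip: real_sqrt_mult)
   also have "\<dots> \<le> (D * indicator L1 x * indicator L2 (inv z)) * (C * indicator K1 x * indicator K2 (tmul (inv z) g))"
    using D C d_nonneg by (intro mult_mono[OF le' le]) (auto simp: indicator_def)
   also have "\<dots> \<le> D * C * indicator K g * indicator (inv ` L2) z * indicator K1 x"
    using conv_mem[OF z, of "inv ` L2" K2] C D by (auto simp: indicator_def K_def simp flip: inv_mem)
   finally have "ennreal (d x * cmod (?F z x)) \<le> ennreal (D * C * indicator K g * indicator (inv ` L2) z * indicator K1 x)"
    by (rule ennreal_leI)
   then show "ennreal (d x) * ennreal (cmod (?F z x)) \<le> ennreal (D * C * indicator K g) * indicator (inv ` L2) z * indicator K1 x"
    using d_nonneg[of x] by (auto simp: indicator_def ennreal_mult'[symmetric])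
  qed
  finally show ?thesis using C D B(1) by (simp add: ennreal_le_iff mult_ac)
 qed
 then show ?thesis using K C D B(1) by (intro exI[of _ "D * C * B"] exI[of _ K]) auto
qed

lemma L_l2:
 assumes "BB \<xi>" "BB \<eta>" "base.l2 h"
 shows "base.l2 (\<lambda>u. TI u (Z_inner G lam \<nu> d \<eta> \<xi>) h)" "AE u in \<mu>. NI u (Z_inner G lam \<nu> d \<eta> \<xi>) h < \<infinity>"
proof -
 obtain C K where "0 \<le> C" "compact K" "\<And>g. cmod (Z_inner G lam \<nu> d \<eta> \<xi> g) \<le> C * indicator K g"
  using Z_inner_bound[OF assms(1,2)] by blast
 then show "base.l2 (\<lambda>u. TI u (Z_inner G lam \<nu> d \<eta> \<xi>) h)" "AE u in \<mu>. NI u (Z_inner G lam \<nu> d \<eta> \<xi>) h < \<infinity>"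
  using TI_l2[OF Z_inner_measurable[OF assms(1,2)] _ _ _ assms(3)] by blast+
qed

end

text \<open>The bound makes \<open>b\<close> vanish on null vectors in either variable, so it
  descends to classes, where bounded forms are represented by operators. Uniqueness is included
  because \<open>IndJ\<close> is a definite description.\<close>

lemma (in semi_inner_space) separation_form_operator:
 assumes hil: "hilbert_space (separation V)"
  and addl: "\<And>x y z. x \<in> carr V \<Longrightarrow> y \<in> carr V \<Longrightarrow> z \<in> carr V \<Longrightarrow> b (vadd V x y) z = b x z + b y z"
  and scalel: "\<And>c x y. x \<in> carr V \<Longrightarrow> y \<in> carr V \<Longrightarrow> b (vscale V c x) y = c * b x y"
  and addr: "\<And>x y z. x \<in> carr V \<Longrightarrow> y \<in> carr V \<Longrightarrow> z \<in> carr V \<Longrightarrow> b x (vadd V y z) = b x y + b x z"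
  and scaler: "\<And>c x y. x \<in> carr V \<Longrightarrow> y \<in> carr V \<Longrightarrow> b x (vscale V c y) = cnj c * b x y"
  and bound: "\<And>x y. x \<in> carr V \<Longrightarrow> y \<in> carr V \<Longrightarrow> cmod (b x y) \<le> C * nrm V x * nrm V y"
 shows "\<exists>!T. T \<in> extensional (carr (separation V)) \<and> bounded_op (separation V) T \<and>
  (\<forall>x\<in>carr V. \<forall>y\<in>carr V. ip (separation V) (T (cls V x)) (cls V y) = b x y)"
proof -
 interpret Q: hilbert_space "separation V" by fact
 have diffl: "b (vdiff V x x') y = b x y - b x' y" and diffr: "b y (vdiff V x x') = b y x - b y x'"
  if "x \<in> carr V" "x' \<in> carr V" "y \<in> carr V" for x x' y
  using that by (simp_all add: vdiff_def addl scalel addr scaler scale_in)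
 have inv: "b x y = b x' y'" if "x \<in> carr V" "x' \<in> carr V" "y \<in> carr V" "y' \<in> carr V"
  "nrm V (vdiff V x x') = 0" "nrm V (vdiff V y y') = 0" for x x' y y'
 proof -
  have "b (vdiff V x x') y = 0" "b x' (vdiff V y y') = 0"
   using bound[of "vdiff V x x'" y] bound[of x' "vdiff V y y'"] that by (simp_all add: diff_in)
  then show ?thesis using that by (simp add: diffl diffr)
 qed
 define b' where "b' A B = b (rep A) (rep B)" for A B
 have b': "b' (cls V x) (cls V y) = b x y" if "x \<in> carr V" "y \<in> carr V" for x y
  unfolding b'_def using rep_cls[OF that(1)] rep_cls[OF that(2)] that by (intro inv) auto
 have "\<exists>T. T \<in> extensional (carr (separation V)) \<and> bounded_op (separation V) T \<and>
  (\<forall>A\<in>carr (separation V). \<forall>B\<in>carr (separation V). ip (separation V) (T A) B = b' A B)"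
  by (rule Q.bounded_form_operator[where C = C])
    (auto simp: carr_separation vadd_separation vscale_separation nrm_separation b' addl addr scalel scaler bound add_in scale_in)
 then obtain T where T: "T \<in> extensional (carr (separation V))" "bounded_op (separation V) T"
  "\<And>A B. A \<in> carr (separation V) \<Longrightarrow> B \<in> carr (separation V) \<Longrightarrow> ip (separation V) (T A) B = b' A B" by blast
 show ?thesis
 proof (rule ex1I)
  show "T \<in> extensional (carr (separation V)) \<and> bounded_op (separation V) T \<and>
   (\<forall>x\<in>carr V. \<forall>y\<in>carr V. ip (separation V) (T (cls V x)) (cls V y) = b x y)"
   using T b' by (auto simp: carr_separation)
  fix S assume S: "S \<in> extensional (carr (separation V)) \<and> bounded_op (separation V) S \<and>
   (\<forall>x\<in>carr V. \<forall>y\<in>carr V. ip (separation V) (S (cls V x)) (cls V y) = b x y)"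
  have in_T: "T A \<in> carr (separation V)" "S A \<in> carr (separation V)" if "A \<in> carr (separation V)" for A
   using T(2) S that by (auto simp: bounded_op_def linear_op_def)
  show "S = T"
  proof (rule extensionalityI)
   show "S A = T A" if A: "A \<in> carr (separation V)" for A
   proof (rule Q.inner_ext[OF in_T(2)[OF A] in_T(1)[OF A]])
    fix B assume "B \<in> carr (separation V)"
    then show "ip (separation V) (S A) B = ip (separation V) (T A) B"
     using A S T(3) b' by (auto simp: carr_separation)
   qed
  qed (use S T in auto)
 qed
qed

section \<open>The form of the representation on sections over \<open>Y\<close>\<close>

context induction_data
begin

text \<open>\<open>IndJ_form\<close> integrates against \<open>\<nu>\<close> and carries the roots
  of \<open>d\<close> in its integrand, whereas the Hilbert space uses the density \<open>d\<close>;
  \<open>muInd_density\<close> links the two.\<close>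

definition muNu :: "'y measure" where "muNu = integrated_measure \<mu> \<nu>"

lemma sets_muNu[simp]: "sets muNu = sets borel" and space_muNu[simp]: "space muNu = UNIV"
 unfolding muNu_def using sets_integrated[OF kernel_mu_nu] space_integrated[OF kernel_mu_nu] by auto

lemma meas_muNu: "measurable muNu M = measurable borel M"
 by (rule measurable_cong_sets[OF sets_muNu refl])

lemma nn_muNu: "f \<in> Borel \<Longrightarrow> (NN x. f x d/muNu) = (NN u. NN x. f x d/\<nu> u d/\<mu>)"
 unfolding muNu_def by (rule nn_integral_integrated[OF kernel_mu_nu])

lemma nn_muInd_nud: "f \<in> Borel \<Longrightarrow> (NN x. f x d/muInd) = (NN u. NN x. f x d/\<nu>d u d/\<mu>)"
 unfolding muInd_def by (rule nn_integral_integrated[OF kernel_mu_nud])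

lemma nn_muInd: "f \<in> Borel \<Longrightarrow> (NN x. f x d/muInd) = (NN x. ennreal (d x) * f x d/muNu)"
 unfolding nn_muInd_nud by (subst nn_muNu) (auto intro!: nn_integral_cong nn_nud)

lemma muInd_density: "muInd = density muNu (\<lambda>x. ennreal (d x))"
proof (rule measure_eqI_nn_integral)
 fix f :: "'y \<Rightarrow> ennreal" assume f: "f \<in> Borel"
 show "(NN x. f x d/muInd) = (NN x. f x d/density muNu (\<lambda>x. ennreal (d x)))"
  unfolding nn_muInd[OF f] using f by (subst nn_integral_density) (auto simp: meas_muNu)
qed simp_all

lemma kernel_nu_s_snd: "kernel bYG (\<lambda>p. \<nu> (s (snd p)))"
 by (rule kernel_borel_compose[OF kernel_nu_s borel_snd])

definition MJ :: "(('y \<times> 'g) \<times> 'y) measure" where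
 "MJ = semidirect (semidirect muNu (\<lambda>x. lam (\<Phi> x))) (\<lambda>p. \<nu> (s (snd p)))"

lemma sets_MJ[simp]: "sets MJ = sets borel"
 unfolding MJ_def by (rule sets_semidirect_iterated[OF sets_muNu kernel_lam_Phi kernel_nu_s_snd])

lemma meas_MJ: "measurable MJ M = measurable borel M"
 by (rule measurable_cong_sets[OF sets_MJ refl])

lemma nn_MJ:
 "f \<in> Borel \<Longrightarrow> (NN p. f p d/MJ) = (NN x. NN g. NN y. f ((x, g), y) d/\<nu> (s g) d/lam (\<Phi> x) d/muNu)"
 unfolding MJ_def using nn_semidirect_iterated[OF sets_muNu kernel_lam_Phi kernel_nu_s_snd] by simp

definition wt :: "('y \<times> 'g \<times> 'y \<Rightarrow> complex) \<Rightarrow> ('y \<times> 'g) \<times> 'y \<Rightarrow> real" where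
 "wt f p = cmod (f (fst (fst p), snd (fst p), snd p)) * (W (snd (fst p)) * sqrt (d (fst (fst p))) * sqrt (d (snd p)))"

lemma wt_nonneg: "0 \<le> wt f p" using d_nonneg by (simp add: wt_def)

lemma assoc_measurable: "f \<in> Borel \<Longrightarrow> (\<lambda>p. f (fst (fst p), snd (fst p), snd p)) \<in> borel_measurable bYGY"
 for f :: "'y \<times> 'g \<times> 'y \<Rightarrow> complex"
 by (rule measurable_compose[rotated], assumption)
   (intro borel_measurable_Pair borel_snd measurable_compose[OF borel_fst borel_fst] measurable_compose[OF borel_fst borel_snd])

lemma xgy_measurable:
 "(\<lambda>p. fst (fst p)) \<in> borel_measurable bYGY"
 "(\<lambda>p. snd (fst p)) \<in> borel_measurable bYGY"
 "(\<lambda>p. snd p) \<in> borel_measurable bYGY"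
 using measurable_compose[OF borel_fst borel_fst] measurable_compose[OF borel_fst borel_snd] borel_snd by auto

lemma wgt_measurable: "(\<lambda>p. W (snd (fst p)) * sqrt (d (fst (fst p))) * sqrt (d (snd p))) \<in> borel_measurable bYGY"
 using measurable_compose[OF xgy_measurable(1) d_measurable] measurable_compose[OF xgy_measurable(2) W_measurable]
  measurable_compose[OF xgy_measurable(3) d_measurable] by measurable

lemma wt_measurable: "f \<in> Borel \<Longrightarrow> wt f \<in> Borel"
 unfolding wt_def[abs_def] using assoc_measurable[of f] wgt_measurable by (intro borel_measurable_times) auto

text \<open>Cauchy-Schwarz on \<open>MJ\<close>. One factor carries \<open>b\<close> and
  \<open>d(x)^{1/2}\<close> and sees only the masses of \<open>K2\<close> and \<open>K3\<close>; the
  other carries \<open>a\<close>, \<open>W\<close> and \<open>d(y)^{1/2}\<close> and is controlled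
  by \<open>shift_bound\<close> and the mass of \<open>K1\<close>.\<close>

lemma form_bound:
 assumes f: "f \<in> Borel" and C: "0 \<le> C" and K1: "compact K1" and K2: "compact K2" and K3: "compact K3"
  and le: "\<And>x \<gamma> y. cmod (f (x, \<gamma>, y)) \<le> C * indicator K1 x * indicator K2 \<gamma> * indicator K3 y"
 shows "\<exists>B\<ge>0. \<forall>a\<in>Borel. \<forall>b\<in>Borel.
  (NN p. ennreal (wt f p) * (b (fst (fst p)) * a (snd p)) d/MJ)\<^sup>2 \<le> ennreal B * (NN x. (a x)\<^sup>2 d/muInd) * (NN x. (b x)\<^sup>2 d/muInd)"
proof -
 have Kb: "K1 \<in> sets borel" "K2 \<in> sets borel" "K3 \<in> sets borel" using K1 K2 K3 by (auto intro: borel_compact)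
 obtain B1 where B1: "0 \<le> B1" "\<And>u. u \<in> X0 \<Longrightarrow> emeasure (\<nu> u) K1 \<le> ennreal B1" using nu_bound[OF K1] by blast
 obtain B2 where B2: "0 \<le> B2" "\<And>u. u \<in> X0 \<Longrightarrow> emeasure (lam u) K2 \<le> ennreal B2" using lam_bound[OF K2] by blast
 obtain B3 where B3: "0 \<le> B3" "\<And>u. u \<in> X0 \<Longrightarrow> emeasure (\<nu> u) K3 \<le> ennreal B3" using nu_bound[OF K3] by blast
 obtain B4 where B4: "0 \<le> B4" "\<And>g. g \<in> borel_measurable N0 \<Longrightarrow>
   (NN u. NN \<gamma>. indicator K2 \<gamma> * ennreal ((W \<gamma>)\<^sup>2) * g (s \<gamma>) d/lam u d/\<mu>) \<le> ennreal B4 * (NN u. g u d/\<mu>)"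
  using shift_bound[OF K2] by blast
 have "(NN p. ennreal (wt f p) * (b (fst (fst p)) * a (snd p)) d/MJ)\<^sup>2
   \<le> ennreal (C\<^sup>2 * B3 * B2 * (B1 * B4)) * (NN x. (a x)\<^sup>2 d/muInd) * (NN x. (b x)\<^sup>2 d/muInd)"
  if a: "a \<in> Borel" and b: "b \<in> Borel" for a b
 proof -
  \<comment> \<open>Each indicator goes to the factor where its variable would otherwise be
    integrated without a cut-off; \<open>K2\<close> is needed in both, which is harmless as
    indicators are idempotent.\<close>
  define \<phi> where "\<phi> p = ennreal (C * sqrt (d (fst (fst p)))) * b (fst (fst p)) * indicator K2 (snd (fst p)) * indicator K3 (snd p)"
   for p :: "('y \<times> 'g) \<times> 'y"
  define \<psi> where "\<psi> p = indicator K1 (fst (fst p)) * (indicator K2 (snd (fst p)) * ennreal (W (snd (fst p))) * (ennreal (sqrt (d (snd p))) * a (snd p)))"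
   for p :: "('y \<times> 'g) \<times> 'y"
  note [measurable] = measurable_compose[OF xgy_measurable(1) d_measurable] measurable_compose[OF xgy_measurable(2) W_measurable]
   measurable_compose[OF xgy_measurable(3) d_measurable] measurable_compose[OF xgy_measurable(1) b] measurable_compose[OF xgy_measurable(3) a]
   measurable_compose[OF xgy_measurable(1) borel_measurable_indicator[OF Kb(1)]]
   measurable_compose[OF xgy_measurable(2) borel_measurable_indicator[OF Kb(2)]]
   measurable_compose[OF xgy_measurable(3) borel_measurable_indicator[OF Kb(3)]]
  have \<phi>m: "\<phi> \<in> Borel" and \<psi>m: "\<psi> \<in> Borel"
   unfolding \<phi>_def[abs_def] \<psi>_def[abs_def] by measurable
  have le: "ennreal (wt f p) * (b (fst (fst p)) * a (snd p)) \<le> \<phi> p * \<psi> p" for p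
  proof -
   obtain x \<gamma> y where p: "p = ((x, \<gamma>), y)" by (metis surj_pair)
   have "wt f p \<le> (C * indicator K1 x * indicator K2 \<gamma> * indicator K3 y) * (W \<gamma> * sqrt (d x) * sqrt (d y))"
    unfolding wt_def p fst_conv snd_conv using d_nonneg by (intro mult_right_mono[OF le]) auto
   then have "ennreal (wt f p) \<le> ennreal ((C * indicator K1 x * indicator K2 \<gamma> * indicator K3 y) * (W \<gamma> * sqrt (d x) * sqrt (d y)))"
    by (rule ennreal_leI)
   also have "\<dots> = ennreal (C * sqrt (d x)) * indicator K1 x * indicator K2 \<gamma> * indicator K3 y * ennreal (W \<gamma>) * ennreal (sqrt (d y))"
    using C d_nonneg by (auto simp: indicator_def mult_ac simp flip: ennreal_mult)
   finally have "ennreal (wt f p) * (b x * a y) \<le> \<dots> * (b x * a y)" by (rule mult_right_mono) simp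
   also have "\<dots> = \<phi> p * \<psi> p" unfolding \<phi>_def \<psi>_def p by (simp add: indicator_def mult_ac)
   finally show ?thesis by (simp add: p)
  qed
  have "(NN p. (\<phi> p)\<^sup>2 d/MJ) = (NN x. NN \<gamma>. NN y. (\<phi> ((x, \<gamma>), y))\<^sup>2 d/\<nu> (s \<gamma>) d/lam (\<Phi> x) d/muNu)"
   using \<phi>m by (intro nn_MJ) measurable
  also have "\<dots> \<le> (NN x. ennreal (C\<^sup>2 * B3 * B2) * (ennreal (d x) * (b x)\<^sup>2) d/muNu)"
  proof (rule nn_integral_mono)
   fix x
   let ?c = "ennreal (C\<^sup>2) * (ennreal (d x) * (b x)\<^sup>2)"
   have sq: "(\<phi> ((x, \<gamma>), y))\<^sup>2 = (?c * indicator K2 \<gamma>) * indicator K3 y" for \<gamma> y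
    using C d_nonneg[of x] by (auto simp: \<phi>_def indicator_def power_mult_distrib ennreal_power ennreal_mult mult_ac)
   have "(NN \<gamma>. NN y. (\<phi> ((x, \<gamma>), y))\<^sup>2 d/\<nu> (s \<gamma>) d/lam (\<Phi> x)) \<le> (NN \<gamma>. (?c * ennreal B3) * indicator K2 \<gamma> d/lam (\<Phi> x))"
   proof (rule nn_integral_mono)
    fix \<gamma>
    have "(NN y. (\<phi> ((x, \<gamma>), y))\<^sup>2 d/\<nu> (s \<gamma>)) = ?c * indicator K2 \<gamma> * emeasure (\<nu> (s \<gamma>)) K3"
     unfolding sq using Kb by (intro nn_integral_cmult_indicator) (simp add: sets_nu)
    also have "\<dots> \<le> ?c * indicator K2 \<gamma> * ennreal B3" by (intro mult_left_mono B3) auto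
    finally show "(NN y. (\<phi> ((x, \<gamma>), y))\<^sup>2 d/\<nu> (s \<gamma>)) \<le> (?c * ennreal B3) * indicator K2 \<gamma>" by (simp add: mult_ac)
   qed
   also have "\<dots> = ?c * ennreal B3 * emeasure (lam (\<Phi> x)) K2"
    using Kb by (intro nn_integral_cmult_indicator) (simp add: sets_lam)
   also have "\<dots> \<le> ?c * ennreal B3 * ennreal B2" by (intro mult_left_mono B2) auto
   also have "\<dots> = ennreal (C\<^sup>2 * B3 * B2) * (ennreal (d x) * (b x)\<^sup>2)" using B3 B2 C by (simp add: ennreal_mult mult_ac)
   finally show "(NN \<gamma>. NN y. (\<phi> ((x, \<gamma>), y))\<^sup>2 d/\<nu> (s \<gamma>) d/lam (\<Phi> x)) \<le> ennreal (C\<^sup>2 * B3 * B2) * (ennreal (d x) * (b x)\<^sup>2)" .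
  qed
  also have "\<dots> = ennreal (C\<^sup>2 * B3 * B2) * (NN x. (b x)\<^sup>2 d/muInd)"
   using b by (subst nn_integral_cmult) (auto simp: meas_muNu nn_muInd)
  finally have 1: "(NN p. (\<phi> p)\<^sup>2 d/MJ) \<le> ennreal (C\<^sup>2 * B3 * B2) * (NN x. (b x)\<^sup>2 d/muInd)" .
  define g where "g u = (NN y. (a y)\<^sup>2 d/\<nu>d u)" for u
  have a2: "(\<lambda>y. (a y)\<^sup>2) \<in> Borel" using a by measurable
  have gm: "g \<in> borel_measurable N0"
   using kernel_nn_measurable[OF kernel_nud measurable_compose[OF measurable_snd a2]] by (simp add: g_def[abs_def])
  define c where "c u = (NN \<gamma>. indicator K2 \<gamma> * ennreal ((W \<gamma>)\<^sup>2) * g (s \<gamma>) d/lam u)" for u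
  have gs: "(\<lambda>\<gamma>. indicator K2 \<gamma> * ennreal ((W \<gamma>)\<^sup>2) * g (s \<gamma>)) \<in> Borel"
   using measurable_compose[OF s_N0 gm] Kb by measurable
  have cm: "c \<in> borel_measurable N0"
   using kernel_nn_measurable[OF kernel_lam measurable_compose[OF measurable_snd gs]] by (simp add: c_def[abs_def])
  have "(NN p. (\<psi> p)\<^sup>2 d/MJ) = (NN x. NN \<gamma>. NN y. (\<psi> ((x, \<gamma>), y))\<^sup>2 d/\<nu> (s \<gamma>) d/lam (\<Phi> x) d/muNu)"
   using \<psi>m by (intro nn_MJ) measurable
  also have "\<dots> = (NN x. indicator K1 x * c (\<Phi> x) d/muNu)"
  proof (rule nn_integral_cong)
   fix x
   have sq: "(\<psi> ((x, \<gamma>), y))\<^sup>2 = (indicator K1 x * (indicator K2 \<gamma> * ennreal ((W \<gamma>)\<^sup>2))) * (ennreal (d y) * (a y)\<^sup>2)" for \<gamma> y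
    using d_nonneg[of y] by (auto simp: \<psi>_def indicator_def power_mult_distrib ennreal_power)
   have da: "(\<lambda>y. ennreal (d y) * (a y)\<^sup>2) \<in> Borel" using a by measurable
   have "(NN y. (\<psi> ((x, \<gamma>), y))\<^sup>2 d/\<nu> (s \<gamma>)) = indicator K1 x * (indicator K2 \<gamma> * ennreal ((W \<gamma>)\<^sup>2) * g (s \<gamma>))" for \<gamma>
    unfolding sq g_def nn_nud[OF s_unit a2] using da by (subst nn_integral_cmult) (auto simp: meas_nu mult_ac)
   then have "(NN \<gamma>. NN y. (\<psi> ((x, \<gamma>), y))\<^sup>2 d/\<nu> (s \<gamma>) d/lam (\<Phi> x)) = (NN \<gamma>. indicator K1 x * (indicator K2 \<gamma> * ennreal ((W \<gamma>)\<^sup>2) * g (s \<gamma>)) d/lam (\<Phi> x))"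
    by simp
   also have "\<dots> = indicator K1 x * c (\<Phi> x)"
    unfolding c_def using gs by (intro nn_integral_cmult) (simp add: meas_lam)
   finally show "(NN \<gamma>. NN y. (\<psi> ((x, \<gamma>), y))\<^sup>2 d/\<nu> (s \<gamma>) d/lam (\<Phi> x)) = indicator K1 x * c (\<Phi> x)" .
  qed
  also have "\<dots> = (NN u. NN x. indicator K1 x * c (\<Phi> x) d/\<nu> u d/\<mu>)"
   using measurable_compose[OF Phi_N0 cm] Kb by (intro nn_muNu borel_measurable_times_ennreal borel_measurable_indicator) auto
  also have "\<dots> \<le> (NN u. ennreal B1 * c u d/\<mu>)"
  proof (rule nn_integral_mono)
   fix u assume "u \<in> space \<mu>"
   then have u: "u \<in> X0" by simp
   have "(NN x. indicator K1 x * c (\<Phi> x) d/\<nu> u) = (NN x. c u * indicator K1 x d/\<nu> u)"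
    by (rule nn_integral_cong_AE, rule eventually_mono[OF nu_AE[OF u]]) (simp add: mult.commute)
   also have "\<dots> = c u * emeasure (\<nu> u) K1" using Kb by (intro nn_integral_cmult_indicator) (simp add: sets_nu[OF u])
   also have "\<dots> \<le> c u * ennreal B1" using B1(2)[OF u] by (intro mult_left_mono) auto
   finally show "(NN x. indicator K1 x * c (\<Phi> x) d/\<nu> u) \<le> ennreal B1 * c u" by (simp add: mult.commute)
  qed
  also have "\<dots> = ennreal B1 * (NN u. c u d/\<mu>)" using cm by (intro nn_integral_cmult) (simp add: meas_mu)
  also have "\<dots> \<le> ennreal B1 * (ennreal B4 * (NN u. g u d/\<mu>))"
   unfolding c_def by (intro mult_left_mono B4(2)[OF gm]) simp
  also have "(NN u. g u d/\<mu>) = (NN x. (a x)\<^sup>2 d/muInd)" unfolding g_def by (rule nn_muInd_nud[OF a2, symmetric])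
  finally have 2: "(NN p. (\<psi> p)\<^sup>2 d/MJ) \<le> ennreal (B1 * B4) * (NN x. (a x)\<^sup>2 d/muInd)"
   using B1 B4 by (simp add: ennreal_mult mult_ac)
  have "(NN p. ennreal (wt f p) * (b (fst (fst p)) * a (snd p)) d/MJ)\<^sup>2 \<le> (NN p. \<phi> p * \<psi> p d/MJ)\<^sup>2"
   by (intro power_mono nn_integral_mono le) simp
  also have "\<dots> \<le> (NN p. (\<phi> p)\<^sup>2 d/MJ) * (NN p. (\<psi> p)\<^sup>2 d/MJ)"
   using \<phi>m \<psi>m by (intro Cauchy_Schwarz_nn_integral) (simp_all add: meas_MJ)
  also have "\<dots> \<le> (ennreal (C\<^sup>2 * B3 * B2) * (NN x. (b x)\<^sup>2 d/muInd)) * (ennreal (B1 * B4) * (NN x. (a x)\<^sup>2 d/muInd))"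
   by (intro mult_mono 1 2) auto
  also have "\<dots> = ennreal (C\<^sup>2 * B3 * B2 * (B1 * B4)) * (NN x. (a x)\<^sup>2 d/muInd) * (NN x. (b x)\<^sup>2 d/muInd)"
   using B1 B2 B3 B4 C by (simp add: ennreal_mult mult_ac)
  finally show ?thesis .
 qed
 then show ?thesis using B1 B2 B3 B4 C by (intro exI[of _ "C\<^sup>2 * B3 * B2 * (B1 * B4)"]) auto
qed


text \<open>What the estimates use of functions in \<open>Cc (YGY G \<Phi>)\<close>: compact support
  is replaced by separate cut-offs in the three variables.\<close>

definition KK :: "('y \<times> 'g \<times> 'y \<Rightarrow> complex) \<Rightarrow> bool" where
 "KK f \<longleftrightarrow> f \<in> Borel \<and> (\<forall>x g y. f (x, g, y) \<noteq> 0 \<longrightarrow> \<Phi> x = r g \<and> \<Phi> y = s g) \<and>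
   (\<exists>C K1 K2 K3. 0 \<le> C \<and> compact K1 \<and> compact K2 \<and> compact K3 \<and>
    (\<forall>x g y. cmod (f (x, g, y)) \<le> C * indicator K1 x * indicator K2 g * indicator K3 y))"

lemma closed_YGY: "closed (YGY G \<Phi>)"
proof -
 have "YGY G \<Phi> = {p. \<Phi> (fst p) = r (fst (snd p))} \<inter> {p. \<Phi> (snd (snd p)) = s (fst (snd p))}"
  by (auto simp: YGY_def)
 then show ?thesis
  by (auto intro!: closed_Int closed_Collect_eq continuous_on_compose2[OF contPhi] continuous_on_compose2[OF continuous_rng]
   continuous_on_compose2[OF continuous_src] continuous_intros)
qed

lemma Cc_KK:
 assumes f: "f \<in> Cc (YGY G \<Phi>)"
 shows "KK f"
proof -
 obtain C K where C: "0 \<le> C" and K: "compact K" and le: "\<And>p. cmod (f p) \<le> C * indicator K p"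
  using Cc_bound[OF f] by blast
 have "cmod (f (x, g, y)) \<le> C * indicator (fst ` K) x * indicator ((\<lambda>p. fst (snd p)) ` K) g * indicator ((\<lambda>p. snd (snd p)) ` K) y" for x g y
 proof (cases "(x, g, y) \<in> K")
  case True
  then have "x \<in> fst ` K" "g \<in> (\<lambda>p. fst (snd p)) ` K" "y \<in> (\<lambda>p. snd (snd p)) ` K" by force+
  then show ?thesis using le[of "(x, g, y)"] True by simp
 next
  case False
  then have "cmod (f (x, g, y)) \<le> 0" using le[of "(x, g, y)"] by simp
  then show ?thesis using C by (auto intro: order_trans)
 qed
 moreover have "compact (fst ` K)" "compact ((\<lambda>p. fst (snd p)) ` K)" "compact ((\<lambda>p. snd (snd p)) ` K)"
  using K by (auto intro!: compact_continuous_image continuous_intros)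
 moreover have "f (x, g, y) = 0" if "\<not> (\<Phi> x = r g \<and> \<Phi> y = s g)" for x g y
  using f that by (auto simp: Cc_def YGY_def)
 ultimately show ?thesis unfolding KK_def using Cc_measurable[OF f closed_YGY] C by blast
qed

definition ap :: "('y \<Rightarrow> 'h) \<Rightarrow> ('y \<Rightarrow> 'h) \<Rightarrow> ('y \<times> 'g) \<times> 'y \<Rightarrow> complex" where
 "ap h k p = (if \<Phi> (fst (fst p)) = r (snd (fst p)) \<and> \<Phi> (snd p) = s (snd (fst p))
   then ip (H (r (snd (fst p)))) (L (snd (fst p)) (h (snd p))) (k (fst (fst p))) else 0)"

lemma ind_in: "ind.bsec h \<Longrightarrow> h x \<in> carr (H (\<Phi> x))" using ind.bsec_in[of h x] by simp

lemma ap_measurable: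
 assumes h: "ind.bsec h" and k: "ind.bsec k"
 shows "ap h k \<in> Borel"
proof -
 note m = measurable_compose[OF xgy_measurable(1) Phi_N0] measurable_compose[OF xgy_measurable(3) Phi_N0]
 have P: "{p \<in> space borel. \<Phi> (fst (fst p)) = r (snd (fst p)) \<and> \<Phi> (snd p) = s (snd (fst p))} \<in> sets bYGY"
  using measurable_compose[OF xgy_measurable(1) Phi_measurable] measurable_compose[OF xgy_measurable(3) Phi_measurable]
   measurable_compose[OF xgy_measurable(2) r_measurable] measurable_compose[OF xgy_measurable(2) s_measurable] by measurable
 have "(\<lambda>p. if \<Phi> (fst (fst p)) = r (snd (fst p)) \<and> \<Phi> (snd p) = s (snd (fst p))
   then ip (H (\<Phi> (fst (fst p)))) (L (snd (fst p)) (h (snd p))) (k (fst (fst p))) else 0) \<in> Borel"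
  by (rule act_pair_measurable[OF xgy_measurable(2) P m(2,1) _ psec_compose[OF Phi_N0 _ xgy_measurable(3)] psec_compose[OF Phi_N0 _ xgy_measurable(1)]])
    (simp_all add: h[unfolded ind_bsec] k[unfolded ind_bsec])
 then show ?thesis by (rule measurable_eqI[rotated]) (simp add: ap_def)
qed

definition nk :: "('y \<Rightarrow> 'h) \<Rightarrow> 'y \<Rightarrow> real" where "nk k x = nrm (H (\<Phi> x)) (k x)"

lemma nk_nonneg: "ind.bsec k \<Longrightarrow> 0 \<le> nk k x"
 unfolding nk_def by (rule semi_inner_space.nrm_nonneg[OF ind.semi ind_in]) auto

lemma nk_measurable: "ind.bsec k \<Longrightarrow> nk k \<in> Borel"
 using ind.nrm_measurable[of k] by (simp add: nk_def[abs_def] meas_muInd)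

lemma ap_bound:
 assumes h: "ind.bsec h" and k: "ind.bsec k"
 shows "cmod (ap h k ((x, g), y)) \<le> nk k x * nk h y"
proof (cases "\<Phi> x = r g \<and> \<Phi> y = s g")
 case True
 interpret hilbert_space "H (r g)" by (rule hilH) simp
 have hy: "h y \<in> carr (H (s g))" and kx: "k x \<in> carr (H (r g))"
  using ind_in[OF h, of y] ind_in[OF k, of x] True by auto
 show ?thesis using Cauchy_Schwarz[OF act_in[OF hy] kx] act_nrm[OF hy] True by (simp add: ap_def nk_def mult.commute)
qed (use nk_nonneg[OF h] nk_nonneg[OF k] in \<open>auto simp: ap_def\<close>)

definition JJ :: "('y \<times> 'g \<times> 'y \<Rightarrow> complex) \<Rightarrow> ('y \<Rightarrow> 'h) \<Rightarrow> ('y \<Rightarrow> 'h) \<Rightarrow> ('y \<times> 'g) \<times> 'y \<Rightarrow> complex" where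
 "JJ f h k p = f (fst (fst p), snd (fst p), snd p) * ap h k p
   * cor (W (snd (fst p)) * sqrt (d (fst (fst p))) * sqrt (d (snd p)))"

text \<open>The zero extension inside \<open>ap\<close> agrees with the bare inner product because
  \<open>f\<close> already vanishes off \<open>YGY\<close>.\<close>

lemma JJ_eq:
 "KK f \<Longrightarrow> JJ f h k ((x, g), y) = f (x, g, y) * ip (H (\<Phi> x)) (L g (h y)) (k x) * cor (\<Delta> g powr (-1/2) * sqrt (d x) * sqrt (d y))"
 by (cases "f (x, g, y) = 0") (auto simp: KK_def JJ_def ap_def W_def)

lemma JJ_measurable:
 assumes f: "KK f" and h: "ind.bsec h" and k: "ind.bsec k"
 shows "JJ f h k \<in> Borel"
proof -
 have "(\<lambda>p. cor (W (snd (fst p)) * sqrt (d (fst (fst p))) * sqrt (d (snd p)))) \<in> borel_measurable bYGY"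
  by (rule measurable_compose[OF wgt_measurable]) measurable
 then show ?thesis
  unfolding JJ_def[abs_def] using assoc_measurable[of f] f ap_measurable[OF h k] by (intro borel_measurable_times) (auto simp: KK_def)
qed

lemma JJ_norm:
 assumes h: "ind.bsec h" and k: "ind.bsec k"
 shows "ennreal (norm (JJ f h k p)) \<le> ennreal (wt f p) * (ennreal (nk k (fst (fst p))) * ennreal (nk h (snd p)))"
proof -
 obtain x g y where p: "p = ((x, g), y)" by (metis surj_pair)
 have "norm (JJ f h k p) = wt f p * cmod (ap h k p)"
  using d_nonneg by (simp add: JJ_def wt_def norm_mult mult_ac)
 also have "\<dots> \<le> wt f p * (nk k x * nk h y)"
  unfolding p by (intro mult_left_mono ap_bound[OF h k] wt_nonneg)
 finally have "ennreal (norm (JJ f h k p)) \<le> ennreal (wt f p * (nk k x * nk h y))" by (rule ennreal_leI)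
 then show ?thesis using wt_nonneg nk_nonneg[OF h] nk_nonneg[OF k] by (simp add: p ennreal_mult)
qed

lemma KK_bound:
 assumes f: "KK f"
 shows "\<exists>B\<ge>0. \<forall>a\<in>Borel. \<forall>b\<in>Borel.
  (NN p. ennreal (wt f p) * (b (fst (fst p)) * a (snd p)) d/MJ)\<^sup>2 \<le> ennreal B * (NN x. (a x)\<^sup>2 d/muInd) * (NN x. (b x)\<^sup>2 d/muInd)"
proof -
 obtain C K1 K2 K3 where "0 \<le> C" "compact K1" "compact K2" "compact K3"
  and le: "\<And>x g y. cmod (f (x, g, y)) \<le> C * indicator K1 x * indicator K2 g * indicator K3 y"
  using f unfolding KK_def by blast
 then show ?thesis using f by (intro form_bound[of f C K1 K2 K3]) (auto simp: KK_def)
qed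

lemma nk_sq: "(NN x. (ennreal (nk h x))\<^sup>2 d/muInd) = sqn muInd (\<lambda>x. H (\<Phi> x)) h" if "ind.bsec h"
 using nk_nonneg[OF that] unfolding nk_def by (simp add: ennreal_power)

lemma JJ_nn_bound:
 assumes f: "KK f"
 shows "\<exists>B\<ge>0. \<forall>h k. ind.l2 h \<longrightarrow> ind.l2 k \<longrightarrow> (NN p. ennreal (norm (JJ f h k p)) d/MJ)\<^sup>2
  \<le> ennreal B * sqn muInd (\<lambda>x. H (\<Phi> x)) h * sqn muInd (\<lambda>x. H (\<Phi> x)) k"
proof -
 obtain B where B: "0 \<le> B" "\<And>a b. a \<in> Borel \<Longrightarrow> b \<in> Borel \<Longrightarrow>
  (NN p. ennreal (wt f p) * (b (fst (fst p)) * a (snd p)) d/MJ)\<^sup>2 \<le> ennreal B * (NN x. (a x)\<^sup>2 d/muInd) * (NN x. (b x)\<^sup>2 d/muInd)"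
  using KK_bound[OF f] by blast
 have "(NN p. ennreal (norm (JJ f h k p)) d/MJ)\<^sup>2
  \<le> ennreal B * sqn muInd (\<lambda>x. H (\<Phi> x)) h * sqn muInd (\<lambda>x. H (\<Phi> x)) k"
  if "ind.l2 h" "ind.l2 k" for h k
 proof -
  have h: "ind.bsec h" and k: "ind.bsec k" using that by (auto simp: ind.l2_def)
  have m: "(\<lambda>x. ennreal (nk h x)) \<in> Borel" "(\<lambda>x. ennreal (nk k x)) \<in> Borel"
   using nk_measurable[OF h] nk_measurable[OF k] by auto
  have "(NN p. ennreal (norm (JJ f h k p)) d/MJ)\<^sup>2
   \<le> (NN p. ennreal (wt f p) * (ennreal (nk k (fst (fst p))) * ennreal (nk h (snd p))) d/MJ)\<^sup>2"
   by (intro power_mono nn_integral_mono JJ_norm[OF h k]) simp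
  also have "\<dots> \<le> ennreal B * (NN x. (ennreal (nk h x))\<^sup>2 d/muInd) * (NN x. (ennreal (nk k x))\<^sup>2 d/muInd)"
   by (rule B(2)[OF m])
  finally show ?thesis by (simp only: nk_sq[OF h] nk_sq[OF k])
 qed
 then show ?thesis using B(1) by blast
qed

lemma JJ_fin:
 assumes f: "KK f" and h: "ind.l2 h" and k: "ind.l2 k"
 shows "(NN p. ennreal (norm (JJ f h k p)) d/MJ) < \<infinity>"
proof -
 obtain B where B: "(NN p. ennreal (norm (JJ f h k p)) d/MJ)\<^sup>2
  \<le> ennreal B * sqn muInd (\<lambda>x. H (\<Phi> x)) h * sqn muInd (\<lambda>x. H (\<Phi> x)) k"
  using JJ_nn_bound[OF f] h k by blast
 have "(NN p. ennreal (norm (JJ f h k p)) d/MJ)\<^sup>2 < \<infinity>"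
  using h k by (intro le_less_trans[OF B]) (simp add: ind.l2_def ennreal_mult_less_top)
 then show ?thesis by (rule ennreal_sq_finite)
qed

lemma JJ_integrable:
 assumes f: "KK f" and h: "ind.l2 h" and k: "ind.l2 k"
 shows "integrable MJ (JJ f h k)"
 using JJ_fin[OF assms] JJ_measurable[OF f] h k by (simp add: integrable_iff_bounded meas_MJ ind.l2_def)

abbreviation "JF \<equiv> IndJ_form G lam \<Phi> \<nu> d R \<Delta>"

lemma JF_iterated:
 assumes f: "KK f" and h: "ind.l2 h" and k: "ind.l2 k"
 shows "JF f h k = (LINT p|MJ. JJ f h k p)"
  and "JF f h k = (LINT x|muNu. LINT g|lam (\<Phi> x). LINT y|\<nu> (s g). JJ f h k ((x, g), y))"
proof -
 have Jm: "JJ f h k \<in> Borel" using JJ_measurable[OF f] h k by (simp add: ind.l2_def)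
 have nJ: "(\<lambda>p. ennreal (norm (JJ f h k p))) \<in> Borel" using Jm by measurable
 have fin: "(NN x. NN g. NN y. ennreal (norm (JJ f h k ((x, g), y))) d/\<nu> (s (snd (x, g))) d/lam (\<Phi> x) d/muNu) < \<infinity>"
  using JJ_fin[OF f h k] by (simp add: nn_MJ[OF nJ])
 define I where "I K x = (LINT g|K. LINT y|\<nu> (s g). JJ f h k ((x, g), y))" for K x
 have inner: "(\<lambda>p. LINT y|\<nu> (s (snd p)). JJ f h k (p, y)) \<in> Borel"
  by (rule integral_kernel_borel[OF kernel_nu_s_snd Jm])
 have Im: "(\<lambda>x. I (lam (\<Phi> x)) x) \<in> Borel"
  unfolding I_def using integral_kernel_borel[OF kernel_lam_Phi inner] by simp
 have Im': "(\<lambda>x. I (lam u) x) \<in> Borel" if "u \<in> X0" for u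
  unfolding I_def using integral_kernel_borel[OF kernel_const_lam[OF that] inner] by simp
 have 1: "(LINT p|MJ. JJ f h k p) = (LINT x|muNu. I (lam (\<Phi> x)) x)"
  unfolding MJ_def I_def using integral_semidirect_iterated(2)[OF sets_muNu kernel_lam_Phi kernel_nu_s_snd Jm fin] by simp
 have nI: "(\<lambda>x. ennreal (norm (I (lam (\<Phi> x)) x))) \<in> Borel" using Im by measurable
 have "(NN u. NN x. ennreal (norm (I (lam (\<Phi> x)) x)) d/\<nu> u d/\<mu>) = (NN x. ennreal (norm (I (lam (\<Phi> x)) x)) d/muNu)"
  by (rule nn_muNu[OF nI, symmetric])
 also have "\<dots> \<le> (NN x. NN g. NN y. ennreal (norm (JJ f h k ((x, g), y))) d/\<nu> (s g) d/lam (\<Phi> x) d/muNu)"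
  unfolding I_def by (rule nn_integral_mono, rule order_trans[OF norm_integral_le], rule nn_integral_mono, rule norm_integral_le)
 also have "\<dots> < \<infinity>" using fin by simp
 finally have "(LINT x|muNu. I (lam (\<Phi> x)) x) = (LINT u|\<mu>. LINT x|\<nu> u. I (lam (\<Phi> x)) x)"
  unfolding muNu_def by (rule integral_integrated(3)[OF kernel_mu_nu Im])
 \<comment> \<open>\<open>\<nu> u\<close> is carried by the points with \<open>\<Phi> x = u\<close>,
   so \<open>lam (\<Phi> x)\<close> may be replaced by the \<open>lam u\<close> of the
   definition.\<close>
 also have "\<dots> = (LINT u|\<mu>. LINT x|\<nu> u. I (lam u) x)"
 proof (rule Bochner_Integration.integral_cong[OF refl])
  fix u assume "u \<in> space \<mu>"
  then have u: "u \<in> X0" by simp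
  show "(LINT x|\<nu> u. I (lam (\<Phi> x)) x) = (LINT x|\<nu> u. I (lam u) x)"
   by (rule integral_cong_AE) (use Im Im'[OF u] nu_AE[OF u] in \<open>auto simp: meas_nu[OF u] elim: eventually_mono\<close>)
 qed
 also have "\<dots> = JF f h k"
  unfolding IndJ_form_def I_def by (simp only: JJ_eq[OF f])
 finally have 2: "(LINT x|muNu. I (lam (\<Phi> x)) x) = JF f h k" .
 show "JF f h k = (LINT p|MJ. JJ f h k p)" by (simp only: 1 2)
 show "JF f h k = (LINT x|muNu. LINT g|lam (\<Phi> x). LINT y|\<nu> (s g). JJ f h k ((x, g), y))"
  using 2 unfolding I_def by simp
qed

lemma ap_linear:
 assumes h: "ind.bsec h" and h': "ind.bsec h'" and k: "ind.bsec k"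
 shows "ap (\<lambda>x. vadd (H (\<Phi> x)) (h x) (h' x)) k p = ap h k p + ap h' k p"
  and "ap (\<lambda>x. vscale (H (\<Phi> x)) c (h x)) k p = c * ap h k p"
  and "ap k (\<lambda>x. vadd (H (\<Phi> x)) (h x) (h' x)) p = ap k h p + ap k h' p"
  and "ap k (\<lambda>x. vscale (H (\<Phi> x)) c (h x)) p = cnj c * ap k h p"
proof -
 obtain x g y where p: "p = ((x, g), y)" by (metis surj_pair)
 interpret hilbert_space "H (r g)" by (rule hilH) simp
 have y: "h y \<in> carr (H (s g))" "h' y \<in> carr (H (s g))" "k y \<in> carr (H (s g))" if "\<Phi> y = s g"
  using ind_in[OF h, of y] ind_in[OF h', of y] ind_in[OF k, of y] that by auto
 have x: "h x \<in> carr (H (r g))" "h' x \<in> carr (H (r g))" "k x \<in> carr (H (r g))" if "\<Phi> x = r g"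
  using ind_in[OF h, of x] ind_in[OF h', of x] ind_in[OF k, of x] that by auto
 show "ap (\<lambda>x. vadd (H (\<Phi> x)) (h x) (h' x)) k p = ap h k p + ap h' k p"
  "ap (\<lambda>x. vscale (H (\<Phi> x)) c (h x)) k p = c * ap h k p"
  "ap k (\<lambda>x. vadd (H (\<Phi> x)) (h x) (h' x)) p = ap k h p + ap k h' p"
  "ap k (\<lambda>x. vscale (H (\<Phi> x)) c (h x)) p = cnj c * ap k h p"
  by (auto simp: ap_def p x y act_add act_scale act_in inner_simps)
qed

lemma JF_linear:
 assumes f: "KK f" and h: "ind.l2 h" and h': "ind.l2 h'" and k: "ind.l2 k"
 shows "JF f (\<lambda>x. vadd (H (\<Phi> x)) (h x) (h' x)) k = JF f h k + JF f h' k"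
  and "JF f (\<lambda>x. vscale (H (\<Phi> x)) c (h x)) k = c * JF f h k"
  and "JF f k (\<lambda>x. vadd (H (\<Phi> x)) (h x) (h' x)) = JF f k h + JF f k h'"
  and "JF f k (\<lambda>x. vscale (H (\<Phi> x)) c (h x)) = cnj c * JF f k h"
proof -
 have b: "ind.bsec h" "ind.bsec h'" "ind.bsec k" using h h' k by (auto simp: ind.l2_def)
 note e = JF_iterated(1)[OF f]
 note i = JJ_integrable[OF f]
 have "JJ f (\<lambda>x. vadd (H (\<Phi> x)) (h x) (h' x)) k p = JJ f h k p + JJ f h' k p"
  "JJ f k (\<lambda>x. vadd (H (\<Phi> x)) (h x) (h' x)) p = JJ f k h p + JJ f k h' p"
  "JJ f (\<lambda>x. vscale (H (\<Phi> x)) c (h x)) k p = c * JJ f h k p"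
  "JJ f k (\<lambda>x. vscale (H (\<Phi> x)) c (h x)) p = cnj c * JJ f k h p" for p
  by (simp_all add: JJ_def ap_linear[OF b] algebra_simps)
 note J = this
 show "JF f (\<lambda>x. vadd (H (\<Phi> x)) (h x) (h' x)) k = JF f h k + JF f h' k"
  using i[OF h k] i[OF h' k] by (simp add: e[OF ind.l2_add[OF h h'] k] e[OF h k] e[OF h' k] J)
 show "JF f k (\<lambda>x. vadd (H (\<Phi> x)) (h x) (h' x)) = JF f k h + JF f k h'"
  using i[OF k h] i[OF k h'] by (simp add: e[OF k ind.l2_add[OF h h']] e[OF k h] e[OF k h'] J)
 show "JF f (\<lambda>x. vscale (H (\<Phi> x)) c (h x)) k = c * JF f h k"
  by (simp add: e[OF ind.l2_scale[OF h] k] e[OF h k] J)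
 show "JF f k (\<lambda>x. vscale (H (\<Phi> x)) c (h x)) = cnj c * JF f k h"
  by (simp add: e[OF k ind.l2_scale[OF h]] e[OF k h] J)
qed

lemma JF_bound:
 assumes f: "KK f"
 shows "\<exists>C. \<forall>h\<in>carr ind.S. \<forall>k\<in>carr ind.S. cmod (JF f h k) \<le> C * nrm ind.S h * nrm ind.S k"
proof -
 obtain B where B: "0 \<le> B" "\<And>h k. ind.l2 h \<Longrightarrow> ind.l2 k \<Longrightarrow> (NN p. ennreal (norm (JJ f h k p)) d/MJ)\<^sup>2
  \<le> ennreal B * sqn muInd (\<lambda>x. H (\<Phi> x)) h * sqn muInd (\<lambda>x. H (\<Phi> x)) k"
  using JJ_nn_bound[OF f] by blast
 have "cmod (JF f h k) \<le> sqrt B * nrm ind.S h * nrm ind.S k" if h: "h \<in> carr ind.S" and k: "k \<in> carr ind.S" for h k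
 proof -
  have l: "ind.l2 h" "ind.l2 k" using h k by (auto simp: ind.carr_S)
  have n: "0 \<le> nrm ind.S h" "0 \<le> nrm ind.S k" using h k by (auto intro: ind.S.nrm_nonneg)
  have "ennreal ((cmod (JF f h k))\<^sup>2) = (ennreal (cmod (LINT p|MJ. JJ f h k p)))\<^sup>2"
   by (simp add: JF_iterated(1)[OF f l] ennreal_power)
  also have "\<dots> \<le> (NN p. ennreal (norm (JJ f h k p)) d/MJ)\<^sup>2" by (intro power_mono norm_integral_le) simp
  also have "\<dots> \<le> ennreal B * ennreal ((nrm ind.S h)\<^sup>2) * ennreal ((nrm ind.S k)\<^sup>2)"
   unfolding ind.nrm_S[OF h] ind.nrm_S[OF k] by (rule B(2)[OF l])
  also have "\<dots> = ennreal ((sqrt B * nrm ind.S h * nrm ind.S k)\<^sup>2)" using B(1) by (simp add: ennreal_mult power_mult_distrib)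
  finally have "(cmod (JF f h k))\<^sup>2 \<le> (sqrt B * nrm ind.S h * nrm ind.S k)\<^sup>2" by (simp add: ennreal_le_iff)
  then show ?thesis by (rule power2_le_imp_le) (intro mult_nonneg_nonneg real_sqrt_ge_zero B(1) n)
 qed
 then show ?thesis by (intro exI[of _ "sqrt B"]) simp
qed

abbreviation Jsp :: "('y \<Rightarrow> 'h) set ips" where "Jsp \<equiv> IndJ_space \<Phi> \<nu> d R"

lemma Jsp_eq: "Jsp = separation ind.S"
 by (simp add: IndJ_space_def L2_def muInd_def)

lemma hilbert_Jsp: "hilbert_space Jsp"
 using ind.hilbert_L2 by (simp add: IndJ_space_def muInd_def)

text \<open>The form is sesquilinear and bounded, so exactly one operator on classes represents it;
  this discharges the definite description.\<close>

lemma IndJ_properties: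
 assumes f: "f \<in> Cc (YGY G \<Phi>)"
 shows "IndJ G lam \<Phi> \<nu> d R \<Delta> f \<in> extensional (carr Jsp)" "bounded_op Jsp (IndJ G lam \<Phi> \<nu> d R \<Delta> f)"
  "\<And>h k. h \<in> carr ind.S \<Longrightarrow> k \<in> carr ind.S \<Longrightarrow> ip Jsp (IndJ G lam \<Phi> \<nu> d R \<Delta> f (cls ind.S h)) (cls ind.S k) = JF f h k"
proof -
 have f': "KK f" by (rule Cc_KK[OF f])
 obtain C where C: "\<And>h k. h \<in> carr ind.S \<Longrightarrow> k \<in> carr ind.S \<Longrightarrow> cmod (JF f h k) \<le> C * nrm ind.S h * nrm ind.S k"
  using JF_bound[OF f'] by blast
 have "\<exists>!T. T \<in> extensional (carr Jsp) \<and> bounded_op Jsp T \<and>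
  (\<forall>h\<in>carr ind.S. \<forall>k\<in>carr ind.S. ip Jsp (T (cls ind.S h)) (cls ind.S k) = JF f h k)"
  unfolding Jsp_eq
 proof (rule ind.S.separation_form_operator[OF _ _ _ _ _ C])
  show "hilbert_space (separation ind.S)" using hilbert_Jsp by (simp add: Jsp_eq)
 qed (simp_all add: ind.S_simps ind.carr_S restrict_def JF_linear[OF f'])
 then have "IndJ G lam \<Phi> \<nu> d R \<Delta> f \<in> extensional (carr Jsp) \<and> bounded_op Jsp (IndJ G lam \<Phi> \<nu> d R \<Delta> f) \<and>
  (\<forall>h\<in>carr ind.S. \<forall>k\<in>carr ind.S. ip Jsp (IndJ G lam \<Phi> \<nu> d R \<Delta> f (cls ind.S h)) (cls ind.S k) = JF f h k)"
  unfolding IndJ_def muInd_def[symmetric] by (rule theI')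
 then show "IndJ G lam \<Phi> \<nu> d R \<Delta> f \<in> extensional (carr Jsp)" "bounded_op Jsp (IndJ G lam \<Phi> \<nu> d R \<Delta> f)"
  "\<And>h k. h \<in> carr ind.S \<Longrightarrow> k \<in> carr ind.S \<Longrightarrow> ip Jsp (IndJ G lam \<Phi> \<nu> d R \<Delta> f (cls ind.S h)) (cls ind.S k) = JF f h k"
  by blast+
qed

end

section \<open>The left action\<close>

context induction_data
begin

abbreviation "LA \<equiv> left_action G lam \<Phi> \<nu> d"

lemma closed_Zsp: "closed (Zsp G \<Phi>)"
proof -
 have "Zsp G \<Phi> = {p. \<Phi> (fst p) = r (snd p)}" by (auto simp: Zsp_def)
 then show ?thesis
  by (auto intro!: closed_Collect_eq continuous_on_compose2[OF contPhi] continuous_on_compose2[OF continuous_rng] continuous_intros)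
qed

text \<open>\<open>sqrt (d x)\<close> is bounded on the compact projection of the support, and the
  support is enclosed in the product of its two projections.\<close>

lemma Cc_BB:
 assumes \<xi>: "\<xi> \<in> Cc (Zsp G \<Phi>)"
 shows "BB \<xi>"
proof -
 obtain C K where C: "0 \<le> C" and K: "compact K" and le: "\<And>p. cmod (\<xi> p) \<le> C * indicator K p"
  using Cc_bound[OF \<xi>] by blast
 have cK: "compact (fst ` K)" "compact (snd ` K)" using K by (auto intro!: compact_continuous_image continuous_intros)
 have "bounded (d ` fst ` K)"
  by (intro compact_imp_bounded[OF compact_continuous_image[OF continuous_on_subset[OF contd] cK(1)]]) simp
 then obtain D where D: "\<And>x. x \<in> fst ` K \<Longrightarrow> \<bar>d x\<bar> \<le> D" by (auto simp: bounded_iff)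
 define E where "E = sqrt (max D 0)"
 have "cmod (\<xi> (x, g)) * sqrt (d x) \<le> (C * E) * indicator (fst ` K) x * indicator (snd ` K) g" for x g
 proof (cases "(x, g) \<in> K")
  case True
  then have m: "x \<in> fst ` K" "g \<in> snd ` K" by force+
  have "sqrt (d x) \<le> E" unfolding E_def using D[OF m(1)] by (intro real_sqrt_le_mono) auto
  then have "cmod (\<xi> (x, g)) * sqrt (d x) \<le> C * E"
   using le[of "(x, g)"] True C d_nonneg by (intro mult_mono) auto
  then show ?thesis using m by simp
 next
  case False
  then have "\<xi> (x, g) = 0" using le[of "(x, g)"] by simp
  then show ?thesis using C by (simp add: E_def indicator_def)
 qed
 moreover have "0 \<le> C * E" using C by (simp add: E_def)
 ultimately show ?thesis unfolding BB_def using Cc_measurable[OF \<xi> closed_Zsp] cK by blast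
qed

lemma KK_support: "KK f \<Longrightarrow> f (x, g, y) \<noteq> 0 \<Longrightarrow> \<Phi> x = r g \<and> \<Phi> y = s g"
 by (simp add: KK_def)

text \<open>If \<open>r z\<close> differs from \<open>r g\<close>, then
  \<open>f (x, z, y) = 0\<close>; hence the restriction to the fibre disappears and the total
  product can be used.\<close>

lemma LA_eq:
 assumes f: "KK f"
 shows "LA f \<xi> (x, g) = (if (x, g) \<in> Zsp G \<Phi>
  then LINT z|lam (r g). LINT y|\<nu> (s z). f (x, z, y) * \<xi> (y, tmul (inv z) g) * cor (sqrt (d y) / sqrt (d x)) else 0)"
proof (cases "(x, g) \<in> Zsp G \<Phi>")
 case True
 then have x: "\<Phi> x = r g" by (simp add: Zsp_def)
 have "indicat_real {z. r z = r g} z *\<^sub>R (LINT y|\<nu> (s z). f (x, z, y) * \<xi> (y, mul G (inv z) g) * cor (sqrt (d y) / sqrt (d x)))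
  = (LINT y|\<nu> (s z). f (x, z, y) * \<xi> (y, tmul (inv z) g) * cor (sqrt (d y) / sqrt (d x)))" for z
 proof (cases "r z = r g")
  case True
  then show ?thesis by (simp add: tmul_def src_ginv)
 next
  case False
  then have "f (x, z, y) = 0" for y using KK_support[OF f, of x z y] x by auto
  then show ?thesis using False by simp
 qed
 then show ?thesis unfolding left_action_def set_lebesgue_integral_def using True by simp
qed (simp add: left_action_def)

lemma LA_integrand:
 assumes f: "f \<in> Borel" and \<xi>: "\<xi> \<in> Borel"
 shows "(\<lambda>q. f (fst (fst (fst q)), snd (fst q), snd q) * \<xi> (snd q, tmul (inv (snd (fst q))) (snd (fst (fst q))))
   * cor (sqrt (d (snd q)) / sqrt (d (fst (fst (fst q))))))
  \<in> borel_measurable bYGGY"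
proof -
 note b = measurable_compose[OF borel_fst borel_fst] measurable_compose[OF borel_fst borel_snd]
 have x: "(\<lambda>q. fst (fst (fst q))) \<in> borel_measurable bYGGY"
  and g: "(\<lambda>q. snd (fst (fst q))) \<in> borel_measurable bYGGY"
  and z: "(\<lambda>q. snd (fst q)) \<in> borel_measurable bYGGY"
  and y: "snd \<in> borel_measurable bYGGY"
  by (rule measurable_compose[OF borel_fst b(1)] measurable_compose[OF borel_fst b(2)] b borel_snd)+
 have "(\<lambda>q. (fst (fst (fst q)), snd (fst q), snd q)) \<in> borel_measurable bYGGY"
  by (intro borel_measurable_Pair x z y)
 moreover have "(\<lambda>q. (snd q, tmul (inv (snd (fst q))) (snd (fst (fst q))))) \<in> borel_measurable bYGGY"
  by (intro borel_measurable_Pair y tmul_measurable' g measurable_compose[OF z inv_measurable])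
 ultimately show ?thesis
  using measurable_compose[OF _ f] measurable_compose[OF _ \<xi>] measurable_compose[OF x d_measurable] measurable_compose[OF y d_measurable]
  by measurable
qed

lemma LA_measurable:
 assumes f: "KK f" and \<xi>: "\<xi> \<in> Borel"
 shows "LA f \<xi> \<in> Borel"
proof -
 have f': "f \<in> Borel" using f by (simp add: KK_def)
 have k1: "kernel bYGG (\<lambda>q. \<nu> (s (snd q)))" by (rule kernel_borel_compose[OF kernel_nu_s borel_snd])
 have k2: "kernel bYG (\<lambda>p. lam (r (snd p)))" by (rule kernel_borel_compose[OF kernel_lam_r borel_snd])
 have "(\<lambda>p. LINT z|lam (r (snd p)). LINT y|\<nu> (s z). f (fst p, z, y) * \<xi> (y, tmul (inv z) (snd p)) * cor (sqrt (d y) / sqrt (d (fst p))))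
   \<in> Borel"
  using integral_kernel_borel[OF k2 integral_kernel_borel[OF k1 LA_integrand[OF f' \<xi>]]] by simp
 then have "(\<lambda>p. if p \<in> Zsp G \<Phi> then LINT z|lam (r (snd p)). LINT y|\<nu> (s z). f (fst p, z, y) * \<xi> (y, tmul (inv z) (snd p)) * cor (sqrt (d y) / sqrt (d (fst p))) else 0)
   \<in> Borel"
  using borel_closed[OF closed_Zsp] by (intro measurable_If) auto
 then show ?thesis
 proof (rule measurable_eqI[rotated])
  fix p :: "'y \<times> 'g"
  show "LA f \<xi> p = (if p \<in> Zsp G \<Phi> then LINT z|lam (r (snd p)). LINT y|\<nu> (s z). f (fst p, z, y) * \<xi> (y, tmul (inv z) (snd p)) * cor (sqrt (d y) / sqrt (d (fst p))) else 0)"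
   by (cases p) (simp only: LA_eq[OF f] fst_conv snd_conv)
 qed
qed

text \<open>The weight \<open>d(x)^{1/2}\<close> in \<open>BB\<close> cancels the quotient in the
  left action, while \<open>d(y)^{1/2}\<close> is used up by the bound on \<open>\<xi>\<close>; the
  new support lies in products of the two old ones.\<close>

lemma LA_BB:
 assumes f: "KK f" and \<xi>: "BB \<xi>"
 shows "BB (LA f \<xi>)"
proof -
 obtain C K1 K2 K3 where C: "0 \<le> C" and K1: "compact K1" and K2: "compact K2" and K3: "compact K3"
  and le: "\<And>x g y. cmod (f (x, g, y)) \<le> C * indicator K1 x * indicator K2 g * indicator K3 y"
  using f unfolding KK_def by blast
 obtain D L1 L2 where D: "0 \<le> D" and L1: "compact L1" and L2: "compact L2"
  and le': "\<And>x g. cmod (\<xi> (x, g)) * sqrt (d x) \<le> D * indicator L1 x * indicator L2 g"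
  using \<xi> unfolding BB_def by blast
 define K where "K = conv K2 L2"
 have K: "compact K" unfolding K_def by (intro compact_conv K2 L2)
 obtain B where B: "0 \<le> B" "\<And>u c G. u \<in> X0 \<Longrightarrow> (\<And>z y. r z = u \<Longrightarrow> G z y \<le> ennreal c * indicator K2 z * indicator K3 y) \<Longrightarrow>
  (NN z. NN y. G z y d/\<nu> (s z) d/lam u) \<le> ennreal (c * B)"
  using double_integral_bound[OF K2 K3] by blast
 have "cmod (LA f \<xi> (x, g)) * sqrt (d x) \<le> (C * D * B) * indicator K1 x * indicator K g" for x g
 proof (cases "(x, g) \<in> Zsp G \<Phi>")
  case True
  then have x: "\<Phi> x = r g" by (simp add: Zsp_def)
  let ?c = "C * D * indicator K1 x * indicator K g :: real"
  let ?F = "\<lambda>z y. cor (sqrt (d x)) * (f (x, z, y) * \<xi> (y, tmul (inv z) g) * cor (sqrt (d y) / sqrt (d x)))"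
  have c: "0 \<le> ?c" using C D by simp
  have pt: "ennreal (norm (?F z y)) \<le> (ennreal ?c * indicator K2 z) * indicator K3 y" for z y
  proof -
   \<comment> \<open>At \<open>d x = 0\<close> the left side is zero, so the cancellation is needed
     only for positive \<open>d x\<close>.\<close>
   have "norm (?F z y) \<le> cmod (f (x, z, y)) * (cmod (\<xi> (y, tmul (inv z) g)) * sqrt (d y))"
    using d_nonneg[of x] d_nonneg[of y] by (cases "d x = 0") (simp_all add: norm_mult norm_divide)
   also have "\<dots> \<le> ?c * indicator K2 z * indicator K3 y"
   proof (cases "f (x, z, y) = 0")
    case True
    then show ?thesis using c by (simp add: indicator_def)
   next
    case False
    then have z: "r z = r g" using KK_support[OF f, of x z y] x by auto
    have "cmod (f (x, z, y)) * (cmod (\<xi> (y, tmul (inv z) g)) * sqrt (d y))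
     \<le> (C * indicator K1 x * indicator K2 z * indicator K3 y) * (D * indicator L1 y * indicator L2 (tmul (inv z) g))"
     using C D d_nonneg by (intro mult_mono[OF le le']) (auto simp: indicator_def)
    also have "\<dots> \<le> ?c * indicator K2 z * indicator K3 y"
     using C D conv_mem[OF z, of K2 L2] by (auto simp: indicator_def K_def)
    finally show ?thesis .
   qed
   finally have "norm (?F z y) \<le> ?c * indicator K2 z * indicator K3 y" .
   then have "ennreal (norm (?F z y)) \<le> ennreal (?c * indicator K2 z * indicator K3 y)" by (rule ennreal_leI)
   also have "\<dots> = (ennreal ?c * indicator K2 z) * indicator K3 y" using c by (auto simp: indicator_def)
   finally show ?thesis .
  qed
  have "ennreal (cmod (LA f \<xi> (x, g)) * sqrt (d x)) = ennreal (norm (cor (sqrt (d x)) * LA f \<xi> (x, g)))"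
   using d_nonneg[of x] by (simp add: norm_mult mult.commute)
  also have "cor (sqrt (d x)) * LA f \<xi> (x, g) = (LINT z|lam (r g). LINT y|\<nu> (s z). ?F z y)"
   using True by (simp only: LA_eq[OF f] if_True integral_mult_right_zero)
  also have "ennreal (norm (LINT z|lam (r g). LINT y|\<nu> (s z). ?F z y)) \<le> (NN z. NN y. ennreal (norm (?F z y)) d/\<nu> (s z) d/lam (r g))"
   by (rule order_trans[OF norm_integral_le], rule nn_integral_mono, rule norm_integral_le)
  also have "\<dots> \<le> ennreal (?c * B)" by (rule B(2)[OF r_unit pt])
  finally have "cmod (LA f \<xi> (x, g)) * sqrt (d x) \<le> ?c * B"
   by (rule ennreal_le_iff[THEN iffD1, rotated]) (intro mult_nonneg_nonneg c B(1))
  then show ?thesis by (simp only: mult_ac)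
 qed (use C D B(1) in \<open>simp add: LA_eq[OF f] indicator_def\<close>)
 moreover have "0 \<le> C * D * B" using C D B(1) by simp
 ultimately show ?thesis unfolding BB_def using LA_measurable[OF f BB_measurable[OF \<xi>]] K1 K by blast
qed

text \<open>The adjoint moves \<open>L g\<close> to \<open>v\<close>, where the weak integral can be
  unfolded; then \<open>L g (L t h)\<close> is \<open>L\<close> at the product, \<open>W\<close> is
  multiplicative, and left invariance substitutes the product as new variable.\<close>

lemma U_translate:
 assumes \<xi>: "BB \<xi>" and h: "N.bsec h" and v: "v \<in> carr (H (r g))" and y: "\<Phi> y = s g" and fin: "A \<xi> h y < \<infinity>"
 shows "cor (W g) * ip (H (r g)) (L g (U \<xi> h y)) v
  = (LINT t|lam (r g). \<xi> (y, tmul (inv g) t) * cor (W t) * pr h (r g) v t)"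
proof -
 have Uy: "U \<xi> h y \<in> carr (H (s g))" using ind_in[OF U_bsec[OF BB_measurable[OF \<xi>] h], of y] y by simp
 have Lv: "L (inv g) v \<in> carr (H (s g))" using act_in[of v "inv g"] v by (simp add: rng_ginv src_ginv)
 define q where "q t = \<xi> (y, tmul (inv g) t) * cor (W (tmul (inv g) t)) * pr h (r g) v t" for t
 have tm: "tmul g \<in> Borel" "tmul (inv g) \<in> Borel" by measurable
 have q1: "(\<lambda>t. \<xi> (y, tmul (inv g) t)) \<in> Borel"
  using measurable_compose[OF tm(2) BB_section[OF \<xi>]] .
 have pm: "pr h (r g) v \<in> Borel" by (rule pr_measurable[OF r_unit h v])
 have qm: "q \<in> Borel"
  unfolding q_def[abs_def] using q1 pm measurable_compose[OF tm(2) W_measurable] by measurable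
 have "ip (H (r g)) (L g (U \<xi> h y)) v = ip (H (s g)) (U \<xi> h y) (L (inv g) v)" by (rule act_adjoint[OF Uy v])
 also have "\<dots> = (LINT t|lam (s g). \<xi> (y, t) * cor (W t) * pr h (s g) (L (inv g) v) t)"
  unfolding U_def y using TI(2)[OF s_unit BB_section[OF \<xi>] h _ Lv, of y] fin by (simp add: A_def y)
 also have "\<dots> = (LINT t|lam (s g). q (tmul g t))"
 proof (rule integral_cong_AE)
  have "(\<lambda>t. \<xi> (y, t) * cor (W t) * pr h (s g) (L (inv g) v) t) \<in> Borel"
   using BB_section[OF \<xi>, of y] pr_measurable[OF s_unit h Lv] by measurable
  then show "(\<lambda>t. \<xi> (y, t) * cor (W t) * pr h (s g) (L (inv g) v) t) \<in> borel_measurable (lam (s g))"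
   by (simp add: meas_lam)
  show "(\<lambda>t. q (tmul g t)) \<in> borel_measurable (lam (s g))"
   using measurable_compose[OF tm(1) qm] by (simp add: meas_lam)
  show "AE t in lam (s g). \<xi> (y, t) * cor (W t) * pr h (s g) (L (inv g) v) t = q (tmul g t)"
  proof (rule eventually_mono[OF lam_AE[OF s_unit]])
   fix t assume t: "r t = s g"
   have hd: "h (s t) \<in> carr (H (s t))" by (rule bsec_s[OF h])
   have Lh: "L t (h (s t)) \<in> carr (H (s g))" using act_in[OF hd] t by simp
   have "pr h (s g) (L (inv g) v) t = ip (H (r g)) (L g (L t (h (s t)))) v"
    using t act_adjoint[OF Lh v] by (simp add: pr_def)
   also have "\<dots> = pr h (r g) v (tmul g t)"
    using t act_mul[of g t "h (s t)"] hd by (simp add: pr_def r_tmul s_tmul) (simp add: tmul_def)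
   finally show "\<xi> (y, t) * cor (W t) * pr h (s g) (L (inv g) v) t = q (tmul g t)"
    by (simp add: q_def tmul_inv[OF t])
  qed
 qed
 also have "\<dots> = (LINT t|distr (lam (s g)) borel (tmul g). q t)"
  using tm(1) qm by (intro integral_distr[symmetric]) (simp_all add: meas_lam)
 finally have "cor (W g) * ip (H (r g)) (L g (U \<xi> h y)) v = (LINT t|lam (r g). cor (W g) * q t)"
  by (simp add: lam_translate)
 also have "\<dots> = (LINT t|lam (r g). \<xi> (y, tmul (inv g) t) * cor (W t) * pr h (r g) v t)"
 proof (rule integral_cong_AE)
  show "(\<lambda>t. cor (W g) * q t) \<in> borel_measurable (lam (r g))" using qm by (simp add: meas_lam)
  have "(\<lambda>t. \<xi> (y, tmul (inv g) t) * cor (W t) * pr h (r g) v t) \<in> Borel"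
   using q1 pm by measurable
  then show "(\<lambda>t. \<xi> (y, tmul (inv g) t) * cor (W t) * pr h (r g) v t) \<in> borel_measurable (lam (r g))"
   by (simp add: meas_lam)
  show "AE t in lam (r g). cor (W g) * q t = \<xi> (y, tmul (inv g) t) * cor (W t) * pr h (r g) v t"
  proof (rule eventually_mono[OF lam_AE[OF r_unit]])
   fix t assume t: "r t = r g"
   have "W g * W (tmul (inv g) t) = W t"
    using W_mul[of "inv g" t] less_imp_neq[OF W_pos[of g]] t by (simp add: tmul_def src_ginv W_inv)
   then have c: "cor (W g) * cor (W (tmul (inv g) t)) = cor (W t)"
    by (simp flip: of_real_mult)
   then show "cor (W g) * q t = \<xi> (y, tmul (inv g) t) * cor (W t) * pr h (r g) v t"
    by (simp only: q_def c[symmetric] mult_ac)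
  qed
 qed
 finally show ?thesis .
qed

lemma nn_U_translate:
 assumes \<xi>: "BB \<xi>" and h: "N.bsec h" and y: "\<Phi> y = s a"
 shows "(NN t. ennreal (cmod (\<xi> (y, tmul (inv a) t)) * W t * hn h t) d/lam (r a)) = ennreal (W a) * A \<xi> h y"
proof -
 let ?g = "\<lambda>t. ennreal (W a) * ennreal (cmod (\<xi> (y, t)) * W t * hn h t)"
 have m: "(\<lambda>t. ennreal (cmod (\<xi> (y, t)) * W t * hn h t)) \<in> Borel"
  using NI_measurable_fun[OF BB_section[OF \<xi>] h] by measurable
 then have gm: "?g \<in> Borel" by measurable
 have "(NN t. ennreal (cmod (\<xi> (y, tmul (inv a) t)) * W t * hn h t) d/lam (r a)) = (NN t. ?g (tmul (inv a) t) d/lam (r a))"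
 proof (rule nn_integral_cong_AE, rule eventually_mono[OF lam_AE[OF r_unit]])
  fix t assume t: "r t = r a"
  have "W a * W (tmul (inv a) t) = W t"
   using W_mul[of "inv a" t] less_imp_neq[OF W_pos[of a]] t by (simp add: tmul_def src_ginv W_inv)
  then have e: "cmod (\<xi> (y, tmul (inv a) t)) * W t * hn h t = W a * (cmod (\<xi> (y, tmul (inv a) t)) * W (tmul (inv a) t) * hn h (tmul (inv a) t))"
   using t by (simp add: hn_def s_tmul src_ginv mult_ac)
  then show "ennreal (cmod (\<xi> (y, tmul (inv a) t)) * W t * hn h t) = ?g (tmul (inv a) t)"
   by (subst e) (rule ennreal_mult'[OF W_nonneg])
 qed
 also have "\<dots> = (NN t. ?g t d/lam (s a))" by (rule nn_translate_inv[OF gm])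
 also have "\<dots> = ennreal (W a) * A \<xi> h y"
  unfolding A_def NI_def y using m by (intro nn_integral_cmult) (simp add: meas_lam)
 finally show ?thesis .
qed

end

section \<open>Fubini on a fibre\<close>

context induction_data
begin

text \<open>The fibre identity below is used with \<open>\<nu>d\<close> for the isometry and with
  \<open>\<nu>\<close> for the intertwining relation; these are the properties of the two that it
  requires.\<close>

lemma nu_or_nud:
 assumes K: "K = \<nu> \<or> K = \<nu>d"
 shows "kernel borel (\<lambda>g. K (s g))" "AE y in K (s g). \<Phi> y = s g" "sets (K (s g)) = sets borel" "sigma_finite_measure (K (s g))"
 using K kernel_nu_s kernel_nud_s nu_AE[OF s_unit] nud_AE[OF s_unit] sets_nu[OF s_unit] sets_nud[OF s_unit] nu_sf[OF s_unit] nud_sf[OF s_unit]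
 by auto

definition TT :: "('g \<times> 'y \<Rightarrow> complex) \<Rightarrow> ('y \<times> 'g \<Rightarrow> complex) \<Rightarrow> ('g \<Rightarrow> 'h) \<Rightarrow> 'g \<Rightarrow> 'h \<Rightarrow> ('g \<times> 'y) \<times> 'g \<Rightarrow> complex" where
 "TT c \<xi> h u v q = c (fst q) * (\<xi> (snd (fst q), tmul (inv (fst (fst q))) (snd q)) * cor (W (snd q)) * pr h u v (snd q))"

text \<open>The left hand side of \<open>U_translate\<close>, extended by zero to all pairs;
  \<open>TT\<close> is its integrand on the right, multiplied by the coefficient
  \<open>c\<close>.\<close>

definition up :: "('y \<Rightarrow> 'h) \<Rightarrow> 'g \<Rightarrow> 'h \<Rightarrow> 'g \<times> 'y \<Rightarrow> complex" where
 "up k u v p = cor (W (fst p)) * (if u = r (fst p) \<and> \<Phi> (snd p) = s (fst p) then ip (H u) (L (fst p) (k (snd p))) v else 0)"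

context
 fixes c :: "'g \<times> 'y \<Rightarrow> complex" and \<xi> h u v
 assumes c: "c \<in> Borel" and \<xi>: "BB \<xi>" and h: "N.bsec h" and u: "u \<in> X0" and v: "v \<in> carr (H u)"
begin

lemma TT_measurable: "TT c \<xi> h u v \<in> Borel"
proof -
 have g: "(\<lambda>q. fst (fst q)) \<in> borel_measurable bGYG"
  and y: "(\<lambda>q. snd (fst q)) \<in> borel_measurable bGYG"
  using measurable_compose[OF borel_fst borel_fst] measurable_compose[OF borel_fst borel_snd] by auto
 have p: "(\<lambda>q. (snd (fst q), tmul (inv (fst (fst q))) (snd q))) \<in> borel_measurable bGYG"
  by (intro borel_measurable_Pair y borel_snd tmul_measurable' measurable_compose[OF g inv_measurable])
 have w: "(\<lambda>a. cor (W a)) \<in> Borel" by measurable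
 show ?thesis
  unfolding TT_def[abs_def]
  by (intro borel_measurable_times measurable_compose[OF borel_fst c] measurable_compose[OF p BB_measurable[OF \<xi>]]
   measurable_compose[OF borel_snd w] measurable_compose[OF borel_snd pr_measurable[OF u h v]])
qed

lemma up_measurable:
 assumes k: "ind.bsec k"
 shows "up k u v \<in> Borel"
proof -
 note m = measurable_compose[OF borel_snd Phi_N0]
 have P: "{p \<in> space borel. u = r (fst p) \<and> \<Phi> (snd p) = s (fst p)} \<in> sets bGY"
  using measurable_compose[OF borel_fst r_measurable] measurable_compose[OF borel_fst s_measurable] measurable_compose[OF borel_snd Phi_measurable]
  by measurable
 have cu: "(\<lambda>_. u) \<in> measurable borel N0" using u by simp
 have "(\<lambda>p. if u = r (fst p) \<and> \<Phi> (snd p) = s (fst p) then ip (H u) (L (fst p) (k (snd p))) v else 0) \<in> borel_measurable bGY"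
  by (rule act_pair_measurable[OF borel_fst P m cu _ psec_compose[OF Phi_N0 k[unfolded ind_bsec] borel_snd]])
    (simp_all add: psec_iff[OF cu] v)
 then show ?thesis
  unfolding up_def[abs_def] using measurable_compose[OF borel_fst W_measurable] by measurable
qed

lemma TT_nn:
 assumes g: "r a = u" and y: "\<Phi> y = s a"
 shows "(NN t. ennreal (norm (TT c \<xi> h u v ((a, y), t))) d/lam u) \<le> ennreal (cmod (c (a, y)) * W a) * (ennreal (nrm (H u) v) * A \<xi> h y)"
proof -
 have n: "0 \<le> nrm (H u) v" by (rule semi_inner_space.nrm_nonneg[OF base.semi v]) (simp add: u)
 let ?c = "cmod (c (a, y)) * nrm (H u) v"
 have c0: "0 \<le> ?c" using n by simp
 let ?g = "\<lambda>t. ennreal (cmod (\<xi> (y, tmul (inv a) t)) * W t * hn h t)"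
 have tm: "tmul (inv a) \<in> Borel" by measurable
 have gm: "?g \<in> Borel"
  using measurable_compose[OF tm BB_section[OF \<xi>, of y]] hn_measurable[OF h] by measurable
 have "norm (TT c \<xi> h u v ((a, y), t)) \<le> ?c * (cmod (\<xi> (y, tmul (inv a) t)) * W t * hn h t)" for t
  using mult_left_mono[OF pr_bound[OF u h v, of t], of "cmod (c (a, y)) * (cmod (\<xi> (y, tmul (inv a) t)) * W t)"]
  by (simp add: TT_def norm_mult mult_ac)
 then have "(NN t. ennreal (norm (TT c \<xi> h u v ((a, y), t))) d/lam u) \<le> (NN t. ennreal ?c * ?g t d/lam u)"
  unfolding ennreal_mult'[OF c0, symmetric] by (intro nn_integral_mono ennreal_leI)
 also have "\<dots> = ennreal ?c * (NN t. ?g t d/lam u)" using gm by (intro nn_integral_cmult) (simp add: meas_lam[OF u])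
 also have "\<dots> = ennreal ?c * (ennreal (W a) * A \<xi> h y)" using nn_U_translate[OF \<xi> h y] g by simp
 also have "\<dots> = ennreal (cmod (c (a, y)) * W a) * (ennreal (nrm (H u) v) * A \<xi> h y)"
  using n by (simp add: ennreal_mult mult_ac)
 finally show ?thesis .
qed

lemma up_as_integral:
 assumes g: "r a = u" and y: "\<Phi> y = s a"
  and fin: "ennreal (cmod (c (a, y)) * W a) * (ennreal (nrm (H u) v) * A \<xi> h y) < \<infinity>"
 shows "c (a, y) * up (U \<xi> h) u v (a, y) = (LINT t|lam u. TT c \<xi> h u v ((a, y), t))"
proof (cases "c (a, y) = 0 \<or> nrm (H u) v = 0")
 \<comment> \<open>Here \<open>fin\<close> says nothing about \<open>A \<xi> h y\<close>, since 0
   times infinity is 0; both sides are zero.\<close>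
 case True
 interpret hilbert_space "H u" by (rule hilH[OF u])
 have "ennreal (norm (LINT t|lam u. TT c \<xi> h u v ((a, y), t))) \<le> ennreal (cmod (c (a, y)) * W a) * (ennreal (nrm (H u) v) * A \<xi> h y)"
  by (rule order_trans[OF norm_integral_le TT_nn[OF g y]])
 moreover have "c (a, y) * up (U \<xi> h) u v (a, y) = 0"
 proof (cases "nrm (H u) v = 0")
  case True
  have "L a (U \<xi> h y) \<in> carr (H u)" using act_in[of "U \<xi> h y" a] ind_in[OF U_bsec[OF BB_measurable[OF \<xi>] h], of y] g y by simp
  then have z: "ip (H u) (L a (U \<xi> h y)) v = 0" using True nrm_eq_0[OF v] by (simp add: inner_zero_right)
  show ?thesis by (simp only: up_def fst_conv snd_conv z if_cancel mult_zero_right)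
 qed (use True in auto)
 ultimately show ?thesis using True by auto
next
 case False
 have n: "0 \<le> nrm (H u) v" by (rule semi_inner_space.nrm_nonneg[OF base.semi v]) (simp add: u)
 then have A: "A \<xi> h y < \<infinity>" using fin False less_imp_neq[OF W_pos[of a]] by (auto simp: ennreal_mult_less_top)
 have v': "v \<in> carr (H (r a))" using v g by simp
 show ?thesis using U_translate[OF \<xi> h v' y A] by (simp add: up_def TT_def g y)
qed

text \<open>By \<open>U_translate\<close> the left side is a triple integral over \<open>a\<close>,
  \<open>y\<close> and the arrow \<open>t\<close> coming from \<open>U\<close>. With
  \<open>t\<close> moved outside, its factor \<open>W(t) pr(t)\<close> leaves the inner double
  integral of \<open>c\<close> against the translate of \<open>\<xi>\<close>, which is
  \<open>F t\<close>.\<close>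

lemma fibre_identity:
 assumes K: "K = \<nu> \<or> K = \<nu>d"
  and fin: "(NN a. NN y. ennreal (cmod (c (a, y)) * W a) * (ennreal (nrm (H u) v) * A \<xi> h y) d/K (s a) d/lam u) < \<infinity>"
  and F: "F \<in> Borel" "\<And>t. r t = u \<Longrightarrow> (LINT a|lam u. LINT y|K (s a). c (a, y) * \<xi> (y, tmul (inv a) t)) = F t"
 shows "(LINT a|lam u. LINT y|K (s a). c (a, y) * up (U \<xi> h) u v (a, y))
  = (LINT t|lam u. F t * cor (W t) * pr h u v t)"
proof -
 let ?lu = "lam u" and ?T = "TT c \<xi> h u v"
 note k = nu_or_nud[OF K]
 have kK: "kernel bGG (\<lambda>p. K (s (snd p)))" by (rule kernel_borel_compose[OF k(1) borel_snd])
 note Tm = TT_measurable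
 have sl: "sets ?lu = sets borel" by (rule sets_lam[OF u])
 have kl: "kernel borel (\<lambda>_::'g. ?lu)" and kl': "kernel borel (\<lambda>_::'g \<times> 'y. ?lu)" by (rule kernel_const_lam[OF u])+
 have Jm: "(\<lambda>p. c p * up (U \<xi> h) u v p) \<in> Borel"
  using c up_measurable[OF U_bsec[OF BB_measurable[OF \<xi>] h]] by measurable
 let ?w = "\<lambda>a y. ennreal (cmod (c (a, y)) * W a) * (ennreal (nrm (H u) v) * A \<xi> h y)"
 have wm: "(\<lambda>p. ?w (fst p) (snd p)) \<in> borel_measurable bGY"
  using c measurable_compose[OF borel_snd A_measurable[OF BB_measurable[OF \<xi>] h]] measurable_compose[OF borel_fst W_measurable]
  by measurable
 define M where "M = semidirect (semidirect ?lu (\<lambda>a. K (s a))) (\<lambda>_. ?lu)"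
 define M' where "M' = semidirect (semidirect ?lu (\<lambda>_. ?lu)) (\<lambda>p. K (s (snd p)))"
 \<comment> \<open>\<open>\<tau>\<close> maps \<open>((t, a), y)\<close> to
   \<open>((a, y), t)\<close>: the reordering that brings \<open>t\<close> outside.\<close>
 define \<tau> where "\<tau> q = ((snd (fst q), snd q), fst (fst q))" for q :: "('g \<times> 'g) \<times> 'y"
 have sM: "sets M = sets borel" unfolding M_def by (rule sets_semidirect_iterated[OF sl k(1) kl'])
 have sM': "sets M' = sets borel" unfolding M'_def by (rule sets_semidirect_iterated[OF sl kl kK])
 have \<tau>m: "\<tau> \<in> Borel"
  unfolding \<tau>_def[abs_def] by (intro borel_measurable_Pair borel_snd measurable_compose[OF borel_fst borel_fst] measurable_compose[OF borel_fst borel_snd])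
 have nnM: "(NN q. g q d/M) = (NN a. NN y. NN t. g ((a, y), t) d/?lu d/K (s a) d/?lu)" if "g \<in> Borel" for g
  unfolding M_def by (rule nn_semidirect_iterated[OF sl k(1) kl' that])
 have nnM': "(NN q. g q d/M') = (NN t. NN a. NN y. g ((t, a), y) d/K (s a) d/?lu d/?lu)" if "g \<in> Borel" for g
  unfolding M'_def using nn_semidirect_iterated[OF sl kl kK that] by simp
 have swap: "(NN q. g q d/M) = (NN q. g (\<tau> q) d/M')" if g: "g \<in> Borel" for g
 proof -
  have g1: "(\<lambda>p. g ((a, fst p), snd p)) \<in> borel_measurable bYG" for a
   by (rule measurable_compose[OF _ g]) (intro borel_measurable_Pair borel_fst borel_snd borel_measurable_const)
  have g2: "(\<lambda>q. g ((fst (fst q), snd q), snd (fst q))) \<in> borel_measurable bGGY"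
   by (rule measurable_compose[OF _ g]) (intro borel_measurable_Pair borel_snd measurable_compose[OF borel_fst borel_fst] measurable_compose[OF borel_fst borel_snd])
  have g3: "(\<lambda>p. NN y. g ((fst p, y), snd p) d/K (s (fst p))) \<in> Borel"
   using nn_kernel_borel[OF kernel_borel_compose[OF k(1) borel_fst] g2] by simp
  have "(NN q. g q d/M) = (NN a. NN t. NN y. g ((a, y), t) d/K (s a) d/?lu d/?lu)"
   unfolding nnM[OF g] using nn_integral_swap[OF k(3) sl k(4) lam_sf[OF u] g1] by simp
  also have "\<dots> = (NN t. NN a. NN y. g ((a, y), t) d/K (s a) d/?lu d/?lu)"
   using nn_integral_swap[OF sl sl lam_sf[OF u] lam_sf[OF u] g3] by simp
  also have "\<dots> = (NN q. g (\<tau> q) d/M')"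
   using nnM'[OF measurable_compose[OF \<tau>m g]] by (simp add: \<tau>_def)
  finally show ?thesis .
 qed
 have nT: "(\<lambda>q. ennreal (norm (?T q))) \<in> Borel" using Tm by measurable
 have finT: "(NN a. NN y. NN t. ennreal (norm (?T ((a, y), t))) d/?lu d/K (s a) d/?lu) < \<infinity>"
 proof (rule le_less_trans[OF _ fin], rule nn_integral_mono_AE, rule eventually_mono[OF lam_AE[OF u]], rule nn_integral_mono_AE)
  fix a assume "r a = u"
  then show "AE y in K (s a). (NN t. ennreal (norm (?T ((a, y), t))) d/?lu) \<le> ?w a y"
   by (intro eventually_mono[OF k(2)] TT_nn)
 qed
 have finT': "(NN t. NN a. NN y. ennreal (norm (?T (\<tau> ((t, a), y)))) d/K (s (snd (t, a))) d/?lu d/?lu) < \<infinity>"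
  using finT unfolding nnM[OF nT, symmetric] swap[OF nT] nnM'[OF measurable_compose[OF \<tau>m nT]] by simp
 have int2: "(\<lambda>p. LINT t|?lu. ?T (p, t)) \<in> Borel"
  by (rule integral_kernel_borel[OF kl' Tm])
 have mlu: "f \<in> Borel \<Longrightarrow> f \<in> borel_measurable ?lu" for f :: "'g \<Rightarrow> complex" by (simp add: meas_lam[OF u])
 have mK: "f \<in> Borel \<Longrightarrow> f \<in> borel_measurable (K (s a))" for f :: "'y \<Rightarrow> complex" and a
  using measurable_cong_sets[OF k(3) refl, of a "borel :: complex measure"] by simp
 have "(LINT a|?lu. LINT y|K (s a). c (a, y) * up (U \<xi> h) u v (a, y)) = (LINT a|?lu. LINT y|K (s a). LINT t|?lu. ?T ((a, y), t))"
 proof (rule integral_cong_AE[OF mlu[OF integral_kernel_borel[OF k(1) Jm]] mlu[OF integral_kernel_borel[OF k(1) int2]]])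
  have "(\<lambda>a. NN y. ?w a y d/K (s a)) \<in> Borel" using nn_kernel_borel[OF k(1) wm] by simp
  then have "AE a in ?lu. (NN y. ?w a y d/K (s a)) \<noteq> \<infinity>"
   using fin by (intro nn_integral_noteq_infinite) (auto simp: meas_lam[OF u])
  with lam_AE[OF u] show "AE a in ?lu. (LINT y|K (s a). c (a, y) * up (U \<xi> h) u v (a, y)) = (LINT y|K (s a). LINT t|?lu. ?T ((a, y), t))"
  proof eventually_elim
   case (elim a)
   have "(\<lambda>y. ?w a y) \<in> borel_measurable (K (s a))"
    using measurable_compose[OF measurable_Pair_borel wm, of a] measurable_cong_sets[OF k(3) refl, of a "borel :: ennreal measure"] by simp
   then have ae: "AE y in K (s a). ?w a y \<noteq> \<infinity>" using elim(2) by (intro nn_integral_noteq_infinite) auto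
   show ?case
   proof (rule integral_cong_AE[OF mK[OF measurable_compose[OF measurable_Pair_borel Jm]] mK[OF measurable_compose[OF measurable_Pair_borel int2]]])
    show "AE y in K (s a). c (a, y) * up (U \<xi> h) u v (a, y) = (LINT t|?lu. ?T ((a, y), t))"
     using ae k(2) by eventually_elim (rule up_as_integral[OF elim(1)], simp_all add: less_top)
   qed
  qed
 qed
 also have "\<dots> = (LINT q|M. ?T q)"
  unfolding M_def by (rule integral_semidirect_iterated(2)[OF sl k(1) kl' Tm finT, symmetric])
 also have "\<dots> = (LINT q|M'. 1 *\<^sub>R ?T (\<tau> q))"
  by (rule integral_transfer[OF sM sM' \<tau>m _ _ Tm]) (simp_all add: swap)
 also have "\<dots> = (LINT t|?lu. LINT a|?lu. LINT y|K (s a). ?T ((a, y), t))"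
  unfolding M'_def using integral_semidirect_iterated(2)[OF sl kl kK measurable_compose[OF \<tau>m Tm] finT'] by (simp add: \<tau>_def)
 also have "\<dots> = (LINT t|lam u. F t * cor (W t) * pr h u v t)"
 proof (rule integral_cong_AE)
  have "(\<lambda>t. LINT a|?lu. LINT y|K (s a). ?T ((a, y), t)) \<in> Borel"
   using integral_kernel_borel[OF kl integral_kernel_borel[OF kK measurable_compose[OF \<tau>m Tm]]] by (simp add: \<tau>_def)
  then show "(\<lambda>t. LINT a|?lu. LINT y|K (s a). ?T ((a, y), t)) \<in> borel_measurable ?lu" by (rule mlu)
  have "(\<lambda>t. F t * cor (W t) * pr h u v t) \<in> Borel" using F(1) pr_measurable[OF u h v] by measurable
  then show "(\<lambda>t. F t * cor (W t) * pr h u v t) \<in> borel_measurable ?lu" by (rule mlu)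
  show "AE t in ?lu. (LINT a|?lu. LINT y|K (s a). ?T ((a, y), t)) = F t * cor (W t) * pr h u v t"
   by (rule eventually_mono[OF lam_AE[OF u]]) (simp only: TT_def fst_conv snd_conv mult.assoc[symmetric] integral_mult_left_zero F(2))
 qed
 finally show ?thesis .
qed

end

section \<open>The isometry\<close>

text \<open>The kernel of the pairing: \<open>(U \<xi> h, k)\<close> is the integral of
  \<open>\<xi>\<close> against it over pairs \<open>(x, \<gamma>)\<close>.\<close>

definition gg :: "('g \<Rightarrow> 'h) \<Rightarrow> ('y \<Rightarrow> 'h) \<Rightarrow> 'y \<times> 'g \<Rightarrow> complex" where
 "gg h k p = cor (W (snd p)) * pr h (\<Phi> (fst p)) (k (fst p)) (snd p)"

lemma gg_measurable:
 assumes h: "N.bsec h" and k: "ind.bsec k"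
 shows "gg h k \<in> Borel"
proof -
 from pairing_measurable[OF Phi_N0 k[unfolded ind_bsec] h] have "(\<lambda>p. pr h (\<Phi> (fst p)) (k (fst p)) (snd p)) \<in> borel_measurable bYG"
  by (simp add: borel_pair)
 then show ?thesis
  unfolding gg_def[abs_def] using measurable_compose[OF borel_snd W_measurable] by measurable
qed

text \<open>Unfolding one vector writes the pairing as an integral of \<open>\<xi>\<close> against a
  kernel independent of \<open>\<xi>\<close>. The isometry starts from this formula, and density
  follows from it by varying \<open>\<xi>\<close>.\<close>

lemma U_semidirect:
 assumes \<xi>: "BB \<xi>" and h: "base.l2 h" and k: "ind.l2 k"
 shows "integrable (semidirect muInd (\<lambda>x. lam (\<Phi> x))) (\<lambda>p. \<xi> p * gg h k p)"
  and "(LINT p|semidirect muInd (\<lambda>x. lam (\<Phi> x)). \<xi> p * gg h k p) = (LINT x|muInd. ip (H (\<Phi> x)) (U \<xi> h x) (k x))"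
proof -
 have hb: "N.bsec h" and kb: "ind.bsec k" using h k by (simp_all add: base.l2_def base_bsec ind.l2_def)
 have Fm: "(\<lambda>p. \<xi> p * gg h k p) \<in> Borel" using BB_measurable[OF \<xi>] gg_measurable[OF hb kb] by measurable
 have km: "kernel muInd (\<lambda>x. lam (\<Phi> x))" by (rule kernel_borel_cong[OF kernel_lam_Phi sets_muInd])
 have nm: "(\<lambda>x. ennreal (nk k x)) \<in> Borel" using nk_measurable[OF kb] by measurable
 have Am: "A \<xi> h \<in> Borel" by (rule A_measurable[OF BB_measurable[OF \<xi>] hb])
 have "(NN x. NN g. ennreal (norm (\<xi> (x, g) * gg h k (x, g))) d/lam (\<Phi> x) d/muInd) \<le> (NN x. A \<xi> h x * ennreal (nk k x) d/muInd)"
 proof (rule nn_integral_mono)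
  fix x
  have "(NN g. ennreal (norm (\<xi> (x, g) * gg h k (x, g))) d/lam (\<Phi> x)) \<le> (NN g. ennreal (cmod (\<xi> (x, g)) * W g * hn h g) * ennreal (nk k x) d/lam (\<Phi> x))"
  proof (rule nn_integral_mono)
   fix g
   have "norm (\<xi> (x, g) * gg h k (x, g)) \<le> cmod (\<xi> (x, g)) * W g * (hn h g * nk k x)"
    using pr_bound[OF Phi_unit hb ind_in[OF kb], of x g] by (simp add: gg_def norm_mult nk_def mult.assoc mult_left_mono)
   then show "ennreal (norm (\<xi> (x, g) * gg h k (x, g))) \<le> ennreal (cmod (\<xi> (x, g)) * W g * hn h g) * ennreal (nk k x)"
    using nk_nonneg[OF kb] hn_nonneg[OF hb] by (simp flip: ennreal_mult add: ennreal_leI mult.assoc)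
  qed
  also have "\<dots> = A \<xi> h x * ennreal (nk k x)"
   unfolding A_def NI_def using NI_measurable_fun[OF BB_section[OF \<xi>] hb] by (intro nn_integral_multc) (simp add: meas_lam)
  finally show "(NN g. ennreal (norm (\<xi> (x, g) * gg h k (x, g))) d/lam (\<Phi> x)) \<le> A \<xi> h x * ennreal (nk k x)" .
 qed
 also have "\<dots> < \<infinity>"
 proof (rule ennreal_sq_finite)
  have "(NN x. A \<xi> h x * ennreal (nk k x) d/muInd)\<^sup>2 \<le> (NN x. (A \<xi> h x)\<^sup>2 d/muInd) * (NN x. (ennreal (nk k x))\<^sup>2 d/muInd)"
   using Am nm by (intro Cauchy_Schwarz_nn_integral) (simp_all add: meas_muInd)
  also have "\<dots> < \<infinity>" using A_finite(1)[OF \<xi> h] k by (simp add: nk_sq[OF kb] ind.l2_def ennreal_mult_less_top)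
  finally show "(NN x. A \<xi> h x * ennreal (nk k x) d/muInd)\<^sup>2 < \<infinity>" .
 qed
 finally have fin: "(NN x. NN g. ennreal (norm (\<xi> (x, g) * gg h k (x, g))) d/lam (\<Phi> x) d/muInd) < \<infinity>" .
 show "integrable (semidirect muInd (\<lambda>x. lam (\<Phi> x))) (\<lambda>p. \<xi> p * gg h k p)"
  by (rule integral_semidirect(1)[OF sets_muInd km Fm fin])
 have "(LINT p|semidirect muInd (\<lambda>x. lam (\<Phi> x)). \<xi> p * gg h k p) = (LINT x|muInd. LINT g|lam (\<Phi> x). \<xi> (x, g) * gg h k (x, g))"
  by (rule integral_semidirect(3)[OF sets_muInd km Fm fin])
 also have "\<dots> = (LINT x|muInd. ip (H (\<Phi> x)) (U \<xi> h x) (k x))"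
 proof (rule integral_cong_AE)
  show "(\<lambda>x. LINT g|lam (\<Phi> x). \<xi> (x, g) * gg h k (x, g)) \<in> borel_measurable muInd"
   using integral_kernel_borel[OF kernel_lam_Phi Fm] by (simp add: meas_muInd)
  show "(\<lambda>x. ip (H (\<Phi> x)) (U \<xi> h x) (k x)) \<in> borel_measurable muInd"
   by (rule ind.ip_measurable[OF U_bsec[OF BB_measurable[OF \<xi>] hb] kb])
  show "AE x in muInd. (LINT g|lam (\<Phi> x). \<xi> (x, g) * gg h k (x, g)) = ip (H (\<Phi> x)) (U \<xi> h x) (k x)"
   using A_finite(2)[OF \<xi> h]
  proof (rule eventually_mono)
   fix x assume "A \<xi> h x < \<infinity>"
   then show "(LINT g|lam (\<Phi> x). \<xi> (x, g) * gg h k (x, g)) = ip (H (\<Phi> x)) (U \<xi> h x) (k x)"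
    using TI(2)[OF Phi_unit BB_section[OF \<xi>] hb _ ind_in[OF kb], of x x] by (simp add: A_def U_def gg_def mult.assoc)
  qed
 qed
 finally show "(LINT p|semidirect muInd (\<lambda>x. lam (\<Phi> x)). \<xi> p * gg h k p) = (LINT x|muInd. ip (H (\<Phi> x)) (U \<xi> h x) (k x))" .
qed

text \<open>Exchange the integrations over \<open>x\<close> and \<open>\<gamma>\<close> on each
  fibre, then apply \<open>nn_mG_inv\<close>: the condition \<open>\<Phi>(x) = r(\<gamma>)\<close>
  turns into \<open>\<Phi>(x) = s(\<gamma>)\<close>.\<close>

lemma nn_invert:
 assumes F: "F \<in> Borel"
 shows "(NN p. F p d/semidirect muInd (\<lambda>x. lam (\<Phi> x)))
  = (NN p. ennreal (1 / \<Delta> (fst p)) * F (snd p, inv (fst p)) d/semidirect mG (\<lambda>a. \<nu>d (s a)))"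
proof -
 have km: "kernel muInd (\<lambda>x. lam (\<Phi> x))" by (rule kernel_borel_cong[OF kernel_lam_Phi sets_muInd])
 have kG: "kernel mG (\<lambda>a. \<nu>d (s a))" by (rule kernel_borel_cong[OF kernel_nud_s sets_mG])
 have F': "(\<lambda>p. F (snd p, fst p)) \<in> borel_measurable bGY"
  by (rule measurable_compose[OF _ F]) (intro borel_measurable_Pair borel_fst borel_snd)
 have F'': "(\<lambda>p. F (snd p, inv (fst p))) \<in> borel_measurable bGY"
  by (rule measurable_compose[OF _ F]) (intro borel_measurable_Pair borel_snd measurable_compose[OF borel_fst inv_measurable])
 define g where "g a = (NN x. F (x, a) d/\<nu>d (r a))" for a
 have gm: "g \<in> Borel" unfolding g_def using nn_kernel_borel[OF kernel_nud_r F'] by simp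
 have Fx: "(\<lambda>a. F (x, a)) \<in> Borel" for x by (rule measurable_compose[OF measurable_Pair_borel F])
 have "(NN p. F p d/semidirect muInd (\<lambda>x. lam (\<Phi> x))) = (NN u. NN x. NN a. F (x, a) d/lam (\<Phi> x) d/\<nu>d u d/\<mu>)"
  unfolding nn_integral_semidirect[OF sets_muInd km F] by (rule nn_muInd_nud[OF nn_kernel_borel[OF kernel_lam_Phi F]])
 also have "\<dots> = (NN u. NN a. g a d/lam u d/\<mu>)"
 proof (rule nn_integral_cong)
  fix u assume "u \<in> space \<mu>"
  then have u: "u \<in> X0" by simp
  have "(NN x. NN a. F (x, a) d/lam (\<Phi> x) d/\<nu>d u) = (NN x. NN a. F (x, a) d/lam u d/\<nu>d u)"
   by (rule nn_integral_cong_AE, rule eventually_mono[OF nud_AE[OF u]]) simp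
  also have "\<dots> = (NN a. NN x. F (x, a) d/\<nu>d u d/lam u)"
   by (rule nn_integral_swap[OF sets_nud[OF u] sets_lam[OF u] nud_sf[OF u] lam_sf[OF u] F])
  also have "\<dots> = (NN a. g a d/lam u)"
   by (rule nn_integral_cong_AE, rule eventually_mono[OF lam_AE[OF u]]) (simp add: g_def)
  finally show "(NN x. NN a. F (x, a) d/lam (\<Phi> x) d/\<nu>d u) = (NN a. g a d/lam u)" .
 qed
 also have "\<dots> = (NN a. ennreal (1 / \<Delta> a) * g (inv a) d/mG)" using nn_mG_inv[OF gm] nn_mG[OF gm] by simp
 also have "\<dots> = (NN a. NN x. ennreal (1 / \<Delta> a) * F (x, inv a) d/\<nu>d (s a) d/mG)"
 proof (rule nn_integral_cong)
  fix a
  have "(\<lambda>x. F (x, inv a)) \<in> borel_measurable (\<nu>d (s a))"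
   using measurable_compose[OF measurable_Pair_borel F'', of a] by (simp add: meas_nud)
  then show "ennreal (1 / \<Delta> a) * g (inv a) = (NN x. ennreal (1 / \<Delta> a) * F (x, inv a) d/\<nu>d (s a))"
   by (simp add: g_def rng_ginv nn_integral_cmult)
 qed
 also have "\<dots> = (NN p. ennreal (1 / \<Delta> (fst p)) * F (snd p, inv (fst p)) d/semidirect mG (\<lambda>a. \<nu>d (s a)))"
  by (subst nn_integral_semidirect[OF sets_mG kG])
    (use F'' measurable_compose[OF borel_fst Delta_measurable] in \<open>simp_all, measurable\<close>)
 finally show ?thesis .
qed

lemma Delta_W_inv: "1 / \<Delta> g * W (inv g) = W g"
 using less_imp_neq[OF W_pos[of g]] by (simp add: W_inv power2_eq_square flip: W_sq)

text \<open>Only \<open>U \<eta> k\<close> is unfolded, while \<open>U \<xi> h\<close> stays a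
  vector. Inverting \<open>\<gamma>\<close> gives the integral of
  \<open>c(a,x) W(a) (L_a (U \<xi> h)(x), k(r(a)))\<close> with \<open>c(a,x)\<close> the conjugate
  of \<open>\<eta>(x, a^{-1})\<close>; \<open>fibre_identity\<close> unfolds the second vector and
  collects \<open>\<eta>\<close> and \<open>\<xi>\<close> into their inner product.\<close>

theorem U_isometry:
 assumes \<xi>: "BB \<xi>" and \<eta>: "BB \<eta>" and h: "base.l2 h" and k: "base.l2 k"
 shows "(LINT x|muInd. ip (H (\<Phi> x)) (U \<xi> h x) (U \<eta> k x)) = (LINT u|\<mu>. ip (H u) (TI u (Z_inner G lam \<nu> d \<eta> \<xi>) h) (k u))"
proof -
 have hb: "N.bsec h" and kb: "N.bsec k" using h k by (simp_all add: base.l2_def base_bsec)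
 note Ul = U_l2[OF \<xi> h]
 note Ub = U_bsec[OF BB_measurable[OF \<xi>] hb]
 have kG: "kernel mG (\<lambda>a. \<nu>d (s a))" by (rule kernel_borel_cong[OF kernel_nud_s sets_mG])
 have km: "kernel muInd (\<lambda>x. lam (\<Phi> x))" by (rule kernel_borel_cong[OF kernel_lam_Phi sets_muInd])
 let ?M1 = "semidirect muInd (\<lambda>x. lam (\<Phi> x))" and ?M2 = "semidirect mG (\<lambda>a. \<nu>d (s a))"
 define c where "c p = cnj (\<eta> (snd p, inv (fst p)))" for p
 have \<tau>: "(\<lambda>p. (snd p, inv (fst p))) \<in> borel_measurable bGY"
  by (intro borel_measurable_Pair borel_snd measurable_compose[OF borel_fst inv_measurable])
 have w: "(\<lambda>p. 1 / \<Delta> (fst p)) \<in> borel_measurable bGY"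
  using measurable_compose[OF borel_fst Delta_measurable] by measurable
 have cm: "c \<in> Borel"
  unfolding c_def[abs_def] using measurable_compose[OF \<tau> BB_measurable[OF \<eta>]] by (rule borel_measurable_cnj)
 define F where "F p = cnj (\<eta> p * gg k (U \<xi> h) p)" for p
 have Fm: "F \<in> Borel"
  unfolding F_def[abs_def] using BB_measurable[OF \<eta>] gg_measurable[OF kb Ub] by measurable
 define E where "E p = (1 / \<Delta> (fst p)) *\<^sub>R F (snd p, inv (fst p))" for p
 have Em: "E \<in> Borel"
  unfolding E_def[abs_def] by (intro borel_measurable_scaleR w measurable_compose[OF \<tau> Fm])
 \<comment> \<open>Conjugation exchanges the arguments of the inner product, and the adjoint moves
   the action from \<open>k\<close> to \<open>U \<xi> h\<close>; off \<open>\<Phi> x = s a\<close>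
   both sides are zero.\<close>
 have E: "E (a, x) = c (a, x) * up (U \<xi> h) u (k u) (a, x)" if "r a = u" for a x u
 proof (cases "\<Phi> x = s a")
  case True
  have x: "U \<xi> h x \<in> carr (H (s a))" using ind_in[OF Ub, of x] True by simp
  have kr: "k (r a) \<in> carr (H (r a))" by (rule bsec_r[OF kb])
  have Lk: "L (inv a) (k (r a)) \<in> carr (H (s a))" using act_in[of "k (r a)" "inv a"] kr by (simp add: rng_ginv src_ginv)
  have "cor (1 / \<Delta> a) * cor (W (inv a)) = cor (W a)"
   unfolding of_real_mult[symmetric] Delta_W_inv ..
  moreover have "cnj (ip (H (s a)) (L (inv a) (k (r a))) (U \<xi> h x)) = ip (H (r a)) (L a (U \<xi> h x)) (k (r a))"
   using semi_inner_space.inner_cnj[OF base.semi Lk x] act_adjoint[OF x kr] by simp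
  ultimately show ?thesis
   using True that by (simp add: E_def F_def c_def up_def gg_def pr_def rng_ginv src_ginv scaleR_conv_of_real mult_ac flip: mult.assoc)
 qed (simp add: E_def F_def up_def gg_def pr_def rng_ginv)
 have inv: "(NN p. g p d/?M1) = (NN p. ennreal (1 / \<Delta> (fst p)) * g (snd p, inv (fst p)) d/?M2)" if "g \<in> Borel" for g
  by (rule nn_invert[OF that])
 have sM: "sets ?M1 = sets borel" "sets ?M2 = sets borel" by (rule sets_semidirect[OF sets_muInd km] sets_semidirect[OF sets_mG kG])+
 have sw: "cnj (ip (H (\<Phi> x)) (U \<eta> k x) (U \<xi> h x)) = ip (H (\<Phi> x)) (U \<xi> h x) (U \<eta> k x)" for x
  using semi_inner_space.inner_cnj[OF ind.semi ind_in[OF U_bsec[OF BB_measurable[OF \<eta>] kb]] ind_in[OF Ub]] by simp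
 have Eeq: "(LINT p|?M2. E p) = (LINT a|mG. LINT x|\<nu>d (s a). E (a, x))"
  and Efin: "(NN a. NN x. ennreal (norm (E (a, x))) d/\<nu>d (s a) d/mG) < \<infinity>"
 proof -
  have nE: "(\<lambda>p. ennreal (norm (E p))) \<in> Borel" and nF: "(\<lambda>p. ennreal (norm (F p))) \<in> Borel"
   using Em Fm by measurable
  have "(NN a. NN x. ennreal (norm (E (a, x))) d/\<nu>d (s a) d/mG) = (NN p. ennreal (norm (E p)) d/?M2)"
   by (rule nn_integral_semidirect[OF sets_mG kG nE, symmetric])
  also have "\<dots> = (NN p. ennreal (norm (F p)) d/?M1)"
   unfolding inv[OF nF] by (rule nn_integral_cong) (simp add: E_def ennreal_mult'[symmetric])
  also have "\<dots> < \<infinity>" using U_semidirect(1)[OF \<eta> k Ul] by (simp add: F_def integrable_iff_bounded del: complex_cnj_mult)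
  finally show fin: "(NN a. NN x. ennreal (norm (E (a, x))) d/\<nu>d (s a) d/mG) < \<infinity>" .
  show "(LINT p|?M2. E p) = (LINT a|mG. LINT x|\<nu>d (s a). E (a, x))"
   by (rule integral_semidirect(3)[OF sets_mG kG Em fin])
 qed
 have "(LINT x|muInd. ip (H (\<Phi> x)) (U \<xi> h x) (U \<eta> k x)) = cnj (LINT p|?M1. \<eta> p * gg k (U \<xi> h) p)"
  unfolding U_semidirect(2)[OF \<eta> k Ul] Bochner_Integration.integral_cnj[symmetric] sw ..
 also have "\<dots> = (LINT p|?M1. F p)" unfolding F_def by (rule Bochner_Integration.integral_cnj[symmetric])
 also have "\<dots> = (LINT p|?M2. E p)"
  unfolding E_def by (rule integral_transfer[OF sM \<tau> w _ Fm inv]) simp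
 also note Eeq
 also have "(LINT a|mG. LINT x|\<nu>d (s a). E (a, x)) = (LINT u|\<mu>. LINT a|lam u. LINT x|\<nu>d (s a). E (a, x))"
 proof -
  have m: "(\<lambda>a. LINT x|\<nu>d (s a). E (a, x)) \<in> Borel" by (rule integral_kernel_borel[OF kernel_nud_s Em])
  then have "(\<lambda>a. ennreal (norm (LINT x|\<nu>d (s a). E (a, x)))) \<in> Borel" by measurable
  from nn_mG[OF this] have "(NN u. NN a. ennreal (norm (LINT x|\<nu>d (s a). E (a, x))) d/lam u d/\<mu>) < \<infinity>"
   using le_less_trans[OF nn_integral_mono[OF norm_integral_le] Efin] by simp
  then show ?thesis unfolding mG_def by (rule integral_integrated(3)[OF kernel_mu_lam m])
 qed
 also have "\<dots> = (LINT u|\<mu>. ip (H u) (TI u (Z_inner G lam \<nu> d \<eta> \<xi>) h) (k u))"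
 proof (rule integral_cong_AE)
  show "(\<lambda>u. ip (H u) (TI u (Z_inner G lam \<nu> d \<eta> \<xi>) h) (k u)) \<in> borel_measurable \<mu>"
   using L_l2(1)[OF \<xi> \<eta> h] k by (intro base.ip_measurable) (simp_all add: base.l2_def)
  show "(\<lambda>u. LINT a|lam u. LINT x|\<nu>d (s a). E (a, x)) \<in> borel_measurable \<mu>"
   using kernel_lebesgue_measurable[OF kernel_mu_lam measurable_compose[OF measurable_snd integral_kernel_borel[OF kernel_nud_s Em]]] by simp
  \<comment> \<open>The majorant demanded by \<open>fibre_identity\<close>; finiteness of its total
    integral gives the identity for almost every \<open>u\<close>.\<close>
  let ?w = "\<lambda>p. ennreal (cmod (c p) * W (fst p)) * (ennreal (nrm (H (r (fst p))) (k (r (fst p)))) * A \<xi> h (snd p))"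
  have nkm: "(\<lambda>a. nrm (H (r a)) (k (r a))) \<in> Borel" by (rule measurable_compose[OF r_N0 N.nrm_measurable[OF kb]])
  note Am = A_measurable[OF BB_measurable[OF \<xi>] hb] A_measurable[OF BB_measurable[OF \<eta>] kb]
  have wm: "?w \<in> Borel"
   using cm measurable_compose[OF borel_fst nkm] measurable_compose[OF borel_fst W_measurable] measurable_compose[OF borel_snd Am(1)] by measurable
  let ?g = "\<lambda>p. ennreal (cmod (\<eta> p) * W (snd p) * hn k (snd p)) * A \<xi> h (fst p)"
  have gm: "?g \<in> Borel"
   using BB_measurable[OF \<eta>] measurable_compose[OF borel_snd W_measurable] measurable_compose[OF borel_snd hn_measurable[OF kb]]
    measurable_compose[OF borel_fst Am(1)] by measurable
  have "(NN u. NN a. NN x. ?w (a, x) d/\<nu>d (s a) d/lam u d/\<mu>) = (NN p. ?w p d/?M2)"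
   unfolding nn_integral_semidirect[OF sets_mG kG wm] by (rule nn_mG[OF nn_kernel_borel[OF kernel_nud_s wm], symmetric])
  also have "\<dots> = (NN p. ?g p d/?M1)"
   unfolding inv[OF gm]
  proof (rule nn_integral_cong)
   fix p :: "'g \<times> 'y"
   have "cmod (c p) * W (fst p) * nrm (H (r (fst p))) (k (r (fst p)))
    = 1 / \<Delta> (fst p) * (cmod (\<eta> (snd p, inv (fst p))) * W (inv (fst p)) * hn k (inv (fst p)))"
    by (subst Delta_W_inv[symmetric]) (simp add: c_def hn_def src_ginv mult_ac)
   then show "?w p = ennreal (1 / \<Delta> (fst p)) * ?g (snd p, inv (fst p))"
    using hn_nonneg[OF kb, of "inv (fst p)"] by (simp add: hn_def src_ginv mult.assoc[symmetric] ennreal_mult'[symmetric] ennreal_mult''[symmetric])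
  qed
  \<comment> \<open>Undoing the inversion leaves a product of two norm integrals, each square
    integrable over \<open>muInd\<close>.\<close>
  also have "\<dots> = (NN x. A \<eta> k x * A \<xi> h x d/muInd)"
   unfolding nn_integral_semidirect[OF sets_muInd km gm]
   using NI_measurable_fun[OF BB_section[OF \<eta>] kb] by (auto simp: A_def NI_def meas_lam intro!: nn_integral_cong nn_integral_multc)
  also have "\<dots> < \<infinity>"
  proof (rule ennreal_sq_finite)
   have "(NN x. A \<eta> k x * A \<xi> h x d/muInd)\<^sup>2 \<le> (NN x. (A \<eta> k x)\<^sup>2 d/muInd) * (NN x. (A \<xi> h x)\<^sup>2 d/muInd)"
    using Am by (intro Cauchy_Schwarz_nn_integral) (simp_all add: meas_muInd)
   also have "\<dots> < \<infinity>" using A_finite(1)[OF \<xi> h] A_finite(1)[OF \<eta> k] by (simp add: ennreal_mult_less_top)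
   finally show "(NN x. A \<eta> k x * A \<xi> h x d/muInd)\<^sup>2 < \<infinity>" .
  qed
  finally have "AE u in \<mu>. (NN a. NN x. ?w (a, x) d/\<nu>d (s a) d/lam u) \<noteq> \<infinity>"
   using kernel_nn_measurable[OF kernel_mu_lam measurable_compose[OF measurable_snd nn_kernel_borel[OF kernel_nud_s wm]]]
   by (intro nn_integral_noteq_infinite) simp_all
  with AE_space L_l2(2)[OF \<xi> \<eta> h] show "AE u in \<mu>. (LINT a|lam u. LINT x|\<nu>d (s a). E (a, x)) = ip (H u) (TI u (Z_inner G lam \<nu> d \<eta> \<xi>) h) (k u)"
  proof eventually_elim
   case (elim u)
   then have u: "u \<in> X0" by simp
   have ku: "k u \<in> carr (H u)" using N.bsec_in[OF kb] u by simp
   have Zm: "Z_inner G lam \<nu> d \<eta> \<xi> \<in> Borel" by (rule Z_inner_measurable[OF \<xi> \<eta>])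
   have "(NN a. NN x. ennreal (cmod (c (a, x)) * W a) * (ennreal (nrm (H u) (k u)) * A \<xi> h x) d/\<nu>d (s a) d/lam u)
    = (NN a. NN x. ?w (a, x) d/\<nu>d (s a) d/lam u)"
    by (rule nn_integral_cong_AE, rule eventually_mono[OF lam_AE[OF u]]) simp
   then have fin: "(NN a. NN x. ennreal (cmod (c (a, x)) * W a) * (ennreal (nrm (H u) (k u)) * A \<xi> h x) d/\<nu>d (s a) d/lam u) < \<infinity>"
    using elim(3) by (simp add: less_top)
   have "(LINT a|lam u. LINT x|\<nu>d (s a). E (a, x)) = (LINT a|lam u. LINT x|\<nu>d (s a). c (a, x) * up (U \<xi> h) u (k u) (a, x))"
    using integral_kernel_borel[OF kernel_nud_s Em] integral_kernel_borel[OF kernel_nud_s borel_measurable_times[OF cm up_measurable[OF cm \<xi> hb u ku Ub]]]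
    by - (rule integral_cong_AE[OF _ _ eventually_mono[OF lam_AE[OF u]]]; simp add: meas_lam[OF u] E)
   also have "\<dots> = (LINT t|lam u. Z_inner G lam \<nu> d \<eta> \<xi> t * cor (W t) * pr h u (k u) t)"
    by (rule fibre_identity[OF cm \<xi> hb u ku _ fin Zm]) (simp_all add: Z_inner_eq[OF \<xi> \<eta>] c_def)
   also have "\<dots> = ip (H u) (TI u (Z_inner G lam \<nu> d \<eta> \<xi>) h) (k u)"
    by (rule TI(2)[OF u Zm hb elim(2) ku, symmetric])
   finally show ?case .
  qed
 qed
 finally show ?thesis .
qed

section \<open>The intertwining relation\<close>

text \<open>With \<open>c = f d(x)^{1/2} d(y)^{1/2}\<close> the fibre identity yields
  \<open>d(x)\<close> times the left action, as \<open>d(x)^{1/2} = d(x) / d(x)^{1/2}\<close>. At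
  \<open>d(x) = 0\<close> both sides vanish; \<open>finA\<close> is restricted to the other points
  because finiteness is known almost everywhere for \<open>muInd\<close>, not for
  \<open>muNu\<close>.\<close>

lemma JJ_fibre:
 assumes f: "KK f" and \<xi>: "BB \<xi>" and h: "N.bsec h" and k: "ind.bsec k"
  and fin: "(NN g. NN y. ennreal (wt f ((x, g), y)) * (ennreal (nk k x) * A \<xi> h y) d/\<nu> (s g) d/lam (\<Phi> x)) < \<infinity>"
  and finA: "d x \<noteq> 0 \<Longrightarrow> A (LA f \<xi>) h x < \<infinity>"
 shows "(LINT g|lam (\<Phi> x). LINT y|\<nu> (s g). JJ f (U \<xi> h) k ((x, g), y))
  = cor (d x) * ip (H (\<Phi> x)) (U (LA f \<xi>) h x) (k x)"
proof (cases "d x = 0")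
 case False
 let ?u = "\<Phi> x" and ?v = "k x"
 define c where "c p = f (x, fst p, snd p) * cor (sqrt (d x) * sqrt (d (snd p)))" for p
 have f': "f \<in> Borel" using f by (simp add: KK_def)
 have dm: "(\<lambda>t. cor (sqrt (d x) * sqrt (d t))) \<in> Borel" by measurable
 have cm: "c \<in> Borel"
  unfolding c_def[abs_def]
  by (intro borel_measurable_times measurable_compose[OF _ f'] measurable_compose[OF borel_snd dm] borel_measurable_Pair borel_fst borel_snd borel_measurable_const)
 have v: "?v \<in> carr (H ?u)" by (rule ind_in[OF k])
 have w: "cmod (c (g, y)) * W g = wt f ((x, g), y)" for g y
  using d_nonneg by (simp add: c_def wt_def norm_mult mult_ac)
 have "JJ f (U \<xi> h) k ((x, g), y) = c (g, y) * up (U \<xi> h) ?u ?v (g, y)" for g y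
  by (simp add: JJ_def ap_def c_def up_def mult_ac)
 then have "(LINT g|lam ?u. LINT y|\<nu> (s g). JJ f (U \<xi> h) k ((x, g), y)) = (LINT g|lam ?u. LINT y|\<nu> (s g). c (g, y) * up (U \<xi> h) ?u ?v (g, y))"
  by simp
 also have "\<dots> = (LINT \<delta>|lam ?u. LA f \<xi> (x, \<delta>) * cor (d x) * cor (W \<delta>) * pr h ?u ?v \<delta>)"
 proof (rule fibre_identity[OF cm \<xi> h Phi_unit v])
  show "(NN g. NN y. ennreal (cmod (c (g, y)) * W g) * (ennreal (nrm (H ?u) ?v) * A \<xi> h y) d/\<nu> (s g) d/lam ?u) < \<infinity>"
   using fin by (simp add: w nk_def)
  show "(\<lambda>\<delta>. LA f \<xi> (x, \<delta>) * cor (d x)) \<in> Borel"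
   using BB_section[OF LA_BB[OF f \<xi>], of x] by measurable
  fix \<delta> assume \<delta>: "r \<delta> = ?u"
  have Z: "(x, \<delta>) \<in> Zsp G \<Phi>" by (simp add: Zsp_def \<delta>)
  have "sqrt (d x) * sqrt (d y) = sqrt (d y) / sqrt (d x) * d x" for y
   using d_nonneg[of x] real_div_sqrt[OF d_nonneg[of x]] False by (simp add: divide_simps)
  then have e: "cor (sqrt (d x) * sqrt (d y)) = cor (sqrt (d y) / sqrt (d x)) * cor (d x)" for y
   by (metis of_real_mult)
  have "c (g, y) * \<xi> (y, tmul (inv g) \<delta>) = f (x, g, y) * \<xi> (y, tmul (inv g) \<delta>) * cor (sqrt (d y) / sqrt (d x)) * cor (d x)" for g y
   unfolding c_def fst_conv snd_conv e by (simp only: mult_ac)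
  then show "(LINT g|lam ?u. LINT y|\<nu> (s g). c (g, y) * \<xi> (y, tmul (inv g) \<delta>)) = LA f \<xi> (x, \<delta>) * cor (d x)"
   by (simp only: integral_mult_left_zero LA_eq[OF f] Z if_True \<delta>)
 qed simp
 also have "\<dots> = cor (d x) * (LINT \<delta>|lam ?u. LA f \<xi> (x, \<delta>) * cor (W \<delta>) * pr h ?u ?v \<delta>)"
  unfolding integral_mult_right_zero[symmetric] by (simp only: mult_ac)
 also have "\<dots> = cor (d x) * ip (H ?u) (U (LA f \<xi>) h x) ?v"
  using TI(2)[OF Phi_unit BB_section[OF LA_BB[OF f \<xi>]] h _ v] finA[OF False] by (simp add: U_def A_def)
 finally show ?thesis .
qed (simp add: JJ_def)

lemma JF_U:
 assumes f: "KK f" and \<xi>: "BB \<xi>" and h: "base.l2 h" and k: "ind.l2 k"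
 shows "JF f (U \<xi> h) k = (LINT x|muInd. ip (H (\<Phi> x)) (U (LA f \<xi>) h x) (k x))"
proof -
 have hb: "N.bsec h" and kb: "ind.bsec k" using h k by (simp_all add: base.l2_def base_bsec ind.l2_def)
 have Ul: "ind.l2 (U \<xi> h)" by (rule U_l2[OF \<xi> h])
 have L: "BB (LA f \<xi>)" by (rule LA_BB[OF f \<xi>])
 have Jm: "JJ f (U \<xi> h) k \<in> Borel" by (rule JJ_measurable[OF f U_bsec[OF BB_measurable[OF \<xi>] hb] kb])
 let ?g = "\<lambda>x. ip (H (\<Phi> x)) (U (LA f \<xi>) h x) (k x)"
 have gm: "?g \<in> Borel"
  using ind.ip_measurable[OF U_bsec[OF BB_measurable[OF L] hb] kb] by (simp add: meas_muInd)
 let ?F = "\<lambda>p. ennreal (wt f p) * (ennreal (nk k (fst (fst p))) * A \<xi> h (snd p))"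
 have Am: "A \<xi> h \<in> Borel" by (rule A_measurable[OF BB_measurable[OF \<xi>] hb])
 have nm: "(\<lambda>x. ennreal (nk k x)) \<in> Borel" using nk_measurable[OF kb] by measurable
 have wm: "wt f \<in> Borel" using f by (intro wt_measurable) (simp add: KK_def)
 have Fm: "?F \<in> Borel"
  using wm measurable_compose[OF xgy_measurable(1) nm] measurable_compose[OF borel_snd Am] by measurable
 have "(NN p. ?F p d/MJ)\<^sup>2 < \<infinity>"
 proof -
  obtain B where B: "\<forall>a\<in>Borel. \<forall>b\<in>Borel.
   (NN p. ennreal (wt f p) * (b (fst (fst p)) * a (snd p)) d/MJ)\<^sup>2 \<le> ennreal B * (NN x. (a x)\<^sup>2 d/muInd) * (NN x. (b x)\<^sup>2 d/muInd)"
   using KK_bound[OF f] by blast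
  show ?thesis
   by (rule le_less_trans[OF B[rule_format, OF Am nm]]) (use A_finite(1)[OF \<xi> h] k in \<open>simp add: nk_sq[OF kb] ind.l2_def ennreal_mult_less_top\<close>)
 qed
 then have "(NN p. ?F p d/MJ) < \<infinity>" by (rule ennreal_sq_finite)
 moreover have "(\<lambda>x. NN \<gamma>. NN y. ?F ((x, \<gamma>), y) d/\<nu> (s \<gamma>) d/lam (\<Phi> x)) \<in> Borel"
  using nn_kernel_borel[OF kernel_lam_Phi nn_kernel_borel[OF kernel_nu_s_snd Fm]] by simp
 ultimately have ae1: "AE x in muNu. (NN \<gamma>. NN y. ?F ((x, \<gamma>), y) d/\<nu> (s \<gamma>) d/lam (\<Phi> x)) \<noteq> \<infinity>"
  unfolding nn_MJ[OF Fm] by (intro nn_integral_noteq_infinite) (auto simp: meas_muNu)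
 have ae2: "AE x in muNu. 0 < ennreal (d x) \<longrightarrow> A (LA f \<xi>) h x < \<infinity>"
  using A_finite(2)[OF L h] unfolding muInd_density by (subst (asm) AE_density) (auto simp: meas_muNu)
 have "JF f (U \<xi> h) k = (LINT x|muNu. LINT \<gamma>|lam (\<Phi> x). LINT y|\<nu> (s \<gamma>). JJ f (U \<xi> h) k ((x, \<gamma>), y))"
  by (rule JF_iterated(2)[OF f Ul k])
 also have "\<dots> = (LINT x|muNu. d x *\<^sub>R ?g x)"
 proof (rule integral_cong_AE)
  show "(\<lambda>x. LINT \<gamma>|lam (\<Phi> x). LINT y|\<nu> (s \<gamma>). JJ f (U \<xi> h) k ((x, \<gamma>), y)) \<in> borel_measurable muNu"
   using integral_kernel_borel[OF kernel_lam_Phi integral_kernel_borel[OF kernel_nu_s_snd Jm]] by (simp add: meas_muNu)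
  show "(\<lambda>x. d x *\<^sub>R ?g x) \<in> borel_measurable muNu"
   using gm by (auto simp: meas_muNu intro!: borel_measurable_scaleR)
  show "AE x in muNu. (LINT \<gamma>|lam (\<Phi> x). LINT y|\<nu> (s \<gamma>). JJ f (U \<xi> h) k ((x, \<gamma>), y)) = d x *\<^sub>R ?g x"
   using ae1 ae2
  proof eventually_elim
   case (elim x)
   then show ?case
    unfolding scaleR_conv_of_real using d_nonneg[of x] by (intro JJ_fibre[OF f \<xi> hb kb]) (auto simp: less_top)
  qed
 qed
 also have "\<dots> = (LINT x|muInd. ?g x)"
  unfolding muInd_density using gm d_nonneg by (intro integral_density[symmetric]) (auto simp: meas_muNu)
 finally show ?thesis .
qed

end

section \<open>Density of the range\<close>

text \<open>Used as densities, the positive and negative parts of \<open>g\<close> give measures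
  that are finite on compact sets and agree on test functions, so they coincide; on the set where
  \<open>g\<close> is positive the second one vanishes.\<close>

lemma AE_nonpos_test_fun:
 fixes Q :: "'a::{second_countable_topology, t2_space} measure" and g :: "'a \<Rightarrow> real"
 assumes lc: "locally_compact_space (euclidean :: 'a topology)" and Q: "sets Q = sets borel" and g: "g \<in> Borel"
  and int: "\<And>f. test_fun f \<Longrightarrow> integrable Q (\<lambda>x. f x * g x)" and eq: "\<And>f. test_fun f \<Longrightarrow> (LINT x|Q. f x * g x) = 0"
 shows "AE x in Q. g x \<le> 0"
proof -
 have mQ: "measurable Q M = measurable borel M" for M :: "'b measure" by (rule measurable_cong_sets[OF Q refl])
 have mQ1: "h \<in> Borel \<Longrightarrow> h \<in> borel_measurable Q" for h :: "'a \<Rightarrow> 'c::topological_space"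
  using measurable_cong_sets[OF Q refl, of "borel :: 'c measure"] by simp
 define p where "p \<sigma> x = max 0 (\<sigma> * g x)" for \<sigma> :: real and x
 have pm: "p \<sigma> \<in> Borel" for \<sigma> unfolding p_def[abs_def] using g by measurable
 have p0: "0 \<le> p \<sigma> x" for \<sigma> x by (simp add: p_def)
 define \<rho> where "\<rho> \<sigma> = density Q (\<lambda>x. ennreal (p \<sigma> x))" for \<sigma>
 have s\<rho>: "sets (\<rho> \<sigma>) = sets borel" for \<sigma> by (simp add: \<rho>_def Q)
 have em: "emeasure (\<rho> \<sigma>) A = (NN x. ennreal (p \<sigma> x) * indicator A x d/Q)" if "A \<in> sets borel" for \<sigma> A
  unfolding \<rho>_def using that pm[of \<sigma>] by (intro emeasure_density) (auto intro: mQ1 simp: Q)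
 have pint: "integrable Q (\<lambda>x. f x * p \<sigma> x)" if f: "test_fun f" and \<sigma>: "\<sigma> = 1 \<or> \<sigma> = -1" for f \<sigma>
 proof (rule Bochner_Integration.integrable_bound[OF int[OF f]])
  show "(\<lambda>x. f x * p \<sigma> x) \<in> borel_measurable Q"
   using test_fun_measurable[OF f] pm[of \<sigma>] by (intro mQ1) measurable
  show "AE x in Q. norm (f x * p \<sigma> x) \<le> norm (f x * g x)"
   using \<sigma> by (auto simp: p_def abs_mult intro!: mult_left_mono)
 qed
 have fin: "emeasure (\<rho> \<sigma>) K < \<infinity>" if K: "compact K" and \<sigma>: "\<sigma> = 1 \<or> \<sigma> = -1" for K \<sigma>
 proof -
  obtain f where f: "test_fun f" "\<And>x. x \<in> K \<Longrightarrow> 1/2 < f x" using compact_test_fun[OF lc K] by blast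
  have "emeasure (\<rho> \<sigma>) K = (NN x. ennreal (p \<sigma> x) * indicator K x d/Q)" using K by (intro em borel_compact)
  also have "\<dots> \<le> (NN x. ennreal (norm (2 * (f x * p \<sigma> x))) d/Q)"
  proof (rule nn_integral_mono)
   fix x
   have f0: "0 \<le> f x" using f(1) by (simp add: test_fun_def)
   show "ennreal (p \<sigma> x) * indicator K x \<le> ennreal (norm (2 * (f x * p \<sigma> x)))"
   proof (cases "x \<in> K")
    case True
    have "1 * p \<sigma> x \<le> (2 * f x) * p \<sigma> x" using f(2)[OF True] p0[of \<sigma> x] by (intro mult_right_mono) auto
    then show ?thesis using True f0 p0 by (simp add: abs_mult ennreal_leI)
   qed simp
  qed
  also have "\<dots> < \<infinity>" using integrable_mult_right[OF pint[OF f(1) \<sigma>], of 2] by (simp only: integrable_iff_bounded)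
  finally show ?thesis .
 qed
 have "\<rho> 1 = \<rho> (-1)"
 proof (rule measure_eqI_test_fun[OF lc])
  fix f :: "'a \<Rightarrow> real" assume f: "test_fun f"
  have L: "(LINT x|\<rho> \<sigma>. cor (f x)) = cor (LINT x|Q. f x * p \<sigma> x)" for \<sigma>
  proof -
   have "(LINT x|\<rho> \<sigma>. cor (f x)) = (LINT x|Q. p \<sigma> x *\<^sub>R cor (f x))"
    unfolding \<rho>_def using pm[of \<sigma>] test_fun_measurable[OF f] by (intro integral_density mQ1) (auto simp: p0)
   also have "\<dots> = (LINT x|Q. cor (f x * p \<sigma> x))" by (simp add: scaleR_conv_of_real mult.commute)
   finally show ?thesis by (simp only: integral_complex_of_real)
  qed
  have "(LINT x|Q. f x * p 1 x) - (LINT x|Q. f x * p (-1) x) = (LINT x|Q. f x * p 1 x - f x * p (-1) x)"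
   by (rule Bochner_Integration.integral_diff[symmetric]) (rule pint[OF f], simp)+
  also have "\<dots> = (LINT x|Q. f x * g x)"
   by (rule Bochner_Integration.integral_cong[OF refl]) (auto simp: p_def max_def)
  finally show "(LINT x|\<rho> 1. cor (f x)) = (LINT x|\<rho> (-1). cor (f x))"
   unfolding L using eq[OF f] by simp
 qed (use s\<rho> fin in auto)
 moreover have P: "{x. 0 < g x} \<in> sets borel" using g by measurable
 ultimately have "(NN x. ennreal (p 1 x) * indicator {x. 0 < g x} x d/Q) = (NN x. ennreal (p (-1) x) * indicator {x. 0 < g x} x d/Q)"
  by (simp flip: em)
 also have "\<dots> = (NN x. 0 d/Q)" by (rule nn_integral_cong) (auto simp: p_def indicator_def)
 finally have "(NN x. ennreal (p 1 x) * indicator {x. 0 < g x} x d/Q) = 0" by simp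
 moreover have "(\<lambda>x. ennreal (p 1 x) * indicator {x. 0 < g x} x) \<in> borel_measurable Q"
  using pm[of 1] by (intro mQ1 borel_measurable_times_ennreal borel_measurable_indicator P) measurable
 ultimately have "AE x in Q. ennreal (p 1 x) * indicator {x. 0 < g x} x = 0" by (simp add: nn_integral_0_iff_AE)
 then show ?thesis by (rule eventually_mono) (auto simp: p_def indicator_def split: if_splits)
qed

lemma AE_zero_test_fun:
 fixes Q :: "'a::{second_countable_topology, t2_space} measure" and g :: "'a \<Rightarrow> complex"
 assumes lc: "locally_compact_space (euclidean :: 'a topology)" and Q: "sets Q = sets borel" and g: "g \<in> Borel"
  and int: "\<And>f. test_fun f \<Longrightarrow> integrable Q (\<lambda>x. cor (f x) * g x)"
  and eq: "\<And>f. test_fun f \<Longrightarrow> (LINT x|Q. cor (f x) * g x) = 0"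
 shows "AE x in Q. g x = 0"
proof -
 have part: "AE x in Q. l (g x) \<le> 0" if l: "bounded_linear l" "\<And>c z. l (cor c * z) = c * l z" for l :: "complex \<Rightarrow> real"
 proof (rule AE_nonpos_test_fun[OF lc Q])
  interpret bounded_linear l by fact
  show "(\<lambda>x. l (g x)) \<in> Borel"
   using g linear_continuous_on[OF l(1)] by (rule borel_measurable_continuous_on[rotated])
  fix f :: "'a \<Rightarrow> real" assume f: "test_fun f"
  show "integrable Q (\<lambda>x. f x * l (g x))" using integrable_bounded_linear[OF l(1) int[OF f]] by (simp add: l(2))
  show "(LINT x|Q. f x * l (g x)) = 0" using integral_bounded_linear[OF l(1) int[OF f]] eq[OF f] by (simp add: l(2) zero)
 qed
 have "AE x in Q. Re (g x) \<le> 0" "AE x in Q. - Re (g x) \<le> 0" "AE x in Q. Im (g x) \<le> 0" "AE x in Q. - Im (g x) \<le> 0"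
  by (rule part; auto intro: bounded_linear_Re bounded_linear_Im bounded_linear_minus)+
 then show ?thesis by eventually_elim (auto simp: complex_eq_iff)
qed

context induction_data
begin

lemma lcYG: "locally_compact_space (euclidean :: ('y \<times> 'g) topology)"
 using lcY lcG locally_compact_space_prod_topology[of "euclidean :: 'y topology" "euclidean :: 'g topology"] by simp

text \<open>A test function on \<open>Y \<times> G\<close>, cut down to the closed set
  \<open>Z\<close>, lies in \<open>Cc (Zsp G \<Phi>)\<close>, and the kernel \<open>gg\<close>
  vanishes off \<open>Z\<close> anyway; so orthogonality forces \<open>gg\<close> to vanish almost
  everywhere. Positivity of \<open>W\<close> then removes the weight.\<close>

lemma orthogonal_AE:
 assumes h: "base.l2 h" and k: "ind.l2 k"
  and orth: "\<And>\<xi>. \<xi> \<in> Cc (Zsp G \<Phi>) \<Longrightarrow> (LINT x|muInd. ip (H (\<Phi> x)) (U \<xi> h x) (k x)) = 0"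
 shows "AE x in muInd. AE g in lam (\<Phi> x). pr h (\<Phi> x) (k x) g = 0"
proof -
 have hb: "N.bsec h" and kb: "ind.bsec k" using h k by (simp_all add: base.l2_def base_bsec ind.l2_def)
 have gm: "gg h k \<in> Borel" by (rule gg_measurable[OF hb kb])
 have km: "kernel muInd (\<lambda>x. lam (\<Phi> x))" by (rule kernel_borel_cong[OF kernel_lam_Phi sets_muInd])
 let ?Q = "semidirect muInd (\<lambda>x. lam (\<Phi> x))"
 have e: "cor (f p) * gg h k p = cor (f p * indicator (Zsp G \<Phi>) p) * gg h k p" for f :: "'y \<times> 'g \<Rightarrow> real" and p
  by (cases p) (auto simp: gg_def pr_def Zsp_def indicator_def)
 have "AE p in ?Q. gg h k p = 0"
 proof (rule AE_zero_test_fun[OF lcYG _ gm])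
  show "sets ?Q = sets borel" by (rule sets_semidirect[OF sets_muInd km])
  fix f :: "'y \<times> 'g \<Rightarrow> real" assume "test_fun f"
  from Cc_restrict[OF this closed_Zsp] have c: "(\<lambda>p. cor (f p * indicator (Zsp G \<Phi>) p)) \<in> Cc (Zsp G \<Phi>)" .
  show "integrable ?Q (\<lambda>p. cor (f p) * gg h k p)" "(LINT p|?Q. cor (f p) * gg h k p) = 0"
   unfolding e using U_semidirect[OF Cc_BB[OF c] h k] orth[OF c] by simp_all
 qed
 moreover have "{p. \<not> gg h k p = 0} \<in> sets borel" using gm by measurable
 ultimately show ?thesis
  using AE_semidirect[OF sets_muInd km, of "\<lambda>p. gg h k p = 0"] by (simp add: gg_def less_imp_neq[OF W_pos, symmetric])
qed

text \<open>Countably many sections \<open>h\<close> are tested at once. For almost every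
  \<open>x\<close> a single arrow \<open>g\<close> into \<open>\<Phi> x\<close> at which all
  coefficients vanish is enough: \<open>L (inv g) (k x)\<close> is then orthogonal to the
  fundamental sequence at \<open>s g\<close>.\<close>

lemma range_dense:
 assumes k: "ind.l2 k"
  and orth: "\<And>\<xi> h. \<xi> \<in> Cc (Zsp G \<Phi>) \<Longrightarrow> base.l2 h \<Longrightarrow> (LINT x|muInd. ip (H (\<Phi> x)) (U \<xi> h x) (k x)) = 0"
 shows "AE x in muInd. k x = vzero (H (\<Phi> x))"
proof -
 have kb: "ind.bsec k" using k by (simp add: ind.l2_def)
 interpret mu: sigma_finite_measure \<mu> by (rule mu_sigma_finite)
 obtain E :: "nat \<Rightarrow> 'g set" where E: "range E \<subseteq> sets \<mu>" "(\<Union>i. E i) = X0" "\<And>i. emeasure \<mu> (E i) \<noteq> \<infinity>"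
  using mu.sigma_finite by auto
 \<comment> \<open>Cutting down to a set of finite measure and dividing by \<open>1 + |e_n|\<close>
   makes the fundamental sections square integrable; the factor is nonzero on \<open>E m\<close>,
   and these sets cover the unit space.\<close>
 define c where "c m n u = indicator (E m) u / (1 + nrm (H u) (e0 n u))" for m n u
 define h where "h m n u = vscale (H u) (cor (c m n u)) (e0 n u)" for m n u
 have eN: "base.bsec (e0 n)" for n by (rule base.bsec_e)
 have e_in: "e0 n u \<in> carr (H u)" if "u \<in> X0" for n u using base.e_in[of u n] that by simp
 have n0: "0 \<le> nrm (H u) (e0 n u)" if "u \<in> X0" for n u
  using semi_inner_space.nrm_nonneg[OF base.semi e_in] that by simp
 have cm: "(\<lambda>u. cor (c m n u)) \<in> borel_measurable \<mu>" for m n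
 proof -
  have "indicat_real (E m) \<in> borel_measurable \<mu>" using E(1) by (intro borel_measurable_indicator) auto
  then show ?thesis unfolding c_def[abs_def] using base.nrm_measurable[OF eN[of n]] by measurable
 qed
 have hl: "base.l2 (h m n)" for m n
 proof -
  have "base.bsec (h m n)" unfolding h_def[abs_def] by (rule base.bsec_scale[OF eN cm])
  moreover have "(NN u. ennreal ((nrm (H u) (h m n u))\<^sup>2) d/\<mu>) \<le> (NN u. indicator (E m) u d/\<mu>)"
  proof (rule nn_integral_mono)
   fix u assume "u \<in> space \<mu>"
   then have u: "u \<in> X0" by simp
   have "nrm (H u) (h m n u) = \<bar>c m n u\<bar> * nrm (H u) (e0 n u)"
    using semi_inner_space.nrm_scale[OF base.semi e_in[OF u]] u by (simp add: h_def)
   then have "nrm (H u) (h m n u) = indicator (E m) u * (nrm (H u) (e0 n u) / (1 + nrm (H u) (e0 n u)))"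
    using n0[OF u, of n] by (simp add: c_def indicator_def)
   moreover have "0 \<le> nrm (H u) (e0 n u) / (1 + nrm (H u) (e0 n u))" "nrm (H u) (e0 n u) / (1 + nrm (H u) (e0 n u)) \<le> 1"
    using n0[OF u, of n] by auto
   ultimately have "(nrm (H u) (h m n u))\<^sup>2 \<le> indicator (E m) u"
    by (auto simp: indicator_def power_mult_distrib intro: power_le_one)
   then show "ennreal ((nrm (H u) (h m n u))\<^sup>2) \<le> indicator (E m) u"
    by (metis ennreal_indicator ennreal_leI)
  qed
  moreover have "(NN u. indicator (E m) u d/\<mu>) < \<infinity>" using E(1) E(3)[of m] by (subst nn_integral_indicator) (auto simp: less_top)
  ultimately show ?thesis by (simp add: base.l2_def)
 qed
 have "AE x in muInd. \<forall>m n. AE g in lam (\<Phi> x). pr (h m n) (\<Phi> x) (k x) g = 0"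
  using orthogonal_AE[OF hl k orth[OF _ hl]] by (simp add: AE_all_countable)
 then show ?thesis
 proof (rule eventually_mono)
  fix x assume "\<forall>m n. AE g in lam (\<Phi> x). pr (h m n) (\<Phi> x) (k x) g = 0"
  then have "AE g in lam (\<Phi> x). \<forall>m n. pr (h m n) (\<Phi> x) (k x) g = 0" by (simp add: AE_all_countable)
  with lam_AE[OF Phi_unit[of x]] have ae: "AE g in lam (\<Phi> x). r g = \<Phi> x \<and> (\<forall>m n. pr (h m n) (\<Phi> x) (k x) g = 0)"
   by eventually_elim simp
  \<comment> \<open>If no such arrow existed, \<open>lam (\<Phi> x)\<close> would be the zero
    measure, against fullness.\<close>
  have "\<exists>g. r g = \<Phi> x \<and> (\<forall>m n. pr (h m n) (\<Phi> x) (k x) g = 0)"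
  proof (rule ccontr)
   assume no: "\<not> ?thesis"
   have "AE g in lam (\<Phi> x). False" by (rule eventually_mono[OF ae]) (use no in blast)
   then have "emeasure (lam (\<Phi> x)) (space (lam (\<Phi> x))) = 0" by (simp add: AE_iff_null null_sets_def)
   then show False using lam_nonzero[OF Phi_unit, of x] by (simp add: space_lam)
  qed
  then obtain g where g: "r g = \<Phi> x" and z: "\<And>m n. pr (h m n) (\<Phi> x) (k x) g = 0" by blast
  interpret Hs: hilbert_space "H (s g)" by (rule hilH) simp
  interpret Hr: hilbert_space "H (r g)" by (rule hilH) simp
  have kx: "k x \<in> carr (H (r g))" using ind_in[OF kb, of x] g by simp
  have Lk: "L (inv g) (k x) \<in> carr (H (s g))" using act_in[of "k x" "inv g"] kx by (simp add: rng_ginv src_ginv)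
  obtain m where m: "s g \<in> E m" using E(2) s_unit[of g] by blast
  have "ip (H (s g)) (L (inv g) (k x)) (e0 n (s g)) = ip (H (s g)) (vzero (H (s g))) (e0 n (s g))" for n
  proof -
   have en: "e0 n (s g) \<in> carr (H (s g))" by (rule e_in) simp
   have "c m n (s g) \<noteq> 0" using m n0[of "s g" n] by (simp add: c_def)
   moreover have "cor (c m n (s g)) * ip (H (r g)) (L g (e0 n (s g))) (k x) = 0"
    using z[of m n] en kx by (simp add: pr_def h_def g[symmetric] act_scale act_in Hr.inner_simps)
   ultimately have "ip (H (s g)) (e0 n (s g)) (L (inv g) (k x)) = 0" using act_adjoint[OF en kx] by simp
   then show ?thesis using Hs.inner_cnj[OF en Lk] en by (simp add: Hs.inner_simps)
  qed
  then have "L (inv g) (k x) = vzero (H (s g))" by (intro base.e_separating[of "s g"] Lk Hs.zero_in) auto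
  then have "nrm (H (r g)) (k x) = 0"
   using act_nrm[OF Lk] act_inv[OF kx] by (simp add: Hs.nrm_zero)
  then show "k x = vzero (H (\<Phi> x))" using Hr.nrm_eq_0[OF kx] g by simp
 qed
qed

end

section \<open>The induced representations\<close>

context induction_data
begin

abbreviation Hsp :: "('g \<Rightarrow> 'h) set ips" where "Hsp \<equiv> rep_space R"

lemma Hsp_eq: "Hsp = separation base.S" by (simp add: rep_space_def L2_def)

lemma hilbert_Hsp: "hilbert_space Hsp" using base.hilbert_L2 by (simp add: rep_space_def)

interpretation Q: hilbert_space Hsp by (rule hilbert_Hsp)
interpretation J: hilbert_space Jsp by (rule hilbert_Jsp)

definition uu :: "('y \<times> 'g \<Rightarrow> complex) \<Rightarrow> ('g \<Rightarrow> 'h) set \<Rightarrow> ('y \<Rightarrow> 'h) set" where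
 "uu \<xi> P = cls ind.S (U \<xi> (rep P))"

lemma rep_Hsp: "P \<in> carr Hsp \<Longrightarrow> rep P \<in> carr base.S" "P \<in> carr Hsp \<Longrightarrow> base.l2 (rep P)" "P \<in> carr Hsp \<Longrightarrow> cls base.S (rep P) = P"
 using base.S.rep_sep_in[of P] base.S.cls_rep[of P] by (auto simp: Hsp_eq base.carr_S)

lemma U_in_S: "BB \<xi> \<Longrightarrow> base.l2 h \<Longrightarrow> U \<xi> h \<in> carr ind.S"
 using U_l2 by (simp add: ind.carr_S)

lemma uu_in: "BB \<xi> \<Longrightarrow> P \<in> carr Hsp \<Longrightarrow> uu \<xi> P \<in> carr Jsp"
 unfolding uu_def Jsp_eq ind.S.carr_separation by (intro imageI U_in_S rep_Hsp)

definition Lh :: "('y \<times> 'g \<Rightarrow> complex) \<Rightarrow> ('y \<times> 'g \<Rightarrow> complex) \<Rightarrow> ('g \<Rightarrow> 'h) \<Rightarrow> 'g \<Rightarrow> 'h" where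
 "Lh \<eta> \<xi> h = (\<lambda>u\<in>X0. TI u (Z_inner G lam \<nu> d \<eta> \<xi>) h)"

lemma Lh_in: "BB \<xi> \<Longrightarrow> BB \<eta> \<Longrightarrow> base.l2 h \<Longrightarrow> Lh \<eta> \<xi> h \<in> carr base.S"
 using L_l2(1)[of \<xi> \<eta> h] base.l2_restrict[of "\<lambda>u. TI u (Z_inner G lam \<nu> d \<eta> \<xi>) h"] by (simp add: Lh_def base.carr_S)

lemma U_ip_S:
 assumes "BB \<xi>" "BB \<eta>" "base.l2 h" "base.l2 k"
 shows "ip ind.S (U \<xi> h) (U \<eta> k) = ip base.S (Lh \<eta> \<xi> h) k"
proof -
 have "ip base.S (Lh \<eta> \<xi> h) k = (LINT u|\<mu>. ip (H u) (TI u (Z_inner G lam \<nu> d \<eta> \<xi>) h) (k u))"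
  unfolding base.S_simps by (rule Bochner_Integration.integral_cong[OF refl]) (simp add: Lh_def)
 then show ?thesis by (simp add: ind.S_simps U_isometry[OF assms])
qed

lemma integrated_form_Lh: "integrated_form G lam R \<Delta> (Z_inner G lam \<nu> d \<eta> \<xi>) P = cls base.S (Lh \<eta> \<xi> (rep P))"
 by (simp add: integrated_form_def Lh_def)

text \<open>Formulated on the class \<open>BB\<close>, so that it also covers the discontinuous
  functions \<open>f \<cdot> \<xi>\<close> in \<open>extended_elem_vector\<close>.\<close>

lemma IndM_form_eq:
 assumes "BB \<xi>" "BB \<eta>" "P \<in> carr Hsp" "B \<in> carr Hsp"
 shows "IndM_form G lam \<nu> d R \<Delta> \<xi> P \<eta> B = ip Jsp (uu \<xi> P) (uu \<eta> B)"
proof -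
 have "IndM_form G lam \<nu> d R \<Delta> \<xi> P \<eta> B = ip Hsp (cls base.S (Lh \<eta> \<xi> (rep P))) (cls base.S (rep B))"
  unfolding IndM_form_def integrated_form_Lh using rep_Hsp(3)[OF assms(4)] by simp
 also have "\<dots> = ip base.S (Lh \<eta> \<xi> (rep P)) (rep B)"
  unfolding Hsp_eq using assms by (intro base.S.ip_separation Lh_in rep_Hsp)
 also have "\<dots> = ip ind.S (U \<xi> (rep P)) (U \<eta> (rep B))"
  using assms by (intro U_ip_S[symmetric] rep_Hsp)
 also have "\<dots> = ip Jsp (uu \<xi> P) (uu \<eta> B)"
  unfolding uu_def Jsp_eq using assms by (intro ind.S.ip_separation[symmetric] U_in_S rep_Hsp)
 finally show ?thesis .
qed

text \<open>The isometry expresses inner products of values of \<open>U\<close> through vectors over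
  the base, where only classes matter; a change of representative therefore changes
  \<open>U \<xi> h\<close> by a null vector.\<close>

lemma uu_cls:
 assumes \<xi>: "BB \<xi>" and h: "h \<in> carr base.S"
 shows "uu \<xi> (cls base.S h) = cls ind.S (U \<xi> h)"
proof -
 let ?h = "rep (cls base.S h)"
 have h': "?h \<in> carr base.S" "nrm base.S (vdiff base.S ?h h) = 0" using base.S.rep_cls[OF h] by auto
 have l: "base.l2 h" "base.l2 ?h" using h h'(1) by (auto simp: base.carr_S)
 have e: "ip ind.S (U \<xi> t) (U \<xi> ?h) = ip ind.S (U \<xi> t) (U \<xi> h)" if t: "base.l2 t" for t
  unfolding U_ip_S[OF \<xi> \<xi> t l(1)] U_ip_S[OF \<xi> \<xi> t l(2)]
  using h h' Lh_in[OF \<xi> \<xi> t] by (intro base.S.inner_cong base.S.nrm_diff_self)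
 have S: "U \<xi> ?h \<in> carr ind.S" "U \<xi> h \<in> carr ind.S" by (rule U_in_S[OF \<xi>], fact)+
 have "Re (ip ind.S (U \<xi> ?h) (U \<xi> h)) = Re (ip ind.S (U \<xi> h) (U \<xi> h))"
  using arg_cong[OF ind.S.inner_cnj[OF S], where f = Re] e[OF l(1)] by simp
 then have "(nrm ind.S (vdiff ind.S (U \<xi> ?h) (U \<xi> h)))\<^sup>2 = 0"
  using e[OF l(2)] by (simp add: ind.S.nrm_sq_diff[OF S] ind.S.nrm_sq S)
 then show ?thesis unfolding uu_def ind.S.cls_eq_iff[OF S] by simp
qed

lemma ip_uu: "BB \<xi> \<Longrightarrow> BB \<eta> \<Longrightarrow> P \<in> carr Hsp \<Longrightarrow> B \<in> carr Hsp \<Longrightarrow>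
  ip Jsp (uu \<xi> P) (uu \<eta> B) = ip Hsp (integrated_form G lam R \<Delta> (Z_inner G lam \<nu> d \<eta> \<xi>) P) B"
 by (simp add: IndM_form_eq[symmetric] IndM_form_def)

lemma integrated_form_in:
 "BB \<xi> \<Longrightarrow> BB \<eta> \<Longrightarrow> P \<in> carr Hsp \<Longrightarrow> integrated_form G lam R \<Delta> (Z_inner G lam \<nu> d \<eta> \<xi>) P \<in> carr Hsp"
 using Lh_in[of \<xi> \<eta> "rep P"] rep_Hsp(2)[of P] unfolding integrated_form_Lh Hsp_eq base.S.carr_separation by (intro imageI) blast

text \<open>By the isometry both sides pair equally with every \<open>uu \<xi> C\<close>. Their
  difference is a combination of such vectors, hence orthogonal to itself.\<close>

lemma uu_addr:
 assumes \<xi>: "BB \<xi>" and P: "P \<in> carr Hsp" and B: "B \<in> carr Hsp"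
 shows "uu \<xi> (vadd Hsp P B) = vadd Jsp (uu \<xi> P) (uu \<xi> B)"
proof (rule J.eq_if_nrm_diff_0)
 let ?a = "uu \<xi> (vadd Hsp P B)" and ?b = "vadd Jsp (uu \<xi> P) (uu \<xi> B)"
 have AB: "vadd Hsp P B \<in> carr Hsp" using P B by (rule Q.add_in)
 note c = uu_in[OF \<xi> AB] uu_in[OF \<xi> P] uu_in[OF \<xi> B]
 show a: "?a \<in> carr Jsp" and b: "?b \<in> carr Jsp" using c by (simp_all add: J.closed)
 have "ip Jsp (uu \<xi> C) ?a = ip Jsp (uu \<xi> C) ?b" if "C \<in> carr Hsp" for C
  using that by (simp add: J.inner_simps c uu_in[OF \<xi>] ip_uu[OF \<xi> \<xi>] AB P B Q.inner_simps integrated_form_in[OF \<xi> \<xi>])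
 then have o: "ip Jsp (uu \<xi> C) (vdiff Jsp ?a ?b) = 0" if "C \<in> carr Hsp" for C
  using that a b by (simp add: J.inner_diff_right uu_in[OF \<xi>])
 have "ip Jsp (vdiff Jsp ?a ?b) (vdiff Jsp ?a ?b) = 0"
  using o[OF AB] o[OF P] o[OF B] a b c by (simp add: J.inner_diff J.inner_add J.diff_in)
 then show "nrm Jsp (vdiff Jsp ?a ?b) = 0" by (simp add: nrm_def)
qed

lemma uu_scaler:
 assumes \<xi>: "BB \<xi>" and P: "P \<in> carr Hsp"
 shows "uu \<xi> (vscale Hsp z P) = vscale Jsp z (uu \<xi> P)"
proof (rule J.eq_if_nrm_diff_0)
 let ?a = "uu \<xi> (vscale Hsp z P)" and ?b = "vscale Jsp z (uu \<xi> P)"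
 have AB: "vscale Hsp z P \<in> carr Hsp" using P by (rule Q.scale_in)
 note c = uu_in[OF \<xi> AB] uu_in[OF \<xi> P]
 show a: "?a \<in> carr Jsp" and b: "?b \<in> carr Jsp" using c by (simp_all add: J.closed)
 have "ip Jsp (uu \<xi> C) ?a = ip Jsp (uu \<xi> C) ?b" if "C \<in> carr Hsp" for C
  using that by (simp add: J.inner_simps c uu_in[OF \<xi>] ip_uu[OF \<xi> \<xi>] AB P Q.inner_simps integrated_form_in[OF \<xi> \<xi>])
 then have o: "ip Jsp (uu \<xi> C) (vdiff Jsp ?a ?b) = 0" if "C \<in> carr Hsp" for C
  using that a b by (simp add: J.inner_diff_right uu_in[OF \<xi>])
 have "ip Jsp (vdiff Jsp ?a ?b) (vdiff Jsp ?a ?b) = 0"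
  using o[OF AB] o[OF P] a b c by (simp add: J.inner_diff J.inner_scale J.diff_in)
 then show "nrm Jsp (vdiff Jsp ?a ?b) = 0" by (simp add: nrm_def)
qed

text \<open>Fibrewise additivity needs both norm integrals finite: where one diverges, its weak
  integral is zero by default. Finiteness holds almost everywhere, so classes are additive.\<close>

lemma U_linear:
 assumes \<xi>: "BB \<xi>" and \<xi>': "BB \<xi>'" and h: "N.bsec h" and fin: "A \<xi> h x < \<infinity>" "A \<xi>' h x < \<infinity>"
 shows "U (\<lambda>p. \<xi> p + \<xi>' p) h x = vadd (H (\<Phi> x)) (U \<xi> h x) (U \<xi>' h x)"
  and "U (\<lambda>p. c * \<xi> p) h x = vscale (H (\<Phi> x)) c (U \<xi> h x)"
proof -
 interpret hilbert_space "H (\<Phi> x)" by (rule hilH) simp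
 note m = BB_section[OF \<xi>, of x] BB_section[OF \<xi>', of x]
 have ma: "(\<lambda>g. \<xi> (x, g) + \<xi>' (x, g)) \<in> Borel" and ms: "(\<lambda>g. c * \<xi> (x, g)) \<in> Borel"
  using m by measurable
 have f: "NI (\<Phi> x) (\<lambda>g. \<xi> (x, g)) h < \<infinity>" "NI (\<Phi> x) (\<lambda>g. \<xi>' (x, g)) h < \<infinity>" using fin by (simp_all add: A_def)
 have NIm: "(\<lambda>g. ennreal (cmod (\<xi> (x, g)) * W g * hn h g)) \<in> borel_measurable (lam (\<Phi> x))"
  "(\<lambda>g. ennreal (cmod (\<xi>' (x, g)) * W g * hn h g)) \<in> borel_measurable (lam (\<Phi> x))"
  using NI_measurable_fun[OF m(1) h] NI_measurable_fun[OF m(2) h] by (simp_all add: meas_lam)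
 have "NI (\<Phi> x) (\<lambda>g. \<xi> (x, g) + \<xi>' (x, g)) h \<le> NI (\<Phi> x) (\<lambda>g. \<xi> (x, g)) h + NI (\<Phi> x) (\<lambda>g. \<xi>' (x, g)) h"
  unfolding NI_def nn_integral_add[OF NIm, symmetric]
 proof (rule nn_integral_mono)
  fix g
  have "cmod (\<xi> (x, g) + \<xi>' (x, g)) * (W g * hn h g) \<le> (cmod (\<xi> (x, g)) + cmod (\<xi>' (x, g))) * (W g * hn h g)"
   using hn_nonneg[OF h] by (intro mult_right_mono norm_triangle_ineq) simp
  then show "ennreal (cmod (\<xi> (x, g) + \<xi>' (x, g)) * W g * hn h g)
   \<le> ennreal (cmod (\<xi> (x, g)) * W g * hn h g) + ennreal (cmod (\<xi>' (x, g)) * W g * hn h g)"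
   using hn_nonneg[OF h, of g] by (subst ennreal_plus[symmetric]) (auto intro!: ennreal_leI simp: distrib_right mult.assoc simp del: ennreal_plus)
 qed
 also have "\<dots> < \<infinity>" using f by simp
 finally have fa: "NI (\<Phi> x) (\<lambda>g. \<xi> (x, g) + \<xi>' (x, g)) h < \<infinity>" .
 have "NI (\<Phi> x) (\<lambda>g. c * \<xi> (x, g)) h = ennreal (cmod c) * NI (\<Phi> x) (\<lambda>g. \<xi> (x, g)) h"
  unfolding NI_def nn_integral_cmult[OF NIm(1), symmetric] by (simp only: norm_mult mult.assoc ennreal_mult'[OF norm_ge_zero])
 also have "\<dots> < \<infinity>" using f by (simp add: ennreal_mult_less_top)
 finally have fs: "NI (\<Phi> x) (\<lambda>g. c * \<xi> (x, g)) h < \<infinity>" .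
 note T = TI(1)[OF Phi_unit m(1) h f(1)] TI(1)[OF Phi_unit m(2) h f(2)]
 note I = TI(2)[OF Phi_unit m(1) h f(1)] TI(2)[OF Phi_unit m(2) h f(2)]
 note P = pr_integrable(1)[OF Phi_unit m(1) h f(1)] pr_integrable(1)[OF Phi_unit m(2) h f(2)]
 show "U (\<lambda>p. \<xi> p + \<xi>' p) h x = vadd (H (\<Phi> x)) (U \<xi> h x) (U \<xi>' h x)"
  unfolding U_def
 proof (rule inner_ext[OF TI(1)[OF Phi_unit ma h fa] add_in[OF T]])
  fix v assume v: "v \<in> carr (H (\<Phi> x))"
  show "ip (H (\<Phi> x)) (TI (\<Phi> x) (\<lambda>g. \<xi> (x, g) + \<xi>' (x, g)) h) v
   = ip (H (\<Phi> x)) (vadd (H (\<Phi> x)) (TI (\<Phi> x) (\<lambda>g. \<xi> (x, g)) h) (TI (\<Phi> x) (\<lambda>g. \<xi>' (x, g)) h)) v"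
   unfolding inner_add[OF T v] TI(2)[OF Phi_unit ma h fa v] I(1)[OF v] I(2)[OF v]
    Bochner_Integration.integral_add[OF P(1)[OF v] P(2)[OF v], symmetric] by (simp add: distrib_right)
 qed
 show "U (\<lambda>p. c * \<xi> p) h x = vscale (H (\<Phi> x)) c (U \<xi> h x)"
  unfolding U_def
 proof (rule inner_ext[OF TI(1)[OF Phi_unit ms h fs] scale_in[OF T(1)]])
  fix v assume v: "v \<in> carr (H (\<Phi> x))"
  show "ip (H (\<Phi> x)) (TI (\<Phi> x) (\<lambda>g. c * \<xi> (x, g)) h) v = ip (H (\<Phi> x)) (vscale (H (\<Phi> x)) c (TI (\<Phi> x) (\<lambda>g. \<xi> (x, g)) h)) v"
   unfolding inner_scale[OF T(1) v] TI(2)[OF Phi_unit ms h fs v] I(1)[OF v] integral_mult_right_zero[symmetric] by (simp only: mult.assoc)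
 qed
qed

lemma uu_addl:
 assumes \<xi>: "BB \<xi>" and \<xi>': "BB \<xi>'" and s: "BB (\<lambda>p. \<xi> p + \<xi>' p)" and P: "P \<in> carr Hsp"
 shows "uu (\<lambda>p. \<xi> p + \<xi>' p) P = vadd Jsp (uu \<xi> P) (uu \<xi>' P)"
proof -
 have l: "base.l2 (rep P)" and b: "N.bsec (rep P)" using rep_Hsp(2)[OF P] by (simp_all add: base.l2_def base_bsec)
 note S = U_in_S[OF s l] U_in_S[OF \<xi> l] U_in_S[OF \<xi>' l]
 have "AE x in muInd. U (\<lambda>p. \<xi> p + \<xi>' p) (rep P) x = vadd ind.S (U \<xi> (rep P)) (U \<xi>' (rep P)) x"
  using A_finite(2)[OF \<xi> l] A_finite(2)[OF \<xi>' l] by eventually_elim (simp add: ind.S_simps U_linear(1)[OF \<xi> \<xi>' b])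
 then show ?thesis
  unfolding uu_def Jsp_eq ind.S.vadd_separation[OF S(2,3)] using S by (subst ind.S_cls_eq) (auto intro: ind.S.add_in)
qed

lemma uu_scalel:
 assumes \<xi>: "BB \<xi>" and s: "BB (\<lambda>p. c * \<xi> p)" and P: "P \<in> carr Hsp"
 shows "uu (\<lambda>p. c * \<xi> p) P = vscale Jsp c (uu \<xi> P)"
proof -
 have l: "base.l2 (rep P)" and b: "N.bsec (rep P)" using rep_Hsp(2)[OF P] by (simp_all add: base.l2_def base_bsec)
 note S = U_in_S[OF s l] U_in_S[OF \<xi> l]
 have "AE x in muInd. U (\<lambda>p. c * \<xi> p) (rep P) x = vscale ind.S c (U \<xi> (rep P)) x"
  using A_finite(2)[OF \<xi> l] by eventually_elim (simp add: ind.S_simps U_linear(2)[OF \<xi> \<xi> b])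
 then show ?thesis
  unfolding uu_def Jsp_eq ind.S.vscale_separation[OF S(2)] using S by (subst ind.S_cls_eq) (auto intro: ind.S.scale_in)
qed

text \<open>\<open>range_dense\<close> passed to classes: the totality behind the completion and
  behind the uniqueness of \<open>IndM\<close> and of the extended vectors.\<close>

lemma uu_total:
 assumes z: "z \<in> carr Jsp" and orth: "\<And>\<xi> P. \<xi> \<in> Cc (Zsp G \<Phi>) \<Longrightarrow> P \<in> carr Hsp \<Longrightarrow> ip Jsp z (uu \<xi> P) = 0"
 shows "z = vzero Jsp"
proof -
 obtain k where k: "k \<in> carr ind.S" "z = cls ind.S k" using z by (auto simp: Jsp_eq ind.S.carr_separation)
 have l: "ind.l2 k" using k by (simp add: ind.carr_S)
 have "AE x in muInd. k x = vzero (H (\<Phi> x))"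
 proof (rule range_dense[OF l])
  fix \<xi> h assume \<xi>: "\<xi> \<in> Cc (Zsp G \<Phi>)" and h: "base.l2 h"
  have B: "BB \<xi>" by (rule Cc_BB[OF \<xi>])
  let ?h = "restrict h X0"
  have hr: "base.l2 ?h" using h base.l2_restrict[of h] by simp
  then have hS: "?h \<in> carr base.S" by (simp add: base.carr_S)
  have "U \<xi> ?h = U \<xi> h" unfolding U_section_def twisted_integral_def by simp
  moreover have "ip ind.S k (U \<xi> ?h) = 0"
   using orth[OF \<xi>, of "cls base.S ?h"] hS
   by (simp add: Hsp_eq base.S.carr_separation k uu_cls[OF B hS] Jsp_eq ind.S.ip_separation U_in_S[OF B hr])
  ultimately have "ip ind.S (U \<xi> h) k = 0" using ind.S.inner_cnj[OF k(1) U_in_S[OF B h]] by simp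
  then show "(LINT x|muInd. ip (H (\<Phi> x)) (U \<xi> h x) (k x)) = 0" by (simp add: ind.S_simps)
 qed
 then have "cls ind.S k = cls ind.S (vzero ind.S)"
  using k(1) ind.S.zero_in by (subst ind.S_cls_eq) (auto simp: ind.S_simps)
 then show ?thesis by (simp add: k Jsp_eq ind.S.vzero_separation)
qed

text \<open>The intertwining relation before any completion: all vectors stay in the concrete space
  of sections, and \<open>LA f \<xi>\<close> stays in \<open>BB\<close> even when it is
  discontinuous.\<close>

lemma IndJ_uu:
 assumes f: "f \<in> Cc (YGY G \<Phi>)" and \<xi>: "BB \<xi>" and P: "P \<in> carr Hsp"
 shows "IndJ G lam \<Phi> \<nu> d R \<Delta> f (uu \<xi> P) = uu (LA f \<xi>) P"
proof (rule J.inner_ext)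
 note T = IndJ_properties[OF f]
 have L: "BB (LA f \<xi>)" by (rule LA_BB[OF Cc_KK[OF f] \<xi>])
 have l: "base.l2 (rep P)" by (rule rep_Hsp(2)[OF P])
 show "IndJ G lam \<Phi> \<nu> d R \<Delta> f (uu \<xi> P) \<in> carr Jsp"
  using T(2) uu_in[OF \<xi> P] by (auto simp: bounded_op_def linear_op_def)
 show "uu (LA f \<xi>) P \<in> carr Jsp" by (rule uu_in[OF L P])
 fix z assume "z \<in> carr Jsp"
 then obtain k where k: "k \<in> carr ind.S" "z = cls ind.S k" by (auto simp: Jsp_eq ind.S.carr_separation)
 have "ip Jsp (IndJ G lam \<Phi> \<nu> d R \<Delta> f (uu \<xi> P)) z = JF f (U \<xi> (rep P)) k"
  unfolding uu_def k by (rule T(3)[OF U_in_S[OF \<xi> l] k(1)])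
 also have "\<dots> = ip ind.S (U (LA f \<xi>) (rep P)) k"
  using JF_U[OF Cc_KK[OF f] \<xi> l] k(1) by (simp add: ind.carr_S ind.S_simps)
 also have "\<dots> = ip Jsp (uu (LA f \<xi>) P) z"
  unfolding uu_def k Jsp_eq by (rule ind.S.ip_separation[OF U_in_S[OF L l] k(1), symmetric])
 finally show "ip Jsp (IndJ G lam \<Phi> \<nu> d R \<Delta> f (uu \<xi> P)) z = ip Jsp (uu (LA f \<xi>) P) z" .
qed

abbreviation "Msp \<equiv> IndM_space G lam \<Phi> \<nu> d R \<Delta>"
abbreviation "ev \<equiv> elem_vector G lam \<Phi> \<nu> d R \<Delta>"

text \<open>\<open>uu\<close> meets the requirements of \<open>tensor_presentation\<close>: the
  isometry reproduces the form, and density of the range is totality.\<close>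

lemma Msp_iso:
 obtains V where "hilbert_iso Msp Jsp V" "closed_ops Msp"
  "\<forall>\<xi>\<in>Cc (Zsp G \<Phi>). \<forall>P\<in>carr Hsp. ev \<xi> P \<in> carr Msp \<and> V (ev \<xi> P) = uu \<xi> P"
proof -
 interpret Cc: cvector_space "Cc_space (Zsp G \<Phi>)" by (rule cvector_space_Cc)
 have Cc: "carr (Cc_space (Zsp G \<Phi>)) = Cc (Zsp G \<Phi>)" by (simp add: Cc_space_def)
 have add: "BB (\<lambda>p. \<xi> p + \<xi>' p)" if "\<xi> \<in> Cc (Zsp G \<Phi>)" "\<xi>' \<in> Cc (Zsp G \<Phi>)" for \<xi> \<xi>'
  using Cc.add_in[of \<xi> \<xi>'] that by (intro Cc_BB) (simp add: Cc_space_def)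
 have scale: "BB (\<lambda>p. c * \<xi> p)" if "\<xi> \<in> Cc (Zsp G \<Phi>)" for \<xi> c
  using Cc.scale_in[of \<xi> c] that by (intro Cc_BB) (simp add: Cc_space_def)
 interpret T: tensor_presentation "Cc_space (Zsp G \<Phi>)" Hsp Jsp uu "IndM_form G lam \<nu> d R \<Delta>"
 proof unfold_locales
  fix v v' :: "'y \<times> 'g \<Rightarrow> complex" and w w' c z
  assume v: "v \<in> carr (Cc_space (Zsp G \<Phi>))" and w: "w \<in> carr Hsp"
  then have B: "BB v" by (intro Cc_BB) (simp add: Cc)
  show "uu v w \<in> carr Jsp" by (rule uu_in[OF B w])
  show "uu (vscale (Cc_space (Zsp G \<Phi>)) c v) w = vscale Jsp c (uu v w)"
   using uu_scalel[OF B scale w] v by (simp add: Cc_space_def)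
  show "uu v (vscale Hsp c w) = vscale Jsp c (uu v w)" by (rule uu_scaler[OF B w])
  show "uu v (vadd Hsp w w') = vadd Jsp (uu v w) (uu v w')" if "w' \<in> carr Hsp" by (rule uu_addr[OF B w that])
  assume v': "v' \<in> carr (Cc_space (Zsp G \<Phi>))"
  then have B': "BB v'" by (intro Cc_BB) (simp add: Cc)
  show "uu (vadd (Cc_space (Zsp G \<Phi>)) v v') w = vadd Jsp (uu v w) (uu v' w)"
   using uu_addl[OF B B' add w] v v' by (simp add: Cc_space_def)
  show "IndM_form G lam \<nu> d R \<Delta> v w v' w' = ip Jsp (uu v w) (uu v' w')" if "w' \<in> carr Hsp"
   by (rule IndM_form_eq[OF B B' w that])
 next
  fix z assume "z \<in> carr Jsp" "\<And>v w. v \<in> carr (Cc_space (Zsp G \<Phi>)) \<Longrightarrow> w \<in> carr Hsp \<Longrightarrow> ip Jsp z (uu v w) = 0"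
  then show "z = vzero Jsp" by (intro uu_total) (simp_all add: Cc)
 qed
 from T.completion_tensor show ?thesis
  using that unfolding IndM_space_def IndM_tensor_def elem_vector_def Cc by blast
qed

text \<open>The preimage of \<open>uu z P\<close> under \<open>V\<close> has the prescribed inner
  products, since those with elementary tensors are transported to \<open>Jsp\<close>; totality
  makes it the only such vector.\<close>

lemma extended_elem_vector:
 assumes V: "hilbert_iso Msp Jsp V" and cl: "closed_ops Msp"
  and ev': "\<forall>\<xi>\<in>Cc (Zsp G \<Phi>). \<forall>P\<in>carr Hsp. ev \<xi> P \<in> carr Msp \<and> V (ev \<xi> P) = uu \<xi> P"
  and z: "BB z" and P: "P \<in> carr Hsp"
 shows "extended_elem_vector G lam \<Phi> \<nu> d R \<Delta> z P \<in> carr Msp" "V (extended_elem_vector G lam \<Phi> \<nu> d R \<Delta> z P) = uu z P"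
proof -
 note ev = ev'[rule_format]
 note iso = iso_simps[OF hilbert_Jsp V cl]
 let ?X = "extended_elem_vector G lam \<Phi> \<nu> d R \<Delta> z P"
 have "?X \<in> carr Msp \<and> V ?X = uu z P"
 proof (cases "z \<in> Cc (Zsp G \<Phi>)")
  case True
  then show ?thesis using ev[OF True P] by (simp add: extended_elem_vector_def)
 next
  case False
  obtain w where w: "w \<in> carr Msp" "V w = uu z P"
   using Vi[OF hilbert_Jsp V cl uu_in[OF z P]] by blast
  have form: "IndM_form G lam \<nu> d R \<Delta> z P \<eta> B = ip Jsp (uu z P) (uu \<eta> B)" if "\<eta> \<in> Cc (Zsp G \<Phi>)" "B \<in> carr Hsp" for \<eta> B
   by (rule IndM_form_eq[OF z Cc_BB[OF that(1)] P that(2)])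
  have ipV: "ip Msp x (ev \<eta> B) = ip Jsp (V x) (uu \<eta> B)" if "x \<in> carr Msp" "\<eta> \<in> Cc (Zsp G \<Phi>)" "B \<in> carr Hsp" for x \<eta> B
   using iso(4)[OF that(1), of "ev \<eta> B"] ev[OF that(2,3)] by simp
  have "?X = (THE w. w \<in> carr Msp \<and> (\<forall>\<eta>\<in>Cc (Zsp G \<Phi>). \<forall>k\<in>carr Hsp. ip Msp w (ev \<eta> k) = IndM_form G lam \<nu> d R \<Delta> z P \<eta> k))"
   using False by (simp add: extended_elem_vector_def)
  also have "\<dots> = w"
  proof (rule the_equality)
   show "w \<in> carr Msp \<and> (\<forall>\<eta>\<in>Cc (Zsp G \<Phi>). \<forall>k\<in>carr Hsp. ip Msp w (ev \<eta> k) = IndM_form G lam \<nu> d R \<Delta> z P \<eta> k)"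
    using w by (simp add: ipV form)
   fix x assume x: "x \<in> carr Msp \<and> (\<forall>\<eta>\<in>Cc (Zsp G \<Phi>). \<forall>k\<in>carr Hsp. ip Msp x (ev \<eta> k) = IndM_form G lam \<nu> d R \<Delta> z P \<eta> k)"
   have c: "V x \<in> carr Jsp" "uu z P \<in> carr Jsp" using x iso(1) uu_in[OF z P] by auto
   have "vdiff Jsp (V x) (uu z P) = vzero Jsp"
    using x c by (intro uu_total) (simp_all add: J.diff_in J.inner_diff uu_in Cc_BB form flip: ipV)
   then have "V x = V w" using c w(2) by (intro J.eq_if_nrm_diff_0) (simp_all add: J.nrm_zero)
   then show "x = w" using x w(1) by (intro iso_inj[OF hilbert_Jsp V cl]) auto
  qed
  finally show ?thesis using w by simp
 qed
 then show "?X \<in> carr Msp" "V ?X = uu z P" by auto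
qed

text \<open>Pulling \<open>IndJ\<close> back along \<open>V\<close> gives a bounded operator with
  the values prescribed for \<open>IndM\<close> on elementary tensors. These determine a bounded
  operator, so \<open>IndM\<close> is that pullback and the relation holds by construction.\<close>

lemma IndM_intertwined:
 assumes V: "hilbert_iso Msp Jsp V" and cl: "closed_ops Msp"
  and ev': "\<forall>\<xi>\<in>Cc (Zsp G \<Phi>). \<forall>P\<in>carr Hsp. ev \<xi> P \<in> carr Msp \<and> V (ev \<xi> P) = uu \<xi> P"
  and f: "f \<in> Cc (YGY G \<Phi>)" and w: "w \<in> carr Msp"
 shows "V (IndM G lam \<Phi> \<nu> d R \<Delta> f w) = IndJ G lam \<Phi> \<nu> d R \<Delta> f (V w)"
proof -
 note ev = ev'[rule_format]
 note X = extended_elem_vector[OF V cl ev']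
 let ?T = "IndJ G lam \<Phi> \<nu> d R \<Delta> f"
 obtain S where S: "S \<in> extensional (carr Msp)" "bounded_op Msp S" "\<And>x. x \<in> carr Msp \<Longrightarrow> V (S x) = ?T (V x)"
  using pull_operator[OF hilbert_Jsp V cl IndJ_properties(2)[OF f]] by blast
 have S_ev: "S (ev \<xi> P) = extended_elem_vector G lam \<Phi> \<nu> d R \<Delta> (LA f \<xi>) P" if \<xi>: "\<xi> \<in> Cc (Zsp G \<Phi>)" and P: "P \<in> carr Hsp" for \<xi> P
 proof (rule iso_inj[OF hilbert_Jsp V cl])
  have L: "BB (LA f \<xi>)" by (rule LA_BB[OF Cc_KK[OF f] Cc_BB[OF \<xi>]])
  show "S (ev \<xi> P) \<in> carr Msp" using S(2) ev[OF \<xi> P] by (auto simp: bounded_op_def linear_op_def)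
  show "extended_elem_vector G lam \<Phi> \<nu> d R \<Delta> (LA f \<xi>) P \<in> carr Msp" by (rule X(1)[OF L P])
  show "V (S (ev \<xi> P)) = V (extended_elem_vector G lam \<Phi> \<nu> d R \<Delta> (LA f \<xi>) P)"
   using ev[OF \<xi> P] by (simp add: S(3) IndJ_uu[OF f Cc_BB[OF \<xi>] P] X(2)[OF L P])
 qed
 have "IndM G lam \<Phi> \<nu> d R \<Delta> f = S"
  unfolding IndM_def
 proof (rule the_equality)
  show "S \<in> extensional (carr Msp) \<and> bounded_op Msp S \<and>
   (\<forall>\<xi>\<in>Cc (Zsp G \<Phi>). \<forall>h\<in>carr Hsp. S (ev \<xi> h) = extended_elem_vector G lam \<Phi> \<nu> d R \<Delta> (LA f \<xi>) h)"
   using S S_ev by simp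
  fix T assume T: "T \<in> extensional (carr Msp) \<and> bounded_op Msp T \<and>
   (\<forall>\<xi>\<in>Cc (Zsp G \<Phi>). \<forall>h\<in>carr Hsp. T (ev \<xi> h) = extended_elem_vector G lam \<Phi> \<nu> d R \<Delta> (LA f \<xi>) h)"
  let ?E = "{ev \<xi> P | \<xi> P. \<xi> \<in> Cc (Zsp G \<Phi>) \<and> P \<in> carr Hsp}"
  show "T = S"
  proof (rule operator_eqI[OF hilbert_Jsp V cl, where A = ?E])
   show "T x = S x" if "x \<in> ?E" for x using that T S_ev by auto
   show "?E \<subseteq> carr Msp" using ev by auto
   fix z assume "z \<in> carr Jsp" and 0: "\<And>x. x \<in> ?E \<Longrightarrow> ip Jsp z (V x) = 0"
   then show "z = vzero Jsp"
   proof (intro uu_total)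
    fix \<xi> P assume "\<xi> \<in> Cc (Zsp G \<Phi>)" "P \<in> carr Hsp"
    then show "ip Jsp z (uu \<xi> P) = 0" using 0[of "ev \<xi> P"] ev[of \<xi> P] by auto
   qed
  qed (use S T in auto)
 qed
 then show ?thesis using S(3)[OF w] by simp
qed

theorem induced_isomorphism:
 "\<exists>V. hilbert_iso Msp Jsp V \<and>
   (\<forall>\<xi>\<in>Cc (Zsp G \<Phi>). \<forall>h\<in>carr base.S. V (ev \<xi> (cls base.S h)) = cls ind.S (U \<xi> h)) \<and>
   (\<forall>f\<in>Cc (YGY G \<Phi>). \<forall>w\<in>carr Msp. V (IndM G lam \<Phi> \<nu> d R \<Delta> f w) = IndJ G lam \<Phi> \<nu> d R \<Delta> f (V w))"
proof -
 obtain V where V: "hilbert_iso Msp Jsp V" and cl: "closed_ops Msp"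
  and ev': "\<forall>\<xi>\<in>Cc (Zsp G \<Phi>). \<forall>P\<in>carr Hsp. ev \<xi> P \<in> carr Msp \<and> V (ev \<xi> P) = uu \<xi> P"
  using Msp_iso by blast
 note ev = ev'[rule_format]
 have "V (ev \<xi> (cls base.S h)) = cls ind.S (U \<xi> h)" if \<xi>: "\<xi> \<in> Cc (Zsp G \<Phi>)" and h: "h \<in> carr base.S" for \<xi> h
  using ev[OF \<xi>, of "cls base.S h"] uu_cls[OF Cc_BB[OF \<xi>] h] h by (simp add: Hsp_eq base.S.carr_separation)
 then show ?thesis using V IndM_intertwined[OF V cl ev'] by blast
qed

end

theorem theorem4p3p1:
  fixes G :: "'g::{second_countable_topology, t2_space} groupoid"
    and lam :: "'g \<Rightarrow> 'g measure"
    and \<Phi> :: "'y::{second_countable_topology, t2_space} \<Rightarrow> 'g"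
    and \<nu> :: "'g \<Rightarrow> 'y measure"
    and d :: "'y \<Rightarrow> real"
    and R :: "('g, 'h) groupoid_rep"
    and \<Delta> :: "'g \<Rightarrow> real"
  assumes "locally_compact_space (euclidean :: 'g topology)"
    and "topological_groupoid G"
    and "haar_system G lam"
    and "locally_compact_space (euclidean :: 'y topology)"
    and "continuous_on UNIV \<Phi>"
    and "open_map euclidean (top_of_set (units G)) \<Phi>"
    and "range \<Phi> = units G"
    and "full_system (units G) \<Phi> \<nu>"
    and "continuous_on UNIV d"
    and "\<And>y. 0 \<le> d y"
    and "\<And>u. u \<in> units G \<Longrightarrow> \<exists>y. \<Phi> y = u \<and> d y \<noteq> 0"
    and "unitary_rep G lam R"
    and "modular_function G lam (meas R) \<Delta>"
  shows "\<exists>V. hilbert_iso (IndM_space G lam \<Phi> \<nu> d R \<Delta>) (IndJ_space \<Phi> \<nu> d R) V \<and>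
     (\<forall>\<xi>\<in>Cc (Zsp G \<Phi>). \<forall>h\<in>carr (rep_sections R).
        V (elem_vector G lam \<Phi> \<nu> d R \<Delta> \<xi> (cls (rep_sections R) h))
        = cls (IndJ_sections \<Phi> \<nu> d R) (U_section G lam \<Phi> R \<Delta> \<xi> h)) \<and>
     (\<forall>f\<in>Cc (YGY G \<Phi>). \<forall>w\<in>carr (IndM_space G lam \<Phi> \<nu> d R \<Delta>).
        V (IndM G lam \<Phi> \<nu> d R \<Delta> f w) = IndJ G lam \<Phi> \<nu> d R \<Delta> f (V w))"
proof -
  interpret topological_groupoid G by fact
  interpret induction_data G lam \<Phi> \<nu> d R \<Delta> by unfold_locales fact+
  show ?thesis using induced_isomorphism unfolding muInd_def .
qed

end
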